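(* Let $\mathbb{F}_q$ be a finite field, $D=\mathfrak{b}_1+\cdots+\mathfrak{b}_r$ a reduced divisor on $\mathbb{P}^1_{\mathbb{F}_q}$ with $d_i=\deg(\mathfrak{b}_i)$, $l=\sum_{i=1}^rd_i$, $\boldsymbol{\mu}=((1,1),\dots,(1,1))$ ($r$ entries), and $w\in\mathfrak{S}_l$ of cycle type $(d_1,\dots,d_r)$. Then for any $d\in\mathbb{Z}$, $$\mathcal{A}_{\boldsymbol{\mu},D}^{2,d}(q)=\begin{cases}\displaystyle\sum_{m=0}^{l-3}\ \sum_{a=1}^{\left[\frac{l-m-1}{2}\right]}\left(\sum_{s=m+2a+1}^l\chi_s^l(w)\right)q^m&\text{if }l\geq3,\\ 0&\text{otherwise,}\end{cases}$$ where $\mathcal{A}_{\boldsymbol{\mu},D}^{2,d}(q)=\sum_{\mathcal{E}}\mathcal{A}_{\boldsymbol{\mu},D}^{\mathcal{E}}(q)$, the sum being over the isomorphism classes of vector bundles $\mathcal{E}$ of rank $2$ and degree $d$ on $\mathbb{P}^1_{\mathbb{F}_q}$ (only finitely many terms are non-zero).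
   Context: For $0<m\le l$, $X^l_m$ is the set of subsets of $\{1,\dots,l\}$ of size $m$, on which $\mathfrak{S}_l$ acts naturally, and $\chi^l_m$ is the character of the corresponding permutation representation of $\mathfrak{S}_l$ on the $\mathbb{C}$-vector space with basis $X^l_m$. $[x]$ denotes the integer part. For the type $\boldsymbol{\mu}$ above, a parabolic structure of type $\boldsymbol{\mu}$ on a rank 2 bundle $\mathcal{E}$ is an $r$-tuple $E=(E_1,\dots,E_r)$ where $E_i$ is a line in the 2-dimensional fiber $\mathcal{E}(\mathfrak{b}_i)$ over the residue field $\mathbb{F}_q(\mathfrak{b}_i)\cong\mathbb{F}_{q^{d_i}}$ (i.e. full flags). In general, parabolic bundles are pairs $(\mathcal{E},E)$ with $E$ a tuple of non-increasing sequences $\mathcal{E}(\mathfrak{b}_i)=E_{i0}\supseteq E_{i1}\supseteq\cdots$ of subspaces with finitely many non-zero terms (repetitions allowed), morphisms are vector bundle morphisms preserving the filtrations termwise, and direct sums are the obvious ones; $E$ is geometrically indecomposable if $(\mathcal{E},E)$ is indecomposable after extension of scalars to $\overline{\mathbb{F}}_q$. $\mathcal{A}_{\boldsymbol{\mu},D}^{\mathcal{E}}(q)$ is the number of $\mathrm{Aut}(\mathcal{E})$-orbits (isomorphism classes) of geometrically indecomposable parabolic structures of type $\boldsymbol{\mu}$ on $\mathcal{E}$. *)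

theory Defs
  imports
    "HOL-Algebra.Algebraic_Closure_Type"
    "HOL-Combinatorics.Orbits"
    "HOL-Library.FuncSet"
    "HOL-Library.Multiset"
    "HOL-Computational_Algebra.Fraction_Field"
    "Jordan_Normal_Form.Determinant"
begin

section \<open>Closed points of the projective line\<close>

text \<open>
  The closed points of the projective line over a field k are the maximal ideals of k[t], given
  by their monic irreducible generators, and the point at infinity. The function field is k(t).
\<close>

typedef (overloaded) 'a prime_poly =
  "{p :: 'a :: field poly. Factorial_Ring.irreducible p \<and> lead_coeff p = 1}"
  morphisms poly_of Abs_prime_poly
proof (rule exI[of _ "[:0, 1:]"], safe)
  show "Factorial_Ring.irreducible ([:0, 1:] :: 'a poly)"
  proof (rule Factorial_Ring.irreducibleI)
    fix f g :: "'a poly"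
    assume fg: "[:0, 1:] = f * g"
    hence nz: "f \<noteq> 0" "g \<noteq> 0" by auto
    have "Polynomial.degree f + Polynomial.degree g = 1"
      using degree_mult_eq[OF nz] by (simp flip: fg)
    hence "Polynomial.degree f = 0 \<or> Polynomial.degree g = 0" by linarith
    thus "f dvd 1 \<or> g dvd 1"
      using nz is_unit_iff_degree by blast
  qed (auto simp: is_unit_iff_degree)
qed simp

declare [[typedef_overloaded]]

datatype 'a closed_pt = Infty | Fin "'a prime_poly"

type_synonym 'a ratfun = "'a poly fract"

fun pt_degree :: "'a :: field closed_pt \<Rightarrow> nat" where
  "pt_degree Infty = 1"
| "pt_degree (Fin p) = Polynomial.degree (poly_of p)"

fun local_ring :: "'a :: field closed_pt \<Rightarrow> 'a ratfun set" where
  "local_ring Infty =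
     {Fraction_Field.Fract f g | f g. g \<noteq> 0 \<and> Polynomial.degree f \<le> Polynomial.degree g}"
| "local_ring (Fin p) = {Fraction_Field.Fract f g | f g. \<not> poly_of p dvd g}"

definition max_ideal :: "'a :: field closed_pt \<Rightarrow> 'a ratfun set" where
  "max_ideal x = {f \<in> local_ring x. f = 0 \<or> inverse f \<notin> local_ring x}"

fun uniformizer :: "'a :: field closed_pt \<Rightarrow> 'a ratfun" where
  "uniformizer Infty = Fraction_Field.Fract 1 [:0, 1:]"
| "uniformizer (Fin p) = Fraction_Field.Fract (poly_of p) 1"

text \<open>Normalised discrete valuation at a closed point; only meaningful for non-zero arguments.\<close>

definition valuation :: "'a :: field closed_pt \<Rightarrow> 'a ratfun \<Rightarrow> int" where
  "valuation x f = (THE k. \<exists>u. u \<noteq> 0 \<and> u \<in> local_ring x \<and> inverse u \<in> local_ring x \<and>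
     f = u * uniformizer x powi k)"


section \<open>Vector bundles\<close>

text \<open>
  The generic fibre of a vector bundle of rank n is an n-dimensional vector space over k(t), and,
  the projective line being integral, a choice of basis of it embeds the bundle into the constant
  sheaf with value the column vectors k(t)^n. A bundle of rank n is therefore given as a
  subsheaf of this constant sheaf, recorded by its stalks at the closed points, which is locally
  free of rank n. The non-empty open sets are those with finite complement among the closed
  points. The sections over U are the vectors lying in the stalks at all points of U.
\<close>

type_synonym 'a stalks = "'a closed_pt \<Rightarrow> 'a ratfun vec set"

definition local_vecs :: "nat \<Rightarrow> 'a :: field closed_pt \<Rightarrow> 'a ratfun vec set" where
  "local_vecs n x = {v \<in> carrier_vec n. \<forall>i<n. v $ i \<in> local_ring x}"

definition vector_bundle :: "nat \<Rightarrow> 'a :: field stalks \<Rightarrow> bool" where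
  "vector_bundle n L \<longleftrightarrow>
     (\<forall>x. \<exists>U g. x \<in> U \<and> finite (- U) \<and> g \<in> carrier_mat n n \<and> det g \<noteq> 0 \<and>
        (\<forall>y\<in>U. L y = (\<lambda>v. g *\<^sub>v v) ` local_vecs n y))"

text \<open>
  The degree of a bundle is the degree of its determinant line bundle, i.e. of the divisor of the
  rational section e_1 \<and> ... \<and> e_n. If the stalk at x is spanned by the columns of g, that section
  is 1 / det g times a local generator, hence has order - v_x (det g).
\<close>

definition local_det :: "nat \<Rightarrow> 'a :: field stalks \<Rightarrow> 'a closed_pt \<Rightarrow> 'a ratfun" where
  "local_det n L x =
     det (SOME g. g \<in> carrier_mat n n \<and> det g \<noteq> 0 \<and> L x = (\<lambda>v. g *\<^sub>v v) ` local_vecs n x)"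

definition bundle_degree :: "nat \<Rightarrow> 'a :: field stalks \<Rightarrow> int" where
  "bundle_degree n L =
     (\<Sum>x | valuation x (local_det n L x) \<noteq> 0.
        - valuation x (local_det n L x) * int (pt_degree x))"

text \<open>A morphism of bundles is determined by the linear map it induces on generic fibres.\<close>

definition bundle_hom ::
    "nat \<Rightarrow> 'a :: field stalks \<Rightarrow> nat \<Rightarrow> 'a stalks \<Rightarrow> 'a ratfun mat set" where
  "bundle_hom n L n' L' = {A \<in> carrier_mat n' n. \<forall>x. \<forall>v\<in>L x. A *\<^sub>v v \<in> L' x}"

definition bundle_isomorphic :: "nat \<Rightarrow> 'a :: field stalks \<Rightarrow> 'a stalks \<Rightarrow> bool" where
  "bundle_isomorphic n L L' \<longleftrightarrow>
     (\<exists>A\<in>bundle_hom n L n L'. \<exists>B\<in>bundle_hom n L' n L. A * B = 1\<^sub>m n \<and> B * A = 1\<^sub>m n)"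

definition bundle_aut :: "nat \<Rightarrow> 'a :: field stalks \<Rightarrow> 'a ratfun mat set" where
  "bundle_aut n L =
     {A \<in> bundle_hom n L n L. \<exists>B\<in>bundle_hom n L n L. A * B = 1\<^sub>m n \<and> B * A = 1\<^sub>m n}"

definition bundle_sum :: "'a :: field stalks \<Rightarrow> 'a stalks \<Rightarrow> 'a stalks" where
  "bundle_sum L L' = (\<lambda>x. {v @\<^sub>v v' | v v'. v \<in> L x \<and> v' \<in> L' x})"


section \<open>Fibres\<close>

definition local_submodule ::
    "nat \<Rightarrow> 'a :: field closed_pt \<Rightarrow> 'a ratfun vec set \<Rightarrow> bool" where
  "local_submodule n x M \<longleftrightarrow> M \<subseteq> carrier_vec n \<and> 0\<^sub>v n \<in> M \<and>
     (\<forall>v\<in>M. \<forall>w\<in>M. v + w \<in> M) \<and> (\<forall>c\<in>local_ring x. \<forall>v\<in>M. c \<cdot>\<^sub>v v \<in> M)"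

definition local_span ::
    "nat \<Rightarrow> 'a :: field closed_pt \<Rightarrow> 'a ratfun vec set \<Rightarrow> 'a ratfun vec set" where
  "local_span n x S = \<Inter> {M. local_submodule n x M \<and> S \<subseteq> M}"

text \<open>
  The fibre at x is the quotient of the stalk by its product with the maximal ideal; its elements
  are cosets. The residue field acts through the local ring.
\<close>

definition fibre_class ::
    "nat \<Rightarrow> 'a :: field stalks \<Rightarrow> 'a closed_pt \<Rightarrow> 'a ratfun vec \<Rightarrow> 'a ratfun vec set" where
  "fibre_class n L x v =
     {v + u | u. u \<in> local_span n x {c \<cdot>\<^sub>v w | c w. c \<in> max_ideal x \<and> w \<in> L x}}"

definition fibre ::
    "nat \<Rightarrow> 'a :: field stalks \<Rightarrow> 'a closed_pt \<Rightarrow> 'a ratfun vec set set" where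
  "fibre n L x = fibre_class n L x ` L x"

definition fibre_subspace ::
    "nat \<Rightarrow> 'a :: field stalks \<Rightarrow> 'a closed_pt \<Rightarrow> 'a ratfun vec set set \<Rightarrow> bool" where
  "fibre_subspace n L x V \<longleftrightarrow> V \<subseteq> fibre n L x \<and> fibre_class n L x (0\<^sub>v n) \<in> V \<and>
     (\<forall>v\<in>L x. \<forall>w\<in>L x. fibre_class n L x v \<in> V \<longrightarrow> fibre_class n L x w \<in> V \<longrightarrow>
        fibre_class n L x (v + w) \<in> V) \<and>
     (\<forall>c\<in>local_ring x. \<forall>v\<in>L x. fibre_class n L x v \<in> V \<longrightarrow> fibre_class n L x (c \<cdot>\<^sub>v v) \<in> V)"

definition fibre_line ::
    "nat \<Rightarrow> 'a :: field stalks \<Rightarrow> 'a closed_pt \<Rightarrow> 'a ratfun vec set set \<Rightarrow> bool" where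
  "fibre_line n L x V \<longleftrightarrow>
     (\<exists>v\<in>L x. fibre_class n L x v \<noteq> fibre_class n L x (0\<^sub>v n) \<and>
        V = {fibre_class n L x (c \<cdot>\<^sub>v v) | c. c \<in> local_ring x})"


section \<open>Parabolic bundles\<close>

text \<open>
  Parabolic bundles with parabolic structure at the points of D, i.e. over the reduced divisor
  that is the sum of the points of D. The filtrations are indexed by the points themselves, and
  only the values at points of D matter.
\<close>

type_synonym 'a filtrations = "'a closed_pt \<Rightarrow> nat \<Rightarrow> 'a ratfun vec set set"

definition parabolic_bundle ::
    "'a :: field closed_pt set \<Rightarrow> nat \<Rightarrow> 'a stalks \<Rightarrow> 'a filtrations \<Rightarrow> bool" where
  "parabolic_bundle D n L F \<longleftrightarrow> vector_bundle n L \<and>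
     (\<forall>x\<in>D. F x 0 = fibre n L x \<and>
        (\<forall>j. fibre_subspace n L x (F x j) \<and> F x (Suc j) \<subseteq> F x j) \<and>
        (\<exists>N. \<forall>j\<ge>N. F x j = {fibre_class n L x (0\<^sub>v n)}))"

definition parabolic_hom ::
    "'a :: field closed_pt set \<Rightarrow> nat \<Rightarrow> 'a stalks \<Rightarrow> 'a filtrations \<Rightarrow>
     nat \<Rightarrow> 'a stalks \<Rightarrow> 'a filtrations \<Rightarrow> 'a ratfun mat set" where
  "parabolic_hom D n L F n' L' F' = {A \<in> bundle_hom n L n' L'.
     \<forall>x\<in>D. \<forall>j. \<forall>v\<in>L x. fibre_class n L x v \<in> F x j \<longrightarrow> fibre_class n' L' x (A *\<^sub>v v) \<in> F' x j}"

definition parabolic_isomorphic ::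
    "'a :: field closed_pt set \<Rightarrow> nat \<Rightarrow> 'a stalks \<Rightarrow> 'a filtrations \<Rightarrow>
     nat \<Rightarrow> 'a stalks \<Rightarrow> 'a filtrations \<Rightarrow> bool" where
  "parabolic_isomorphic D n L F n' L' F' \<longleftrightarrow>
     (\<exists>A\<in>parabolic_hom D n L F n' L' F'. \<exists>B\<in>parabolic_hom D n' L' F' n L F.
        A * B = 1\<^sub>m n' \<and> B * A = 1\<^sub>m n)"

definition filtrations_sum ::
    "nat \<Rightarrow> 'a :: field stalks \<Rightarrow> 'a filtrations \<Rightarrow>
     nat \<Rightarrow> 'a stalks \<Rightarrow> 'a filtrations \<Rightarrow> 'a filtrations" where
  "filtrations_sum n L F n' L' F' = (\<lambda>x j.
     {fibre_class (n + n') (bundle_sum L L') x (v @\<^sub>v v') | v v'.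
        v \<in> L x \<and> v' \<in> L' x \<and> fibre_class n L x v \<in> F x j \<and> fibre_class n' L' x v' \<in> F' x j})"

definition parabolic_indecomposable ::
    "'a :: field closed_pt set \<Rightarrow> nat \<Rightarrow> 'a stalks \<Rightarrow> 'a filtrations \<Rightarrow> bool" where
  "parabolic_indecomposable D n L F \<longleftrightarrow> n \<noteq> 0 \<and>
     \<not> (\<exists>n1 L1 F1 n2 L2 F2. n1 \<noteq> 0 \<and> n2 \<noteq> 0 \<and>
          parabolic_bundle D n1 L1 F1 \<and> parabolic_bundle D n2 L2 F2 \<and>
          parabolic_isomorphic D n L F
            (n1 + n2) (bundle_sum L1 L2) (filtrations_sum n1 L1 F1 n2 L2 F2))"


section \<open>Extension of scalars to the algebraic closure\<close>

lemma map_poly_to_ac_mult: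
  fixes f g :: "'a :: field poly"
  shows "map_poly to_ac (f * g) = map_poly to_ac f * map_poly to_ac g"
  by (rule poly_eqI) (simp add: coeff_map_poly coeff_mult to_ac_sum)

lemma map_poly_to_ac_eq_0_iff:
  fixes f :: "'a :: field poly"
  shows "map_poly to_ac f = 0 \<longleftrightarrow> f = 0"
  by (rule map_poly_eq_0_iff) auto

definition ratfun_ac :: "'a :: field ratfun \<Rightarrow> 'a alg_closure ratfun" where
  "ratfun_ac h = (THE h'. \<exists>f g. g \<noteq> 0 \<and> h = Fraction_Field.Fract f g \<and>
     h' = Fraction_Field.Fract (map_poly to_ac f) (map_poly to_ac g))"

lemma ratfun_ac_Fract:
  fixes f g :: "'a :: field poly"
  assumes "g \<noteq> 0"
  shows "ratfun_ac (Fraction_Field.Fract f g) =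
    Fraction_Field.Fract (map_poly to_ac f) (map_poly to_ac g)"
  unfolding ratfun_ac_def
proof (rule the_equality)
  show "\<exists>f' g'. g' \<noteq> 0 \<and> Fraction_Field.Fract f g = Fraction_Field.Fract f' g' \<and>
    Fraction_Field.Fract (map_poly to_ac f) (map_poly to_ac g) =
    Fraction_Field.Fract (map_poly to_ac f') (map_poly to_ac g')"
    using assms by blast
next
  fix h'
  assume "\<exists>f' g'. g' \<noteq> 0 \<and> Fraction_Field.Fract f g = Fraction_Field.Fract f' g' \<and>
    h' = Fraction_Field.Fract (map_poly to_ac f') (map_poly to_ac g')"
  then obtain f' g' where *: "g' \<noteq> 0"
      "Fraction_Field.Fract f g = Fraction_Field.Fract f' g'"
      "h' = Fraction_Field.Fract (map_poly to_ac f') (map_poly to_ac g')"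
    by blast
  have "f * g' = f' * g"
    using * assms by (simp add: eq_fract)
  hence "map_poly to_ac f' * map_poly to_ac g = map_poly to_ac f * map_poly to_ac g'"
    by (simp flip: map_poly_to_ac_mult)
  thus "h' = Fraction_Field.Fract (map_poly to_ac f) (map_poly to_ac g)"
    using * assms by (simp add: eq_fract map_poly_to_ac_eq_0_iff)
qed

fun lies_over :: "'a :: field alg_closure closed_pt \<Rightarrow> 'a closed_pt \<Rightarrow> bool" where
  "lies_over Infty x \<longleftrightarrow> x = Infty"
| "lies_over (Fin p') x \<longleftrightarrow> (\<exists>p. x = Fin p \<and> poly_of p' dvd map_poly to_ac (poly_of p))"

definition pt_below :: "'a :: field alg_closure closed_pt \<Rightarrow> 'a closed_pt" where
  "pt_below y = (THE x. lies_over y x)"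

definition bundle_ac :: "nat \<Rightarrow> 'a :: field stalks \<Rightarrow> 'a alg_closure stalks" where
  "bundle_ac n L = (\<lambda>y. local_span n y (map_vec ratfun_ac ` L (pt_below y)))"

definition filtrations_ac ::
    "nat \<Rightarrow> 'a :: field stalks \<Rightarrow> 'a filtrations \<Rightarrow> 'a alg_closure filtrations" where
  "filtrations_ac n L F = (\<lambda>y j.
     fibre_class n (bundle_ac n L) y ` local_span n y
       (map_vec ratfun_ac ` {v \<in> L (pt_below y). fibre_class n L (pt_below y) v \<in> F (pt_below y) j}))"

definition geom_indecomposable ::
    "'a :: field closed_pt set \<Rightarrow> nat \<Rightarrow> 'a stalks \<Rightarrow> 'a filtrations \<Rightarrow> bool" where
  "geom_indecomposable D n L F \<longleftrightarrow>
     parabolic_indecomposable {y. pt_below y \<in> D} n (bundle_ac n L) (filtrations_ac n L F)"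


section \<open>Counting full flag structures in rank 2\<close>

text \<open>
  A parabolic structure of type ((1,1),...,(1,1)) on a bundle of rank 2 is a choice of a line in
  the fibre at each point of D; the line E x stands for the filtration (fibre, E x, 0, 0, ...).
\<close>

definition flag_structures ::
    "'a :: field closed_pt set \<Rightarrow> 'a stalks \<Rightarrow> ('a closed_pt \<Rightarrow> 'a ratfun vec set set) set" where
  "flag_structures D L = (\<Pi>\<^sub>E x\<in>D. {V. fibre_line 2 L x V})"

definition flag_filtrations ::
    "'a :: field stalks \<Rightarrow> ('a closed_pt \<Rightarrow> 'a ratfun vec set set) \<Rightarrow> 'a filtrations" where
  "flag_filtrations L E = (\<lambda>x j.
     if j = 0 then fibre 2 L x else if j = 1 then E x else {fibre_class 2 L x (0\<^sub>v 2)})"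

definition flag_action ::
    "'a :: field closed_pt set \<Rightarrow> 'a stalks \<Rightarrow> 'a ratfun mat \<Rightarrow>
     ('a closed_pt \<Rightarrow> 'a ratfun vec set set) \<Rightarrow> ('a closed_pt \<Rightarrow> 'a ratfun vec set set)" where
  "flag_action D L g E =
     (\<lambda>x\<in>D. {fibre_class 2 L x (g *\<^sub>v v) | v. v \<in> L x \<and> fibre_class 2 L x v \<in> E x})"

definition geom_indec_flags ::
    "'a :: field closed_pt set \<Rightarrow> 'a stalks \<Rightarrow> ('a closed_pt \<Rightarrow> 'a ratfun vec set set) set" where
  "geom_indec_flags D L =
     {E \<in> flag_structures D L. geom_indecomposable D 2 L (flag_filtrations L E)}"

definition flag_count :: "'a :: field closed_pt set \<Rightarrow> 'a stalks \<Rightarrow> nat" where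
  "flag_count D L =
     card (geom_indec_flags D L //
       {(E, E'). E \<in> geom_indec_flags D L \<and> E' \<in> geom_indec_flags D L \<and>
          (\<exists>g\<in>bundle_aut 2 L. E' = flag_action D L g E)})"

definition bundle_classes :: "int \<Rightarrow> 'a :: field stalks set set" where
  "bundle_classes d =
     {L. vector_bundle 2 L \<and> bundle_degree 2 L = d} //
       {(L, L'). vector_bundle 2 L \<and> bundle_degree 2 L = d \<and>
          vector_bundle 2 L' \<and> bundle_degree 2 L' = d \<and> bundle_isomorphic 2 L L'}"

definition class_flag_count :: "'a :: field closed_pt set \<Rightarrow> 'a stalks set \<Rightarrow> nat" where
  "class_flag_count D C = flag_count D (SOME L. L \<in> C)"

definition contributing_classes ::
    "'a :: field closed_pt set \<Rightarrow> int \<Rightarrow> 'a stalks set set" where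
  "contributing_classes D d = {C \<in> bundle_classes d. class_flag_count D C \<noteq> 0}"

text \<open>
  The sum over all isomorphism classes of bundles of rank 2 and degree d. There are infinitely
  many classes, so the sum is restricted to those with non-zero contribution.
\<close>

definition total_flag_count :: "'a :: field closed_pt set \<Rightarrow> int \<Rightarrow> nat" where
  "total_flag_count D d = (\<Sum>C\<in>contributing_classes D d. class_flag_count D C)"


section \<open>Permutation characters on subsets\<close>

definition cycle_type :: "('b \<Rightarrow> 'b) \<Rightarrow> 'b set \<Rightarrow> nat multiset" where
  "cycle_type w A = image_mset card (mset_set (orbit w ` A))"

definition subsets_of_size :: "nat \<Rightarrow> nat \<Rightarrow> nat set set" where
  "subsets_of_size l m = {S. S \<subseteq> {1..l} \<and> card S = m}"

definition basis_fun :: "'b \<Rightarrow> 'b \<Rightarrow> complex" where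
  "basis_fun S = (\<lambda>T. if T = S then 1 else 0)"

text \<open>Vectors are coefficient functions; this is the linear map sending S to its image under w.\<close>

definition subset_rep ::
    "(nat \<Rightarrow> nat) \<Rightarrow> (nat set \<Rightarrow> complex) \<Rightarrow> nat set \<Rightarrow> complex" where
  "subset_rep w f = (\<lambda>T. f (inv_into UNIV w ` T))"

text \<open>The trace of w on the span of the subsets of size m.\<close>

definition subset_character :: "nat \<Rightarrow> nat \<Rightarrow> (nat \<Rightarrow> nat) \<Rightarrow> complex" where
  "subset_character l m w = (\<Sum>S\<in>subsets_of_size l m. subset_rep w (basis_fun S) S)"

end

theory Submission
  imports Defs
begin

text \<open>
  Every bundle of rank 2 on the projective line is isomorphic to O(a) + O(b) for exactly one pair with
  b \<le> a. A line in the fibre at a point x is recorded by a point of the projective line over the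
  residue field of x, and a tuple of such lines on O(a) + O(b) is geometrically indecomposable if and
  only if it has no endomorphisms except scalars, which amounts to the absence of a non-zero solution of a
  linear condition over the ground field, so Galois descent from the algebraic closure applies. The
  automorphism group modulo scalars acts freely on these tuples, whence the number of
  orbits is the number of such tuples times q - 1 divided by the order of the automorphism group.
  For e = a - b > 0 the tuples are counted by the set I of points at which the line is not O(a): they
  are indecomposable if and only if they do not come from the evaluation of a polynomial of degree at
  most e, which contributes (q^deg I - q^(e+1)) for deg I > e. For e = 0 the decomposable tuples take
  their values in two rational points or in a conjugate pair of quadratic points. Since the subsets of
  D of degree s are counted by the character of w on subsets of size s, what remains is to sum
  geometric series.
\<close>

section \<open>Local rings of the projective line\<close>

text \<open>Having only scalar endomorphisms is in general stronger than being indecomposable, since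
  a nilpotent endomorphism splits nothing by itself. Here its existence does force a splitting. On
  O(a) + O(b) with e = a - b > 0 it is a non-zero section of O(e) vanishing wherever the line is not
  O(a); these points then have total degree at most e, so a polynomial of degree at most e
  interpolates their lines and the flag splits. For e = 0 it forces all lines to coincide.

  Independence of the degree d is not visible bundle by bundle, because e runs through the odd
  numbers for odd d and through the even ones for even d. An unbalanced bundle contributes
  \<open>geo q (s - e - 1)\<close> for each subset of D of degree s, where \<open>geo q n\<close> =
  1 + ... + q^(n - 1). Passing from e = 2k + 1 to e = 2k + 2 loses one power of q, and the balanced
  bundle contributes exactly the sum of these losses (\<open>gap\<close>): multiplied by q^3 - q,
  the order of PGL2, it telescopes in steps of two.\<close>

abbreviation (input) Fr :: "'a :: field poly \<Rightarrow> 'a poly \<Rightarrow> 'a ratfun" where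
  "Fr \<equiv> Fraction_Field.Fract"

lemma irreducible_poly_of: "Factorial_Ring.irreducible (poly_of p)"
  and monic_poly_of: "lead_coeff (poly_of p) = 1"
  using poly_of[of p] by auto

lemma prime_poly_of: "prime_elem (poly_of p)"
  by (rule field_poly_irreducible_imp_prime[OF irreducible_poly_of])

lemma poly_of_nz [simp]: "poly_of p \<noteq> 0"
  using prime_poly_of[of p] by auto

lemma poly_of_dvd_mult [simp]: "poly_of p dvd f * g \<longleftrightarrow> poly_of p dvd f \<or> poly_of p dvd g"
  using prime_elem_dvd_mult_iff[OF prime_poly_of] .

lemma poly_of_not_unit [simp]: "\<not> poly_of p dvd 1"
  using prime_poly_of[of p] by (simp add: prime_elem_not_unit)

lemma degree_poly_of_pos: "Polynomial.degree (poly_of p) > 0"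
  using poly_of_not_unit[of p] is_unit_iff_degree[OF poly_of_nz[of p]] by auto

lemma pt_degree_pos: "pt_degree x > 0"
  by (cases x) (auto simp: degree_poly_of_pos)

lemma poly_of_dvd_poly_of: "poly_of p dvd poly_of q \<longleftrightarrow> p = q"
proof
  assume "poly_of p dvd poly_of q"
  then obtain c where c: "poly_of q = poly_of p * c" by blast
  have "c dvd 1"
    using irreducible_poly_of[of q] c poly_of_not_unit[of p]
    by (metis Factorial_Ring.irreducible_def)
  then obtain a where a: "c = [:a:]" by (rule is_unit_polyE)
  have "lead_coeff (poly_of q) = lead_coeff (poly_of p) * lead_coeff c"
    by (simp add: c lead_coeff_mult)
  hence "a = 1" by (simp add: a monic_poly_of)
  thus "p = q" using c a by (simp add: poly_of_inject)
qed simp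

lemma ratfun_cases:
  obtains f g where "h = Fr f g" "g \<noteq> 0"
  by (cases h rule: Fract_cases) auto

lemma Fract_nz_iff: "g \<noteq> 0 \<Longrightarrow> Fr f g = 0 \<longleftrightarrow> f = 0"
  by (simp add: Zero_fract_def eq_fract)

lemma Fract_0_left [simp]: "Fr 0 g = 0"
  by (cases "g = 0") (auto simp: Zero_fract_def eq_fract)

lemma local_ring_InftyI:
  "g \<noteq> 0 \<Longrightarrow> Polynomial.degree f \<le> Polynomial.degree g \<Longrightarrow> Fr f g \<in> local_ring Infty"
  by auto

lemma local_ring_InftyE:
  assumes "h \<in> local_ring Infty"
  obtains f g where "h = Fr f g" "g \<noteq> 0" "Polynomial.degree f \<le> Polynomial.degree g"
  using assms by auto

lemma local_ring_FinI: "\<not> poly_of p dvd g \<Longrightarrow> Fr f g \<in> local_ring (Fin p)"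
  by auto

lemma local_ring_FinE:
  assumes "h \<in> local_ring (Fin p)"
  obtains f g where "h = Fr f g" "\<not> poly_of p dvd g" "g \<noteq> 0"
  using assms by auto

declare local_ring.simps [simp del]

lemma local_ring_0: "0 \<in> local_ring x"
  by (cases x) (use local_ring_InftyI[of 1 0] local_ring_FinI[of _ 1 0] in auto)

lemma local_ring_1: "1 \<in> local_ring x"
  by (cases x) (auto simp: One_fract_def intro!: local_ring_InftyI local_ring_FinI)

lemma local_ring_mult:
  assumes "h \<in> local_ring x" "h' \<in> local_ring x"
  shows "h * h' \<in> local_ring x"
proof (cases x)
  case Infty
  with assms obtain f g f' g' where *: "h = Fr f g" "g \<noteq> 0" "Polynomial.degree f \<le> Polynomial.degree g"
    "h' = Fr f' g'" "g' \<noteq> 0" "Polynomial.degree f' \<le> Polynomial.degree g'"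
    by (auto elim!: local_ring_InftyE)
  have "Polynomial.degree (f * f') \<le> Polynomial.degree (g * g')"
    using * by (intro order.trans[OF degree_mult_le]) (simp add: degree_mult_eq)
  thus ?thesis using * Infty by (auto intro!: local_ring_InftyI)
next
  case (Fin p)
  with assms obtain f g f' g' where *: "h = Fr f g" "\<not> poly_of p dvd g"
    "h' = Fr f' g'" "\<not> poly_of p dvd g'" by (auto elim!: local_ring_FinE)
  thus ?thesis using Fin by (auto intro!: local_ring_FinI)
qed

lemma local_ring_uminus: "h \<in> local_ring x \<Longrightarrow> - h \<in> local_ring x"
  by (cases x) (auto elim!: local_ring_InftyE local_ring_FinE intro!: local_ring_InftyI local_ring_FinI)

lemma local_ring_add:
  assumes "h \<in> local_ring x" "h' \<in> local_ring x"
  shows "h + h' \<in> local_ring x"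
proof (cases x)
  case Infty
  with assms obtain f g f' g' where *: "h = Fr f g" "g \<noteq> 0" "Polynomial.degree f \<le> Polynomial.degree g"
    "h' = Fr f' g'" "g' \<noteq> 0" "Polynomial.degree f' \<le> Polynomial.degree g'"
    by (auto elim!: local_ring_InftyE)
  have "Polynomial.degree (f * g') \<le> Polynomial.degree (g * g')"
    "Polynomial.degree (f' * g) \<le> Polynomial.degree (g * g')"
    using * by (auto intro!: order.trans[OF degree_mult_le] simp: degree_mult_eq)
  hence "Polynomial.degree (f * g' + f' * g) \<le> Polynomial.degree (g * g')"
    by (rule degree_add_le)
  thus ?thesis using * Infty by (auto intro!: local_ring_InftyI)
next
  case (Fin p)
  with assms obtain f g f' g' where *: "h = Fr f g" "\<not> poly_of p dvd g"
    "h' = Fr f' g'" "\<not> poly_of p dvd g'" by (auto elim!: local_ring_FinE)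
  moreover from * have "g \<noteq> 0" "g' \<noteq> 0" by auto
  ultimately show ?thesis using Fin by (auto intro!: local_ring_FinI)
qed

lemma local_ring_diff: "h \<in> local_ring x \<Longrightarrow> h' \<in> local_ring x \<Longrightarrow> h - h' \<in> local_ring x"
  using local_ring_add[of h x "- h'"] local_ring_uminus by force

lemma local_ring_power: "h \<in> local_ring x \<Longrightarrow> h ^ n \<in> local_ring x"
  by (induction n) (auto simp: local_ring_1 local_ring_mult)

lemma Fr_power: "Fr a b ^ n = Fr (a ^ n) (b ^ n)"
  by (induction n) (auto simp: One_fract_def)

section \<open>Units, uniformizers and the valuation at a closed point\<close>

lemma uniformizer_nz: "uniformizer x \<noteq> 0"
  by (cases x) (auto simp: Fract_nz_iff)

lemma uniformizer_in: "uniformizer x \<in> local_ring x"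
  by (cases x) (auto intro!: local_ring_InftyI local_ring_FinI)

lemma inverse_uniformizer_notin: "inverse (uniformizer x) \<notin> local_ring x"
proof (cases x)
  case Infty
  show ?thesis
  proof
    assume "inverse (uniformizer x) \<in> local_ring x"
    hence "Fr [:0, 1:] (1 :: 'a poly) \<in> local_ring Infty" using Infty by simp
    then obtain f g where *: "Fr [:0, 1:] (1 :: 'a poly) = Fr f g" "g \<noteq> 0"
      "Polynomial.degree f \<le> Polynomial.degree g"
      by (rule local_ring_InftyE)
    hence "[:0, 1:] * g = f" by (simp add: eq_fract)
    hence "Polynomial.degree f = 1 + Polynomial.degree g"
      using *(2) by (metis degree_mult_eq degree_pCons_eq_if pCons_eq_0_iff one_neq_zero degree_1 One_nat_def degree_0)
    thus False using * by simp
  qed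
next
  case (Fin p)
  show ?thesis
  proof
    assume "inverse (uniformizer x) \<in> local_ring x"
    then obtain f g where *: "Fr 1 (poly_of p) = Fr f g" "\<not> poly_of p dvd g"
      using Fin by (auto elim!: local_ring_FinE)
    from *(2) have "g \<noteq> 0" by auto
    with * have "g = f * poly_of p" by (simp add: eq_fract)
    thus False using *(2) by simp
  qed
qed

text \<open>The condition on \<open>u\<close> in the definite description that defines
  \<open>valuation\<close>.\<close>

definition local_unit :: "'a :: field closed_pt \<Rightarrow> 'a ratfun \<Rightarrow> bool" where
  "local_unit x u \<longleftrightarrow> u \<noteq> 0 \<and> u \<in> local_ring x \<and> inverse u \<in> local_ring x"

lemma local_unit_mult: "local_unit x u \<Longrightarrow> local_unit x v \<Longrightarrow> local_unit x (u * v)"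
  by (auto simp: local_unit_def local_ring_mult)

lemma local_unit_inverse: "local_unit x u \<Longrightarrow> local_unit x (inverse u)"
  by (auto simp: local_unit_def)

lemma local_unit_1: "local_unit x 1"
  by (simp add: local_unit_def local_ring_1)

lemma local_unit_Infty:
  assumes "f \<noteq> 0" "g \<noteq> 0" "Polynomial.degree f = Polynomial.degree g"
  shows "local_unit Infty (Fr f g)"
  using assms by (auto simp: local_unit_def Fract_nz_iff intro!: local_ring_InftyI)

lemma local_unit_Fin:
  assumes "\<not> poly_of p dvd f" "\<not> poly_of p dvd g"
  shows "local_unit (Fin p) (Fr f g)"
proof -
  have "f \<noteq> 0" "g \<noteq> 0" using assms by auto
  thus ?thesis using assms by (auto simp: local_unit_def Fract_nz_iff intro!: local_ring_FinI)
qed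

lemma powi_Fr: "t \<noteq> 0 \<Longrightarrow> Fr t 1 powi k = (if k \<ge> 0 then Fr (t ^ nat k) 1 else Fr 1 (t ^ nat (-k)))"
  by (auto simp: power_int_def Fr_power)

lemma Infty_powi: "uniformizer Infty powi k =
  (if k \<ge> 0 then Fr 1 ([:0, 1:] ^ nat k) else Fr ([:0, 1:] ^ nat (-k)) 1)"
  by (auto simp: power_int_def Fr_power)

lemma Fract_Infty_decomp:
  assumes "f \<noteq> 0" "g \<noteq> 0"
  shows "\<exists>u. local_unit Infty u \<and>
    Fr f g = u * uniformizer Infty powi (int (Polynomial.degree g) - int (Polynomial.degree f))"
proof -
  define k where "k = int (Polynomial.degree g) - int (Polynomial.degree f)"
  let ?t = "[:0, 1:] :: 'a poly"
  define u where "u = (if k \<ge> 0 then Fr (f * ?t ^ nat k) g else Fr f (g * ?t ^ nat (-k)))"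
  have t: "?t ^ n \<noteq> 0" for n by simp
  have d: "Polynomial.degree (?t ^ n) = n" for n
    by (subst degree_power_eq) auto
  have "local_unit Infty u"
    unfolding u_def using assms d t
    by (auto intro!: local_unit_Infty simp: degree_mult_eq k_def)
  moreover have "Fr f g = u * uniformizer Infty powi k"
    unfolding Infty_powi u_def using assms t by (auto simp: eq_fract)
  ultimately show ?thesis unfolding k_def by blast
qed

lemma poly_of_factor:
  assumes "f \<noteq> 0"
  shows "\<exists>n f'. f = poly_of p ^ n * f' \<and> \<not> poly_of p dvd f'"
  using assms
proof (induction "Polynomial.degree f" arbitrary: f rule: less_induct)
  case less
  show ?case
  proof (cases "poly_of p dvd f")
    case False
    thus ?thesis by (intro exI[of _ 0] exI[of _ f]) auto
  next
    case True
    then obtain g where g: "f = poly_of p * g" by blast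
    with less.prems have "g \<noteq> 0" by auto
    moreover have "Polynomial.degree g < Polynomial.degree f"
      using \<open>g \<noteq> 0\<close> degree_poly_of_pos[of p] by (simp add: g degree_mult_eq)
    ultimately obtain n f' where "g = poly_of p ^ n * f'" "\<not> poly_of p dvd f'"
      using less.hyps by blast
    thus ?thesis by (intro exI[of _ "Suc n"] exI[of _ f']) (auto simp: g)
  qed
qed

lemma Fract_Fin_decomp:
  assumes "f \<noteq> 0" "g \<noteq> 0"
  shows "\<exists>u k. local_unit (Fin p) u \<and> Fr f g = u * uniformizer (Fin p) powi k"
proof -
  from poly_of_factor[OF assms(1), of p] obtain n f' where f: "f = poly_of p ^ n * f'" "\<not> poly_of p dvd f'" by blast
  from poly_of_factor[OF assms(2), of p] obtain m g' where g: "g = poly_of p ^ m * g'" "\<not> poly_of p dvd g'" by blast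
  have nz: "g' \<noteq> 0" "f' \<noteq> 0" using g assms f by auto
  have "Fr f g = Fr f' g' * (Fr (poly_of p) 1 powi int n * Fr (poly_of p) 1 powi (- int m))"
    unfolding powi_Fr[OF poly_of_nz] using nz f(1) g(1) by (auto simp: eq_fract)
  also have "Fr (poly_of p) 1 powi int n * Fr (poly_of p) 1 powi (- int m) = 
     uniformizer (Fin p) powi (int n - int m)"
    using uniformizer_nz[of "Fin p"] by (simp add: power_int_diff power_int_minus field_simps)
  finally show ?thesis using local_unit_Fin[OF f(2) g(2)] by blast
qed

text \<open>Existence half of the definite description in \<open>valuation\<close>: at infinity
  \<open>k\<close> is the degree of the denominator minus that of the numerator, at a finite point
  the powers of the prime are pulled out of both. Uniqueness is
  \<open>local_unit_uniformizer_powi\<close>.\<close>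

lemma local_decomp:
  assumes "h \<noteq> 0"
  obtains u k where "local_unit x u" "h = u * uniformizer x powi k"
proof -
  obtain f g where h: "h = Fr f g" "g \<noteq> 0" by (rule ratfun_cases)
  with assms have "f \<noteq> 0" by auto
  have "\<exists>u k. local_unit x u \<and> h = u * uniformizer x powi k"
    unfolding h(1)
    by (cases x) (use Fract_Infty_decomp[OF \<open>f \<noteq> 0\<close> h(2)] Fract_Fin_decomp[OF \<open>f \<noteq> 0\<close> h(2)] in blast)+
  thus ?thesis using that by blast
qed

text \<open>If a positive power were a unit, multiplying its inverse by all but one of its factors
  would put the inverse of the uniformizer into the local ring.\<close>

lemma local_unit_uniformizer_powi: "local_unit x (uniformizer x powi k) \<Longrightarrow> k = 0"
proof -
  have *: False if "local_unit x (uniformizer x ^ Suc n)" for n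
  proof -
    have "inverse (uniformizer x ^ Suc n) * uniformizer x ^ n \<in> local_ring x"
      using that uniformizer_in by (intro local_ring_mult local_ring_power) (auto simp: local_unit_def)
    moreover have "inverse (uniformizer x ^ Suc n) * uniformizer x ^ n = inverse (uniformizer x)"
      using uniformizer_nz[of x] by (simp add: power_Suc2)
    ultimately show False using inverse_uniformizer_notin[of x] by metis
  qed
  assume u: "local_unit x (uniformizer x powi k)"
  show "k = 0"
  proof (rule ccontr)
    assume "k \<noteq> 0"
    then consider n where "k = int (Suc n)" | n where "k = - int (Suc n)"
      by (metis int_cases2 not0_implies_Suc of_nat_0 neg_0_equal_iff_equal)
    thus False
    proof cases
      case 1 thus False using u *[of n] by (simp add: power_int_def nat_add_distrib)
    next
      case 2
      have "local_unit x (uniformizer x powi (- k))" using local_unit_inverse[OF u] by (simp add: power_int_minus)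
      hence "local_unit x (uniformizer x powi int (Suc n))" using 2 by (simp add: add.commute)
      hence "local_unit x (uniformizer x ^ Suc n)" by (simp only: power_int_of_nat)
      thus False by (rule *)
    qed
  qed
qed

lemma valuation_eqI:
  assumes "local_unit x u" "h = u * uniformizer x powi k"
  shows "valuation x h = k"
  unfolding valuation_def
proof (rule the_equality)
  show "\<exists>u. u \<noteq> 0 \<and> u \<in> local_ring x \<and> inverse u \<in> local_ring x \<and> h = u * uniformizer x powi k"
    using assms by (auto simp: local_unit_def)
next
  fix k' assume "\<exists>u. u \<noteq> 0 \<and> u \<in> local_ring x \<and> inverse u \<in> local_ring x \<and> h = u * uniformizer x powi k'"
  then obtain u' where u': "local_unit x u'" "h = u' * uniformizer x powi k'" by (auto simp: local_unit_def)
  have "uniformizer x powi (k' - k) = u * inverse u'"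
    using u' assms uniformizer_nz[of x] by (simp add: power_int_diff field_simps local_unit_def)
  hence "local_unit x (uniformizer x powi (k' - k))"
    using local_unit_mult[OF assms(1) local_unit_inverse[OF u'(1)]] by simp
  thus "k' = k" using local_unit_uniformizer_powi by fastforce
qed

lemma valuation_decomp:
  assumes "h \<noteq> 0"
  obtains u where "local_unit x u" "h = u * uniformizer x powi valuation x h"
proof -
  obtain u k where u: "local_unit x u" "h = u * uniformizer x powi k"
    using local_decomp[OF assms] .
  thus ?thesis using that[OF u(1)] valuation_eqI[OF u] by simp
qed

lemma valuation_mult:
  assumes "h \<noteq> 0" "h' \<noteq> 0"
  shows "valuation x (h * h') = valuation x h + valuation x h'"
proof -
  obtain u k where u: "local_unit x u" "h = u * uniformizer x powi k"
    using local_decomp[OF assms(1)] .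
  obtain u' k' where u': "local_unit x u'" "h' = u' * uniformizer x powi k'"
    using local_decomp[OF assms(2)] .
  have "valuation x (h * h') = k + k'" using uniformizer_nz[of x] u u'
    by (intro valuation_eqI[of x "u * u'"] local_unit_mult)
       (auto simp: power_int_add ac_simps)
  thus ?thesis using valuation_eqI[OF u] valuation_eqI[OF u'] by simp
qed

lemma valuation_1 [simp]: "valuation x 1 = 0"
  by (rule valuation_eqI[OF local_unit_1]) simp

lemma valuation_inverse: "h \<noteq> 0 \<Longrightarrow> valuation x (inverse h) = - valuation x h"
  using valuation_mult[of h "inverse h" x] by simp

lemma valuation_divide: "h \<noteq> 0 \<Longrightarrow> h' \<noteq> 0 \<Longrightarrow> valuation x (h / h') = valuation x h - valuation x h'"
  using valuation_mult[of h "inverse h'" x] by (simp add: valuation_inverse divide_inverse)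

lemma valuation_uniformizer_powi: "valuation x (uniformizer x powi k) = k"
  by (rule valuation_eqI[OF local_unit_1]) simp

lemma valuation_uniformizer [simp]: "valuation x (uniformizer x) = 1"
  using valuation_uniformizer_powi[of x 1] by simp

lemma local_ring_iff: "h \<in> local_ring x \<longleftrightarrow> h = 0 \<or> valuation x h \<ge> 0"
proof (cases "h = 0")
  case False
  then obtain u k where u: "local_unit x u" "h = u * uniformizer x powi k"
    by (rule local_decomp)
  have k_def: "k = valuation x h" using valuation_eqI[OF u] by simp
  show ?thesis
  proof (cases "k \<ge> 0")
    case True
    hence "uniformizer x powi k \<in> local_ring x" by (simp add: power_int_def local_ring_power uniformizer_in)
    hence "h \<in> local_ring x"
      using u local_ring_mult[of u x "uniformizer x powi k"] by (auto simp: local_unit_def)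
    thus ?thesis using True by (simp add: k_def)
  next
    case neg: False
    have "h \<notin> local_ring x"
    proof
      assume h: "h \<in> local_ring x"
      \<comment> \<open>The exponent brings the total order to exactly -1, the case excluded by
        \<open>inverse_uniformizer_notin\<close>.\<close>
      have "inverse u * h * uniformizer x ^ nat (- k - 1) \<in> local_ring x"
        using u h by (intro local_ring_mult local_ring_power uniformizer_in) (auto simp: local_unit_def)
      also have "inverse u * h = uniformizer x powi k" 
        using u by (auto simp: local_unit_def)
      also have "\<dots> * uniformizer x ^ nat (- k - 1) = uniformizer x powi (k + (- k - 1))"
        using neg uniformizer_nz[of x] by (subst power_int_add) (auto simp: power_int_def)
      finally show False using inverse_uniformizer_notin[of x] by simp
    qed
    thus ?thesis using neg False by (simp add: k_def)
  qed
qed (simp add: local_ring_0)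

lemma max_ideal_iff: "h \<in> max_ideal x \<longleftrightarrow> h = 0 \<or> valuation x h \<ge> 1"
  unfolding max_ideal_def by (auto simp: local_ring_iff valuation_inverse)

lemma local_unit_iff: "local_unit x u \<longleftrightarrow> u \<noteq> 0 \<and> valuation x u = 0"
  by (auto simp: local_unit_def local_ring_iff valuation_inverse)

lemma max_ideal_subset: "h \<in> max_ideal x \<Longrightarrow> h \<in> local_ring x"
  by (simp add: max_ideal_def)

lemma max_ideal_0: "0 \<in> max_ideal x"
  by (simp add: max_ideal_iff)

lemma max_ideal_uniformizer: "h \<in> max_ideal x \<longleftrightarrow> (\<exists>c\<in>local_ring x. h = uniformizer x * c)"
proof
  assume h: "h \<in> max_ideal x"
  show "\<exists>c\<in>local_ring x. h = uniformizer x * c"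
  proof (cases "h = 0")
    case False
    have "h / uniformizer x \<in> local_ring x" 
      using h False uniformizer_nz[of x] by (auto simp: max_ideal_iff local_ring_iff valuation_divide)
    thus ?thesis using uniformizer_nz[of x] by (intro bexI[of _ "h / uniformizer x"]) auto
  qed (auto intro: local_ring_0)
next
  assume "\<exists>c\<in>local_ring x. h = uniformizer x * c"
  then obtain c where c: "c \<in> local_ring x" "h = uniformizer x * c" by blast
  show "h \<in> max_ideal x"
  proof (cases "c = 0")
    case False
    have "valuation x h = 1 + valuation x c"
      unfolding c(2) using valuation_mult[OF uniformizer_nz False] by simp
    thus ?thesis using c(1) False by (simp add: max_ideal_iff local_ring_iff)
  qed (simp add: c max_ideal_iff)
qed

lemma max_ideal_mult:
  assumes "c \<in> local_ring x" "h \<in> max_ideal x"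
  shows "c * h \<in> max_ideal x"
proof -
  obtain c' where c': "c' \<in> local_ring x" "h = uniformizer x * c'"
    using assms(2)[unfolded max_ideal_uniformizer] by blast
  have "c * c' \<in> local_ring x" using assms(1) c'(1) by (rule local_ring_mult)
  moreover have "c * h = uniformizer x * (c * c')" by (simp add: c'(2))
  ultimately show ?thesis unfolding max_ideal_uniformizer by (rule bexI[rotated])
qed

lemma max_ideal_add:
  assumes "h \<in> max_ideal x" "h' \<in> max_ideal x"
  shows "h + h' \<in> max_ideal x"
proof -
  obtain c where c: "c \<in> local_ring x" "h = uniformizer x * c"
    using assms(1)[unfolded max_ideal_uniformizer] by blast
  obtain c' where c': "c' \<in> local_ring x" "h' = uniformizer x * c'"
    using assms(2)[unfolded max_ideal_uniformizer] by blast
  show ?thesis unfolding max_ideal_uniformizer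
    by (rule bexI[of _ "c + c'"]) (use c c' in \<open>simp_all add: distrib_left local_ring_add\<close>)
qed

lemma max_ideal_uminus: "h \<in> max_ideal x \<Longrightarrow> - h \<in> max_ideal x"
  using max_ideal_mult[of "-1" x h] local_ring_uminus[OF local_ring_1, of x] by simp

lemma max_ideal_diff: "h \<in> max_ideal x \<Longrightarrow> h' \<in> max_ideal x \<Longrightarrow> h - h' \<in> max_ideal x"
  using max_ideal_add[of h x "-h'"] max_ideal_uminus by force

lemma local_ring_not_max_ideal: "h \<in> local_ring x \<Longrightarrow> h \<notin> max_ideal x \<Longrightarrow> local_unit x h"
  by (auto simp: local_ring_iff max_ideal_iff local_unit_iff)

lemma one_notin_max_ideal: "1 \<notin> max_ideal x"
  by (simp add: max_ideal_iff)

lemma valuation_Infty: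
  assumes "f \<noteq> 0" "g \<noteq> 0"
  shows "valuation Infty (Fr f g) = int (Polynomial.degree g) - int (Polynomial.degree f)"
  using Fract_Infty_decomp[OF assms] valuation_eqI by metis

lemma valuation_Fin_0:
  assumes "\<not> poly_of p dvd f" "\<not> poly_of p dvd g"
  shows "valuation (Fin p) (Fr f g) = 0"
  using local_unit_Fin[OF assms] local_unit_iff by blast

lemma poly_in_local_ring_Fin: "Fr f 1 \<in> local_ring (Fin p)"
  by (intro local_ring_FinI) simp

lemma poly_in_max_ideal_Fin: "Fr f 1 \<in> max_ideal (Fin p) \<longleftrightarrow> poly_of p dvd f"
proof
  assume m: "Fr f 1 \<in> max_ideal (Fin p)"
  show "poly_of p dvd f"
  proof (rule ccontr)
    assume n: "\<not> poly_of p dvd f"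
    hence "valuation (Fin p) (Fr f 1) = 0" by (intro valuation_Fin_0) auto
    thus False using m n by (auto simp: max_ideal_iff Fract_nz_iff)
  qed
next
  assume "poly_of p dvd f"
  then obtain g where "f = poly_of p * g" by blast
  hence "Fr f 1 = uniformizer (Fin p) * Fr g 1" by simp
  thus "Fr f 1 \<in> max_ideal (Fin p)" unfolding max_ideal_uniformizer
    using poly_in_local_ring_Fin by blast
qed

lemma const_in_local_ring: "Fr [:c:] 1 \<in> local_ring x"
  by (cases x) (auto intro!: local_ring_InftyI local_ring_FinI)

lemma irreducible_factor:
  assumes "Polynomial.degree (f :: 'a :: field poly) > 0"
  obtains p where "poly_of p dvd f"
proof -
  have "\<exists>p. Factorial_Ring.irreducible p \<and> p dvd f"
    using assms
  proof (induction "Polynomial.degree f" arbitrary: f rule: less_induct)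
    case less
    show ?case
    proof (cases "Factorial_Ring.irreducible f")
      case False
      have "f \<noteq> 0" using less.prems by (metis degree_0 less_irrefl)
      have "\<not> f dvd 1" using less.prems is_unit_iff_degree[OF \<open>f \<noteq> 0\<close>] by linarith
      have "\<exists>a b. f = a * b \<and> \<not> a dvd 1 \<and> \<not> b dvd 1"
      proof (rule ccontr)
        assume "\<nexists>a b. f = a * b \<and> \<not> a dvd 1 \<and> \<not> b dvd 1"
        hence "\<And>a b. f = a * b \<Longrightarrow> a dvd 1 \<or> b dvd 1" by blast
        with \<open>f \<noteq> 0\<close> \<open>\<not> f dvd 1\<close> have "Factorial_Ring.irreducible f" by (rule Factorial_Ring.irreducibleI)
        with False show False by contradiction
      qed
      then obtain a b where ab: "f = a * b" "\<not> a dvd 1" "\<not> b dvd 1" by blast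
      have nz: "a \<noteq> 0" "b \<noteq> 0" using \<open>f \<noteq> 0\<close> unfolding ab(1) by simp_all
      have "Polynomial.degree a > 0" "Polynomial.degree b > 0" using ab nz is_unit_iff_degree by blast+
      moreover from nz have "Polynomial.degree f = Polynomial.degree a + Polynomial.degree b" by (simp add: ab degree_mult_eq)
      ultimately have "Polynomial.degree a < Polynomial.degree f" "Polynomial.degree a > 0" by simp_all
      from less.hyps[OF this] obtain p where "Factorial_Ring.irreducible p" "p dvd a" by blast
      thus ?thesis unfolding ab(1) by (meson dvd_mult2)
    qed auto
  qed
  then obtain p where p: "Factorial_Ring.irreducible p" "p dvd f" by blast
  \<comment> \<open>Elements of \<open>prime_poly\<close> are monic, hence the rescaling.\<close>
  define q where "q = smult (inverse (lead_coeff p)) p"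
  have pnz: "p \<noteq> 0" using p by auto
  have "Factorial_Ring.irreducible q"
  proof -
    have "inverse (lead_coeff p) dvd 1"
      using pnz by (intro dvdI[of _ _ "lead_coeff p"]) simp
    thus ?thesis
      using p(1) irreducible_mult_unit_left[of "[:inverse (lead_coeff p):]" p]
      by (simp add: q_def is_unit_const_poly_iff)
  qed
  moreover have "lead_coeff q = 1" using pnz by (simp add: q_def)
  ultimately have "poly_of (Abs_prime_poly q) = q" by (intro Abs_prime_poly_inverse) auto
  moreover have "q dvd f" using p(2) pnz by (simp add: q_def smult_dvd_iff)
  ultimately have "poly_of (Abs_prime_poly q) dvd f" by simp
  thus ?thesis by (rule that)
qed

text \<open>A prime factor \<open>p\<close> of the denominator can be cancelled: regularity at
  \<open>p\<close> gives a second fraction with denominator prime to \<open>p\<close>, and comparing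
  the two shows that \<open>p\<close> divides the numerator as well. The degree of the denominator
  drops.\<close>

lemma everywhere_finite_regular_is_poly:
  assumes "\<And>p. h \<in> local_ring (Fin p)"
  obtains f where "h = Fr f 1"
proof -
  have "\<exists>f. h = Fr f 1" if "h = Fr f g" "g \<noteq> 0" for f g
    using that
  proof (induction "Polynomial.degree g" arbitrary: f g rule: less_induct)
    case less
    show ?case
    proof (cases "Polynomial.degree g = 0")
      case True
      then obtain c where c: "g = [:c:]" by (rule degree_eq_zeroE)
      have "h = Fr (smult (inverse c) f) 1"
        unfolding less.prems(1) using less.prems(2) c by (simp add: eq_fract)
      thus ?thesis by blast
    next
      case False
      hence "Polynomial.degree g > 0" by simp
      then obtain p where p: "poly_of p dvd g" by (rule irreducible_factor)
      obtain f' g' where *: "h = Fr f' g'" "\<not> poly_of p dvd g'"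
        using local_ring_FinE[OF assms[of p]] by metis
      hence "g' \<noteq> 0" by auto
      with * less.prems have "f * g' = f' * g" by (simp add: eq_fract)
      hence "poly_of p dvd f * g'" using p by simp
      hence "poly_of p dvd f" using * by simp
      then obtain f1 where f1: "f = poly_of p * f1" by blast
      from p obtain g1 where g1: "g = poly_of p * g1" by blast
      have "g1 \<noteq> 0" using g1 less.prems by auto
      moreover have "Polynomial.degree g1 < Polynomial.degree g"
        using \<open>g1 \<noteq> 0\<close> degree_poly_of_pos[of p] by (simp add: g1 degree_mult_eq)
      moreover have "h = Fr f1 g1" using less.prems \<open>g1 \<noteq> 0\<close> by (simp add: f1 g1 eq_fract)
      ultimately show ?thesis using less.hyps by blast
    qed
  qed
  moreover obtain f g where "h = Fr f g" "g \<noteq> 0" by (rule ratfun_cases)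
  ultimately obtain f where "h = Fr f 1" by blast
  thus ?thesis by (rule that)
qed

section \<open>Submodules of the generic fibre and fibres of bundles\<close>

lemma local_submodule_carrier: "local_submodule n x (carrier_vec n)"
  by (auto simp: local_submodule_def)

lemma local_submodule_span:
  assumes "S \<subseteq> carrier_vec n"
  shows "local_submodule n x (local_span n x S)"
proof -
  have "local_span n x S \<subseteq> carrier_vec n"
    using assms local_submodule_carrier unfolding local_span_def by blast
  thus ?thesis unfolding local_submodule_def local_span_def by blast
qed

lemma local_span_superset: "S \<subseteq> local_span n x S"
  unfolding local_span_def by blast

lemma local_span_least: "local_submodule n x M \<Longrightarrow> S \<subseteq> M \<Longrightarrow> local_span n x S \<subseteq> M"
  unfolding local_span_def by blast

lemma local_submodule_uminus:
  assumes "local_submodule n x M" "v \<in> M"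
  shows "- v \<in> M"
proof -
  have "(-1) \<cdot>\<^sub>v v \<in> M" using assms local_ring_uminus[OF local_ring_1, of x]
    unfolding local_submodule_def by blast
  moreover have "(-1) \<cdot>\<^sub>v v = - v" by (rule eq_vecI) auto
  ultimately show ?thesis by simp
qed

lemma local_submodule_add: "local_submodule n x M \<Longrightarrow> v \<in> M \<Longrightarrow> w \<in> M \<Longrightarrow> v + w \<in> M"
  and local_submodule_smult: "local_submodule n x M \<Longrightarrow> c \<in> local_ring x \<Longrightarrow> v \<in> M \<Longrightarrow> c \<cdot>\<^sub>v v \<in> M"
  and local_submodule_zero: "local_submodule n x M \<Longrightarrow> 0\<^sub>v n \<in> M"
  and local_submodule_dim: "local_submodule n x M \<Longrightarrow> v \<in> M \<Longrightarrow> v \<in> carrier_vec n"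
  unfolding local_submodule_def by blast+

lemma local_submodule_preimage:
  assumes "local_submodule n' x M" "A \<in> carrier_mat n' n"
  shows "local_submodule n x {v \<in> carrier_vec n. A *\<^sub>v v \<in> M}"
  unfolding local_submodule_def
proof (intro conjI ballI)
  have "A *\<^sub>v 0\<^sub>v n = 0\<^sub>v n'" using assms(2) by auto
  thus "0\<^sub>v n \<in> {v \<in> carrier_vec n. A *\<^sub>v v \<in> M}" using local_submodule_zero[OF assms(1)] by simp
next
  fix v w assume "v \<in> {v \<in> carrier_vec n. A *\<^sub>v v \<in> M}" "w \<in> {v \<in> carrier_vec n. A *\<^sub>v v \<in> M}"
  thus "v + w \<in> {v \<in> carrier_vec n. A *\<^sub>v v \<in> M}"
    using assms by (auto simp: mult_add_distrib_mat_vec intro: local_submodule_add)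
next
  fix c v assume "c \<in> local_ring x" "v \<in> {v \<in> carrier_vec n. A *\<^sub>v v \<in> M}"
  thus "c \<cdot>\<^sub>v v \<in> {v \<in> carrier_vec n. A *\<^sub>v v \<in> M}"
    using assms by (auto simp: mult_mat_vec intro: local_submodule_smult)
qed auto

text \<open>The product of the maximal ideal with the stalk; the fibre is the quotient of the stalk
  by it.\<close>

definition mlat :: "nat \<Rightarrow> 'a :: field stalks \<Rightarrow> 'a closed_pt \<Rightarrow> 'a ratfun vec set" where
  "mlat n L x = local_span n x {c \<cdot>\<^sub>v w | c w. c \<in> max_ideal x \<and> w \<in> L x}"

text \<open>What the formal arguments on morphisms and fibres use of a bundle. It passes to
  \<open>bundle_sum\<close> and \<open>bundle_ac\<close> without any choice of local bases.\<close>

definition stalks_ok :: "nat \<Rightarrow> 'a :: field stalks \<Rightarrow> bool" where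
  "stalks_ok n L \<longleftrightarrow> (\<forall>x. local_submodule n x (L x))"

lemma stalks_okD: "stalks_ok n L \<Longrightarrow> local_submodule n x (L x)"
  by (simp add: stalks_ok_def)

lemma stalks_ok_dim: "stalks_ok n L \<Longrightarrow> v \<in> L x \<Longrightarrow> v \<in> carrier_vec n"
  using stalks_okD local_submodule_dim by blast

lemma mlat_submodule: "stalks_ok n L \<Longrightarrow> local_submodule n x (mlat n L x)"
  unfolding mlat_def by (rule local_submodule_span) (auto dest: stalks_ok_dim)

lemma mlat_dim: "stalks_ok n L \<Longrightarrow> v \<in> mlat n L x \<Longrightarrow> v \<in> carrier_vec n"
  using mlat_submodule local_submodule_dim by blast

lemma fibre_class_alt: "fibre_class n L x v = {v + u | u. u \<in> mlat n L x}"
  by (simp add: fibre_class_def mlat_def)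

lemma fibre_class_eq_iff:
  assumes "stalks_ok n L" "v \<in> carrier_vec n" "w \<in> carrier_vec n"
  shows "fibre_class n L x v = fibre_class n L x w \<longleftrightarrow> v - w \<in> mlat n L x"
proof
  assume eq: "fibre_class n L x v = fibre_class n L x w"
  have "v + 0\<^sub>v n \<in> fibre_class n L x v"
    unfolding fibre_class_alt using local_submodule_zero[OF mlat_submodule[OF assms(1)]] by blast
  then obtain u where u: "u \<in> mlat n L x" "v = w + u"
    unfolding eq using assms by (auto simp: fibre_class_alt)
  have "v - w = u" using u assms mlat_dim[OF assms(1) u(1)] by (intro eq_vecI) auto
  thus "v - w \<in> mlat n L x" using u by simp
next
  assume d: "v - w \<in> mlat n L x"
  have d': "w - v \<in> mlat n L x"
  proof -
    have "- (v - w) \<in> mlat n L x" by (rule local_submodule_uminus[OF mlat_submodule[OF assms(1)] d])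
    moreover have "- (v - w) = w - v" using assms by (intro eq_vecI) auto
    ultimately show ?thesis by simp
  qed
  have sub: "fibre_class n L x a \<subseteq> fibre_class n L x b"
    if "a - b \<in> mlat n L x" "a \<in> carrier_vec n" "b \<in> carrier_vec n" for a b
  proof
    fix z assume "z \<in> fibre_class n L x a"
    then obtain u where u: "u \<in> mlat n L x" "z = a + u" by (auto simp: fibre_class_alt)
    have "z = b + ((a - b) + u)" using u that mlat_dim[OF assms(1) u(1)] by (intro eq_vecI) auto
    thus "z \<in> fibre_class n L x b"
      using that u local_submodule_add[OF mlat_submodule[OF assms(1)]] by (auto simp: fibre_class_alt)
  qed
  show "fibre_class n L x v = fibre_class n L x w"
    using sub[OF d] sub[OF d'] assms by blast
qed

lemma bundle_hom_dim: "A \<in> bundle_hom n L n' L' \<Longrightarrow> A \<in> carrier_mat n' n"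
  and bundle_hom_stalk: "A \<in> bundle_hom n L n' L' \<Longrightarrow> v \<in> L x \<Longrightarrow> A *\<^sub>v v \<in> L' x"
  by (auto simp: bundle_hom_def)

text \<open>The vectors that \<open>A\<close> sends into the target form a submodule containing the
  generators. This makes the induced map on fibres well defined
  (\<open>fibre_class_hom\<close>).\<close>

lemma mlat_hom:
  assumes "stalks_ok n L" "stalks_ok n' L'" "A \<in> carrier_mat n' n"
    and "\<And>v. v \<in> L x \<Longrightarrow> A *\<^sub>v v \<in> L' x" "v \<in> mlat n L x"
  shows "A *\<^sub>v v \<in> mlat n' L' x"
proof -
  let ?M = "{v \<in> carrier_vec n. A *\<^sub>v v \<in> mlat n' L' x}"
  have "mlat n L x \<subseteq> ?M" unfolding mlat_def
  proof (rule local_span_least, fold mlat_def)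
    show "local_submodule n x ?M" by (rule local_submodule_preimage[OF mlat_submodule[OF assms(2)] assms(3)])
    show "{c \<cdot>\<^sub>v w |c w. c \<in> max_ideal x \<and> w \<in> L x} \<subseteq> ?M"
    proof safe
      fix c w assume cw: "c \<in> max_ideal x" "w \<in> L x"
      have w: "w \<in> carrier_vec n" using cw stalks_ok_dim assms by blast
      thus "c \<cdot>\<^sub>v w \<in> carrier_vec n" by simp
      have "A *\<^sub>v (c \<cdot>\<^sub>v w) = c \<cdot>\<^sub>v (A *\<^sub>v w)" using w assms(3) by (simp add: mult_mat_vec)
      thus "A *\<^sub>v (c \<cdot>\<^sub>v w) \<in> mlat n' L' x"
        using cw assms(4) local_span_superset unfolding mlat_def by fastforce
    qed
  qed
  thus ?thesis using assms(5) by auto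
qed

lemma mult_minus_distrib_mat_vec':
  "A \<in> carrier_mat n' n \<Longrightarrow> v \<in> carrier_vec n \<Longrightarrow> w \<in> carrier_vec n \<Longrightarrow>
     A *\<^sub>v (v - w) = A *\<^sub>v v - A *\<^sub>v (w :: 'a :: comm_ring_1 vec)"
  by (rule mult_minus_distrib_mat_vec)

lemma fibre_class_hom:
  assumes "stalks_ok n L" "stalks_ok n' L'" "A \<in> carrier_mat n' n"
    and "\<And>v. v \<in> L x \<Longrightarrow> A *\<^sub>v v \<in> L' x" "v \<in> carrier_vec n" "w \<in> carrier_vec n"
    and "fibre_class n L x v = fibre_class n L x w"
  shows "fibre_class n' L' x (A *\<^sub>v v) = fibre_class n' L' x (A *\<^sub>v w)"
proof -
  have "A *\<^sub>v (v - w) \<in> mlat n' L' x"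
    using assms fibre_class_eq_iff[OF assms(1) assms(5,6)] by (intro mlat_hom[OF assms(1-4)]) auto
  thus ?thesis
    using assms by (subst fibre_class_eq_iff) (auto simp: mult_minus_distrib_mat_vec')
qed

lemma local_submodule_image:
  assumes "local_submodule n x M" "A \<in> carrier_mat n' n"
  shows "local_submodule n' x ((\<lambda>v. A *\<^sub>v v) ` M)"
  unfolding local_submodule_def
proof (intro conjI ballI)
  show "(\<lambda>v. A *\<^sub>v v) ` M \<subseteq> carrier_vec n'"
    using assms(2) local_submodule_dim[OF assms(1)] by fastforce
  have "A *\<^sub>v 0\<^sub>v n = 0\<^sub>v n'" using assms(2) by auto
  thus "0\<^sub>v n' \<in> (\<lambda>v. A *\<^sub>v v) ` M" using local_submodule_zero[OF assms(1)] by (metis imageI)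
next
  fix v w assume "v \<in> (\<lambda>v. A *\<^sub>v v) ` M" "w \<in> (\<lambda>v. A *\<^sub>v v) ` M"
  then obtain v' w' where *: "v' \<in> M" "w' \<in> M" "v = A *\<^sub>v v'" "w = A *\<^sub>v w'" by blast
  hence "v + w = A *\<^sub>v (v' + w')"
    using assms local_submodule_dim[OF assms(1)] by (simp add: mult_add_distrib_mat_vec)
  thus "v + w \<in> (\<lambda>v. A *\<^sub>v v) ` M" using * local_submodule_add[OF assms(1)] by blast
next
  fix c v assume "c \<in> local_ring x" "v \<in> (\<lambda>v. A *\<^sub>v v) ` M"
  then obtain v' where *: "v' \<in> M" "v = A *\<^sub>v v'" "c \<in> local_ring x" by blast
  hence "c \<cdot>\<^sub>v v = A *\<^sub>v (c \<cdot>\<^sub>v v')"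
    using assms local_submodule_dim[OF assms(1)] by (simp add: mult_mat_vec)
  thus "c \<cdot>\<^sub>v v \<in> (\<lambda>v. A *\<^sub>v v) ` M" using * local_submodule_smult[OF assms(1)] by blast
qed

lemma local_vecs_submodule: "local_submodule n x (local_vecs n x)"
  unfolding local_submodule_def local_vecs_def
  by (auto intro: local_ring_0 simp: local_ring_add local_ring_mult)

lemma vector_bundle_stalk:
  assumes "vector_bundle n L"
  obtains g where "g \<in> carrier_mat n n" "det g \<noteq> 0" "L x = (\<lambda>v. g *\<^sub>v v) ` local_vecs n x"
  using assms unfolding vector_bundle_def by metis

lemma vector_bundle_stalks_ok:
  assumes "vector_bundle n L" shows "stalks_ok n L"
  unfolding stalks_ok_def
proof
  fix x obtain g where "g \<in> carrier_mat n n" "L x = (\<lambda>v. g *\<^sub>v v) ` local_vecs n x"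
    using vector_bundle_stalk[OF assms] by blast
  thus "local_submodule n x (L x)" using local_submodule_image[OF local_vecs_submodule] by metis
qed

section \<open>Parabolic morphisms\<close>

lemma bundle_hom_comp:
  assumes "A \<in> bundle_hom n L n' L'" "B \<in> bundle_hom n' L' n'' L''" "stalks_ok n L"
  shows "B * A \<in> bundle_hom n L n'' L''"
proof -
  have "(B * A) *\<^sub>v v \<in> L'' x" if "v \<in> L x" for v x
  proof -
    have "(B * A) *\<^sub>v v = B *\<^sub>v (A *\<^sub>v v)"
      using that assms by (intro assoc_mult_mat_vec) (auto dest: bundle_hom_dim stalks_ok_dim)
    thus ?thesis using that assms by (auto simp: bundle_hom_def)
  qed
  thus ?thesis using assms by (auto simp: bundle_hom_def)
qed

lemma bundle_hom_one: "stalks_ok n L \<Longrightarrow> 1\<^sub>m n \<in> bundle_hom n L n L"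
  by (auto simp: bundle_hom_def one_mult_mat_vec dest: stalks_ok_dim)

lemma parabolic_hom_bundle_hom: "A \<in> parabolic_hom D n L F n' L' F' \<Longrightarrow> A \<in> bundle_hom n L n' L'"
  and parabolic_hom_filtration: "A \<in> parabolic_hom D n L F n' L' F' \<Longrightarrow> x \<in> D \<Longrightarrow> v \<in> L x \<Longrightarrow>
    fibre_class n L x v \<in> F x j \<Longrightarrow> fibre_class n' L' x (A *\<^sub>v v) \<in> F' x j"
  by (auto simp: parabolic_hom_def)

lemma parabolic_hom_comp:
  assumes A: "A \<in> parabolic_hom D n L F n' L' F'" and B: "B \<in> parabolic_hom D n' L' F' n'' L'' F''"
    and ok: "stalks_ok n L"
  shows "B * A \<in> parabolic_hom D n L F n'' L'' F''"
proof -
  have *: "(B * A) *\<^sub>v v = B *\<^sub>v (A *\<^sub>v v)" if "v \<in> L x" for v x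
    using that assms parabolic_hom_bundle_hom
    by (intro assoc_mult_mat_vec) (blast dest: bundle_hom_dim stalks_ok_dim)+
  have "fibre_class n'' L'' x ((B * A) *\<^sub>v v) \<in> F'' x j"
    if "x \<in> D" "v \<in> L x" "fibre_class n L x v \<in> F x j" for x v j
    unfolding *[OF that(2)]
    using that parabolic_hom_filtration[OF A] parabolic_hom_filtration[OF B]
      bundle_hom_stalk[OF parabolic_hom_bundle_hom[OF A]] by blast
  thus ?thesis
    using bundle_hom_comp[OF parabolic_hom_bundle_hom[OF A] parabolic_hom_bundle_hom[OF B] ok]
    by (auto simp: parabolic_hom_def)
qed

lemma parabolic_isomorphic_sym:
  "parabolic_isomorphic D n L F n' L' F' \<Longrightarrow> parabolic_isomorphic D n' L' F' n L F"
  unfolding parabolic_isomorphic_def by blast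

lemma mult_mat_assoc4:
  fixes A :: "'a :: semiring_0 mat"
  assumes "A \<in> carrier_mat a b" "B \<in> carrier_mat b c" "C \<in> carrier_mat c d" "E \<in> carrier_mat d e"
  shows "(A * B) * (C * E) = A * (B * C) * E"
proof -
  have "(A * B) * (C * E) = ((A * B) * C) * E"
    using assms by (intro assoc_mult_mat[symmetric, of _ a c _ d _ e]) auto
  also have "(A * B) * C = A * (B * C)" using assms by (intro assoc_mult_mat) auto
  finally show ?thesis .
qed

lemma parabolic_isomorphic_trans:
  assumes "parabolic_isomorphic D n L F n' L' F'" "parabolic_isomorphic D n' L' F' n'' L'' F''"
    and "stalks_ok n L" "stalks_ok n'' L''"
  shows "parabolic_isomorphic D n L F n'' L'' F''"
proof -
  from assms(1) obtain A B where AB: "A \<in> parabolic_hom D n L F n' L' F'" "B \<in> parabolic_hom D n' L' F' n L F"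
    "A * B = 1\<^sub>m n'" "B * A = 1\<^sub>m n" unfolding parabolic_isomorphic_def by blast
  from assms(2) obtain A' B' where AB': "A' \<in> parabolic_hom D n' L' F' n'' L'' F''" "B' \<in> parabolic_hom D n'' L'' F'' n' L' F'"
    "A' * B' = 1\<^sub>m n''" "B' * A' = 1\<^sub>m n'" unfolding parabolic_isomorphic_def by blast
  note dims = AB(1,2) AB'(1,2)
  have c: "A \<in> carrier_mat n' n" "B \<in> carrier_mat n n'" "A' \<in> carrier_mat n'' n'" "B' \<in> carrier_mat n' n''"
    using dims parabolic_hom_bundle_hom bundle_hom_dim by blast+
  have "(A' * A) * (B * B') = A' * (A * B) * B'" 
    by (rule mult_mat_assoc4[OF c(3,1,2,4)])
  also have "\<dots> = 1\<^sub>m n''" using c AB AB' by simp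
  finally have 1: "(A' * A) * (B * B') = 1\<^sub>m n''" .
  have "(B * B') * (A' * A) = B * (B' * A') * A" 
    by (rule mult_mat_assoc4[OF c(2,4,3,1)])
  also have "\<dots> = 1\<^sub>m n" using c AB AB' by simp
  finally have 2: "(B * B') * (A' * A) = 1\<^sub>m n" .
  show ?thesis unfolding parabolic_isomorphic_def
    using 1 2 parabolic_hom_comp[OF AB(1) AB'(1) assms(3)] parabolic_hom_comp[OF AB'(2) AB(2) assms(4)] by blast
qed

lemma bundle_sum_submodule:
  assumes "stalks_ok n1 L1" "stalks_ok n2 L2"
  shows "stalks_ok (n1 + n2) (bundle_sum L1 L2)"
  unfolding stalks_ok_def local_submodule_def
proof (intro allI conjI ballI)
  fix x
  show "bundle_sum L1 L2 x \<subseteq> carrier_vec (n1 + n2)"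
    using assms by (auto simp: bundle_sum_def dest: stalks_ok_dim)
  have "0\<^sub>v n1 @\<^sub>v 0\<^sub>v n2 = (0\<^sub>v (n1 + n2) :: 'a ratfun vec)" by (rule eq_vecI) auto
  thus "0\<^sub>v (n1 + n2) \<in> bundle_sum L1 L2 x"
    using local_submodule_zero[OF stalks_okD[OF assms(1)]] local_submodule_zero[OF stalks_okD[OF assms(2)]]
    unfolding bundle_sum_def by (smt (verit) mem_Collect_eq)
next
  fix x v w assume "v \<in> bundle_sum L1 L2 x" "w \<in> bundle_sum L1 L2 x"
  then obtain v1 v2 w1 w2 where *: "v = v1 @\<^sub>v v2" "w = w1 @\<^sub>v w2" "v1 \<in> L1 x" "w1 \<in> L1 x" "v2 \<in> L2 x" "w2 \<in> L2 x"
    unfolding bundle_sum_def by blast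
  have "v + w = (v1 + w1) @\<^sub>v (v2 + w2)"
    unfolding *(1,2) using *(3-6) stalks_ok_dim[OF assms(1)] stalks_ok_dim[OF assms(2)]
    by (intro append_vec_add) auto
  thus "v + w \<in> bundle_sum L1 L2 x"
    using * local_submodule_add[OF stalks_okD[OF assms(1)]] local_submodule_add[OF stalks_okD[OF assms(2)]]
    unfolding bundle_sum_def by blast
next
  fix x c v assume c: "c \<in> local_ring x" and "v \<in> bundle_sum L1 L2 x"
  then obtain v1 v2 where *: "v = v1 @\<^sub>v v2" "v1 \<in> L1 x" "v2 \<in> L2 x"
    unfolding bundle_sum_def by blast
  have "c \<cdot>\<^sub>v v = (c \<cdot>\<^sub>v v1) @\<^sub>v (c \<cdot>\<^sub>v v2)" unfolding * by (rule eq_vecI) auto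
  thus "c \<cdot>\<^sub>v v \<in> bundle_sum L1 L2 x"
    using * c local_submodule_smult[OF stalks_okD[OF assms(1)]] local_submodule_smult[OF stalks_okD[OF assms(2)]]
    unfolding bundle_sum_def by blast
qed

lemma parabolic_indecomposable_cong:
  assumes "stalks_ok n L" "stalks_ok n L'" "parabolic_isomorphic D n L F n L' F'"
  shows "parabolic_indecomposable D n L F \<longleftrightarrow> parabolic_indecomposable D n L' F'"
proof -
  have "parabolic_indecomposable D n L F"
    if ok: "stalks_ok n L" "stalks_ok n L'" and iso: "parabolic_isomorphic D n L F n L' F'"
      and ind: "parabolic_indecomposable D n L' F'" for L F L' F'
    unfolding parabolic_indecomposable_def
  proof (intro conjI notI)
    assume "n = 0" thus False using ind by (simp add: parabolic_indecomposable_def)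
  next
    assume "\<exists>n1 L1 F1 n2 L2 F2. n1 \<noteq> 0 \<and> n2 \<noteq> 0 \<and>
          parabolic_bundle D n1 L1 F1 \<and> parabolic_bundle D n2 L2 F2 \<and>
          parabolic_isomorphic D n L F (n1 + n2) (bundle_sum L1 L2) (filtrations_sum n1 L1 F1 n2 L2 F2)"
    then obtain n1 L1 F1 n2 L2 F2 where *: "n1 \<noteq> 0" "n2 \<noteq> 0"
      "parabolic_bundle D n1 L1 F1" "parabolic_bundle D n2 L2 F2"
      "parabolic_isomorphic D n L F (n1 + n2) (bundle_sum L1 L2) (filtrations_sum n1 L1 F1 n2 L2 F2)"
      by blast
    have "stalks_ok (n1 + n2) (bundle_sum L1 L2)"
      using *(3,4) by (intro bundle_sum_submodule vector_bundle_stalks_ok) (auto simp: parabolic_bundle_def)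
    from parabolic_isomorphic_trans[OF parabolic_isomorphic_sym[OF iso] *(5) ok(2) this]
    show False using ind *(1-4) unfolding parabolic_indecomposable_def by blast
  qed
  thus ?thesis using assms parabolic_isomorphic_sym[OF assms(3)] by blast
qed

lemma block_projection_append:
  fixes v :: "'a :: comm_ring_1 vec"
  assumes "v \<in> carrier_vec n1" "v' \<in> carrier_vec n2"
  shows "four_block_mat (1\<^sub>m n1) (0\<^sub>m n1 n2) (0\<^sub>m n2 n1) (0\<^sub>m n2 n2) *\<^sub>v (v @\<^sub>v v') = v @\<^sub>v 0\<^sub>v n2"
  using assms by (subst four_block_mat_mult_vec[of _ n1 n1 _ n2 _ n2]) auto

text \<open>The projection onto a summand is an idempotent, whatever the ranks of the two summands.\<close>

lemma decomposable_imp_idempotent: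
  assumes ok: "stalks_ok n L" and "n \<noteq> 0" "\<not> parabolic_indecomposable D n L F"
  obtains A where "A \<in> parabolic_hom D n L F n L F" "A * A = A" "A \<noteq> 0\<^sub>m n n" "A \<noteq> 1\<^sub>m n"
proof -
  from assms obtain n1 L1 F1 n2 L2 F2 where n: "n1 \<noteq> 0" "n2 \<noteq> 0" and
    pb: "parabolic_bundle D n1 L1 F1" "parabolic_bundle D n2 L2 F2" and
    iso: "parabolic_isomorphic D n L F (n1 + n2) (bundle_sum L1 L2) (filtrations_sum n1 L1 F1 n2 L2 F2)"
    unfolding parabolic_indecomposable_def by blast
  let ?S = "bundle_sum L1 L2" and ?FS = "filtrations_sum n1 L1 F1 n2 L2 F2" and ?N = "n1 + n2"
  have ok1: "stalks_ok n1 L1" and ok2: "stalks_ok n2 L2"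
    using pb vector_bundle_stalks_ok by (auto simp: parabolic_bundle_def)
  have okS: "stalks_ok ?N ?S" by (rule bundle_sum_submodule[OF ok1 ok2])
  define P where "P = (four_block_mat (1\<^sub>m n1) (0\<^sub>m n1 n2) (0\<^sub>m n2 n1) (0\<^sub>m n2 n2) :: 'a ratfun mat)"
  have P: "P \<in> carrier_mat ?N ?N" unfolding P_def by auto
  have Pv: "P *\<^sub>v (v @\<^sub>v v') = v @\<^sub>v 0\<^sub>v n2" if "v \<in> L1 x" "v' \<in> L2 x" for v v' x
    unfolding P_def using that ok1 ok2 by (intro block_projection_append) (auto dest: stalks_ok_dim)
  have Phom: "P \<in> bundle_hom ?N ?S ?N ?S"
    unfolding bundle_hom_def
  proof (safe intro!: P)
    fix x v assume "v \<in> ?S x"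
    then obtain v1 v2 where "v = v1 @\<^sub>v v2" "v1 \<in> L1 x" "v2 \<in> L2 x" unfolding bundle_sum_def by blast
    thus "P *\<^sub>v v \<in> ?S x" using Pv[of v1 x v2] local_submodule_zero[OF stalks_okD[OF ok2]]
      unfolding bundle_sum_def by auto
  qed
  have Ppar: "P \<in> parabolic_hom D ?N ?S ?FS ?N ?S ?FS"
    unfolding parabolic_hom_def
  proof (safe intro!: Phom)
    fix x j v assume x: "x \<in> D" "v \<in> ?S x" "fibre_class ?N ?S x v \<in> ?FS x j"
    then obtain v1 v2 where v: "fibre_class ?N ?S x v = fibre_class ?N ?S x (v1 @\<^sub>v v2)"
      "v1 \<in> L1 x" "v2 \<in> L2 x" "fibre_class n1 L1 x v1 \<in> F1 x j" "fibre_class n2 L2 x v2 \<in> F2 x j"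
      unfolding filtrations_sum_def by blast
    have d: "v1 @\<^sub>v v2 \<in> ?S x" using v unfolding bundle_sum_def by blast
    have "fibre_class ?N ?S x (P *\<^sub>v v) = fibre_class ?N ?S x (P *\<^sub>v (v1 @\<^sub>v v2))"
      using x d by (intro fibre_class_hom[OF okS okS P _ _ _ v(1)] bundle_hom_stalk[OF Phom])
        (auto intro: stalks_ok_dim[OF okS])
    also have "\<dots> = fibre_class ?N ?S x (v1 @\<^sub>v 0\<^sub>v n2)" by (simp add: Pv[OF v(2,3)])
    also have "\<dots> \<in> ?FS x j"
    proof -
      have "fibre_class n2 L2 x (0\<^sub>v n2) \<in> F2 x j"
        using pb(2) x(1) unfolding parabolic_bundle_def fibre_subspace_def by blast
      thus ?thesis using v local_submodule_zero[OF stalks_okD[OF ok2]] 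
        unfolding filtrations_sum_def by blast
    qed
    finally show "fibre_class ?N ?S x (P *\<^sub>v v) \<in> ?FS x j" .
  qed
  from iso obtain A B where A: "A \<in> parabolic_hom D n L F ?N ?S ?FS" and B: "B \<in> parabolic_hom D ?N ?S ?FS n L F"
    and AB: "A * B = 1\<^sub>m ?N" "B * A = 1\<^sub>m n" unfolding parabolic_isomorphic_def by blast
  have c: "A \<in> carrier_mat ?N n" "B \<in> carrier_mat n ?N"
    using A B parabolic_hom_bundle_hom bundle_hom_dim by blast+
  define E where "E = B * (P * A)"
  have E: "E \<in> parabolic_hom D n L F n L F" unfolding E_def
    using parabolic_hom_comp[OF parabolic_hom_comp[OF A Ppar ok] B ok] .
  have PP: "P * P = P" unfolding P_def
    by (subst mult_four_block_mat[of _ n1 n1 _ n2 _ n2 _ _ n1 _ n2]) auto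
  have PA: "P * A \<in> carrier_mat ?N n" using c P by simp
  have PAB: "(P * A) * B = P" using assoc_mult_mat[OF P c] P AB(1) by simp
  have AEB: "A * E * B = P" 
    unfolding E_def mult_mat_assoc4[OF c PA c(2), symmetric] using P AB(1) by (simp add: PAB)
  have "E * E = B * ((P * A) * B) * (P * A)" unfolding E_def
    by (rule mult_mat_assoc4[OF c(2) PA c(2) PA])
  also have "\<dots> = (B * P) * (P * A)" by (simp add: PAB)
  also have "\<dots> = B * (P * P) * A" by (rule mult_mat_assoc4[OF c(2) P P c(1)])
  also have "\<dots> = E" unfolding PP E_def by (rule assoc_mult_mat[OF c(2) P c(1)])
  finally have "E * E = E" .
  moreover have "E \<noteq> 0\<^sub>m n n"
  proof
    assume "E = 0\<^sub>m n n"
    hence "P = 0\<^sub>m ?N ?N" using AEB c by simp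
    hence "P $$ (0, 0) = 0" using n by simp
    thus False using n by (simp add: P_def)
  qed
  moreover have "E \<noteq> 1\<^sub>m n"
  proof
    assume "E = 1\<^sub>m n"
    hence "P = 1\<^sub>m ?N" using AEB c AB by simp
    hence "P $$ (n1, n1) = 1" using n by simp
    thus False using n by (simp add: P_def)
  qed
  ultimately show ?thesis using that E by blast
qed

section \<open>Functoriality of the extension of scalars\<close>

lemma ratfun_ac_add: "ratfun_ac (h + h') = ratfun_ac h + ratfun_ac h'"
proof -
  obtain f g f' g' where "h = Fr f g" "g \<noteq> 0" "h' = Fr f' g'" "g' \<noteq> 0"
    using ratfun_cases by metis
  moreover have "map_poly to_ac (f * g' + f' * g) = map_poly to_ac f * map_poly to_ac g' + map_poly to_ac f' * map_poly to_ac g"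
    by (simp flip: map_poly_to_ac_mult) (rule poly_eqI, simp add: coeff_map_poly)
  ultimately show ?thesis by (simp add: ratfun_ac_Fract map_poly_to_ac_mult map_poly_to_ac_eq_0_iff)
qed

lemma ratfun_ac_mult: "ratfun_ac (h * h') = ratfun_ac h * ratfun_ac h'"
proof -
  obtain f g f' g' where "h = Fr f g" "g \<noteq> 0" "h' = Fr f' g'" "g' \<noteq> 0"
    using ratfun_cases by metis
  thus ?thesis by (simp add: ratfun_ac_Fract map_poly_to_ac_mult)
qed

lemma map_poly_to_ac_1: "map_poly to_ac 1 = 1"
  by (rule poly_eqI) (simp add: coeff_map_poly)

lemma ratfun_ac_0 [simp]: "ratfun_ac 0 = 0"
  using ratfun_ac_Fract[of 1 0] by simp

lemma ratfun_ac_1 [simp]: "ratfun_ac 1 = 1"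
  using ratfun_ac_Fract[of 1 1] by (simp add: map_poly_to_ac_1 flip: One_fract_def)

lemma semiring_hom_ratfun_ac: "semiring_hom ratfun_ac"
  by unfold_locales (auto simp: ratfun_ac_add ratfun_ac_mult)

lemma ratfun_ac_mat_vec:
  "A \<in> carrier_mat n' n \<Longrightarrow> v \<in> carrier_vec n \<Longrightarrow>
     map_vec ratfun_ac (A *\<^sub>v v) = map_mat ratfun_ac A *\<^sub>v map_vec ratfun_ac v"
  using semiring_hom.mult_mat_vec_hom[OF semiring_hom_ratfun_ac] .

lemma ratfun_ac_mat_mult:
  "A \<in> carrier_mat n' n \<Longrightarrow> B \<in> carrier_mat n n'' \<Longrightarrow>
     map_mat ratfun_ac (A * B) = map_mat ratfun_ac A * map_mat ratfun_ac B"
  using semiring_hom.mat_hom_mult[OF semiring_hom_ratfun_ac] .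

lemma ratfun_ac_mat_one: "map_mat ratfun_ac (1\<^sub>m n) = 1\<^sub>m n"
  using semiring_hom.mat_hom_one[OF semiring_hom_ratfun_ac] .

lemma local_span_ac_hom:
  assumes "A \<in> carrier_mat n' n" "S \<subseteq> carrier_vec n" "T \<subseteq> carrier_vec n'"
    and "\<And>v. v \<in> S \<Longrightarrow> A *\<^sub>v v \<in> T" "v \<in> local_span n y (map_vec ratfun_ac ` S)"
  shows "map_mat ratfun_ac A *\<^sub>v v \<in> local_span n' y (map_vec ratfun_ac ` T)"
proof -
  let ?M = "{v \<in> carrier_vec n. map_mat ratfun_ac A *\<^sub>v v \<in> local_span n' y (map_vec ratfun_ac ` T)}"
  have "local_span n y (map_vec ratfun_ac ` S) \<subseteq> ?M"
  proof (rule local_span_least)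
    have "map_vec ratfun_ac ` T \<subseteq> carrier_vec n'" using assms(3) by auto
    thus "local_submodule n y ?M"
      using assms(1) by (intro local_submodule_preimage[OF local_submodule_span]) auto
    show "map_vec ratfun_ac ` S \<subseteq> ?M"
    proof
      fix w assume "w \<in> map_vec ratfun_ac ` S"
      then obtain v where v: "v \<in> S" "w = map_vec ratfun_ac v" by blast
      hence vc: "v \<in> carrier_vec n" using assms(2) by blast
      hence "map_mat ratfun_ac A *\<^sub>v w = map_vec ratfun_ac (A *\<^sub>v v)"
        using v(2) ratfun_ac_mat_vec[OF assms(1)] by simp
      thus "w \<in> ?M" using v vc assms(4) local_span_superset[of "map_vec ratfun_ac ` T" n' y] by auto
    qed
  qed
  thus ?thesis using assms(5) by blast
qed

lemma bundle_ac_stalks_ok: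
  assumes "stalks_ok n L" shows "stalks_ok n (bundle_ac n L)"
proof -
  have "local_submodule n y (bundle_ac n L y)" for y
    unfolding bundle_ac_def using assms
    by (intro local_submodule_span) (auto dest: stalks_ok_dim)
  thus ?thesis by (simp add: stalks_ok_def)
qed

lemma parabolic_hom_ac:
  assumes ok: "stalks_ok n L" "stalks_ok n' L'" and A: "A \<in> parabolic_hom D n L F n' L' F'"
  shows "map_mat ratfun_ac A \<in> parabolic_hom {y. pt_below y \<in> D} n (bundle_ac n L) (filtrations_ac n L F)
     n' (bundle_ac n' L') (filtrations_ac n' L' F')"
proof -
  let ?A = "map_mat ratfun_ac A"
  have c: "A \<in> carrier_mat n' n" and st: "\<And>v x. v \<in> L x \<Longrightarrow> A *\<^sub>v v \<in> L' x"
    using parabolic_hom_bundle_hom[OF A] by (auto simp: bundle_hom_def)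
  note ok' = ok[THEN bundle_ac_stalks_ok]
  have c': "?A \<in> carrier_mat n' n" using c by simp
  have hom: "?A *\<^sub>v v \<in> bundle_ac n' L' y" if "v \<in> bundle_ac n L y" for v y
    using that ok st unfolding bundle_ac_def
    by (intro local_span_ac_hom[OF c, of "L (pt_below y)" "L' (pt_below y)"])
       (auto dest: stalks_ok_dim)
  have "fibre_class n' (bundle_ac n' L') y (?A *\<^sub>v v) \<in> filtrations_ac n' L' F' y j"
    if y: "pt_below y \<in> D" and v: "v \<in> bundle_ac n L y"
      and F: "fibre_class n (bundle_ac n L) y v \<in> filtrations_ac n L F y j" for y v j
  proof -
    let ?x = "pt_below y"
    let ?S = "{v \<in> L ?x. fibre_class n L ?x v \<in> F ?x j}" and ?T = "{v \<in> L' ?x. fibre_class n' L' ?x v \<in> F' ?x j}"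
    \<comment> \<open>Membership in \<open>filtrations_ac\<close> is a statement about classes, so
      \<open>v\<close> is traded for a representative \<open>s\<close> in the span of base-changed
      vectors, where \<open>local_span_ac_hom\<close> applies.\<close>
    from F obtain s where s: "s \<in> local_span n y (map_vec ratfun_ac ` ?S)"
      "fibre_class n (bundle_ac n L) y v = fibre_class n (bundle_ac n L) y s"
      unfolding filtrations_ac_def by blast
    have sd: "s \<in> carrier_vec n"
      using s(1) ok by (intro local_submodule_dim[OF local_submodule_span s(1)]) (auto dest: stalks_ok_dim)
    have "fibre_class n' (bundle_ac n' L') y (?A *\<^sub>v v) = fibre_class n' (bundle_ac n' L') y (?A *\<^sub>v s)"
      using v sd hom by (intro fibre_class_hom[OF ok' c' _ _ _ s(2)]) (auto intro: stalks_ok_dim[OF ok'(1)])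
    moreover have "?A *\<^sub>v s \<in> local_span n' y (map_vec ratfun_ac ` ?T)"
      using ok st y by (intro local_span_ac_hom[OF c, of ?S ?T _ y, OF _ _ _ s(1)])
        (auto dest: stalks_ok_dim parabolic_hom_filtration[OF A])
    ultimately show ?thesis unfolding filtrations_ac_def by blast
  qed
  thus ?thesis using hom c' by (auto simp: parabolic_hom_def bundle_hom_def)
qed

text \<open>Since \<open>ratfun_ac\<close> is a ring homomorphism, the two inverse matrices remain
  inverse after extension of scalars.\<close>

lemma geom_indecomposable_cong:
  assumes ok: "stalks_ok n L" "stalks_ok n L'" and iso: "parabolic_isomorphic D n L F n L' F'"
  shows "geom_indecomposable D n L F \<longleftrightarrow> geom_indecomposable D n L' F'"
proof -
  from iso obtain A B where AB: "A \<in> parabolic_hom D n L F n L' F'" "B \<in> parabolic_hom D n L' F' n L F"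
    "A * B = 1\<^sub>m n" "B * A = 1\<^sub>m n" unfolding parabolic_isomorphic_def by blast
  have c: "A \<in> carrier_mat n n" "B \<in> carrier_mat n n"
    using AB parabolic_hom_bundle_hom bundle_hom_dim by blast+
  have "map_mat ratfun_ac A * map_mat ratfun_ac B = 1\<^sub>m n" "map_mat ratfun_ac B * map_mat ratfun_ac A = 1\<^sub>m n"
    using AB c by (auto simp: ratfun_ac_mat_one simp flip: ratfun_ac_mat_mult)
  hence "parabolic_isomorphic {y. pt_below y \<in> D} n (bundle_ac n L) (filtrations_ac n L F)
     n (bundle_ac n L') (filtrations_ac n L' F')"
    unfolding parabolic_isomorphic_def
    using parabolic_hom_ac[OF ok AB(1)] parabolic_hom_ac[OF ok(2,1) AB(2)] by blast
  thus ?thesis unfolding geom_indecomposable_def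
    by (intro parabolic_indecomposable_cong ok bundle_ac_stalks_ok)
qed

section \<open>Two by two matrices\<close>

definition vec2 :: "'a \<Rightarrow> 'a \<Rightarrow> 'a vec" where
  "vec2 x y = vec 2 (\<lambda>i. if i = 0 then x else y)"

definition mat2 :: "'a \<Rightarrow> 'a \<Rightarrow> 'a \<Rightarrow> 'a \<Rightarrow> 'a mat" where
  "mat2 a b c d = mat 2 2 (\<lambda>(i, j). if i = 0 then if j = 0 then a else b else if j = 0 then c else d)"

lemma vec2_carrier [simp]: "vec2 x y \<in> carrier_vec 2"
  and mat2_carrier [simp]: "mat2 a b c d \<in> carrier_mat 2 2"
  and vec2_index [simp]: "vec2 x y $ 0 = x" "vec2 x y $ 1 = y" "vec2 x y $ Suc 0 = y"
  and vec2_dim [simp]: "dim_vec (vec2 x y) = 2"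
  and mat2_dim [simp]: "dim_row (mat2 a b c d) = 2" "dim_col (mat2 a b c d) = 2"
  and mat2_index [simp]: "mat2 a b c d $$ (0, 0) = a" "mat2 a b c d $$ (0, 1) = b"
    "mat2 a b c d $$ (1, 0) = c" "mat2 a b c d $$ (1, 1) = d"
    "mat2 a b c d $$ (0, Suc 0) = b" "mat2 a b c d $$ (Suc 0, 0) = c" "mat2 a b c d $$ (Suc 0, Suc 0) = d"
  by (auto simp: vec2_def mat2_def)

lemma less_2_iff: "i < (2 :: nat) \<longleftrightarrow> i = 0 \<or> i = 1"
  by auto

lemma vec2_cases:
  assumes "v \<in> carrier_vec 2" obtains x y where "v = vec2 x y"
proof
  show "v = vec2 (v $ 0) (v $ 1)"
    using assms by (intro eq_vecI) (auto simp: less_2_iff)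
qed

lemma mat2_cases:
  assumes "A \<in> carrier_mat 2 2" obtains a b c d where "A = mat2 a b c d"
proof
  show "A = mat2 (A $$ (0, 0)) (A $$ (0, 1)) (A $$ (1, 0)) (A $$ (1, 1))"
    using assms by (intro eq_matI) (auto simp: less_2_iff)
qed

lemma vec2_eq_iff [simp]: "vec2 x y = vec2 x' y' \<longleftrightarrow> x = x' \<and> y = y'"
  by (metis vec2_index(1,2))

lemma mat2_eq_iff [simp]: "mat2 a b c d = mat2 a' b' c' d' \<longleftrightarrow> a = a' \<and> b = b' \<and> c = c' \<and> d = d'"
  by (metis mat2_index)

lemma vec2_arith:
  fixes x y :: "'a :: comm_ring_1"
  shows "vec2 x y + vec2 x' y' = vec2 (x + x') (y + y')"
    and "vec2 x y - vec2 x' y' = vec2 (x - x') (y - y')"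
    and "c \<cdot>\<^sub>v vec2 x y = vec2 (c * x) (c * y)"
    and "0\<^sub>v 2 = vec2 (0 :: 'a) 0"
  by (rule eq_vecI; auto simp: less_2_iff)+

lemma mat2_mult_vec2:
  fixes a b c d x y :: "'a :: comm_ring_1"
  shows "mat2 a b c d *\<^sub>v vec2 x y = vec2 (a * x + b * y) (c * x + d * y)"
  by (rule eq_vecI) (auto simp: less_2_iff mult_mat_vec_def scalar_prod_def vec2_def mat2_def numeral_2_eq_2)

lemma mat2_mult:
  fixes a b c d :: "'a :: comm_ring_1"
  shows "mat2 a b c d * mat2 a' b' c' d' =
    mat2 (a * a' + b * c') (a * b' + b * d') (c * a' + d * c') (c * b' + d * d')"
  by (rule eq_matI) (auto simp: less_2_iff times_mat_def scalar_prod_def mat2_def numeral_2_eq_2)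

lemma one_mat2: "1\<^sub>m 2 = mat2 1 0 0 1"
  by (rule eq_matI) (auto simp: less_2_iff)

lemma zero_mat2: "0\<^sub>m 2 2 = mat2 0 0 0 0"
  by (rule eq_matI) (auto simp: less_2_iff)

lemma det_mat2: "det (mat2 a b c d) = a * d - b * (c :: 'a :: comm_ring_1)"
proof -
  have "{0..<2 :: nat} = {0, 1}" by auto
  hence "{p. p permutes {0..<2 :: nat}} = {id, Transposition.transpose 0 1}"
    by (simp only: permutes_doubleton_iff) auto
  moreover have "(id :: nat \<Rightarrow> nat) \<noteq> Transposition.transpose 0 1"
    by (metis id_apply transpose_apply_first zero_neq_one)
  ultimately show ?thesis
    unfolding Determinant.det_def'[OF mat2_carrier]
    by (simp add: sign_swap_id numeral_2_eq_2 atLeast0_lessThan_Suc)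
qed

lemma map_vec2: "map_vec h (vec2 x y) = vec2 (h x) (h y)"
  by (rule eq_vecI) (auto simp: less_2_iff)

lemma mat2_inverse:
  fixes a b c d :: "'a :: field"
  assumes "\<delta> = a * d - b * c" "\<delta> \<noteq> 0"
  shows "mat2 a b c d * mat2 (d / \<delta>) (- b / \<delta>) (- c / \<delta>) (a / \<delta>) = 1\<^sub>m 2"
    and "mat2 (d / \<delta>) (- b / \<delta>) (- c / \<delta>) (a / \<delta>) * mat2 a b c d = 1\<^sub>m 2"
proof -
  have "a * d / \<delta> - b * c / \<delta> = 1" using assms by (simp flip: diff_divide_distrib)
  thus "mat2 a b c d * mat2 (d / \<delta>) (- b / \<delta>) (- c / \<delta>) (a / \<delta>) = 1\<^sub>m 2"
    and "mat2 (d / \<delta>) (- b / \<delta>) (- c / \<delta>) (a / \<delta>) * mat2 a b c d = 1\<^sub>m 2"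
    by (auto simp: mat2_mult one_mat2 mult_ac)
qed

section \<open>Split bundles\<close>

lemma finite_prime_divisors:
  assumes "f \<noteq> 0" shows "finite {p. poly_of p dvd f}"
  using assms
proof (induction "Polynomial.degree f" arbitrary: f rule: less_induct)
  case less
  show ?case
  proof (cases "\<exists>p. poly_of p dvd f")
    case True
    then obtain p g where g: "f = poly_of p * g" by (auto elim: dvdE)
    with less.prems have "g \<noteq> 0" by auto
    hence "Polynomial.degree g < Polynomial.degree f"
      using degree_poly_of_pos[of p] by (simp add: g degree_mult_eq)
    from less.hyps[OF this \<open>g \<noteq> 0\<close>] have "finite {p. poly_of p dvd g}" .
    moreover have "{p. poly_of p dvd f} = insert p {p. poly_of p dvd g}"
      by (auto simp: g poly_of_dvd_poly_of)
    ultimately show ?thesis by simp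
  qed auto
qed

text \<open>The generator at \<open>x\<close> of the stalk of O(n), embedded in k(t) so that 1
  generates it at every finite point and t^n at infinity; its global sections are then the
  polynomials of degree at most n.\<close>

definition tw :: "'a :: field closed_pt \<Rightarrow> int \<Rightarrow> 'a ratfun" where
  "tw x n = (if x = Infty then Fr [:0, 1:] 1 powi n else 1)"

lemma t_nz: "Fr [:0, 1:] (1 :: 'a :: field poly) \<noteq> 0"
  by (simp add: Fract_nz_iff)

lemma tw_nz [simp]: "tw x n \<noteq> 0"
  by (simp add: tw_def t_nz)

lemma tw_0 [simp]: "tw x 0 = 1"
  by (simp add: tw_def)

lemma tw_Fin [simp]: "tw (Fin p) n = 1"
  by (simp add: tw_def)

lemma tw_add: "tw x (n + m) = tw x n * tw x m"
  by (simp add: tw_def power_int_add[OF disjI1[OF t_nz]])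

lemma tw_diff: "tw x (n - m) = tw x n / tw x m"
  by (simp add: tw_def power_int_diff[OF disjI1[OF t_nz]])

lemma tw_Infty: "tw Infty n = uniformizer Infty powi (- n)"
proof -
  have "Fr [:0, 1:] (1 :: 'a poly) = inverse (uniformizer Infty)" by simp
  thus ?thesis by (simp only: tw_def if_True power_int_inverse power_int_minus refl)
qed

lemma valuation_tw: "valuation x (tw x n) = (if x = Infty then - n else 0)"
  by (cases x) (auto simp: tw_Infty valuation_uniformizer_powi simp del: uniformizer.simps)

text \<open>The sum of the line bundles O(a 0), ..., O(a (n - 1)).\<close>

definition split_bundle :: "nat \<Rightarrow> (nat \<Rightarrow> int) \<Rightarrow> 'a :: field stalks" where
  "split_bundle n a = (\<lambda>x. {v \<in> carrier_vec n. \<forall>i<n. v $ i / tw x (a i) \<in> local_ring x})"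

lemma diag_mult_vec:
  assumes "v \<in> carrier_vec n" "i < n"
  shows "(mat n n (\<lambda>(i, j). if i = j then d i else 0) *\<^sub>v v) $ i = d i * (v $ i :: 'a :: field)"
proof -
  have "(mat n n (\<lambda>(i, j). if i = j then d i else 0) *\<^sub>v v) $ i =
    (\<Sum>j = 0..<n. (if i = j then d i else 0) * v $ j)"
    using assms by (auto simp: scalar_prod_def intro!: sum.cong)
  also have "\<dots> = (\<Sum>j = 0..<n. if j = i then d i * v $ i else 0)"
    by (intro sum.cong) auto
  also have "\<dots> = d i * v $ i" using assms by simp
  finally show ?thesis .
qed

lemma diag_image:
  fixes d :: "nat \<Rightarrow> 'a :: field ratfun"
  assumes "\<And>i. i < n \<Longrightarrow> d i \<noteq> 0"
  shows "(\<lambda>v. mat n n (\<lambda>(i, j). if i = j then d i else 0) *\<^sub>v v) ` local_vecs n x =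
    {v \<in> carrier_vec n. \<forall>i<n. v $ i / d i \<in> local_ring x}" (is "?l = ?r")
proof
  show "?l \<subseteq> ?r"
  proof
    fix z assume "z \<in> ?l"
    then obtain v where v: "v \<in> local_vecs n x" "z = mat n n (\<lambda>(i, j). if i = j then d i else 0) *\<^sub>v v" by blast
    hence "v \<in> carrier_vec n" by (simp add: local_vecs_def)
    hence "z $ i / d i = v $ i" if "i < n" for i
      unfolding v(2) using assms that by (simp only: diag_mult_vec) simp
    thus "z \<in> ?r" using v by (auto simp: local_vecs_def intro!: mult_mat_vec_carrier)
  qed
  show "?r \<subseteq> ?l"
  proof
    fix v assume v: "v \<in> ?r"
    define w where "w = vec n (\<lambda>i. v $ i / d i)"
    have "w \<in> local_vecs n x" using v by (auto simp: w_def local_vecs_def)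
    moreover have "mat n n (\<lambda>(i, j). if i = j then d i else 0) *\<^sub>v w = v"
      using v assms by (intro eq_vecI) (auto simp: diag_mult_vec w_def simp del: index_mult_mat_vec)
    ultimately show "v \<in> ?l" by blast
  qed
qed

lemma det_diag:
  "det (mat n n (\<lambda>(i, j). if i = j then d i else (0 :: 'a :: field))) = (\<Prod>i<n. d i)"
proof -
  let ?A = "mat n n (\<lambda>(i, j). if i = j then d i else (0 :: 'a))"
  have "det ?A = prod_list (diag_mat ?A)"
    by (rule det_upper_triangular[of _ n]) (auto intro!: upper_triangularI)
  also have "\<dots> = (\<Prod>i<n. d i)"
    by (simp add: prod_list_diag_prod atLeast0LessThan)
  finally show ?thesis .
qed

lemma vector_bundle_split: "vector_bundle n (split_bundle n a :: 'a :: field stalks)"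
  unfolding vector_bundle_def
proof
  fix x :: "'a closed_pt"
  show "\<exists>U g. x \<in> U \<and> finite (- U) \<and> g \<in> carrier_mat n n \<and> det g \<noteq> 0 \<and>
    (\<forall>y\<in>U. split_bundle n a y = (\<lambda>v. g *\<^sub>v v) ` local_vecs n y)"
  proof (cases x)
    case Infty
    \<comment> \<open>Away from t = 0 and infinity t is a unit, so the diagonal matrix of the t^(a
      i) that generates the stalk at infinity also generates all others over
      \<open>U\<close>.\<close>
    define U where "U = - (Fin ` {p :: 'a prime_poly. poly_of p dvd [:0, 1:]})"
    define d where "d = (\<lambda>i. tw (Infty :: 'a closed_pt) (a i))"
    have "split_bundle n a y = {v \<in> carrier_vec n. \<forall>i<n. v $ i / d i \<in> local_ring y}" if "y \<in> U" for y
    proof (cases y)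
      case Infty
      thus ?thesis by (simp add: split_bundle_def d_def)
    next
      case (Fin p)
      hence p: "\<not> poly_of p dvd [:0, 1:]" using that by (auto simp: U_def)
      have t: "local_unit (Fin p) (Fr [:0, 1:] 1)" by (rule local_unit_Fin[OF p]) simp
      have pw: "local_unit (Fin p) (Fr [:0, 1:] 1 ^ m)" for m
        by (induction m) (auto intro: local_unit_1 local_unit_mult t)
      have "local_unit (Fin p) (d i)" for i
        using pw local_unit_inverse[OF pw]
        by (simp only: d_def tw_def power_int_def power_inverse if_True refl split: if_splits) simp
      hence "h / d i \<in> local_ring (Fin p) \<longleftrightarrow> h \<in> local_ring (Fin p)" for i h
        by (cases "h = 0") (auto simp: local_unit_iff local_ring_iff valuation_divide)
      thus ?thesis using Fin by (auto simp: split_bundle_def)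
    qed
    moreover have "x \<in> U" "finite (- U)" using Infty finite_prime_divisors[of "[:0, 1 :: 'a:]"] by (auto simp: U_def)
    moreover have "d i \<noteq> 0" for i by (simp add: d_def)
    ultimately show ?thesis
      by (intro exI[of _ U] exI[of _ "mat n n (\<lambda>(i, j). if i = j then d i else 0)"])
         (auto simp: det_diag diag_image)
  next
    case (Fin p)
    have "split_bundle n a y = {v \<in> carrier_vec n. \<forall>i<n. v $ i / 1 \<in> local_ring y}" if "y \<in> - {Infty}" for y
      using that by (cases y) (auto simp: split_bundle_def)
    thus ?thesis using Fin
      by (intro exI[of _ "- {Infty}"] exI[of _ "mat n n (\<lambda>(i, j). if i = j then 1 else 0)"])
         (auto simp: det_diag diag_image[of n "\<lambda>_. 1"])
  qed
qed

lemmas split_bundle_ok = vector_bundle_stalks_ok[OF vector_bundle_split]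

lemma mlat_split:
  "mlat n (split_bundle n a) x = {v \<in> carrier_vec n. \<forall>i<n. v $ i / tw x (a i) \<in> max_ideal x}" (is "?l = ?r")
proof
  have "local_submodule n x ?r"
    unfolding local_submodule_def
  proof (intro conjI ballI)
    fix c v assume c: "c \<in> local_ring x" and v: "v \<in> ?r"
    have "c * v $ i / tw x (a i) \<in> max_ideal x" if "i < n" for i
      using max_ideal_mult[OF c, of "v $ i / tw x (a i)"] v that by simp
    thus "c \<cdot>\<^sub>v v \<in> ?r" using v by auto
  qed (auto simp: max_ideal_0 add_divide_distrib max_ideal_add)
  moreover have "{c \<cdot>\<^sub>v w |c w. c \<in> max_ideal x \<and> w \<in> split_bundle n a x} \<subseteq> ?r"
  proof safe
    fix c w i assume *: "c \<in> max_ideal x" "w \<in> split_bundle n a x"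
    thus "c \<cdot>\<^sub>v w \<in> carrier_vec n" by (auto simp: split_bundle_def)
    assume "i < n"
    thus "(c \<cdot>\<^sub>v w) $ i / tw x (a i) \<in> max_ideal x"
      using * max_ideal_mult[of "w $ i / tw x (a i)" x c]
      by (auto simp: split_bundle_def mult.commute)
  qed
  ultimately show "?l \<subseteq> ?r" unfolding mlat_def by (rule local_span_least)
  show "?r \<subseteq> ?l"
  proof
    fix v assume v: "v \<in> ?r"
    define w where "w = vec n (\<lambda>i. v $ i / uniformizer x)"
    have "w $ i / tw x (a i) \<in> local_ring x" if i: "i < n" for i
    proof -
      have "v $ i / tw x (a i) \<in> max_ideal x" using v i by simp
      then obtain c where c: "c \<in> local_ring x" "v $ i / tw x (a i) = uniformizer x * c"
        unfolding max_ideal_uniformizer by (rule bexE)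
      have "w $ i / tw x (a i) = (v $ i / tw x (a i)) / uniformizer x"
        using i by (simp add: w_def mult.commute)
      also have "\<dots> = c" unfolding c(2) using uniformizer_nz[of x] by simp
      finally show ?thesis using c(1) by simp
    qed
    hence "w \<in> split_bundle n a x" by (auto simp: split_bundle_def w_def)
    moreover have "v = uniformizer x \<cdot>\<^sub>v w"
      using v uniformizer_nz[of x] by (intro eq_vecI) (simp_all add: w_def)
    moreover have "uniformizer x \<in> max_ideal x" by (simp add: max_ideal_iff del: uniformizer.simps)
    ultimately have "v \<in> {c \<cdot>\<^sub>v w |c w. c \<in> max_ideal x \<and> w \<in> split_bundle n a x}" by blast
    thus "v \<in> ?l" unfolding mlat_def by (rule subsetD[OF local_span_superset])
  qed
qed

abbreviation std :: "int \<Rightarrow> int \<Rightarrow> 'a :: field stalks" where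
  "std a b \<equiv> split_bundle 2 (\<lambda>i. if i = 0 then a else b)"

lemma std_iff: "vec2 u v \<in> std a b x \<longleftrightarrow> u / tw x a \<in> local_ring x \<and> v / tw x b \<in> local_ring x"
  by (auto simp: split_bundle_def less_2_iff)

lemma std_cases:
  assumes "w \<in> std a b x"
  obtains u v where "w = vec2 u v" "u / tw x a \<in> local_ring x" "v / tw x b \<in> local_ring x"
proof -
  have "w \<in> carrier_vec 2" using assms by (simp add: split_bundle_def)
  then obtain u v where "w = vec2 u v" by (rule vec2_cases)
  thus ?thesis using that assms std_iff by blast
qed

lemma mlat_std_iff:
  "vec2 u v \<in> mlat 2 (std a b) x \<longleftrightarrow> u / tw x a \<in> max_ideal x \<and> v / tw x b \<in> max_ideal x"
  by (auto simp: mlat_split less_2_iff)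

definition sections :: "int \<Rightarrow> 'a :: field ratfun set" where
  "sections n = {h. \<forall>x. h / tw x n \<in> local_ring x}"

definition polys_upto :: "int \<Rightarrow> 'a :: field poly set" where
  "polys_upto n = {f. f = 0 \<or> int (Polynomial.degree f) \<le> n}"

text \<open>Regularity at the finite points leaves only polynomials, and the condition at infinity
  is the bound on the degree.\<close>

lemma sections_iff: "h \<in> sections n \<longleftrightarrow> (\<exists>f\<in>polys_upto n. h = Fr f 1)"
proof -
  have inf: "Fr f 1 / tw Infty n \<in> local_ring Infty \<longleftrightarrow> f \<in> polys_upto n" for f :: "'a poly"
    by (cases "f = 0") (auto simp: local_ring_iff polys_upto_def valuation_divide valuation_tw
        valuation_Infty Fract_nz_iff)
  show ?thesis
  proof
    assume h: "h \<in> sections n"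
    hence "h / tw (Fin p) n \<in> local_ring (Fin p)" for p unfolding sections_def by blast
    hence "\<And>p. h \<in> local_ring (Fin p)" by simp
    then obtain f where "h = Fr f 1" by (rule everywhere_finite_regular_is_poly)
    moreover from this have "f \<in> polys_upto n" using h inf unfolding sections_def by blast
    ultimately show "\<exists>f\<in>polys_upto n. h = Fr f 1" by blast
  next
    assume "\<exists>f\<in>polys_upto n. h = Fr f 1"
    then obtain f where f: "f \<in> polys_upto n" "h = Fr f 1" by blast
    have "h / tw x n \<in> local_ring x" for x
      using f inf[of f] poly_in_local_ring_Fin[of f] by (cases x) auto
    thus "h \<in> sections n" by (simp add: sections_def)
  qed
qed

text \<open>Hom(O(a), O(a')) is O(a' - a), entry by entry; the entries are read off from the images
  of the generators of the two summands.\<close>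

lemma std_hom_iff:
  "mat2 p f g s \<in> bundle_hom 2 (std a b) 2 (std a' b') \<longleftrightarrow>
     p \<in> sections (a' - a) \<and> f \<in> sections (a' - b) \<and> g \<in> sections (b' - a) \<and> s \<in> sections (b' - b)"
  (is "?l = ?r")
proof
  assume l: ?l
  have "vec2 (tw x a) 0 \<in> std a b x" "vec2 0 (tw x b) \<in> std a b x" for x
    by (auto simp: std_iff local_ring_0 local_ring_1)
  hence "mat2 p f g s *\<^sub>v vec2 (tw x a) 0 \<in> std a' b' x" "mat2 p f g s *\<^sub>v vec2 0 (tw x b) \<in> std a' b' x" for x
    using bundle_hom_stalk[OF l] by blast+
  thus ?r by (auto simp: mat2_mult_vec2 std_iff sections_def tw_diff)
next
  assume r: ?r
  have "mat2 p f g s *\<^sub>v w \<in> std a' b' x" if w: "w \<in> std a b x" for w x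
  proof -
    from w obtain u v where uv: "w = vec2 u v" "u / tw x a \<in> local_ring x" "v / tw x b \<in> local_ring x"
      by (rule std_cases)
    have "(p * u + f * v) / tw x a' = (p / tw x (a' - a)) * (u / tw x a) + (f / tw x (a' - b)) * (v / tw x b)"
      "(g * u + s * v) / tw x b' = (g / tw x (b' - a)) * (u / tw x a) + (s / tw x (b' - b)) * (v / tw x b)"
      by (auto simp: tw_diff add_divide_distrib)
    moreover have "(p / tw x (a' - a)) * (u / tw x a) + (f / tw x (a' - b)) * (v / tw x b) \<in> local_ring x"
      "(g / tw x (b' - a)) * (u / tw x a) + (s / tw x (b' - b)) * (v / tw x b) \<in> local_ring x"
      using r uv unfolding sections_def by (blast intro: local_ring_add local_ring_mult)+
    ultimately have "(p * u + f * v) / tw x a' \<in> local_ring x" "(g * u + s * v) / tw x b' \<in> local_ring x"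
      by presburger+
    thus ?thesis by (simp add: uv(1) mat2_mult_vec2 std_iff)
  qed
  thus ?l by (auto simp: bundle_hom_def)
qed

lemma bundle_sum_std: "bundle_sum (split_bundle 1 (\<lambda>_. a)) (split_bundle 1 (\<lambda>_. b)) = std a b"
proof
  fix x :: "'a closed_pt"
  have app: "v @\<^sub>v w = vec2 (v $ 0) (w $ 0)" if "v \<in> carrier_vec 1" "w \<in> carrier_vec 1" for v w :: "'a ratfun vec"
    using that by (intro eq_vecI) (auto simp: less_2_iff)
  show "bundle_sum (split_bundle 1 (\<lambda>_. a)) (split_bundle 1 (\<lambda>_. b)) x = std a b x" (is "?l = ?r")
  proof
    show "?l \<subseteq> ?r"
    proof
      fix z assume "z \<in> ?l"
      then obtain v w where vw: "z = v @\<^sub>v w" "v \<in> split_bundle 1 (\<lambda>_. a) x" "w \<in> split_bundle 1 (\<lambda>_. b) x"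
        unfolding bundle_sum_def by blast
      hence "z = vec2 (v $ 0) (w $ 0)" using app[of v w] by (simp add: split_bundle_def)
      moreover have "vec2 (v $ 0) (w $ 0) \<in> std a b x"
        using vw unfolding std_iff by (simp add: split_bundle_def)
      ultimately show "z \<in> ?r" by simp
    qed
    show "?r \<subseteq> ?l"
    proof
      fix z assume "z \<in> ?r"
      then obtain u v where uv: "z = vec2 u v" "u / tw x a \<in> local_ring x" "v / tw x b \<in> local_ring x"
        by (rule std_cases)
      have "z = vec 1 (\<lambda>_. u) @\<^sub>v vec 1 (\<lambda>_. v)" by (subst app) (auto simp: uv)
      moreover have "vec 1 (\<lambda>_. u) \<in> split_bundle 1 (\<lambda>_. a) x" "vec 1 (\<lambda>_. v) \<in> split_bundle 1 (\<lambda>_. b) x"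
        using uv by (auto simp: split_bundle_def)
      ultimately show "z \<in> ?l" unfolding bundle_sum_def by blast
    qed
  qed
qed

section \<open>Residues at geometric points\<close>

lemma poly_bezout:
  fixes f g :: "'a :: field poly"
  obtains d u v where "d = u * f + v * g" "d dvd f" "d dvd g"
proof -
  have "\<exists>d u v. d = u * f + v * g \<and> d dvd f \<and> d dvd g"
  \<comment> \<open>Euclidean algorithm. The degree of 0 is 0, so the measure is shifted by one to
    rank \<open>g = 0\<close> below non-zero constants.\<close>
  proof (induction "if g = 0 then 0 else Suc (Polynomial.degree g)" arbitrary: f g rule: less_induct)
    case less
    show ?case
    proof (cases "g = 0")
      case True
      thus ?thesis by (intro exI[of _ f] exI[of _ 1] exI[of _ 0]) simp
    next
      case False
      have "(if f mod g = 0 then 0 else Suc (Polynomial.degree (f mod g))) < (if g = 0 then 0 else Suc (Polynomial.degree g))"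
        using False degree_mod_less'[of g f] by simp
      from less.hyps[OF this, of g] obtain d u v where d: "d = u * g + v * (f mod g)" "d dvd g" "d dvd f mod g"
        by blast
      have "v * (f div g * g + f mod g) + (u - v * (f div g)) * g = d"
        unfolding d(1) by (simp only: algebra_simps)
      hence "d = v * f + (u - v * (f div g)) * g" by simp
      moreover have "d dvd f" using d(2,3) by (metis dvd_mod_iff)
      ultimately show ?thesis using d(2) by blast
    qed
  qed
  thus ?thesis using that by blast
qed

lemma poly_of_coprime_bezout:
  assumes "\<not> poly_of p dvd f"
  obtains u v where "u * f + v * poly_of p = 1"
proof -
  obtain d u v where d: "d = u * f + v * poly_of p" "d dvd f" "d dvd poly_of p" by (rule poly_bezout)
  from d(3) obtain c where c: "poly_of p = d * c" by blast
  have "d dvd 1"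
  proof (rule ccontr)
    assume "\<not> d dvd 1"
    hence "c dvd 1" using irreducible_poly_of[of p] c Factorial_Ring.irreducibleD by blast
    hence "poly_of p dvd d" unfolding c by (simp add: mult_unit_dvd_iff)
    thus False using d(2) assms dvd_trans by blast
  qed
  then obtain e where "1 = d * e" by blast
  hence "(e * u) * f + (e * v) * poly_of p = 1" unfolding d(1) by (simp add: algebra_simps)
  thus ?thesis by (rule that)
qed

definition const :: "'a :: field \<Rightarrow> 'a ratfun" where
  "const c = Fr [:c:] 1"

lemma const_add: "const (c + d) = const c + const d"
  and const_diff: "const (c - d) = const c - const d"
  and const_mult: "const (c * d) = const c * const d"
  and const_0 [simp]: "const 0 = 0"
  and const_1 [simp]: "const 1 = 1"
  by (auto simp: const_def One_fract_def one_pCons mult.commute)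

lemma const_eq_0_iff [simp]: "const c = 0 \<longleftrightarrow> c = 0"
  by (simp add: const_def Fract_nz_iff)

lemma const_eq_iff [simp]: "const c = const d \<longleftrightarrow> c = d"
  using const_eq_0_iff[of "c - d"] by (simp add: const_diff)

lemma const_in: "const c \<in> local_ring x"
  unfolding const_def by (rule const_in_local_ring)

lemma const_max_ideal: "const c \<in> max_ideal x \<longleftrightarrow> c = 0"
proof
  assume c: "const c \<in> max_ideal x"
  show "c = 0"
  proof (rule ccontr)
    assume "c \<noteq> 0"
    hence "const (inverse c) * const c = 1" by (simp flip: const_mult)
    thus False using max_ideal_mult[OF const_in c, of "inverse c"] one_notin_max_ideal[of x] by simp
  qed
qed (simp add: max_ideal_0)

definition lin_pt :: "'c :: field \<Rightarrow> 'c closed_pt" where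
  "lin_pt \<alpha> = Fin (Abs_prime_poly [:- \<alpha>, 1:])"

lemma poly_of_lin: "poly_of (Abs_prime_poly [:- \<alpha>, 1:]) = [:- \<alpha>, 1 :: 'c :: field:]"
  by (rule Abs_prime_poly_inverse) (simp add: irreducible_linear_field_poly)

lemma lin_pt_eq_iff [simp]: "lin_pt \<alpha> = lin_pt \<beta> \<longleftrightarrow> \<alpha> = \<beta>"
proof
  assume "lin_pt \<alpha> = lin_pt \<beta>"
  hence "poly_of (Abs_prime_poly [:- \<alpha>, 1:]) = poly_of (Abs_prime_poly [:- \<beta>, 1:])"
    by (simp add: lin_pt_def)
  thus "\<alpha> = \<beta>" by (simp add: poly_of_lin)
qed simp

lemma lin_pt_Infty [simp]: "lin_pt \<alpha> \<noteq> Infty" "Infty \<noteq> lin_pt \<alpha>"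
  by (auto simp: lin_pt_def)

text \<open>The prime of a finite point has a root, and the linear polynomial of that root divides
  it, hence equals it.\<close>

lemma geom_pt_cases:
  fixes y :: "'c :: alg_closed_field closed_pt"
  obtains "y = Infty" | \<alpha> where "y = lin_pt \<alpha>"
proof (cases y)
  case (Fin p)
  obtain \<alpha> where "poly (poly_of p) \<alpha> = 0"
    using alg_closed_imp_poly_has_root degree_poly_of_pos by blast
  hence "[:- \<alpha>, 1:] dvd poly_of p" by (simp add: poly_eq_0_iff_dvd)
  hence "Abs_prime_poly [:- \<alpha>, 1:] = p"
    using poly_of_dvd_poly_of[of "Abs_prime_poly [:- \<alpha>, 1:]" p] by (simp add: poly_of_lin)
  hence "y = lin_pt \<alpha>" using Fin by (simp add: lin_pt_def)
  thus ?thesis by (rule that(2))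
qed (use that in blast)

lemma local_ring_lin_ptI: "poly g \<alpha> \<noteq> 0 \<Longrightarrow> Fr f g \<in> local_ring (lin_pt \<alpha>)"
  unfolding lin_pt_def by (rule local_ring_FinI) (simp add: poly_of_lin flip: poly_eq_0_iff_dvd)

lemma local_ring_lin_ptE:
  assumes "h \<in> local_ring (lin_pt \<alpha>)"
  obtains f g where "h = Fr f g" "poly g \<alpha> \<noteq> 0" "g \<noteq> 0"
proof -
  obtain f g where "h = Fr f g" "\<not> [:- \<alpha>, 1:] dvd g" "g \<noteq> 0"
    using assms unfolding lin_pt_def by (elim local_ring_FinE) (simp add: poly_of_lin)
  thus ?thesis using that by (simp flip: poly_eq_0_iff_dvd)
qed

lemma max_ideal_lin_ptI:
  assumes "poly g \<alpha> \<noteq> 0" "poly f \<alpha> = 0"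
  shows "Fr f g \<in> max_ideal (lin_pt \<alpha>)"
proof -
  have "Fr f 1 \<in> max_ideal (lin_pt \<alpha>)"
    unfolding lin_pt_def poly_in_max_ideal_Fin using assms by (simp add: poly_of_lin flip: poly_eq_0_iff_dvd)
  moreover have "Fr 1 g \<in> local_ring (lin_pt \<alpha>)" using assms by (intro local_ring_lin_ptI)
  moreover have "Fr f g = Fr 1 g * Fr f 1" by simp
  ultimately show ?thesis using max_ideal_mult by metis
qed

lemma max_ideal_InftyI:
  assumes "g \<noteq> 0" "f = 0 \<or> Polynomial.degree f < Polynomial.degree g"
  shows "Fr f g \<in> max_ideal Infty"
  using assms by (cases "f = 0") (auto simp: max_ideal_iff valuation_Infty)

text \<open>The residue field at a point over an algebraically closed field consists of the
  constants, so the class of \<open>h\<close> is recorded by the constant congruent to it.\<close>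

definition resid :: "'c :: alg_closed_field closed_pt \<Rightarrow> 'c ratfun \<Rightarrow> 'c" where
  "resid y h = (THE c. h - const c \<in> max_ideal y)"

lemma resid_eqI: "h - const c \<in> max_ideal y \<Longrightarrow> resid y h = c"
  unfolding resid_def
proof (rule the_equality)
  fix c' assume c: "h - const c \<in> max_ideal y" "h - const c' \<in> max_ideal y"
  have "(h - const c') - (h - const c) \<in> max_ideal y" by (rule max_ideal_diff[OF c(2,1)])
  thus "c' = c" using const_max_ideal[of "c - c'" y] by (simp add: const_diff)
qed

lemma resid_lin_pt:
  assumes "poly g \<alpha> \<noteq> 0"
  shows "resid (lin_pt \<alpha>) (Fr f g) = poly f \<alpha> / poly g \<alpha>"
proof (rule resid_eqI)
  let ?c = "poly f \<alpha> / poly g \<alpha>"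
  have "g \<noteq> 0" using assms by auto
  hence "Fr f g - const ?c = Fr (f - smult ?c g) g"
    by (simp add: const_def eq_fract)
  also have "\<dots> \<in> max_ideal (lin_pt \<alpha>)" using assms by (intro max_ideal_lin_ptI) auto
  finally show "Fr f g - const ?c \<in> max_ideal (lin_pt \<alpha>)" .
qed

lemma resid_Infty:
  assumes "g \<noteq> 0" "Polynomial.degree f \<le> Polynomial.degree g"
  shows "resid Infty (Fr f g) = Polynomial.coeff f (Polynomial.degree g) / lead_coeff g"
proof (rule resid_eqI)
  let ?c = "Polynomial.coeff f (Polynomial.degree g) / lead_coeff g"
  let ?f = "f - smult ?c g"
  have "Fr f g - const ?c = Fr ?f g"
    using assms by (simp add: const_def eq_fract)
  also have "\<dots> \<in> max_ideal Infty"
  proof (intro max_ideal_InftyI assms(1))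
    have "Polynomial.degree ?f \<le> Polynomial.degree g"
      using assms by (intro degree_diff_le) auto
    moreover have "Polynomial.coeff ?f (Polynomial.degree g) = 0" using assms by simp
    ultimately show "?f = 0 \<or> Polynomial.degree ?f < Polynomial.degree g"
      by (metis leading_coeff_0_iff le_neq_implies_less)
  qed
  finally show "Fr f g - const ?c \<in> max_ideal Infty" .
qed

lemma resid_ex:
  assumes "h \<in> local_ring y" shows "h - const (resid y h) \<in> max_ideal y"
proof -
  have "\<exists>c. h - const c \<in> max_ideal y"
  proof (cases y rule: geom_pt_cases)
    case 1
    then obtain f g where "h = Fr f g" "g \<noteq> 0" "Polynomial.degree f \<le> Polynomial.degree g"
      using assms by (auto elim: local_ring_InftyE)
    let ?c = "Polynomial.coeff f (Polynomial.degree g) / lead_coeff g"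
    let ?f = "f - smult ?c g"
    have "h - const ?c = Fr ?f g"
      using \<open>g \<noteq> 0\<close> by (simp add: const_def eq_fract \<open>h = Fr f g\<close>)
    moreover have "Polynomial.degree ?f \<le> Polynomial.degree g"
      using \<open>Polynomial.degree f \<le> Polynomial.degree g\<close> by (intro degree_diff_le) auto
    moreover have "Polynomial.coeff ?f (Polynomial.degree g) = 0" using \<open>g \<noteq> 0\<close> by simp
    ultimately show ?thesis
      using max_ideal_InftyI[OF \<open>g \<noteq> 0\<close>, of ?f] 1
      by (metis leading_coeff_0_iff le_neq_implies_less)
  next
    case (2 \<alpha>)
    then obtain f g where "h = Fr f g" "poly g \<alpha> \<noteq> 0" "g \<noteq> 0"
      using assms by (auto elim: local_ring_lin_ptE)
    let ?c = "poly f \<alpha> / poly g \<alpha>"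
    have "h - const ?c = Fr (f - smult ?c g) g"
      using \<open>g \<noteq> 0\<close> by (simp add: const_def eq_fract \<open>h = Fr f g\<close>)
    also have "\<dots> \<in> max_ideal (lin_pt \<alpha>)"
      using \<open>poly g \<alpha> \<noteq> 0\<close> by (intro max_ideal_lin_ptI) auto
    finally show ?thesis using 2 by blast
  qed
  thus ?thesis using resid_eqI by metis
qed

lemma resid_const [simp]: "resid y (const c) = c"
  by (rule resid_eqI) (simp add: max_ideal_0)

lemma resid_0 [simp]: "resid y 0 = 0" and resid_1 [simp]: "resid y 1 = 1"
  using resid_const[of y 0] resid_const[of y 1] by simp_all

lemma resid_add:
  assumes "h \<in> local_ring y" "h' \<in> local_ring y"
  shows "resid y (h + h') = resid y h + resid y h'"
  using max_ideal_add[OF resid_ex[OF assms(1)] resid_ex[OF assms(2)]]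
  by (intro resid_eqI) (simp add: const_add algebra_simps)

lemma resid_diff:
  assumes "h \<in> local_ring y" "h' \<in> local_ring y"
  shows "resid y (h - h') = resid y h - resid y h'"
  using max_ideal_diff[OF resid_ex[OF assms(1)] resid_ex[OF assms(2)]]
  by (intro resid_eqI) (simp add: const_diff algebra_simps)

lemma resid_mult:
  assumes "h \<in> local_ring y" "h' \<in> local_ring y"
  shows "resid y (h * h') = resid y h * resid y h'"
proof (rule resid_eqI)
  have "h' * (h - const (resid y h)) + const (resid y h) * (h' - const (resid y h')) \<in> max_ideal y"
    by (intro max_ideal_add max_ideal_mult resid_ex assms const_in)
  thus "h * h' - const (resid y h * resid y h') \<in> max_ideal y"
    by (simp add: const_mult algebra_simps)
qed

lemma resid_eq_0_iff: "h \<in> local_ring y \<Longrightarrow> resid y h = 0 \<longleftrightarrow> h \<in> max_ideal y"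
  using resid_ex[of h y] resid_eqI[of h 0 y] by auto

lemma resid_divide:
  assumes "h \<in> local_ring y" "h' \<in> local_ring y" "resid y h' \<noteq> 0"
  shows "h / h' \<in> local_ring y" "resid y (h / h') = resid y h / resid y h'"
proof -
  have u: "local_unit y h'" using assms resid_eq_0_iff local_ring_not_max_ideal by blast
  hence "h * inverse h' \<in> local_ring y" using assms by (intro local_ring_mult) (auto simp: local_unit_def)
  thus 1: "h / h' \<in> local_ring y" by (simp add: divide_inverse)
  have "resid y (h / h' * h') = resid y (h / h') * resid y h'" using 1 assms by (intro resid_mult)
  moreover have "h / h' * h' = h" using u by (simp add: local_unit_def)
  ultimately show "resid y (h / h') = resid y h / resid y h'" using assms by (simp add: field_simps)
qed

lemma resid_section_lin_pt: "resid (lin_pt \<alpha>) (Fr f 1 / tw (lin_pt \<alpha>) n) = poly f \<alpha>"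
  using resid_lin_pt[of 1 \<alpha> f] by (simp add: lin_pt_def)

lemma resid_section_Infty:
  assumes "f \<in> polys_upto n"
  shows "resid Infty (Fr f 1 / tw Infty n) = Polynomial.coeff f (nat n)"
proof (cases "f = 0")
  case False
  hence n: "n \<ge> 0" "Polynomial.degree f \<le> nat n" using assms by (auto simp: polys_upto_def)
  have "Fr f 1 / tw Infty n = Fr f ([:0, 1:] ^ nat n)"
    using n by (simp add: tw_def power_int_def Fr_power)
  moreover have "Polynomial.degree ([:0, 1 :: 'a:] ^ nat n) = nat n" by (subst degree_power_eq) auto
  moreover have "lead_coeff ([:0, 1 :: 'a:] ^ nat n) = 1" by (simp add: lead_coeff_power)
  ultimately show ?thesis using n by (subst \<open>_ = Fr f _\<close>, subst resid_Infty) auto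
qed simp

section \<open>Points over a closed point\<close>

abbreviation (input) pac :: "'a :: field poly \<Rightarrow> 'a alg_closure poly" where
  "pac \<equiv> map_poly to_ac"

lemma pac_add: "pac (f + g) = pac f + pac g"
  by (rule poly_eqI) (simp add: coeff_map_poly)

lemma degree_pac [simp]: "Polynomial.degree (pac f) = Polynomial.degree f"
  by (rule degree_map_poly) auto

text \<open>Says that \<open>poly_of p\<close> is the minimal polynomial of its root \<alpha>: a
  Bezout identity with a polynomial prime to it, evaluated at \<alpha>, would read 0 = 1.\<close>

lemma pac_root_iff:
  assumes "poly (pac (poly_of p)) \<alpha> = 0"
  shows "poly (pac f) \<alpha> = 0 \<longleftrightarrow> poly_of p dvd f"
proof
  assume 0: "poly (pac f) \<alpha> = 0"
  show "poly_of p dvd f"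
  proof (rule ccontr)
    assume "\<not> poly_of p dvd f"
    then obtain u v where "u * f + v * poly_of p = 1" by (rule poly_of_coprime_bezout)
    hence "poly (pac (u * f + v * poly_of p)) \<alpha> = poly (pac 1) \<alpha>" by simp
    thus False using 0 assms by (simp add: pac_add map_poly_to_ac_mult map_poly_to_ac_1)
  qed
qed (use assms in \<open>auto simp: map_poly_to_ac_mult elim!: dvdE\<close>)

text \<open>Split off prime factors from a polynomial that annihilates \<alpha>: one of them must
  have the root \<alpha>.\<close>

lemma minimal_polynomial_ex:
  fixes \<alpha> :: "'a :: field alg_closure"
  obtains p :: "'a prime_poly" where "poly (pac (poly_of p)) \<alpha> = 0"
proof -
  obtain f :: "'a poly" where f: "f \<noteq> 0" "poly (pac f) \<alpha> = 0" by (rule alg_closure_algebraic)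
  have "\<exists>p :: 'a prime_poly. poly (pac (poly_of p)) \<alpha> = 0" using f
  proof (induction "Polynomial.degree f" arbitrary: f rule: less_induct)
    case less
    have "Polynomial.degree f > 0"
    proof (rule ccontr)
      assume "\<not> Polynomial.degree f > 0"
      then obtain c where "f = [:c:]" by (auto elim: degree_eq_zeroE)
      thus False using less.prems by (simp add: map_poly_pCons)
    qed
    then obtain p where "poly_of p dvd f" by (rule irreducible_factor)
    then obtain g where g: "f = poly_of p * g" by blast
    show ?case
    proof (cases "poly (pac (poly_of p)) \<alpha> = 0")
      case False
      have "g \<noteq> 0" using g less.prems by auto
      moreover have "Polynomial.degree g < Polynomial.degree f"
        using \<open>g \<noteq> 0\<close> degree_poly_of_pos[of p] by (simp add: g degree_mult_eq)
      moreover have "poly (pac g) \<alpha> = 0" using less.prems False by (simp add: g map_poly_to_ac_mult)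
      ultimately show ?thesis using less.hyps by blast
    qed blast
  qed
  thus ?thesis using that by blast
qed

lemma lies_over_lin_pt: "lies_over (lin_pt \<alpha>) x \<longleftrightarrow> (\<exists>p. x = Fin p \<and> poly (pac (poly_of p)) \<alpha> = 0)"
  by (simp add: lin_pt_def poly_of_lin poly_eq_0_iff_dvd)

text \<open>Two primes with the common root \<alpha> divide each other, so the description in
  \<open>pt_below\<close> is definite.\<close>

lemma pt_below_lin_pt_iff: "pt_below (lin_pt \<alpha>) = x \<longleftrightarrow> (\<exists>p. x = Fin p \<and> poly (pac (poly_of p)) \<alpha> = 0)"
proof -
  obtain p where p: "poly (pac (poly_of p)) \<alpha> = 0" by (rule minimal_polynomial_ex)
  have u: "p' = p" if "poly (pac (poly_of p')) \<alpha> = 0" for p'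
    using pac_root_iff[OF p] that poly_of_dvd_poly_of[of p p'] by metis
  have "pt_below (lin_pt \<alpha>) = Fin p" unfolding pt_below_def lies_over_lin_pt
    by (rule the_equality) (use p u in blast)+
  thus ?thesis using p u by blast
qed

lemma pt_below_Infty [simp]: "pt_below Infty = Infty"
  by (simp add: pt_below_def)

lemma pt_below_eq_Infty: "pt_below y = Infty \<longleftrightarrow> y = Infty"
  by (cases y rule: geom_pt_cases) (auto simp: pt_below_lin_pt_iff)

lemma pt_below_surj: "\<exists>y. pt_below y = x"
proof (cases x)
  case Infty
  thus ?thesis using pt_below_Infty by blast
next
  case (Fin p)
  obtain \<alpha> where "poly (pac (poly_of p)) \<alpha> = 0"
    using alg_closed_imp_poly_has_root[of "pac (poly_of p)"] degree_poly_of_pos[of p] by auto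
  hence "pt_below (lin_pt \<alpha>) = x" using Fin by (auto simp: pt_below_lin_pt_iff)
  thus ?thesis by blast
qed

section \<open>Local rings and split bundles under extension of scalars\<close>

lemma ratfun_ac_inverse: "ratfun_ac (inverse h) = inverse (ratfun_ac h)"
proof (cases "h = 0")
  case False
  hence "ratfun_ac (inverse h) * ratfun_ac h = 1" by (simp flip: ratfun_ac_mult)
  thus ?thesis by (metis inverse_unique mult.commute)
qed simp

lemma ratfun_ac_divide: "ratfun_ac (h / h') = ratfun_ac h / ratfun_ac h'"
  by (simp add: divide_inverse ratfun_ac_mult ratfun_ac_inverse)

lemma ratfun_ac_power: "ratfun_ac (h ^ n) = ratfun_ac h ^ n"
  by (induction n) (auto simp: ratfun_ac_mult)

lemma ratfun_ac_poly: "ratfun_ac (Fr f 1) = Fr (pac f) 1"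
  by (simp add: ratfun_ac_Fract map_poly_to_ac_1)

lemma ratfun_ac_const: "ratfun_ac (const c) = const (to_ac c)"
  by (simp add: const_def ratfun_ac_poly map_poly_pCons)

lemma ratfun_ac_tw: "ratfun_ac (tw (pt_below y) n) = tw y n"
proof -
  have "ratfun_ac (Fr [:0, 1:] (1 :: 'a poly)) = Fr [:0, 1:] 1"
    by (simp add: ratfun_ac_poly map_poly_pCons)
  thus ?thesis
    by (simp add: tw_def pt_below_eq_Infty power_int_def ratfun_ac_power ratfun_ac_inverse
        del: inverse_fract)
qed

lemma ratfun_ac_local_ring:
  assumes "h \<in> local_ring (pt_below y)"
  shows "ratfun_ac h \<in> local_ring y"
proof (cases y rule: geom_pt_cases)
  case 1
  then obtain f g where "h = Fr f g" "g \<noteq> 0" "Polynomial.degree f \<le> Polynomial.degree g"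
    using assms by (auto elim: local_ring_InftyE)
  thus ?thesis using 1 by (simp add: ratfun_ac_Fract local_ring_InftyI map_poly_to_ac_eq_0_iff)
next
  case (2 \<alpha>)
  then obtain p where p: "pt_below y = Fin p" "poly (pac (poly_of p)) \<alpha> = 0"
    using pt_below_lin_pt_iff by blast
  then obtain f g where "h = Fr f g" "\<not> poly_of p dvd g" "g \<noteq> 0"
    using assms by (auto elim: local_ring_FinE)
  thus ?thesis using 2 by (simp add: ratfun_ac_Fract local_ring_lin_ptI pac_root_iff[OF p(2)])
qed

lemma ratfun_ac_max_ideal:
  assumes "h \<in> local_ring (pt_below y)"
  shows "ratfun_ac h \<in> max_ideal y \<longleftrightarrow> h \<in> max_ideal (pt_below y)"
proof
  assume "h \<in> max_ideal (pt_below y)"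
  then obtain c where c: "c \<in> local_ring (pt_below y)" "h = uniformizer (pt_below y) * c"
    unfolding max_ideal_uniformizer by blast
  have "ratfun_ac (uniformizer (pt_below y)) \<in> max_ideal y"
  proof (cases y rule: geom_pt_cases)
    case 1
    thus ?thesis by (simp add: ratfun_ac_Fract map_poly_to_ac_1 map_poly_pCons max_ideal_InftyI)
  next
    case (2 \<alpha>)
    then obtain p where p: "pt_below y = Fin p" "poly (pac (poly_of p)) \<alpha> = 0"
      using pt_below_lin_pt_iff by blast
    thus ?thesis using 2 by (simp add: ratfun_ac_poly max_ideal_lin_ptI)
  qed
  thus "ratfun_ac h \<in> max_ideal y"
    using max_ideal_mult[OF ratfun_ac_local_ring[OF c(1)]] by (metis c(2) ratfun_ac_mult mult.commute)
next
  assume m: "ratfun_ac h \<in> max_ideal y"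
  show "h \<in> max_ideal (pt_below y)"
  proof (rule ccontr)
    assume "h \<notin> max_ideal (pt_below y)"
    with assms have "local_unit (pt_below y) h" by (intro local_ring_not_max_ideal)
    hence "inverse h \<in> local_ring (pt_below y)" "inverse h * h = 1" by (auto simp: local_unit_def)
    hence "ratfun_ac (inverse h) * ratfun_ac h \<in> max_ideal y" "ratfun_ac (inverse h * h) = 1"
      using max_ideal_mult[OF ratfun_ac_local_ring m] by simp_all
    hence "1 \<in> max_ideal y" by (simp only: ratfun_ac_mult)
    thus False using one_notin_max_ideal[of y] by simp
  qed
qed

text \<open>One geometric point over each closed point, fixed once and for all. Evaluation there
  embeds the residue field of \<open>x\<close> in the algebraic closure.\<close>

definition pick :: "'a :: field closed_pt \<Rightarrow> 'a alg_closure closed_pt" where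
  "pick x = (SOME y. pt_below y = x)"

lemma pt_below_pick [simp]: "pt_below (pick x) = x"
  unfolding pick_def by (rule someI_ex[OF pt_below_surj])

text \<open>\<open>ratfun_ac\<close> takes the generators \<open>tw\<close> of the stalk below to
  those of the stalk above, so they lie in the span and generate it.\<close>

lemma bundle_ac_std: "bundle_ac 2 (std a b :: 'a :: field stalks) = std a b"
proof
  fix y :: "'a alg_closure closed_pt"
  let ?x = "pt_below y"
  let ?S = "map_vec ratfun_ac ` (std a b ?x :: 'a ratfun vec set)"
  show "bundle_ac 2 (std a b :: 'a stalks) y = std a b y" (is "?l = ?r")
  proof
    have "?S \<subseteq> ?r"
    proof
      fix z assume "z \<in> ?S"
      then obtain w where w: "w \<in> std a b ?x" "z = map_vec ratfun_ac w" by blast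
      then obtain u v where uv: "w = vec2 u v" "u / tw ?x a \<in> local_ring ?x" "v / tw ?x b \<in> local_ring ?x"
        by (elim std_cases)
      show "z \<in> ?r" using ratfun_ac_local_ring[OF uv(2)] ratfun_ac_local_ring[OF uv(3)]
        by (simp add: w(2) uv(1) map_vec2 std_iff ratfun_ac_divide ratfun_ac_tw)
    qed
    thus "?l \<subseteq> ?r" unfolding bundle_ac_def
      by (intro local_span_least stalks_okD split_bundle_ok)
    show "?r \<subseteq> ?l"
    proof
      fix z assume "z \<in> ?r"
      then obtain u v where uv: "z = vec2 u v" "u / tw y a \<in> local_ring y" "v / tw y b \<in> local_ring y"
        by (elim std_cases)
      have e: "vec2 (tw y a) 0 \<in> ?S" "vec2 0 (tw y b) \<in> ?S"
        by (rule image_eqI[of _ _ "vec2 (tw ?x a) 0"] image_eqI[of _ _ "vec2 0 (tw ?x b)"];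
            simp add: map_vec2 ratfun_ac_tw std_iff local_ring_0 local_ring_1)+
      have ok: "local_submodule 2 y ?l"
        by (intro stalks_okD bundle_ac_stalks_ok split_bundle_ok)
      have "vec2 (tw y a) 0 \<in> ?l" "vec2 0 (tw y b) \<in> ?l"
        unfolding bundle_ac_def using e local_span_superset[of ?S 2 y] by blast+
      hence "(u / tw y a) \<cdot>\<^sub>v vec2 (tw y a) 0 + (v / tw y b) \<cdot>\<^sub>v vec2 0 (tw y b) \<in> ?l"
        using uv by (intro local_submodule_add[OF ok] local_submodule_smult[OF ok])
      thus "z \<in> ?l" by (simp add: vec2_arith uv(1))
    qed
  qed
qed

section \<open>Frobenius\<close>

text \<open>Multiplication by \<open>u\<close> permutes the non-zero elements of \<open>K\<close>;
  compare the products. The set \<open>K\<close> is general because both the ground field and the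
  residue fields \<open>resf x\<close> are of this kind.\<close>

lemma finite_mult_closed_power_card:
  fixes K :: "'c :: field set"
  assumes "finite K" "0 \<in> K" "\<And>u v. u \<in> K \<Longrightarrow> v \<in> K \<Longrightarrow> u * v \<in> K" "u \<in> K"
  shows "u ^ card K = u"
proof (cases "u = 0")
  case True
  have "card K > 0" using assms by (auto simp: card_gt_0_iff)
  thus ?thesis using True by simp
next
  case False
  let ?U = "K - {0}"
  have inj: "inj_on ((*) u) ?U" using False by (auto simp: inj_on_def)
  have "(*) u ` ?U \<subseteq> ?U" using assms False by auto
  hence "(*) u ` ?U = ?U" using inj assms(1) by (intro endo_inj_surj) auto
  hence "(\<Prod>v\<in>?U. v) = (\<Prod>v\<in>?U. u * v)" using prod.reindex[OF inj, of "\<lambda>v. v"] by simp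
  also have "\<dots> = u ^ card ?U * (\<Prod>v\<in>?U. v)" by (simp add: prod.distrib)
  finally have "u ^ card ?U = 1" using assms(1) by (simp add: prod_zero_iff)
  moreover have "card K = Suc (card ?U)" using card.remove[OF assms(1,2)] by simp
  ultimately show ?thesis by simp
qed

lemma field_power_card:
  fixes c :: "'k :: {field, finite}"
  shows "c ^ card (UNIV :: 'k set) = c"
  by (rule finite_mult_closed_power_card) auto

lemma card_UNIV_ge_2: "card (UNIV :: 'k :: {field, finite} set) \<ge> 2"
proof -
  have "card {0, 1 :: 'k} \<le> card (UNIV :: 'k set)" by (intro card_mono) auto
  thus ?thesis by simp
qed

text \<open>The polynomial (t + 1)^q - t^q - 1 has degree less than q but vanishes on the field, so the
  mixed binomial coefficients are zero in it.\<close>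

lemma binomial_card_eq_0:
  assumes "0 < i" "i < card (UNIV :: 'k :: {field, finite} set)"
  shows "of_nat (card (UNIV :: 'k set) choose i) = (0 :: 'k)"
proof -
  define q where "q = card (UNIV :: 'k set)"
  define g where "g = (\<Sum>i\<in>{1..<q}. Polynomial.monom (of_nat (q choose i)) i :: 'k poly)"
  have q2: "q \<ge> 2" unfolding q_def by (rule card_UNIV_ge_2)
  have "poly g t = 0" for t
  proof -
    have "(t + 1) ^ q = (\<Sum>i\<le>q. of_nat (q choose i) * t ^ i)"
      by (simp add: binomial_ring)
    also have "{..q} = insert 0 (insert q {1..<q})" using q2 by auto
    also have "(\<Sum>i\<in>\<dots>. of_nat (q choose i) * t ^ i) = 1 + (t ^ q + poly g t)"
      using q2 by (simp add: g_def poly_sum poly_monom)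
    finally show ?thesis using field_power_card[of t] field_power_card[of "t + 1"] by (simp add: q_def)
  qed
  moreover have "Polynomial.degree g < q"
    using q2 by (auto simp: g_def intro!: degree_sum_less order.strict_trans1[OF degree_monom_le])
  ultimately have "g = 0" using q2 by (intro poly_eqI_degree[of UNIV]) (auto simp: q_def)
  moreover have "Polynomial.coeff g i = of_nat (q choose i)"
    using assms by (simp add: g_def coeff_sum q_def)
  ultimately show ?thesis by (simp add: q_def)
qed

definition frob :: "'k :: {field, finite} alg_closure \<Rightarrow> 'k alg_closure" where
  "frob z = z ^ card (UNIV :: 'k set)"

lemma frob_0 [simp]: "frob 0 = 0"
  using card_UNIV_ge_2[where 'k = 'a] by (simp add: frob_def)

lemma frob_1 [simp]: "frob 1 = 1"
  by (simp add: frob_def)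

lemma frob_mult: "frob (u * v) = frob u * frob v"
  by (simp add: frob_def power_mult_distrib)

lemma frob_power: "frob (u ^ n) = frob u ^ n"
  by (simp add: frob_def power_mult [symmetric] mult.commute)

lemma frob_add: "frob (u + v) = frob u + frob (v :: 'k :: {field, finite} alg_closure)"
proof -
  let ?q = "card (UNIV :: 'k set)"
  have q2: "?q \<ge> 2" by (rule card_UNIV_ge_2)
  have z: "of_nat (?q choose i) = (0 :: 'k alg_closure)" if "i \<in> {1..<?q}" for i
  proof -
    have "to_ac (of_nat (?q choose i) :: 'k) = 0" using binomial_card_eq_0[where 'k = 'k, of i] that by simp
    thus ?thesis by simp
  qed
  have "(u + v) ^ ?q = (\<Sum>i\<le>?q. of_nat (?q choose i) * u ^ i * v ^ (?q - i))"
    by (rule binomial_ring)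
  also have "{..?q} = insert 0 (insert ?q {1..<?q})" using q2 by auto
  also have "(\<Sum>i\<in>\<dots>. of_nat (?q choose i) * u ^ i * v ^ (?q - i)) = v ^ ?q + (u ^ ?q + 0)"
    using q2 z by (simp add: sum.neutral)
  finally show ?thesis by (simp add: frob_def)
qed

lemma frob_minus: "frob (- u) = - frob u"
  using frob_add[of u "- u"] by (simp add: eq_neg_iff_add_eq_0 add.commute)

lemma frob_diff: "frob (u - v) = frob u - frob v"
  using frob_add[of u "- v"] by (simp add: frob_minus)

lemma frob_sum: "frob (\<Sum>i\<in>A. f i) = (\<Sum>i\<in>A. frob (f i))"
  by (induction A rule: infinite_finite_induct) (auto simp: frob_add)

lemma frob_eq_0_iff [simp]: "frob u = 0 \<longleftrightarrow> u = 0"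
  using card_UNIV_ge_2[where 'k = 'a] by (simp add: frob_def)

lemma frob_eq_iff [simp]: "frob u = frob v \<longleftrightarrow> u = v"
  using frob_eq_0_iff[of "u - v"] by (simp add: frob_diff)

lemma frob_divide: "frob (u / v) = frob u / frob v"
  by (simp add: frob_def power_divide)

lemma frob_to_ac [simp]: "frob (to_ac c) = to_ac c"
  unfolding frob_def by (simp add: field_power_card flip: to_ac_power)

text \<open>X^q - X has at most q roots, and the q elements of the ground field are among
  them.\<close>

lemma frob_fixed_iff: "frob z = z \<longleftrightarrow> z \<in> range (to_ac :: 'k :: {field, finite} \<Rightarrow> _)"
proof
  assume z: "frob z = z"
  let ?q = "card (UNIV :: 'k set)"
  let ?g = "Polynomial.monom 1 ?q - Polynomial.monom 1 1 :: 'k alg_closure poly"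
  have q2: "?q \<ge> 2" by (rule card_UNIV_ge_2)
  have "Polynomial.coeff ?g ?q = 1" using q2 by simp
  hence g: "?g \<noteq> 0" by (metis coeff_0 zero_neq_one)
  have "Polynomial.degree ?g \<le> ?q" using q2
    by (intro degree_diff_le order.trans[OF degree_monom_le]) auto
  hence 1: "card {z. poly ?g z = 0} \<le> ?q" using card_poly_roots_bound[OF g] by linarith
  have 2: "range to_ac \<subseteq> {z. poly ?g z = 0}"
    using frob_to_ac by (auto simp: poly_monom frob_def)
  have 3: "card (range (to_ac :: 'k \<Rightarrow> _)) = ?q" by (intro card_image inj_to_ac)
  have fin: "finite {z. poly ?g z = 0}" by (rule poly_roots_finite[OF g])
  have "card (range (to_ac :: 'k \<Rightarrow> _)) = card {z. poly ?g z = 0}"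
    using 1 3 card_mono[OF fin 2] by linarith
  hence "range to_ac = {z. poly ?g z = 0}" by (rule card_subset_eq[OF fin 2])
  thus "z \<in> range to_ac" using z by (simp add: poly_monom frob_def)
qed auto

lemma frob_poly: "frob (poly (pac f) \<alpha>) = poly (pac f) (frob \<alpha>)"
  by (simp add: poly_altdef frob_sum frob_mult frob_power coeff_map_poly)

definition frob_pt :: "'k :: {field, finite} alg_closure closed_pt \<Rightarrow> 'k alg_closure closed_pt" where
  "frob_pt y = (if y = Infty then Infty else lin_pt (frob (THE \<alpha>. y = lin_pt \<alpha>)))"

lemma frob_pt_simps [simp]: "frob_pt Infty = Infty" "frob_pt (lin_pt \<alpha>) = lin_pt (frob \<alpha>)"
  by (auto simp: frob_pt_def)

text \<open>Frobenius is injective on the finite set of roots of a prime polynomial, hence permutes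
  it. The descent needs this direction: every equation must be the conjugate of another one.\<close>

lemma frob_pt_surj:
  assumes "pt_below y = x"
  obtains y' where "pt_below y' = x" "y = frob_pt y'"
proof (cases y rule: geom_pt_cases)
  case 1
  thus ?thesis using assms that by (metis frob_pt_simps(1))
next
  case (2 \<alpha>)
  then obtain p where p: "x = Fin p" "poly (pac (poly_of p)) \<alpha> = 0"
    using pt_below_lin_pt_iff assms by blast
  let ?R = "{\<beta>. poly (pac (poly_of p)) \<beta> = 0}"
  have "finite ?R" by (rule poly_roots_finite) (simp add: map_poly_to_ac_eq_0_iff)
  moreover have "frob ` ?R \<subseteq> ?R" using frob_poly[of "poly_of p"] by (auto simp flip: frob_poly)
  ultimately have "frob ` ?R = ?R" by (intro endo_inj_surj) (auto simp: inj_on_def)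
  moreover have "\<alpha> \<in> ?R" using p by simp
  ultimately have "\<alpha> \<in> frob ` ?R" by simp
  then obtain \<beta> where "\<alpha> = frob \<beta>" "\<beta> \<in> ?R" by (rule imageE)
  hence "poly (pac (poly_of p)) \<beta> = 0" "frob \<beta> = \<alpha>" by simp_all
  thus ?thesis using that[of "lin_pt \<beta>"] p 2 by (auto simp: pt_below_lin_pt_iff)
qed

text \<open>Functions over the ground field have coefficients fixed by Frobenius, so their values at
  conjugate points are conjugate.\<close>

lemma resid_frob_pt:
  assumes "h \<in> local_ring (pt_below y)"
  shows "resid (frob_pt y) (ratfun_ac h) = frob (resid y (ratfun_ac h))"
proof (cases y rule: geom_pt_cases)
  case 1
  then obtain f g where "h = Fr f g" "g \<noteq> 0" "Polynomial.degree f \<le> Polynomial.degree g"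
    using assms by (auto elim: local_ring_InftyE)
  thus ?thesis using 1
    by (simp add: ratfun_ac_Fract resid_Infty map_poly_to_ac_eq_0_iff coeff_map_poly frob_divide)
next
  case (2 \<alpha>)
  then obtain p where p: "pt_below y = Fin p" "poly (pac (poly_of p)) \<alpha> = 0"
    using pt_below_lin_pt_iff by blast
  then obtain f g where fg: "h = Fr f g" "\<not> poly_of p dvd g" "g \<noteq> 0"
    using assms by (auto elim: local_ring_FinE)
  hence g: "poly (pac g) \<alpha> \<noteq> 0" by (simp add: pac_root_iff[OF p(2)])
  hence "poly (pac g) (frob \<alpha>) \<noteq> 0" by (simp flip: frob_poly)
  thus ?thesis using g 2 fg by (simp add: ratfun_ac_Fract resid_lin_pt frob_divide frob_poly)
qed

section \<open>Lines in the fibres of split bundles\<close>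

text \<open>Points of the projective line over the algebraic closure: None is (1 : 0), Some z is (z : 1).\<close>

fun on_line :: "'c :: field option \<Rightarrow> 'c \<Rightarrow> 'c \<Rightarrow> bool" where
  "on_line None r0 r1 \<longleftrightarrow> r1 = 0"
| "on_line (Some z) r0 r1 \<longleftrightarrow> r0 = z * r1"

lemma on_line_smult: "on_line c r0 r1 \<Longrightarrow> on_line c (t * r0) (t * r1)"
  by (cases c) auto

lemma on_line_add: "on_line c r0 r1 \<Longrightarrow> on_line c s0 s1 \<Longrightarrow> on_line c (r0 + s0) (r1 + s1)"
  by (cases c) (auto simp: algebra_simps)

lemma on_line_0 [simp]: "on_line c 0 0"
  by (cases c) auto

text \<open>The value at a geometric point of a function over the ground field that is regular at
  the point below.\<close>

definition kres :: "'a :: field alg_closure closed_pt \<Rightarrow> 'a ratfun \<Rightarrow> 'a alg_closure" where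
  "kres y h = resid y (ratfun_ac h)"

lemma kres_add: "h \<in> local_ring (pt_below y) \<Longrightarrow> h' \<in> local_ring (pt_below y) \<Longrightarrow> kres y (h + h') = kres y h + kres y h'"
  and kres_mult: "h \<in> local_ring (pt_below y) \<Longrightarrow> h' \<in> local_ring (pt_below y) \<Longrightarrow> kres y (h * h') = kres y h * kres y h'"
  by (simp_all add: kres_def ratfun_ac_add ratfun_ac_mult resid_add resid_mult ratfun_ac_local_ring)

lemma kres_const [simp]: "kres y (const c) = to_ac c"
  by (simp add: kres_def ratfun_ac_const)

lemma kres_0 [simp]: "kres y 0 = 0" and kres_1 [simp]: "kres y 1 = 1"
  by (simp_all add: kres_def)

lemma kres_eq_0_iff: "h \<in> local_ring (pt_below y) \<Longrightarrow> kres y h = 0 \<longleftrightarrow> h \<in> max_ideal (pt_below y)"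
  by (simp add: kres_def resid_eq_0_iff ratfun_ac_local_ring ratfun_ac_max_ideal)

lemma kres_diff: 
  assumes "h \<in> local_ring (pt_below y)" "h' \<in> local_ring (pt_below y)"
  shows "kres y (h - h') = kres y h - kres y h'"
  using kres_add[OF local_ring_diff[OF assms] assms(2)] by simp

lemma kres_divide:
  assumes "h \<in> local_ring (pt_below y)" "h' \<in> local_ring (pt_below y)" "kres y h' \<noteq> 0"
  shows "h / h' \<in> local_ring (pt_below y)" "kres y (h / h') = kres y h / kres y h'"
proof -
  have u: "local_unit (pt_below y) h'"
    using assms kres_eq_0_iff local_ring_not_max_ideal by blast
  hence "h * inverse h' \<in> local_ring (pt_below y)"
    using assms by (intro local_ring_mult) (auto simp: local_unit_def)
  thus "h / h' \<in> local_ring (pt_below y)" by (simp add: divide_inverse)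
  show "kres y (h / h') = kres y h / kres y h'"
    using assms by (simp add: kres_def ratfun_ac_divide resid_divide ratfun_ac_local_ring)
qed

text \<open>Vanishing at a geometric point means lying in the maximal ideal of the closed point
  below, which is the same for all points above.\<close>

lemma kres_transfer:
  assumes "h \<in> local_ring x" "pt_below y = x" "pt_below y' = x" "kres y h = 0"
  shows "kres y' h = 0"
  using assms kres_eq_0_iff[of h y] kres_eq_0_iff[of h y'] by simp

lemma kres_frob_pt:
  assumes "h \<in> local_ring (pt_below y)"
  shows "kres (frob_pt y) h = frob (kres y h)"
  using resid_frob_pt[OF assms] by (simp add: kres_def)

text \<open>The residue field of \<open>x\<close>, embedded in the algebraic closure by evaluation
  at \<open>pick x\<close>.\<close>

definition resf :: "'a :: field closed_pt \<Rightarrow> 'a alg_closure set" where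
  "resf x = kres (pick x) ` local_ring x"

definition hrep :: "'a :: field closed_pt \<Rightarrow> 'a alg_closure \<Rightarrow> 'a ratfun" where
  "hrep x z = (SOME h. h \<in> local_ring x \<and> kres (pick x) h = z)"

lemma hrep:
  assumes "z \<in> resf x" shows "hrep x z \<in> local_ring x" "kres (pick x) (hrep x z) = z"
proof -
  have "\<exists>h. h \<in> local_ring x \<and> kres (pick x) h = z" using assms by (auto simp: resf_def)
  from someI_ex[OF this] show "hrep x z \<in> local_ring x" "kres (pick x) (hrep x z) = z"
    by (auto simp: hrep_def)
qed

text \<open>The points of the projective line over the residue field of \<open>x\<close>.\<close>

definition codes :: "'a :: field closed_pt \<Rightarrow> 'a alg_closure option set" where
  "codes x = insert None (Some ` resf x)"

lemma to_ac_in_resf: "to_ac c \<in> resf x"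
  unfolding resf_def by (rule image_eqI[of _ _ "const c"]) (simp_all add: const_in)

text \<open>The line with code \<open>c\<close>, in coordinates with respect to the generators of
  O(a) and O(b) at \<open>x\<close>. The code \<open>None\<close> is the fibre of O(a),
  \<open>Some 0\<close> that of O(b).\<close>

definition kline :: "int \<Rightarrow> int \<Rightarrow> 'a :: field closed_pt \<Rightarrow> 'a alg_closure option \<Rightarrow> 'a ratfun vec set set" where
  "kline a b x c = {fibre_class 2 (std a b) x (vec2 u v) | u v.
     u / tw x a \<in> local_ring x \<and> v / tw x b \<in> local_ring x \<and>
     on_line c (kres (pick x) (u / tw x a)) (kres (pick x) (v / tw x b))}"

definition gline :: "int \<Rightarrow> int \<Rightarrow> 'c :: alg_closed_field closed_pt \<Rightarrow> 'c option \<Rightarrow> 'c ratfun vec set set" where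
  "gline a b y c = {fibre_class 2 (std a b) y (vec2 u v) | u v.
     u / tw y a \<in> local_ring y \<and> v / tw y b \<in> local_ring y \<and>
     on_line c (resid y (u / tw y a)) (resid y (v / tw y b))}"

lemma fibre_class_std_eq_iff:
  "fibre_class 2 (std a b) x (vec2 u v) = fibre_class 2 (std a b) x (vec2 u' v') \<longleftrightarrow>
     u / tw x a - u' / tw x a \<in> max_ideal x \<and> v / tw x b - v' / tw x b \<in> max_ideal x"
  by (subst fibre_class_eq_iff[OF split_bundle_ok]) (auto simp: vec2_arith mlat_std_iff diff_divide_distrib)

lemma fibre_class_in_kline_iff:
  assumes "u / tw x a \<in> local_ring x" "v / tw x b \<in> local_ring x"
  shows "fibre_class 2 (std a b) x (vec2 u v) \<in> kline a b x c \<longleftrightarrow>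
    on_line c (kres (pick x) (u / tw x a)) (kres (pick x) (v / tw x b))"
proof
  assume "fibre_class 2 (std a b) x (vec2 u v) \<in> kline a b x c"
  then obtain u' v' where *: "u' / tw x a \<in> local_ring x" "v' / tw x b \<in> local_ring x"
    "on_line c (kres (pick x) (u' / tw x a)) (kres (pick x) (v' / tw x b))"
    "fibre_class 2 (std a b) x (vec2 u v) = fibre_class 2 (std a b) x (vec2 u' v')"
    unfolding kline_def by blast
  from *(4) have "kres (pick x) (u / tw x a - u' / tw x a) = 0" "kres (pick x) (v / tw x b - v' / tw x b) = 0"
    unfolding fibre_class_std_eq_iff
    by (subst kres_eq_0_iff; use assms * in \<open>simp add: local_ring_diff\<close>)+
  thus "on_line c (kres (pick x) (u / tw x a)) (kres (pick x) (v / tw x b))"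
    using assms * by (simp add: kres_diff)
qed (use assms in \<open>auto simp: kline_def\<close>)

lemma fibre_class_in_gline_iff:
  assumes "u / tw y a \<in> local_ring y" "v / tw y b \<in> local_ring y"
  shows "fibre_class 2 (std a b) y (vec2 u v) \<in> gline a b y c \<longleftrightarrow>
    on_line c (resid y (u / tw y a)) (resid y (v / tw y b))"
proof
  assume "fibre_class 2 (std a b) y (vec2 u v) \<in> gline a b y c"
  then obtain u' v' where *: "u' / tw y a \<in> local_ring y" "v' / tw y b \<in> local_ring y"
    "on_line c (resid y (u' / tw y a)) (resid y (v' / tw y b))"
    "fibre_class 2 (std a b) y (vec2 u v) = fibre_class 2 (std a b) y (vec2 u' v')"
    unfolding gline_def by blast
  from *(4) have "resid y (u / tw y a - u' / tw y a) = 0" "resid y (v / tw y b - v' / tw y b) = 0"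
    unfolding fibre_class_std_eq_iff
    by (subst resid_eq_0_iff; use assms * in \<open>simp add: local_ring_diff\<close>)+
  thus "on_line c (resid y (u / tw y a)) (resid y (v / tw y b))"
    using assms * by (simp add: resid_diff)
qed (use assms in \<open>auto simp: gline_def\<close>)

text \<open>Linear algebra in a plane over the residue field: the determinant of the two vectors
  vanishes and the second is non-zero, so the first is a multiple of it. The factor is the quotient
  at a coordinate in which the second vector is a unit.\<close>

lemma fibre_class_line_multiple:
  assumes w: "u / tw x a \<in> local_ring x" "v / tw x b \<in> local_ring x"
    and w': "u' / tw x a \<in> local_ring x" "v' / tw x b \<in> local_ring x"
    and nz: "u' / tw x a \<notin> max_ideal x \<or> v' / tw x b \<notin> max_ideal x"
    and cr: "(u / tw x a) * (v' / tw x b) - (v / tw x b) * (u' / tw x a) \<in> max_ideal x"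
  obtains c where "c \<in> local_ring x"
    "fibre_class 2 (std a b) x (vec2 u v) = fibre_class 2 (std a b) x (c \<cdot>\<^sub>v vec2 u' v')"
proof -
  define U V U' V' where d: "U = u / tw x a" "V = v / tw x b" "U' = u' / tw x a" "V' = v' / tw x b"
  have cl: "fibre_class 2 (std a b) x (vec2 u v) = fibre_class 2 (std a b) x (c \<cdot>\<^sub>v vec2 u' v') \<longleftrightarrow>
     U - c * U' \<in> max_ideal x \<and> V - c * V' \<in> max_ideal x" for c
    unfolding vec2_arith fibre_class_std_eq_iff d by simp
  show ?thesis
  proof (cases "V' \<in> max_ideal x")
    case False
    hence u: "local_unit x V'" using w'(2) local_ring_not_max_ideal unfolding d by blast
    define c where "c = V * inverse V'"
    have c: "c \<in> local_ring x" unfolding c_def using u w unfolding d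
      by (intro local_ring_mult) (auto simp: local_unit_def)
    have "U - c * U' = inverse V' * (U * V' - V * U')"
      using u by (simp add: c_def local_unit_def field_simps)
    also have "\<dots> \<in> max_ideal x" using u cr unfolding d by (intro max_ideal_mult) (auto simp: local_unit_def)
    finally have "U - c * U' \<in> max_ideal x" .
    moreover have "V - c * V' = 0" using u by (simp add: c_def local_unit_def)
    ultimately show ?thesis using that[OF c] cl max_ideal_0 by metis
  next
    case True
    hence "U' \<notin> max_ideal x" using nz d by auto
    hence u: "local_unit x U'" using w'(1) local_ring_not_max_ideal unfolding d by blast
    define c where "c = U * inverse U'"
    have c: "c \<in> local_ring x" unfolding c_def using u w unfolding d
      by (intro local_ring_mult) (auto simp: local_unit_def)
    have "V - c * V' = inverse U' * - (U * V' - V * U')"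
      using u by (simp add: c_def local_unit_def field_simps)
    also have "\<dots> \<in> max_ideal x" using u cr unfolding d
      by (intro max_ideal_mult max_ideal_uminus) (auto simp: local_unit_def)
    finally have "V - c * V' \<in> max_ideal x" .
    moreover have "U - c * U' = 0" using u by (simp add: c_def local_unit_def)
    ultimately show ?thesis using that[OF c] cl max_ideal_0 by metis
  qed
qed

text \<open>\<open>rep0\<close> and \<open>rep1\<close> lift the homogeneous coordinates (1 : 0) or
  (z : 1) of a code to the local ring at \<open>x\<close>.\<close>

definition rep0 :: "'a :: field closed_pt \<Rightarrow> 'a alg_closure option \<Rightarrow> 'a ratfun" where
  "rep0 x c = (case c of None \<Rightarrow> 1 | Some z \<Rightarrow> hrep x z)"

definition rep1 :: "'a :: field alg_closure option \<Rightarrow> 'a ratfun" where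
  "rep1 c = (case c of None \<Rightarrow> 0 | Some z \<Rightarrow> 1)"

lemma rep_in: "c \<in> codes x \<Longrightarrow> rep0 x c \<in> local_ring x" "rep1 c \<in> local_ring x"
  by (auto simp: codes_def rep0_def rep1_def hrep local_ring_0 local_ring_1 split: option.splits)

lemma rep_nz: "c \<in> codes x \<Longrightarrow> rep0 x c \<notin> max_ideal x \<or> rep1 c \<notin> max_ideal x"
  by (auto simp: codes_def rep0_def rep1_def one_notin_max_ideal)

text \<open>A code is written with the embedding of the residue field at \<open>pick x\<close>; at
  another point \<open>y\<close> over \<open>x\<close> the same line has the conjugate code,
  obtained by lifting the value and evaluating the lift at \<open>y\<close>.\<close>

definition gcode :: "'a :: field alg_closure closed_pt \<Rightarrow> 'a alg_closure option \<Rightarrow> 'a alg_closure option" where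
  "gcode y c = (case c of None \<Rightarrow> None | Some z \<Rightarrow> Some (kres y (hrep (pt_below y) z)))"

lemma gcode_pick: "c \<in> codes x \<Longrightarrow> gcode (pick x) c = c"
  by (auto simp: codes_def gcode_def hrep)

text \<open>The right-hand side is a determinant in the local ring below and does not mention
  \<open>y\<close>, so incidence may be tested at any point over \<open>x\<close>.\<close>

lemma on_line_gcode:
  assumes c: "c \<in> codes x" and y: "pt_below y = x" and h: "h \<in> local_ring x" "h' \<in> local_ring x"
  shows "on_line (gcode y c) (kres y h) (kres y h') \<longleftrightarrow> h * rep1 c - h' * rep0 x c \<in> max_ideal x"
proof -
  have *: "h * rep1 c - h' * rep0 x c \<in> local_ring x"
    by (intro local_ring_diff local_ring_mult rep_in c h)
  show ?thesis
  proof (cases c)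
    case None
    have "- h' \<in> max_ideal x \<longleftrightarrow> h' \<in> max_ideal x"
      using max_ideal_uminus[of h' x] max_ideal_uminus[of "- h'" x] by auto
    thus ?thesis using None h y kres_eq_0_iff[of h' y] by (simp add: gcode_def rep0_def rep1_def)
  next
    case (Some z)
    hence z: "z \<in> resf x" using c by (auto simp: codes_def)
    have "kres y (h - h' * hrep x z) = kres y h - kres y h' * kres y (hrep x z)"
      using h y hrep[OF z] by (simp add: kres_diff kres_mult local_ring_mult)
    thus ?thesis using * Some y kres_eq_0_iff[of "h - h' * hrep x z" y]
      by (simp add: gcode_def rep0_def rep1_def mult.commute)
  qed
qed

lemma kline_alt:
  assumes "c \<in> codes x"
  shows "kline a b x c = {fibre_class 2 (std a b) x (d \<cdot>\<^sub>v vec2 (rep0 x c * tw x a) (rep1 c * tw x b)) | d. d \<in> local_ring x}"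
proof -
  let ?u = "rep0 x c * tw x a" and ?v = "rep1 c * tw x b"
  have rep: "?u / tw x a \<in> local_ring x" "?v / tw x b \<in> local_ring x"
    using rep_in assms by (simp_all add: rep_in(2))
  show ?thesis
  proof (intro equalityI subsetI)
    fix V assume "V \<in> kline a b x c"
    then obtain u v where uv: "V = fibre_class 2 (std a b) x (vec2 u v)" "u / tw x a \<in> local_ring x" "v / tw x b \<in> local_ring x"
      "on_line (gcode (pick x) c) (kres (pick x) (u / tw x a)) (kres (pick x) (v / tw x b))"
      unfolding kline_def gcode_pick[OF assms] by blast
    have "(u / tw x a) * (?v / tw x b) - (v / tw x b) * (?u / tw x a) \<in> max_ideal x"
      using on_line_gcode[OF assms pt_below_pick uv(2,3)] uv(4) by simp
    from fibre_class_line_multiple[OF uv(2,3) rep _ this] rep_nz[OF assms] 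
    obtain d where "d \<in> local_ring x" "V = fibre_class 2 (std a b) x (d \<cdot>\<^sub>v vec2 ?u ?v)"
      unfolding uv(1) by auto
    thus "V \<in> {fibre_class 2 (std a b) x (d \<cdot>\<^sub>v vec2 ?u ?v) | d. d \<in> local_ring x}" by blast
  next
    fix V assume "V \<in> {fibre_class 2 (std a b) x (d \<cdot>\<^sub>v vec2 ?u ?v) | d. d \<in> local_ring x}"
    then obtain d where d: "d \<in> local_ring x" "V = fibre_class 2 (std a b) x (vec2 (d * ?u) (d * ?v))"
      by (auto simp: vec2_arith)
    have m: "d * rep0 x c \<in> local_ring x" "d * rep1 c \<in> local_ring x"
      using d(1) rep_in(1)[OF assms] rep_in(2)[of c x] by (simp_all add: local_ring_mult)
    have "on_line (gcode (pick x) c) (kres (pick x) (d * rep0 x c)) (kres (pick x) (d * rep1 c))"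
      by (subst on_line_gcode[OF assms pt_below_pick m]) (simp add: mult_ac max_ideal_0)
    thus "V \<in> kline a b x c" unfolding d(2) using m
      by (subst fibre_class_in_kline_iff) (simp_all add: gcode_pick[OF assms])
  qed
qed

lemma rep_std: "c \<in> codes x \<Longrightarrow> vec2 (rep0 x c * tw x a) (rep1 c * tw x b) \<in> std a b x"
  by (simp add: std_iff rep_in)

lemma fibre_line_iff_code: "fibre_line 2 (std a b) x V \<longleftrightarrow> (\<exists>c\<in>codes x. V = kline a b x c)"
proof
  assume "fibre_line 2 (std a b) x V"
  then obtain w where w: "w \<in> std a b x" "fibre_class 2 (std a b) x w \<noteq> fibre_class 2 (std a b) x (0\<^sub>v 2)"
    "V = {fibre_class 2 (std a b) x (c \<cdot>\<^sub>v w) |c. c \<in> local_ring x}"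
    unfolding fibre_line_def by blast
  from w(1) obtain u v where uv: "w = vec2 u v" "u / tw x a \<in> local_ring x" "v / tw x b \<in> local_ring x"
    by (rule std_cases)
  let ?r0 = "kres (pick x) (u / tw x a)" and ?r1 = "kres (pick x) (v / tw x b)"
  \<comment> \<open>The ratio of the two coordinates of a spanning vector. If the second residue
    vanishes, the vector spans the fibre of O(a).\<close>
  define c where "c = (if ?r1 = 0 then None else Some (?r0 / ?r1))"
  have ck: "c \<in> codes x"
    using uv kres_divide[of "u / tw x a" "pick x" "v / tw x b"] 
    by (auto simp: codes_def c_def resf_def intro!: imageI image_eqI[of _ _ "(u / tw x a) / (v / tw x b)"])
  have line: "on_line c ?r0 ?r1" by (auto simp: c_def)
  have nz: "u / tw x a \<notin> max_ideal x \<or> v / tw x b \<notin> max_ideal x"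
    using w(2) unfolding uv(1) vec2_arith fibre_class_std_eq_iff by simp
  have cross: "(u / tw x a) * rep1 c - (v / tw x b) * rep0 x c \<in> max_ideal x"
    using on_line_gcode[OF ck pt_below_pick uv(2,3)] line by (simp add: gcode_pick[OF ck])
  have "V = kline a b x c"
  proof (intro equalityI subsetI)
    fix Z assume "Z \<in> V"
    then obtain d where d: "d \<in> local_ring x" "Z = fibre_class 2 (std a b) x (vec2 (d * u) (d * v))"
      unfolding w(3) uv(1) by (auto simp: vec2_arith)
    have "kres (pick x) (d * (u / tw x a)) = kres (pick x) d * ?r0" "kres (pick x) (d * (v / tw x b)) = kres (pick x) d * ?r1"
      using d uv by (simp_all add: kres_mult del: times_divide_eq_right)
    thus "Z \<in> kline a b x c" unfolding d(2) using d uv on_line_smult[OF line]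
        local_ring_mult[OF d(1) uv(2)] local_ring_mult[OF d(1) uv(3)]
      by (subst fibre_class_in_kline_iff) simp_all
  next
    fix Z assume "Z \<in> kline a b x c"
    then obtain u' v' where uv': "Z = fibre_class 2 (std a b) x (vec2 u' v')" "u' / tw x a \<in> local_ring x" "v' / tw x b \<in> local_ring x"
      "on_line c (kres (pick x) (u' / tw x a)) (kres (pick x) (v' / tw x b))"
      unfolding kline_def by blast
    let ?U = "u / tw x a" and ?V = "v / tw x b" and ?U' = "u' / tw x a" and ?V' = "v' / tw x b"
    have "kres (pick x) (?U' * ?V - ?V' * ?U) = kres (pick x) ?U' * ?r1 - kres (pick x) ?V' * ?r0"
      using uv uv' by (simp add: kres_diff kres_mult local_ring_mult
          del: times_divide_eq_right times_divide_eq_left times_divide_times_eq)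
    also have "\<dots> = 0" using uv'(4) line by (cases c) auto
    finally have "?U' * ?V - ?V' * ?U \<in> max_ideal x"
      using uv uv' kres_eq_0_iff[of "?U' * ?V - ?V' * ?U" "pick x"]
      by (simp add: local_ring_diff local_ring_mult
          del: times_divide_eq_right times_divide_eq_left times_divide_times_eq)
    from fibre_class_line_multiple[OF uv'(2,3) uv(2,3) nz this]
    obtain d where "d \<in> local_ring x" "Z = fibre_class 2 (std a b) x (d \<cdot>\<^sub>v w)"
      unfolding uv'(1) uv(1) by blast
    thus "Z \<in> V" unfolding w(3) by blast
  qed
  thus "\<exists>c\<in>codes x. V = kline a b x c" using ck by blast
next
  assume "\<exists>c\<in>codes x. V = kline a b x c"
  then obtain c where c: "c \<in> codes x" "V = kline a b x c" by blast
  let ?w = "vec2 (rep0 x c * tw x a) (rep1 c * tw x b)"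
  have "fibre_class 2 (std a b) x ?w \<noteq> fibre_class 2 (std a b) x (0\<^sub>v 2)"
    using rep_nz[OF c(1)] unfolding vec2_arith fibre_class_std_eq_iff by simp
  thus "fibre_line 2 (std a b) x V"
    unfolding fibre_line_def c(2) kline_alt[OF c(1)] using rep_std[OF c(1)] by blast
qed

text \<open>The vector (1, 0) or (z, 1) of one line lies on the other line only if the codes
  agree.\<close>

lemma kline_inj:
  assumes "c \<in> codes x" "c' \<in> codes x" "kline a b x c = kline a b x c'"
  shows "c = c'"
proof -
  let ?u = "rep0 x c * tw x a" and ?v = "rep1 c * tw x b"
  have rep: "?u / tw x a \<in> local_ring x" "?v / tw x b \<in> local_ring x"
    using rep_in assms by (simp_all add: rep_in(2))
  have r: "kres (pick x) (?u / tw x a) = (case c of None \<Rightarrow> 1 | Some z \<Rightarrow> z)"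
    "kres (pick x) (?v / tw x b) = (case c of None \<Rightarrow> 0 | Some z \<Rightarrow> 1)"
    using assms(1) by (auto simp: rep0_def rep1_def codes_def hrep)
  have "fibre_class 2 (std a b) x (vec2 ?u ?v) \<in> kline a b x c"
    unfolding fibre_class_in_kline_iff[OF rep] r by (cases c) auto
  hence "on_line c' (kres (pick x) (?u / tw x a)) (kres (pick x) (?v / tw x b))"
    unfolding assms(3) fibre_class_in_kline_iff[OF rep] .
  thus ?thesis unfolding r by (cases c; cases c') auto
qed

section \<open>Extension of scalars of a flag\<close>

definition gfil :: "int \<Rightarrow> int \<Rightarrow> ('c :: alg_closed_field closed_pt \<Rightarrow> 'c option) \<Rightarrow> 'c filtrations" where
  "gfil a b c = (\<lambda>y j. if j = 0 then fibre 2 (std a b) y else if j = 1 then gline a b y (c y)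
     else {fibre_class 2 (std a b) y (0\<^sub>v 2)})"

lemma gline_submodule:
  "local_submodule 2 y {vec2 u v | u v. u / tw y a \<in> local_ring y \<and> v / tw y b \<in> local_ring y \<and>
     on_line c (resid y (u / tw y a)) (resid y (v / tw y b))}" (is "local_submodule 2 y ?M")
  unfolding local_submodule_def
proof (intro conjI ballI)
  show "0\<^sub>v 2 \<in> ?M" unfolding vec2_arith by (auto simp: local_ring_0)
next
  fix w w' assume "w \<in> ?M" "w' \<in> ?M"
  then obtain u v u' v' where *: "w = vec2 u v" "w' = vec2 u' v'"
    "u / tw y a \<in> local_ring y" "v / tw y b \<in> local_ring y" "on_line c (resid y (u / tw y a)) (resid y (v / tw y b))"
    "u' / tw y a \<in> local_ring y" "v' / tw y b \<in> local_ring y" "on_line c (resid y (u' / tw y a)) (resid y (v' / tw y b))"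
    by blast
  have "on_line c (resid y ((u + u') / tw y a)) (resid y ((v + v') / tw y b))"
    using * on_line_add[OF *(5,8)] by (simp add: add_divide_distrib resid_add)
  thus "w + w' \<in> ?M" using * unfolding *(1,2) vec2_arith by (auto simp: add_divide_distrib local_ring_add)
next
  fix d w assume d: "d \<in> local_ring y" and "w \<in> ?M"
  then obtain u v where *: "w = vec2 u v"
    "u / tw y a \<in> local_ring y" "v / tw y b \<in> local_ring y" "on_line c (resid y (u / tw y a)) (resid y (v / tw y b))"
    by blast
  have "on_line c (resid y (d * (u / tw y a))) (resid y (d * (v / tw y b)))"
    using resid_mult[OF d *(2)] resid_mult[OF d *(3)] on_line_smult[OF *(4)] by simp
  thus "d \<cdot>\<^sub>v w \<in> ?M" using local_ring_mult[OF d *(2)] local_ring_mult[OF d *(3)]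
    unfolding *(1) vec2_arith by auto
qed auto

text \<open>Extension of scalars of a flag is again a flag, with conjugate codes. The content is at
  \<open>j = 1\<close>: incidence with the line is the vanishing of a determinant, which
  \<open>on_line_gcode\<close> carries from \<open>x\<close> to \<open>y\<close>.\<close>

lemma filtrations_ac_flag:
  fixes u :: "'a :: field closed_pt \<Rightarrow> 'a alg_closure option"
  assumes x: "x \<in> D" "pt_below y = x" and c: "u x \<in> codes x"
  shows "filtrations_ac 2 (std a b) (flag_filtrations (std a b) (\<lambda>x\<in>D. kline a b x (u x))) y j =
    gfil a b (\<lambda>y. gcode y (u (pt_below y))) y j"
proof -
  let ?F = "flag_filtrations (std a b) (\<lambda>x\<in>D. kline a b x (u x))"
  define S where "S = {v \<in> std a b x. fibre_class 2 (std a b) x v \<in> ?F x j}"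
  define T where "T = local_span 2 y (map_vec ratfun_ac ` S)"
  have F: "filtrations_ac 2 (std a b) ?F y j = fibre_class 2 (std a b) y ` T"
    by (simp add: filtrations_ac_def bundle_ac_std S_def T_def x)
  have Sd: "S \<subseteq> carrier_vec 2" unfolding S_def using stalks_ok_dim[OF split_bundle_ok] by blast
  have Tok: "local_submodule 2 y T" unfolding T_def using Sd by (intro local_submodule_span) auto
  have Tsup: "map_vec ratfun_ac w \<in> T" if "w \<in> S" for w
    unfolding T_def using local_span_superset that by blast
  have acin: "ratfun_ac h / tw y n \<in> local_ring y" "resid y (ratfun_ac h / tw y n) = kres y (h / tw x n)"
    if "h / tw x n \<in> local_ring x" for h n
    using ratfun_ac_local_ring[of "h / tw x n" y] that
    by (simp_all add: kres_def ratfun_ac_divide x(2) ratfun_ac_tw flip: x(2))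
  consider "j = 0" | "j = 1" | "j \<ge> 2" by linarith
  thus ?thesis
  proof cases
    case 1
    have "S = std a b x" using 1 x by (auto simp: S_def flag_filtrations_def fibre_def)
    moreover have "bundle_ac 2 (std a b :: 'a stalks) y = std a b y" by (simp only: bundle_ac_std)
    ultimately have "T = std a b y" by (simp add: T_def bundle_ac_def x(2))
    thus ?thesis using 1 unfolding F by (simp add: gfil_def fibre_def)
  next
    case 2
    let ?c = "gcode y (u x)"
    let ?M = "{vec2 u v | u v. u / tw y a \<in> local_ring y \<and> v / tw y b \<in> local_ring y \<and>
     on_line ?c (resid y (u / tw y a)) (resid y (v / tw y b))}"
    have S: "vec2 p q \<in> S \<longleftrightarrow> p / tw x a \<in> local_ring x \<and> q / tw x b \<in> local_ring x \<and>
      on_line (u x) (kres (pick x) (p / tw x a)) (kres (pick x) (q / tw x b))" for p q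
      using 2 x fibre_class_in_kline_iff[of p x a q b "u x"]
      by (auto simp: S_def flag_filtrations_def std_iff)
    have "map_vec ratfun_ac ` S \<subseteq> ?M"
    proof
      fix z assume "z \<in> map_vec ratfun_ac ` S"
      then obtain w where w: "w \<in> S" "z = map_vec ratfun_ac w" by blast
      then obtain p q where pq: "w = vec2 p q" using Sd vec2_cases by blast
      have pq': "p / tw x a \<in> local_ring x" "q / tw x b \<in> local_ring x"
        "on_line (gcode (pick x) (u x)) (kres (pick x) (p / tw x a)) (kres (pick x) (q / tw x b))"
        using w(1) unfolding pq S gcode_pick[OF c] by blast+
      have "on_line ?c (kres y (p / tw x a)) (kres y (q / tw x b))"
        using on_line_gcode[OF c pt_below_pick pq'(1,2)] on_line_gcode[OF c x(2) pq'(1,2)] pq'(3) by blast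
      thus "z \<in> ?M" using acin[OF pq'(1)] acin[OF pq'(2)] unfolding w(2) pq map_vec2 by auto
    qed
    hence TM: "T \<subseteq> ?M" unfolding T_def by (intro local_span_least gline_submodule)
    have "fibre_class 2 (std a b) y ` T = gline a b y ?c"
    proof (intro equalityI subsetI)
      fix V assume "V \<in> fibre_class 2 (std a b) y ` T"
      thus "V \<in> gline a b y ?c" using TM unfolding gline_def by blast
    next
      fix V assume "V \<in> gline a b y ?c"
      then obtain p q where pq: "V = fibre_class 2 (std a b) y (vec2 p q)" "p / tw y a \<in> local_ring y" "q / tw y b \<in> local_ring y"
        "on_line ?c (resid y (p / tw y a)) (resid y (q / tw y b))"
        unfolding gline_def by blast
      \<comment> \<open>One spanning vector of the line below; every vector of the line above is a
        multiple of its base change, up to vectors that vanish in the fibre.\<close>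
      let ?w = "vec2 (rep0 x (u x) * tw x a) (rep1 (u x) * tw x b)"
      let ?p = "ratfun_ac (rep0 x (u x)) * tw y a" and ?q = "ratfun_ac (rep1 (u x)) * tw y b"
      have mw: "map_vec ratfun_ac ?w = vec2 ?p ?q"
        using ratfun_ac_tw[of y] by (simp add: map_vec2 ratfun_ac_mult x)
      have wS: "?w \<in> S" unfolding S using c
        by (auto simp: rep_in codes_def rep0_def rep1_def hrep local_ring_0 local_ring_1)
      have r: "rep0 x (u x) \<in> local_ring x" "rep1 (u x) \<in> local_ring x" using c by (auto intro: rep_in)
      have rac: "?p / tw y a \<in> local_ring y" "?q / tw y b \<in> local_ring y"
        using r ratfun_ac_local_ring[of _ y] x by auto
      have nz: "?p / tw y a \<notin> max_ideal y \<or> ?q / tw y b \<notin> max_ideal y"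
        using rep_nz[OF c] r ratfun_ac_max_ideal[of _ y] x by auto
      have rs: "resid y (?p / tw y a) = (case u x of None \<Rightarrow> 1 | Some z \<Rightarrow> kres y (hrep x z))"
        "resid y (?q / tw y b) = (case u x of None \<Rightarrow> 0 | Some z \<Rightarrow> 1)"
        by (auto simp: rep0_def rep1_def kres_def split: option.splits)
      have "resid y ((p / tw y a) * (?q / tw y b) - (q / tw y b) * (?p / tw y a)) =
         resid y (p / tw y a) * resid y (?q / tw y b) - resid y (q / tw y b) * resid y (?p / tw y a)"
        using pq rac by (simp only: resid_diff resid_mult local_ring_mult)
      also have "\<dots> = 0" using pq(4) unfolding rs by (cases "u x") (auto simp: gcode_def x(2))
      finally have "(p / tw y a) * (?q / tw y b) - (q / tw y b) * (?p / tw y a) \<in> max_ideal y"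
        using resid_eq_0_iff[OF local_ring_diff[OF local_ring_mult[OF pq(2) rac(2)] local_ring_mult[OF pq(3) rac(1)]]]
        by blast
      from fibre_class_line_multiple[OF pq(2,3) rac nz this] obtain d where
        d: "d \<in> local_ring y" "V = fibre_class 2 (std a b) y (d \<cdot>\<^sub>v vec2 ?p ?q)"
        unfolding pq(1) by blast
      have "d \<cdot>\<^sub>v vec2 ?p ?q \<in> T"
        using Tsup[OF wS] unfolding mw by (intro local_submodule_smult[OF Tok d(1)])
      thus "V \<in> fibre_class 2 (std a b) y ` T" unfolding d(2) by blast
    qed
    thus ?thesis using 2 x unfolding F by (simp add: gfil_def)
  next
    case 3
    \<comment> \<open>From index 2 on the filtration is zero, so only vectors of the stalk that
      vanish in the fibre remain, and these still vanish in the fibre above.\<close>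
    have Sm: "S \<subseteq> mlat 2 (std a b) x"
    proof
      fix w assume w: "w \<in> S"
      hence wc: "w \<in> carrier_vec 2" using Sd by blast
      have "fibre_class 2 (std a b) x w = fibre_class 2 (std a b) x (0\<^sub>v 2)"
        using w 3 by (auto simp: S_def flag_filtrations_def)
      thus "w \<in> mlat 2 (std a b) x"
        using fibre_class_eq_iff[OF split_bundle_ok wc zero_carrier_vec] wc by simp
    qed
    have "map_vec ratfun_ac ` S \<subseteq> mlat 2 (std a b) y"
    proof
      fix z assume "z \<in> map_vec ratfun_ac ` S"
      then obtain w where w: "w \<in> S" "z = map_vec ratfun_ac w" by blast
      then obtain p q where pq: "w = vec2 p q" using Sd vec2_cases by blast
      hence m: "p / tw x a \<in> max_ideal x" "q / tw x b \<in> max_ideal x"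
        using w(1) Sm mlat_std_iff[of p q a b x] by blast+
      have "ratfun_ac (p / tw x a) \<in> max_ideal y" "ratfun_ac (q / tw x b) \<in> max_ideal y"
        using m max_ideal_subset ratfun_ac_max_ideal[of _ y] x(2) by blast+
      thus "z \<in> mlat 2 (std a b) y" unfolding w(2) pq map_vec2 mlat_std_iff
        using ratfun_ac_tw[of y] x(2) by (simp add: ratfun_ac_divide)
    qed
    hence "T \<subseteq> mlat 2 (std a b) y" unfolding T_def
      by (intro local_span_least mlat_submodule split_bundle_ok)
    moreover have "0\<^sub>v 2 \<in> T" by (rule local_submodule_zero[OF Tok])
    moreover have "fibre_class 2 (std a b) y t = fibre_class 2 (std a b) y (0\<^sub>v 2)" if "t \<in> mlat 2 (std a b) y" for t
      using that mlat_dim[OF split_bundle_ok that] by (subst fibre_class_eq_iff[OF split_bundle_ok]) auto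
    ultimately have "fibre_class 2 (std a b) y ` T = {fibre_class 2 (std a b) y (0\<^sub>v 2)}" by blast
    thus ?thesis using 3 unfolding F by (simp add: gfil_def)
  qed
qed

section \<open>Evaluation of sections and interpolation\<close>

text \<open>The bound is strict so that the index is the dimension; \<open>n = 0\<close> gives the
  zero space, which is \<open>polys_upto (-1)\<close>.\<close>

definition polys_below :: "nat \<Rightarrow> 'a :: field poly set" where
  "polys_below n = {f. \<forall>i\<ge>n. Polynomial.coeff f i = 0}"

lemma polys_upto_alt: "n \<ge> -1 \<Longrightarrow> polys_upto n = polys_below (nat (n + 1))"
proof (intro equalityI subsetI)
  fix f :: "'a poly" assume "f \<in> polys_upto n" "n \<ge> -1"
  thus "f \<in> polys_below (nat (n + 1))"
    by (auto simp: polys_upto_def polys_below_def intro: coeff_eq_0)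
next
  fix f :: "'a poly" assume f: "f \<in> polys_below (nat (n + 1))" "n \<ge> -1"
  show "f \<in> polys_upto n"
  proof (cases "f = 0")
    case False
    hence "Polynomial.coeff f (Polynomial.degree f) \<noteq> 0" by simp
    hence "\<not> Polynomial.degree f \<ge> nat (n + 1)" using f by (auto simp: polys_below_def)
    hence "int (Polynomial.degree f) \<le> n" by linarith
    thus ?thesis by (simp add: polys_upto_def)
  qed (simp add: polys_upto_def)
qed

lemma polys_below_diff: "f \<in> polys_below n \<Longrightarrow> g \<in> polys_below n \<Longrightarrow> f - g \<in> polys_below n"
  by (simp add: polys_below_def)

lemma polys_below_mono: "m \<le> n \<Longrightarrow> f \<in> polys_below m \<Longrightarrow> f \<in> polys_below n"
  by (simp add: polys_below_def)

lemma polys_below_degree: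
  assumes "f \<noteq> 0" shows "f \<in> polys_below n \<longleftrightarrow> Polynomial.degree f < n"
proof
  assume "f \<in> polys_below n"
  moreover have "Polynomial.coeff f (Polynomial.degree f) \<noteq> 0" using assms by simp
  ultimately show "Polynomial.degree f < n" unfolding polys_below_def using leI by blast
qed (auto simp: polys_below_def intro: coeff_eq_0)

lemma polys_below_multiple:
  assumes "p dvd f" "f \<in> polys_below (Polynomial.degree p)" shows "f = 0"
proof (rule ccontr)
  assume "f \<noteq> 0"
  hence "Polynomial.degree p \<le> Polynomial.degree f" using assms(1) by (intro dvd_imp_degree_le)
  thus False using assms(2) polys_below_degree[OF \<open>f \<noteq> 0\<close>] by simp
qed

lemma polys_below_Suc: "polys_below (Suc n) = (\<lambda>(c, f). pCons c f) ` (UNIV \<times> polys_below n)"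
proof (intro equalityI subsetI)
  fix f :: "'a poly" assume f: "f \<in> polys_below (Suc n)"
  obtain c g where g: "f = pCons c g" by (rule pCons_cases)
  have "g \<in> polys_below n"
    unfolding polys_below_def
  proof safe
    fix i assume "i \<ge> n"
    hence "Polynomial.coeff f (Suc i) = 0" using f by (simp add: polys_below_def)
    thus "Polynomial.coeff g i = 0" by (simp add: g)
  qed
  thus "f \<in> (\<lambda>(c, f). pCons c f) ` (UNIV \<times> polys_below n)" using g by auto
qed (auto simp: polys_below_def coeff_pCons split: nat.splits)

lemma card_polys_below:
  shows "finite (polys_below n :: 'k :: {field, finite} poly set)"
    and "card (polys_below n :: 'k poly set) = card (UNIV :: 'k set) ^ n"
proof -
  have "finite (polys_below n :: 'k poly set) \<and> card (polys_below n :: 'k poly set) = card (UNIV :: 'k set) ^ n"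
  proof (induction n)
    case 0
    have "polys_below 0 = {0 :: 'k poly}" by (auto simp: polys_below_def poly_eq_iff)
    thus ?case by simp
  next
    case (Suc n)
    have "inj_on (\<lambda>(c, f). pCons c f) (UNIV \<times> (polys_below n :: 'k poly set))" by (auto simp: inj_on_def)
    thus ?case using Suc by (simp add: polys_below_Suc card_image card_cartesian_product)
  qed
  thus "finite (polys_below n :: 'k poly set)" "card (polys_below n :: 'k poly set) = card (UNIV :: 'k set) ^ n"
    by simp_all
qed

section \<open>Size of the residue fields\<close>

lemma pick_Infty [simp]: "pick Infty = Infty"
  using pt_below_pick[of Infty] by (simp only: pt_below_eq_Infty)

lemma pick_Fin:
  obtains \<alpha> where "pick (Fin p) = lin_pt \<alpha>" "poly (pac (poly_of p)) \<alpha> = 0"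
proof (cases "pick (Fin p)" rule: geom_pt_cases)
  case 1
  thus ?thesis using pt_below_pick[of "Fin p"] by simp
next
  case (2 \<alpha>)
  thus ?thesis using that pt_below_pick[of "Fin p"] by (auto simp: pt_below_lin_pt_iff)
qed

lemma kres_poly: "kres (lin_pt \<alpha>) (Fr f 1) = poly (pac f) \<alpha>"
  using resid_lin_pt[of 1 \<alpha> "pac f"] by (simp add: kres_def ratfun_ac_poly)

text \<open>Evaluation at \<alpha> identifies the residue field with the remainders modulo the
  prime: a Bezout identity inverts the denominator and division reduces the numerator. Injectivity
  holds because a multiple of the prime of smaller degree is zero.\<close>

lemma resf_Fin:
  assumes "pick (Fin p) = lin_pt \<alpha>" "poly (pac (poly_of p)) \<alpha> = 0"
  shows "bij_betw (\<lambda>f. poly (pac f) \<alpha>) (polys_below (Polynomial.degree (poly_of p))) (resf (Fin p))"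
  unfolding bij_betw_def
proof (intro conjI equalityI subsetI)
  let ?d = "Polynomial.degree (poly_of p)"
  show "inj_on (\<lambda>f. poly (pac f) \<alpha>) (polys_below ?d)"
  proof (rule inj_onI)
    fix f g assume fg: "f \<in> polys_below ?d" "g \<in> polys_below ?d" "poly (pac f) \<alpha> = poly (pac g) \<alpha>"
    have "pac f = pac (f - g) + pac g" by (simp flip: pac_add)
    hence "poly (pac (f - g)) \<alpha> = 0" using fg(3) by simp
    hence "poly_of p dvd f - g" by (simp add: pac_root_iff[OF assms(2)])
    hence "f - g = 0" using fg by (intro polys_below_multiple polys_below_diff)
    thus "f = g" by simp
  qed
  fix z
  {
    assume "z \<in> (\<lambda>f. poly (pac f) \<alpha>) ` polys_below ?d"
    then obtain f where "z = poly (pac f) \<alpha>" by blast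
    thus "z \<in> resf (Fin p)" unfolding resf_def assms(1)
      using kres_poly poly_in_local_ring_Fin by (metis imageI)
  }
  assume "z \<in> resf (Fin p)"
  then obtain h where h: "h \<in> local_ring (Fin p)" "z = kres (lin_pt \<alpha>) h"
    unfolding resf_def assms(1) by blast
  from h(1) obtain f g where fg: "h = Fr f g" "\<not> poly_of p dvd g" "g \<noteq> 0" by (rule local_ring_FinE)
  from fg(2) obtain u v where uv: "u * g + v * poly_of p = 1" by (rule poly_of_coprime_bezout)
  have g: "poly (pac g) \<alpha> \<noteq> 0" using fg(2) by (simp add: pac_root_iff[OF assms(2)])
  have "poly (pac (u * g + v * poly_of p)) \<alpha> = 1" unfolding uv by (simp add: map_poly_to_ac_1)
  hence ug: "poly (pac u) \<alpha> * poly (pac g) \<alpha> = 1" by (simp add: pac_add map_poly_to_ac_mult assms)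
  have "z = poly (pac f) \<alpha> / poly (pac g) \<alpha>" unfolding h(2) fg(1) kres_def using fg g
    by (simp add: ratfun_ac_Fract resid_lin_pt)
  also have "\<dots> = poly (pac (f * u)) \<alpha>" using ug g by (simp add: map_poly_to_ac_mult field_simps)
  also have "f * u = f * u div poly_of p * poly_of p + f * u mod poly_of p" by simp
  also have "poly (pac \<dots>) \<alpha> = poly (pac (f * u mod poly_of p)) \<alpha>"
    using assms(2) by (simp only: pac_add map_poly_to_ac_mult poly_add poly_mult) simp
  finally have "z = poly (pac (f * u mod poly_of p)) \<alpha>" .
  moreover have "f * u mod poly_of p \<in> polys_below ?d"
  proof (cases "f * u mod poly_of p = 0")
    case False
    thus ?thesis using degree_mod_less'[OF poly_of_nz] by (simp add: polys_below_degree)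
  qed (simp add: polys_below_def)
  ultimately show "z \<in> (\<lambda>f. poly (pac f) \<alpha>) ` polys_below ?d" by blast
qed

lemma resf_Infty: "resf Infty = range to_ac"
proof (intro equalityI subsetI)
  fix z :: "'a alg_closure" assume "z \<in> resf Infty"
  then obtain h where h: "h \<in> local_ring Infty" "z = kres Infty h" by (auto simp: resf_def)
  from h(1) obtain f g where "h = Fr f g" "g \<noteq> 0" "Polynomial.degree f \<le> Polynomial.degree g"
    by (rule local_ring_InftyE)
  hence "z = Polynomial.coeff (pac f) (Polynomial.degree g) / Polynomial.coeff (pac g) (Polynomial.degree g)"
    unfolding h(2) kres_def
    by (simp add: ratfun_ac_Fract resid_Infty map_poly_to_ac_eq_0_iff)
  hence "z = to_ac (Polynomial.coeff f (Polynomial.degree g) / lead_coeff g)"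
    by (simp add: coeff_map_poly)
  thus "z \<in> range to_ac" by blast
next
  fix z :: "'a alg_closure" assume "z \<in> range to_ac"
  then obtain c where "z = to_ac c" by (rule rangeE)
  thus "z \<in> resf Infty" by (simp add: to_ac_in_resf)
qed

lemma card_resf:
  fixes x :: "'k :: {field, finite} closed_pt"
  shows "finite (resf x)" "card (resf x) = card (UNIV :: 'k set) ^ pt_degree x"
proof -
  have "finite (resf x) \<and> card (resf x) = card (UNIV :: 'k set) ^ pt_degree x"
  proof (cases x)
    case Infty
    thus ?thesis by (simp add: resf_Infty card_image inj_to_ac)
  next
    case (Fin p)
    obtain \<alpha> where "pick (Fin p) = lin_pt \<alpha>" "poly (pac (poly_of p)) \<alpha> = 0" by (rule pick_Fin)
    from resf_Fin[OF this] show ?thesis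
      using card_polys_below[where 'k = 'k, of "Polynomial.degree (poly_of p)"] Fin
      by (auto simp: bij_betw_same_card bij_betw_finite dest: bij_betw_same_card bij_betw_finite)
  qed
  thus "finite (resf x)" "card (resf x) = card (UNIV :: 'k set) ^ pt_degree x" by simp_all
qed

text \<open>The value at \<open>y\<close> of the section \<open>f\<close> of O(e), relative to the
  generator \<open>tw y e\<close>: the ordinary value at a finite point, the coefficient of t^e at
  infinity.\<close>

definition evs :: "int \<Rightarrow> 'c :: alg_closed_field closed_pt \<Rightarrow> 'c poly \<Rightarrow> 'c" where
  "evs e y f = resid y (Fr f 1 / tw y e)"

lemma evs_lin_pt [simp]: "evs e (lin_pt \<alpha>) f = poly f \<alpha>"
  by (simp add: evs_def resid_section_lin_pt)

lemma evs_Infty: "f \<in> polys_upto e \<Longrightarrow> evs e Infty f = Polynomial.coeff f (nat e)"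
  by (simp add: evs_def resid_section_Infty)

lemma pac_polys_upto: "pac f \<in> polys_upto e \<longleftrightarrow> f \<in> polys_upto e"
  by (simp add: polys_upto_def map_poly_to_ac_eq_0_iff)

lemma section_local: "f \<in> polys_upto e \<Longrightarrow> Fr f 1 / tw x e \<in> local_ring x"
  using sections_iff[of "Fr f 1" e] by (auto simp: sections_def)

lemma evs_pac: "evs e y (pac f) = kres y (Fr f 1 / tw (pt_below y) e)"
  by (simp add: evs_def kres_def ratfun_ac_divide ratfun_ac_poly ratfun_ac_tw)

lemma polys_upto_add: "f \<in> polys_upto e \<Longrightarrow> g \<in> polys_upto e \<Longrightarrow> f + g \<in> polys_upto e"
proof (cases "e \<ge> 0")
  case True
  assume "f \<in> polys_upto e" "g \<in> polys_upto e"
  thus ?thesis using True by (simp add: polys_upto_alt) (simp add: polys_below_def)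
qed (auto simp: polys_upto_def)

lemma polys_upto_smult: "f \<in> polys_upto e \<Longrightarrow> Polynomial.smult c f \<in> polys_upto e"
  by (auto simp: polys_upto_def)

lemma evs_add: "f \<in> polys_upto e \<Longrightarrow> g \<in> polys_upto e \<Longrightarrow> evs e y (f + g) = evs e y f + evs e y g"
  by (cases y rule: geom_pt_cases) (auto simp: evs_Infty polys_upto_add)

lemma evs_smult: "f \<in> polys_upto e \<Longrightarrow> evs e y (Polynomial.smult c f) = c * evs e y f"
  by (cases y rule: geom_pt_cases) (auto simp: evs_Infty polys_upto_smult)

lemma evs_uminus: "f \<in> polys_upto e \<Longrightarrow> evs e y (- f) = - evs e y f"
  using evs_smult[of f e y "-1"] by simp

lemma polys_upto_uminus: "f \<in> polys_upto e \<Longrightarrow> - f \<in> polys_upto e"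
  by (auto simp: polys_upto_def)

lemma polys_upto_diff: "f \<in> polys_upto e \<Longrightarrow> g \<in> polys_upto e \<Longrightarrow> f - g \<in> polys_upto e"
  using polys_upto_add[of f e "- g"] polys_upto_uminus by force

lemma pac_diff: "pac (f - g) = pac f - pac g"
  by (rule poly_eqI) (simp add: coeff_map_poly)

lemma pac_uminus: "pac (- f) = - pac f"
  by (rule poly_eqI) (simp add: coeff_map_poly)

lemma pac_smult: "pac (Polynomial.smult c f) = Polynomial.smult (to_ac c) (pac f)"
  by (rule poly_eqI) (simp add: coeff_map_poly)

lemma evs_diff: "f \<in> polys_upto e \<Longrightarrow> g \<in> polys_upto e \<Longrightarrow> evs e y (f - g) = evs e y f - evs e y g"
  using evs_add[of f e "- g" y] evs_uminus[of g e y] polys_upto_uminus by force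

lemma evs_in_resf: "f \<in> polys_upto e \<Longrightarrow> evs e (pick x) (pac f) \<in> resf x"
  unfolding evs_pac resf_def by (simp add: section_local)

definition deg_sum :: "'a :: field closed_pt set \<Rightarrow> nat" where
  "deg_sum I = (\<Sum>x\<in>I. pt_degree x)"

lemma prime_polys_prod_dvd:
  assumes "finite P" "\<And>p. p \<in> P \<Longrightarrow> poly_of p dvd f"
  shows "(\<Prod>p\<in>P. poly_of p) dvd f"
  using assms
proof (induction P)
  case (insert p P)
  then obtain g where g: "f = (\<Prod>p\<in>P. poly_of p) * g" by (auto elim: dvdE)
  have "\<not> poly_of p dvd (\<Prod>p\<in>P. poly_of p)"
    using insert.hyps by (induction P) (auto simp: poly_of_dvd_poly_of)
  moreover have "poly_of p dvd f" using insert.prems by simp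
  ultimately have "poly_of p dvd g" by (simp add: g)
  then obtain h where "g = poly_of p * h" by blast
  thus ?case using insert.hyps by (simp add: g mult_ac)
qed simp

lemma degree_prod_poly_of:
  assumes "finite P" shows "Polynomial.degree (\<Prod>p\<in>P. poly_of p) = (\<Sum>p\<in>P. Polynomial.degree (poly_of p))"
  using assms by (induction P) (auto simp: degree_mult_eq prod_zero_iff)

text \<open>A point at infinity in I imposes a vanishing leading coefficient, so it lowers the degree bound by one.\<close>

lemma vanishing_section_eq_0:
  assumes fin: "finite I" and f: "f \<in> polys_upto e" "e \<ge> 0"
    and van: "\<And>x. x \<in> I \<Longrightarrow> evs e (pick x) (pac f) = 0"
    and bd: "f \<in> polys_below (deg_sum (I - {Infty})) \<or> deg_sum I \<ge> nat e + 1"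
  shows "f = 0"
proof -
  define P where "P = {p. Fin p \<in> I}"
  have FP: "Fin ` P = I - {Infty}" by (auto simp: P_def) (metis closed_pt.exhaust image_eqI mem_Collect_eq)
  have inj: "inj_on Fin P" by (auto simp: inj_on_def)
  have "finite (Fin ` P)" unfolding FP using fin by simp
  hence finP: "finite P" using inj by (rule finite_imageD)
  have dg: "deg_sum (I - {Infty}) = (\<Sum>p\<in>P. Polynomial.degree (poly_of p))"
    unfolding FP[symmetric] deg_sum_def by (simp add: sum.reindex[OF inj])
  have "poly_of p dvd f" if "p \<in> P" for p
  proof -
    obtain \<alpha> where "pick (Fin p) = lin_pt \<alpha>" "poly (pac (poly_of p)) \<alpha> = 0" by (rule pick_Fin)
    thus ?thesis using van[of "Fin p"] that pac_root_iff by (auto simp: P_def)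
  qed
  hence dvd: "(\<Prod>p\<in>P. poly_of p) dvd f" by (intro prime_polys_prod_dvd finP)
  have "f \<in> polys_below (deg_sum (I - {Infty}))"
  proof (cases "f \<in> polys_below (deg_sum (I - {Infty}))")
    case False
    hence bd: "deg_sum I \<ge> nat e + 1" using bd by simp
    show ?thesis
    proof (cases "Infty \<in> I")
      case True
      have "Polynomial.coeff f (nat e) = 0"
        using van[OF True] f by (simp add: evs_Infty pac_polys_upto coeff_map_poly)
      moreover have "f \<in> polys_below (nat e + 1)" using f by (simp add: polys_upto_alt nat_add_distrib)
      ultimately have "Polynomial.coeff f i = 0" if "i \<ge> nat e" for i
        using that by (cases "i = nat e") (auto simp: polys_below_def)
      hence "f \<in> polys_below (nat e)" by (simp add: polys_below_def)
      moreover have "deg_sum I = 1 + deg_sum (I - {Infty})"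
        unfolding deg_sum_def using sum.remove[OF fin True, of pt_degree] by simp
      ultimately show ?thesis using bd by (auto intro: polys_below_mono)
    next
      case False
      moreover have "f \<in> polys_below (nat e + 1)" using f by (simp add: polys_upto_alt nat_add_distrib)
      ultimately show ?thesis using bd by (auto intro: polys_below_mono)
    qed
  qed
  thus ?thesis using dvd by (intro polys_below_multiple[OF dvd]) (simp add: degree_prod_poly_of finP dg)
qed

lemma card_PiE_resf:
  fixes I :: "'k :: {field, finite} closed_pt set"
  assumes "finite I"
  shows "card (PiE I resf) = card (UNIV :: 'k set) ^ deg_sum I" "finite (PiE I resf)"
  using assms by (auto simp: card_PiE card_resf deg_sum_def power_sum intro!: finite_PiE)

text \<open>Chinese remainder theorem by counting: the evaluation map is injective on a space of
  sections with as many elements as the target, hence onto.\<close>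

lemma interpolation:
  fixes I :: "'k :: {field, finite} closed_pt set"
  assumes fin: "finite I" and e: "e \<ge> 0" and s: "deg_sum I \<le> nat e + 1" and z: "\<And>x. x \<in> I \<Longrightarrow> z x \<in> resf x"
  obtains f where "f \<in> polys_upto e" "\<And>x. x \<in> I \<Longrightarrow> evs e (pick x) (pac f) = z x"
proof -
  let ?q = "card (UNIV :: 'k set)"
  let ?\<Phi> = "\<lambda>f. \<lambda>x\<in>I. evs e (pick x) (pac f)"
  define s' where "s' = deg_sum (I - {Infty})"
  \<comment> \<open>A complement to the sections vanishing on \<open>I\<close>, of dimension exactly
    \<open>deg_sum I\<close>: remainders modulo the product of the finite points, and, if infinity
    belongs to \<open>I\<close>, the coefficient of t^e as an independent coordinate, since
    \<open>s'\<close> is then at most e.\<close>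
  define Q :: "'k poly set" where "Q = (if Infty \<in> I then (\<lambda>(c, g). g + Polynomial.monom c (nat e)) ` (UNIV \<times> polys_below s')
      else polys_below s')"
  have ss: "deg_sum I = (if Infty \<in> I then 1 + s' else s')"
    unfolding s'_def deg_sum_def using sum.remove[OF fin, of Infty pt_degree] by simp
  have Qe: "Q \<subseteq> polys_upto e"
    using s e by (auto simp: Q_def ss polys_upto_alt polys_below_def nat_add_distrib split: if_splits)
  have cardQ: "card Q = ?q ^ deg_sum I" "finite Q"
  proof -
    have "inj_on (\<lambda>(c, g). g + Polynomial.monom c (nat e)) (UNIV \<times> (polys_below s' :: 'k poly set))" if "Infty \<in> I"
    proof (rule inj_onI, clarify)
      fix c c' and g g' :: "'k poly"
      assume *: "g \<in> polys_below s'" "g' \<in> polys_below s'" "g + Polynomial.monom c (nat e) = g' + Polynomial.monom c' (nat e)"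
      have "Polynomial.coeff g (nat e) = 0" "Polynomial.coeff g' (nat e) = 0"
        using * s that by (auto simp: polys_below_def ss)
      hence "c = c'" using arg_cong[OF *(3), of "\<lambda>f. Polynomial.coeff f (nat e)"] by simp
      thus "c = c' \<and> g = g'" using *(3) by simp
    qed
    thus "card Q = ?q ^ deg_sum I" "finite Q"
      by (auto simp: Q_def ss card_image card_cartesian_product card_polys_below)
  qed
  have inj: "inj_on ?\<Phi> Q"
  proof (rule inj_onI)
    fix f g assume fg: "f \<in> Q" "g \<in> Q" "?\<Phi> f = ?\<Phi> g"
    have fge: "f \<in> polys_upto e" "g \<in> polys_upto e" using fg Qe by auto
    have eq: "evs e (pick x) (pac f) = evs e (pick x) (pac g)" if "x \<in> I" for x
      using fun_cong[OF fg(3), of x] that by simp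
    have van: "evs e (pick x) (pac (f - g)) = 0" if "x \<in> I" for x
      using eq[OF that] fge by (simp add: pac_diff evs_diff pac_polys_upto)
    have "f - g \<in> polys_below s'"
    proof (cases "Infty \<in> I")
      case True
      from fg obtain c c' f' g' where *: "f = f' + Polynomial.monom c (nat e)" "g = g' + Polynomial.monom c' (nat e)"
        "f' \<in> polys_below s'" "g' \<in> polys_below s'" using True by (auto simp: Q_def)
      have 0: "Polynomial.coeff f' (nat e) = 0" "Polynomial.coeff g' (nat e) = 0"
        using * s True by (auto simp: polys_below_def ss)
      have "Polynomial.coeff (f - g) (nat e) = 0"
        using van[OF True] fge by (simp add: evs_Infty pac_polys_upto polys_upto_diff coeff_map_poly)
      hence "c = c'" using * 0 by simp
      thus ?thesis using * by (simp add: polys_below_diff)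
    qed (use fg in \<open>auto simp: Q_def intro: polys_below_diff\<close>)
    hence "f - g = 0" using fge van
      by (intro vanishing_section_eq_0[OF fin _ e]) (auto simp: s'_def polys_upto_diff)
    thus "f = g" by simp
  qed
  have sub: "?\<Phi> ` Q \<subseteq> PiE I resf"
    using Qe by (auto intro!: evs_in_resf)
  have "?\<Phi> ` Q = PiE I resf"
    using card_PiE_resf[OF fin] by (intro card_subset_eq sub) (simp_all add: card_image[OF inj] cardQ)
  moreover have "(\<lambda>x\<in>I. z x) \<in> PiE I resf" using z by auto
  ultimately obtain f where f: "f \<in> Q" "(\<lambda>x\<in>I. z x) = ?\<Phi> f" by blast
  have "evs e (pick x) (pac f) = z x" if "x \<in> I" for x
    using fun_cong[OF f(2), of x] that by simp
  thus ?thesis using that f(1) Qe by blast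
qed

section \<open>Descent of endomorphisms to the ground field\<close>

text \<open>A solution of minimal support, normalised to have an entry 1, is fixed by Frobenius:
  otherwise its difference with its Frobenius conjugate would have smaller support.\<close>

lemma frob_descent:
  fixes m :: "nat \<Rightarrow> 'y \<Rightarrow> 'k :: {field, finite} alg_closure"
  assumes fin: "finite J" and fr: "\<And>y. y \<in> Y \<Longrightarrow> \<exists>y'\<in>Y. \<forall>j\<in>J. m j y = frob (m j y')"
    and sol: "\<forall>y\<in>Y. (\<Sum>j\<in>J. C j * m j y) = 0" and nz: "\<exists>j\<in>J. C j \<noteq> 0"
  shows "\<exists>C' :: nat \<Rightarrow> 'k. (\<exists>j\<in>J. C' j \<noteq> 0) \<and> (\<forall>y\<in>Y. (\<Sum>j\<in>J. to_ac (C' j) * m j y) = 0)"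
  using sol nz
proof (induction "card {j\<in>J. C j \<noteq> 0}" arbitrary: C rule: less_induct)
  case less
  then obtain j0 where j0: "j0 \<in> J" "C j0 \<noteq> 0" by blast
  define B where "B = (\<lambda>j. C j / C j0)"
  define E where "E = (\<lambda>j. frob (B j) - B j)"
  have Bsol: "(\<Sum>j\<in>J. B j * m j y) = 0" if "y \<in> Y" for y
  proof -
    have "(\<Sum>j\<in>J. B j * m j y) = (\<Sum>j\<in>J. C j * m j y) / C j0"
      by (simp add: B_def sum_divide_distrib)
    thus ?thesis using less.prems that by simp
  qed
  have "(\<Sum>j\<in>J. frob (B j) * m j y) = 0" if "y \<in> Y" for y
  proof -
    obtain y' where y': "y' \<in> Y" "\<forall>j\<in>J. m j y = frob (m j y')" using fr \<open>y \<in> Y\<close> by blast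
    hence "(\<Sum>j\<in>J. frob (B j) * m j y) = frob (\<Sum>j\<in>J. B j * m j y')"
      by (simp add: frob_sum frob_mult)
    thus ?thesis using Bsol y' by simp
  qed
  hence Esol: "\<forall>y\<in>Y. (\<Sum>j\<in>J. E j * m j y) = 0"
    using Bsol by (simp add: E_def left_diff_distrib sum_subtractf)
  show ?case
  proof (cases "\<exists>j\<in>J. E j \<noteq> 0")
    case True
    have "j0 \<notin> {j\<in>J. E j \<noteq> 0}" "j0 \<in> {j\<in>J. C j \<noteq> 0}" using j0 by (simp_all add: E_def B_def)
    moreover have "{j\<in>J. E j \<noteq> 0} \<subseteq> {j\<in>J. C j \<noteq> 0}" by (auto simp: E_def B_def)
    ultimately have "{j\<in>J. E j \<noteq> 0} \<subset> {j\<in>J. C j \<noteq> 0}" by blast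
    hence "card {j\<in>J. E j \<noteq> 0} < card {j\<in>J. C j \<noteq> 0}" using fin by (intro psubset_card_mono) auto
    thus ?thesis using less.hyps Esol True by blast
  next
    case False
    hence "B j \<in> range to_ac" if "j \<in> J" for j
      using that frob_fixed_iff[of "B j"] by (auto simp: E_def)
    hence "to_ac (of_ac (B j)) = B j" if "j \<in> J" for j using that to_ac_of_ac by blast
    moreover from this[OF j0(1)] have "of_ac (B j0) \<noteq> 0" using j0 by (auto simp: B_def)
    ultimately show ?thesis using Bsol j0(1) by (intro exI[of _ "\<lambda>j. of_ac (B j)"]) auto
  qed
qed

text \<open>The equation satisfied at a point z of the projective line fixed by the matrix with rows
  (p, f) and (g, s), where c2 = - g and c1 = p - s.\<close>

definition qcond :: "int \<Rightarrow> 'c :: alg_closed_field closed_pt \<Rightarrow> 'c option \<Rightarrow> 'c \<Rightarrow> 'c \<Rightarrow> 'c poly \<Rightarrow> bool" where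
  "qcond e y c c2 c1 f \<longleftrightarrow> (case c of None \<Rightarrow> c2 = 0 | Some z \<Rightarrow> c2 * z\<^sup>2 + c1 * z + evs e y f = 0)"

text \<open>The flag has only scalar endomorphisms over the ground field. Modulo scalars an
  endomorphism has the three parameters \<open>c2\<close>, \<open>c1\<close>, \<open>f\<close>; the
  lower left entry is a section of O(-e), hence the condition \<open>c2 = 0\<close> for
  \<open>e > 0\<close>. Each closed point is tested at one geometric point.\<close>

definition brick :: "int \<Rightarrow> 'a :: field closed_pt set \<Rightarrow> ('a closed_pt \<Rightarrow> 'a alg_closure option) \<Rightarrow> bool" where
  "brick e D u \<longleftrightarrow> (\<forall>c2 c1 f. (e > 0 \<longrightarrow> c2 = 0) \<and> f \<in> polys_upto e \<and>
     (\<forall>x\<in>D. qcond e (pick x) (u x) (to_ac c2) (to_ac c1) (pac f)) \<longrightarrow> c2 = 0 \<and> c1 = 0 \<and> f = 0)"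

text \<open>The quadratic expression is the value of a function \<open>H\<close> regular at the
  point below, so its vanishing can be tested at any geometric point above.\<close>

lemma qcond_transfer:
  assumes "c \<in> codes (pt_below y)" "f \<in> polys_upto e"
  shows "qcond e (pick (pt_below y)) c (to_ac c2) (to_ac c1) (pac f) \<longleftrightarrow>
    qcond e y (gcode y c) (to_ac c2) (to_ac c1) (pac f)"
proof (cases c)
  case (Some z)
  let ?x = "pt_below y"
  have z: "z \<in> resf ?x" using assms Some by (auto simp: codes_def)
  define h where "h = hrep ?x z"
  have h: "h \<in> local_ring ?x" unfolding h_def by (rule hrep[OF z])
  define H where "H = const c2 * (h * h) + const c1 * h + Fr f 1 / tw ?x e"
  have Hin: "H \<in> local_ring ?x" unfolding H_def
    by (intro local_ring_add local_ring_mult const_in h section_local assms)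
  have H: "kres y' H = to_ac c2 * (kres y' h)\<^sup>2 + to_ac c1 * kres y' h + evs e y' (pac f)"
    if "pt_below y' = ?x" for y'
    unfolding H_def evs_pac using h section_local[OF assms(2), of ?x] that
    by (simp add: kres_add kres_mult local_ring_add local_ring_mult const_in power2_eq_square)
  have "kres (pick ?x) H = 0 \<longleftrightarrow> kres y H = 0"
    using kres_transfer[OF Hin, of y "pick ?x"] kres_transfer[OF Hin, of "pick ?x" y] by auto
  thus ?thesis using H[of y] H[of "pick ?x"] Some hrep[OF z] by (simp add: qcond_def gcode_def h_def)
qed (simp add: qcond_def gcode_def)

lemma evs_expansion:
  assumes "f \<in> polys_upto e" "e \<ge> 0"
  shows "evs e y f = (\<Sum>i\<le>nat e. Polynomial.coeff f i * evs e y (Polynomial.monom 1 i))"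
proof -
  have m: "Polynomial.monom 1 i \<in> polys_upto e" if "i \<le> nat e" for i
    using that assms(2) by (auto simp: polys_upto_def degree_monom_eq)
  show ?thesis
  proof (cases y rule: geom_pt_cases)
    case 1
    have "(\<Sum>i\<le>nat e. Polynomial.coeff f i * evs e y (Polynomial.monom 1 i)) =
      (\<Sum>i\<le>nat e. if i = nat e then Polynomial.coeff f (nat e) else 0)"
      unfolding 1 by (intro sum.cong) (auto simp: evs_Infty m)
    thus ?thesis using 1 assms by (simp add: evs_Infty)
  next
    case (2 \<alpha>)
    have "Polynomial.degree f \<le> nat e" using assms by (auto simp: polys_upto_def)
    hence "(\<Sum>i\<le>nat e. Polynomial.coeff f i * \<alpha> ^ i) = poly f \<alpha>"
      unfolding poly_altdef by (intro sum.mono_neutral_right) (auto intro: coeff_eq_0)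
    thus ?thesis using 2 by (simp add: poly_monom)
  qed
qed

text \<open>For fixed codes the conditions \<open>qcond\<close> are homogeneous linear in
  \<open>c2\<close>, \<open>c1\<close> and the coefficients of \<open>f\<close>, and Frobenius
  permutes these linear equations over the geometric points of D. A non-zero solution over the
  closure therefore yields one over the ground field.\<close>

lemma brick_descent:
  fixes u :: "'k :: {field, finite} closed_pt \<Rightarrow> 'k alg_closure option"
  assumes e: "e \<ge> 0" and u: "\<And>x. x \<in> D \<Longrightarrow> u x \<in> codes x"
    and c: "e > 0 \<longrightarrow> c2 = 0" "f \<in> polys_upto e" "\<not> (c2 = 0 \<and> c1 = 0 \<and> f = 0)"
    and q: "\<And>y. pt_below y \<in> D \<Longrightarrow> qcond e y (gcode y (u (pt_below y))) c2 c1 f"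
  shows "\<not> brick e D u"
proof -
  \<comment> \<open>Numbering of the unknowns: 0 is \<open>c2\<close>, left out when
    \<open>e > 0\<close>, 1 is \<open>c1\<close>, and i + 2 is the coefficient of t^i in
    \<open>f\<close>.\<close>
  define J where "J = (if e > 0 then {} else {0 :: nat}) \<union> {1} \<union> (\<lambda>i. i + 2) ` {..nat e}"
  define Y where "Y = {y :: 'k alg_closure closed_pt. pt_below y \<in> D}"
  \<comment> \<open>At the code \<open>None\<close> the equation is just \<open>c2 = 0\<close>, so
    the only non-zero coefficient is the one with index 0; for \<open>e > 0\<close> the equation is
    empty.\<close>
  define m where "m = (\<lambda>j y. case gcode y (u (pt_below y)) of None \<Rightarrow> if j = 0 then 1 else 0
    | Some z \<Rightarrow> if j = 0 then z\<^sup>2 else if j = 1 then z else evs e y (Polynomial.monom 1 (j - 2)))"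
  have finJ: "finite J" by (simp add: J_def)
  have sumJ: "(\<Sum>j\<in>J. h j) = (if e > 0 then 0 else h 0) + h 1 + (\<Sum>i\<le>nat e. h (i + 2))"
    for h :: "nat \<Rightarrow> 'k alg_closure"
  proof -
    have "(\<Sum>j\<in>(\<lambda>i. i + 2) ` {..nat e}. h j) = (\<Sum>i\<le>nat e. h (i + 2))"
      by (subst sum.reindex) (auto simp: inj_on_def)
    moreover have "(\<Sum>j\<in>J. h j) = (\<Sum>j\<in>(if e > 0 then {} else {0 :: nat}). h j) + h 1
        + (\<Sum>j\<in>(\<lambda>i. i + 2) ` {..nat e}. h j)"
      unfolding J_def by (subst sum.union_disjoint; (subst sum.union_disjoint)?) auto
    ultimately show ?thesis by simp
  qed
  define cf where "cf = (\<lambda>(c2 :: 'k alg_closure) c1 f j. if j = 0 then c2 else if j = 1 then c1 else Polynomial.coeff f (j - 2))"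
  have qsum: "qcond e y (gcode y (u (pt_below y))) c2 c1 f \<longleftrightarrow> (\<Sum>j\<in>J. cf c2 c1 f j * m j y) = 0"
    if "e > 0 \<longrightarrow> c2 = 0" "f \<in> polys_upto e" for c2 c1 f y
    using that evs_expansion[OF that(2) e, of y]
    by (cases "gcode y (u (pt_below y))") (auto simp: sumJ qcond_def cf_def m_def)
  have "\<exists>C' :: nat \<Rightarrow> 'k. (\<exists>j\<in>J. C' j \<noteq> 0) \<and> (\<forall>y\<in>Y. (\<Sum>j\<in>J. to_ac (C' j) * m j y) = 0)"
  proof (rule frob_descent[OF finJ])
    show "\<forall>y\<in>Y. (\<Sum>j\<in>J. cf c2 c1 f j * m j y) = 0"
      using q qsum[OF c(1,2)] by (auto simp: Y_def)
    show "\<exists>j\<in>J. cf c2 c1 f j \<noteq> 0"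
    proof (rule ccontr)
      assume "\<not> (\<exists>j\<in>J. cf c2 c1 f j \<noteq> 0)"
      hence z: "cf c2 c1 f j = 0" if "j \<in> J" for j using that by blast
      have "c2 = 0" using z[of 0] c(1) by (auto simp: J_def cf_def split: if_splits)
      moreover have "c1 = 0" using z[of 1] by (auto simp: J_def cf_def)
      moreover have "f = 0"
      proof (rule poly_eqI)
        fix i show "Polynomial.coeff f i = Polynomial.coeff 0 i"
        proof (cases "i \<le> nat e")
          case True
          thus ?thesis using z[of "i + 2"] by (auto simp: J_def cf_def)
        next
          case False
          thus ?thesis using c(2) e by (auto simp: polys_upto_def intro!: coeff_eq_0)
        qed
      qed
      ultimately show False using c(3) by blast
    qed
    fix y assume y: "y \<in> Y"
    then obtain y' where y': "pt_below y' = pt_below y" "y = frob_pt y'"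
      using frob_pt_surj[of y "pt_below y"] by metis
    let ?x = "pt_below y"
    have "m j y = frob (m j y')" if "j \<in> J" for j
    proof (cases "u ?x")
      case None
      thus ?thesis using y' by (simp add: m_def gcode_def)
    next
      case (Some z)
      have "Some z \<in> codes ?x" using u[of ?x] y Some by (simp add: Y_def)
      hence z: "z \<in> resf ?x" by (auto simp: codes_def)
      have 1: "kres y (hrep ?x z) = frob (kres y' (hrep ?x z))"
        using kres_frob_pt[of "hrep ?x z" y'] hrep[OF z] y' by simp
      have 2: "evs e y (Polynomial.monom 1 i) = frob (evs e y' (Polynomial.monom 1 i))" if "i \<le> nat e" for i
      proof -
        let ?f = "Polynomial.monom 1 i :: 'k poly"
        have "?f \<in> polys_upto e" using that e by (auto simp: polys_upto_def degree_monom_eq)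
        hence "kres (frob_pt y') (Fr ?f 1 / tw ?x e) = frob (kres y' (Fr ?f 1 / tw ?x e))"
          by (intro kres_frob_pt) (simp add: y'(1) section_local)
        hence "evs e y (pac ?f) = frob (evs e y' (pac ?f))"
          unfolding evs_pac y'(1) by (simp only: y'(2)[symmetric])
        thus ?thesis by (simp add: map_poly_monom)
      qed
      have "j = 0 \<or> j = 1 \<or> (j \<noteq> 0 \<and> j \<noteq> 1 \<and> j - 2 \<le> nat e)" using that by (auto simp: J_def split: if_splits)
      thus ?thesis using Some y' 1 2[of "j - 2"] by (auto simp: m_def gcode_def frob_power)
    qed
    moreover have "y' \<in> Y" using y y'(1) by (simp add: Y_def)
    ultimately show "\<exists>y'\<in>Y. \<forall>j\<in>J. m j y = frob (m j y')" by blast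
  qed
  then obtain C' :: "nat \<Rightarrow> 'k" where C': "\<exists>j\<in>J. C' j \<noteq> 0" "\<forall>y\<in>Y. (\<Sum>j\<in>J. to_ac (C' j) * m j y) = 0"
    by blast
  \<comment> \<open>For \<open>e > 0\<close> the index 0 lies outside \<open>J\<close> and
    \<open>C' 0\<close> is arbitrary, hence the default 0.\<close>
  define c2' where "c2' = (if e > 0 then 0 else C' 0)"
  define f' where "f' = (\<Sum>i\<le>nat e. Polynomial.monom (C' (i + 2)) i)"
  have cf': "Polynomial.coeff f' i = (if i \<le> nat e then C' (i + 2) else 0)" for i
    by (simp add: f'_def coeff_sum)
  have f': "f' \<in> polys_upto e" using e by (simp add: polys_upto_alt polys_below_def cf' nat_add_distrib)
  have "cf (to_ac c2') (to_ac (C' 1)) (pac f') j = to_ac (C' j)" if "j \<in> J" for j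
    using that by (auto simp: J_def cf_def c2'_def cf' coeff_map_poly split: if_splits)
  hence sol: "qcond e y (gcode y (u (pt_below y))) (to_ac c2') (to_ac (C' 1)) (pac f')" if "y \<in> Y" for y
    using qsum[of "to_ac c2'" "pac f'" y "to_ac (C' 1)"] C'(2) that f'
    by (simp add: c2'_def pac_polys_upto)
  have "qcond e (pick x) (u x) (to_ac c2') (to_ac (C' 1)) (pac f')" if "x \<in> D" for x
    using sol[of "pick x"] that gcode_pick[OF u[OF that]] by (simp add: Y_def)
  moreover have "\<not> (c2' = 0 \<and> C' 1 = 0 \<and> f' = 0)"
  proof
    assume 0: "c2' = 0 \<and> C' 1 = 0 \<and> f' = 0"
    obtain j where j: "j \<in> J" "C' j \<noteq> 0" using C'(1) by blast
    moreover have "C' (i + 2) = 0" if "i \<le> nat e" for i using cf'[of i] 0 that by simp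
    ultimately show False using 0 by (auto simp: J_def c2'_def split: if_splits)
  qed
  moreover have "e > 0 \<longrightarrow> c2' = 0" by (simp add: c2'_def)
  ultimately show ?thesis unfolding brick_def using f' by blast
qed

section \<open>Indecomposable flags\<close>

text \<open>The matrix that an endomorphism induces on the fibre at \<open>y\<close>, in the
  coordinates given by the generators of the two summands; off the diagonal the twists O(a - b) and
  O(b - a) enter.\<close>

lemma std_hom_resid:
  assumes A: "mat2 p f g s \<in> bundle_hom 2 (std a b) 2 (std a b)"
    and w: "u / tw y a \<in> local_ring y" "v / tw y b \<in> local_ring y"
  shows "(p * u + f * v) / tw y a \<in> local_ring y" "(g * u + s * v) / tw y b \<in> local_ring y"
    and "resid y ((p * u + f * v) / tw y a) =
      resid y p * resid y (u / tw y a) + resid y (f / tw y (a - b)) * resid y (v / tw y b)"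
    and "resid y ((g * u + s * v) / tw y b) =
      resid y (g / tw y (b - a)) * resid y (u / tw y a) + resid y s * resid y (v / tw y b)"
proof -
  from A have "p \<in> sections (a - a)" "f \<in> sections (a - b)" "g \<in> sections (b - a)" "s \<in> sections (b - b)"
    unfolding std_hom_iff by blast+
  hence sec: "p / tw y (a - a) \<in> local_ring y" "f / tw y (a - b) \<in> local_ring y"
     "g / tw y (b - a) \<in> local_ring y" "s / tw y (b - b) \<in> local_ring y"
    unfolding sections_def by blast+
  hence sec: "p \<in> local_ring y" "f / tw y (a - b) \<in> local_ring y" "g / tw y (b - a) \<in> local_ring y" "s \<in> local_ring y"
    by simp_all
  have 1: "(p * u + f * v) / tw y a = p * (u / tw y a) + (f / tw y (a - b)) * (v / tw y b)"
    and 2: "(g * u + s * v) / tw y b = (g / tw y (b - a)) * (u / tw y a) + s * (v / tw y b)"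
    by (auto simp: tw_diff add_divide_distrib)
  show "(p * u + f * v) / tw y a \<in> local_ring y" "(g * u + s * v) / tw y b \<in> local_ring y"
    unfolding 1 2 by (intro local_ring_add local_ring_mult sec w)+
  show "resid y ((p * u + f * v) / tw y a) =
      resid y p * resid y (u / tw y a) + resid y (f / tw y (a - b)) * resid y (v / tw y b)"
    unfolding 1 resid_add[OF local_ring_mult[OF sec(1) w(1)] local_ring_mult[OF sec(2) w(2)]]
      resid_mult[OF sec(1) w(1)] resid_mult[OF sec(2) w(2)] ..
  show "resid y ((g * u + s * v) / tw y b) =
      resid y (g / tw y (b - a)) * resid y (u / tw y a) + resid y s * resid y (v / tw y b)"
    unfolding 2 resid_add[OF local_ring_mult[OF sec(3) w(1)] local_ring_mult[OF sec(4) w(2)]]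
      resid_mult[OF sec(3) w(1)] resid_mult[OF sec(4) w(2)] ..
qed

lemma gfil_membership:
  assumes "u / tw y a \<in> local_ring y" "v / tw y b \<in> local_ring y"
  shows "fibre_class 2 (std a b) y (vec2 u v) \<in> gfil a b c y j \<longleftrightarrow>
    j = 0 \<or> (j = 1 \<and> on_line (c y) (resid y (u / tw y a)) (resid y (v / tw y b))) \<or>
    (j \<ge> 2 \<and> resid y (u / tw y a) = 0 \<and> resid y (v / tw y b) = 0)"
proof -
  have "vec2 u v \<in> std a b y" using assms by (simp add: std_iff)
  moreover have "fibre_class 2 (std a b) y (vec2 u v) = fibre_class 2 (std a b) y (0\<^sub>v 2) \<longleftrightarrow>
     resid y (u / tw y a) = 0 \<and> resid y (v / tw y b) = 0"
    unfolding vec2_arith fibre_class_std_eq_iff using assms by (simp add: resid_eq_0_iff)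
  ultimately show ?thesis
    using fibre_class_in_gline_iff[OF assms, of "c y"] by (auto simp: gfil_def fibre_def)
qed

section \<open>Explicit splittings of flags into line bundles\<close>

lemma fibre_subspace_fibre: "stalks_ok n L \<Longrightarrow> fibre_subspace n L x (fibre n L x)"
  unfolding fibre_subspace_def fibre_def
  by (auto intro!: imageI local_submodule_zero[OF stalks_okD] local_submodule_add[OF stalks_okD]
      local_submodule_smult[OF stalks_okD])

lemma fibre_class_eq_zero_iff:
  assumes "stalks_ok n L" "v \<in> L x"
  shows "fibre_class n L x v = fibre_class n L x (0\<^sub>v n) \<longleftrightarrow> v \<in> mlat n L x"
proof -
  have "v \<in> carrier_vec n" using assms stalks_ok_dim by blast
  moreover from this have "v - 0\<^sub>v n = v" by simp
  ultimately show ?thesis by (subst fibre_class_eq_iff[OF assms(1)]) auto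
qed

lemma fibre_subspace_zero:
  assumes ok: "stalks_ok n L" shows "fibre_subspace n L x {fibre_class n L x (0\<^sub>v n)}"
  unfolding fibre_subspace_def
proof (intro conjI ballI impI)
  show "{fibre_class n L x (0\<^sub>v n)} \<subseteq> fibre n L x"
    using local_submodule_zero[OF stalks_okD[OF ok]] by (auto simp: fibre_def)
next
  fix v w assume "v \<in> L x" "w \<in> L x" "fibre_class n L x v \<in> {fibre_class n L x (0\<^sub>v n)}"
    "fibre_class n L x w \<in> {fibre_class n L x (0\<^sub>v n)}"
  thus "fibre_class n L x (v + w) \<in> {fibre_class n L x (0\<^sub>v n)}"
    using local_submodule_add[OF stalks_okD[OF ok]] local_submodule_add[OF mlat_submodule[OF ok]]
    by (simp add: fibre_class_eq_zero_iff[OF ok])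
next
  fix c v assume "c \<in> local_ring x" "v \<in> L x" "fibre_class n L x v \<in> {fibre_class n L x (0\<^sub>v n)}"
  thus "fibre_class n L x (c \<cdot>\<^sub>v v) \<in> {fibre_class n L x (0\<^sub>v n)}"
    using local_submodule_smult[OF stalks_okD[OF ok]] local_submodule_smult[OF mlat_submodule[OF ok]]
    by (simp add: fibre_class_eq_zero_iff[OF ok])
qed auto

text \<open>The filtration that a flag induces on a summand: at the points marked by
  \<open>P\<close> the summand is the line of the flag and survives to index 1, elsewhere it drops
  to zero there.\<close>

definition step_fil :: "int \<Rightarrow> ('c :: field closed_pt \<Rightarrow> bool) \<Rightarrow> 'c filtrations" where
  "step_fil a P = (\<lambda>y j. if j = 0 \<or> (j = 1 \<and> P y) then fibre 1 (split_bundle 1 (\<lambda>_. a)) y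
     else {fibre_class 1 (split_bundle 1 (\<lambda>_. a)) y (0\<^sub>v 1)})"

lemma parabolic_bundle_step: "parabolic_bundle D 1 (split_bundle 1 (\<lambda>_. a)) (step_fil a P)"
proof -
  let ?L = "split_bundle 1 (\<lambda>_. a) :: 'a stalks"
  have "{fibre_class 1 ?L x (0\<^sub>v 1)} \<subseteq> fibre 1 ?L x" for x
    using fibre_subspace_zero[OF split_bundle_ok, of 1 "\<lambda>_. a" x]
    unfolding fibre_subspace_def by (rule conjunct1)
  moreover have "fibre_subspace 1 ?L x (step_fil a P x j)" for x j
    by (auto simp: step_fil_def intro: fibre_subspace_zero fibre_subspace_fibre split_bundle_ok)
  ultimately show ?thesis
    unfolding parabolic_bundle_def
    by (intro conjI vector_bundle_split ballI allI exI[of _ 2]) (auto simp: step_fil_def)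
qed

lemma fibre_class_line_bundle_zero:
  assumes "v \<in> split_bundle 1 (\<lambda>_. a) y"
  shows "fibre_class 1 (split_bundle 1 (\<lambda>_. a)) y v = fibre_class 1 (split_bundle 1 (\<lambda>_. a)) y (0\<^sub>v 1) \<longleftrightarrow>
    v $ 0 / tw y a \<in> max_ideal y"
proof -
  have "v \<in> carrier_vec 1" using assms by (simp add: split_bundle_def)
  thus ?thesis by (subst fibre_class_eq_zero_iff[OF split_bundle_ok assms]) (simp add: mlat_split)
qed

lemma step_fil_membership:
  assumes "v \<in> split_bundle 1 (\<lambda>_. a) y"
  shows "fibre_class 1 (split_bundle 1 (\<lambda>_. a)) y v \<in> step_fil a P y j \<longleftrightarrow>
    j = 0 \<or> (j = 1 \<and> P y) \<or> v $ 0 / tw y a \<in> max_ideal y"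
  using assms fibre_class_line_bundle_zero[OF assms] by (auto simp: step_fil_def fibre_def)

text \<open>The codes \<open>None\<close> and \<open>Some 0\<close> are the two coordinate axes, so
  a flag with no other codes is the direct sum of a step filtration on O(a) and the complementary
  one on O(b).\<close>

lemma sum_fil_membership:
  fixes c :: "'c :: alg_closed_field closed_pt \<Rightarrow> 'c option"
  assumes w: "u / tw y a \<in> local_ring y" "v / tw y b \<in> local_ring y" and c: "c y = None \<or> c y = Some 0"
  shows "fibre_class 2 (std a b) y (vec2 u v) \<in>
      filtrations_sum 1 (split_bundle 1 (\<lambda>_. a)) (step_fil a (\<lambda>y. c y = None))
        1 (split_bundle 1 (\<lambda>_. b)) (step_fil b (\<lambda>y. c y \<noteq> None)) y j \<longleftrightarrow>
    fibre_class 2 (std a b) y (vec2 u v) \<in> gfil a b c y j" (is "?l \<longleftrightarrow> ?r")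
proof -
  let ?L1 = "split_bundle 1 (\<lambda>_. a) :: 'c stalks" and ?L2 = "split_bundle 1 (\<lambda>_. b) :: 'c stalks"
  let ?F1 = "step_fil a (\<lambda>y. c y = None)" and ?F2 = "step_fil b (\<lambda>y. c y \<noteq> None)"
  have FS: "filtrations_sum 1 ?L1 ?F1 1 ?L2 ?F2 y j = {fibre_class 2 (std a b) y (v @\<^sub>v v') | v v'.
        v \<in> ?L1 y \<and> v' \<in> ?L2 y \<and> fibre_class 1 ?L1 y v \<in> ?F1 y j \<and> fibre_class 1 ?L2 y v' \<in> ?F2 y j}"
    unfolding filtrations_sum_def bundle_sum_std one_add_one ..
  have app: "v @\<^sub>v w = vec2 (v $ 0) (w $ 0)" if "v \<in> carrier_vec 1" "w \<in> carrier_vec 1" for v w :: "'c ratfun vec"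
    using that by (intro eq_vecI) (auto simp: less_2_iff)
  have char: "?r \<longleftrightarrow> (j = 0 \<or> (j = 1 \<and> c y = None) \<or> u / tw y a \<in> max_ideal y) \<and>
     (j = 0 \<or> (j = 1 \<and> c y \<noteq> None) \<or> v / tw y b \<in> max_ideal y)"
    unfolding gfil_membership[OF w] using c w by (auto simp: resid_eq_0_iff)
  show ?thesis
  proof
    assume ?l
    then obtain v1 v2 where v: "fibre_class 2 (std a b) y (vec2 u v) = fibre_class 2 (std a b) y (v1 @\<^sub>v v2)"
      "v1 \<in> ?L1 y" "v2 \<in> ?L2 y" "fibre_class 1 ?L1 y v1 \<in> ?F1 y j" "fibre_class 1 ?L2 y v2 \<in> ?F2 y j"
      unfolding FS by blast
    have "v1 \<in> carrier_vec 1" "v2 \<in> carrier_vec 1" using v by (auto simp: split_bundle_def)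
    hence d: "u / tw y a - v1 $ 0 / tw y a \<in> max_ideal y" "v / tw y b - v2 $ 0 / tw y b \<in> max_ideal y"
      using v(1) unfolding app[OF \<open>v1 \<in> carrier_vec 1\<close> \<open>v2 \<in> carrier_vec 1\<close>] fibre_class_std_eq_iff by blast+
    have "u / tw y a \<in> max_ideal y" if "v1 $ 0 / tw y a \<in> max_ideal y"
      using max_ideal_add[OF d(1) that] by simp
    moreover have "v / tw y b \<in> max_ideal y" if "v2 $ 0 / tw y b \<in> max_ideal y"
      using max_ideal_add[OF d(2) that] by simp
    ultimately show ?r unfolding char
      using v(4,5) unfolding step_fil_membership[OF v(2)] step_fil_membership[OF v(3)] by auto
  next
    assume r: ?r
    let ?v1 = "vec 1 (\<lambda>_. u)" and ?v2 = "vec 1 (\<lambda>_. v)"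
    have in1: "?v1 \<in> ?L1 y" and in2: "?v2 \<in> ?L2 y" using w by (auto simp: split_bundle_def)
    have "fibre_class 1 ?L1 y ?v1 \<in> ?F1 y j" "fibre_class 1 ?L2 y ?v2 \<in> ?F2 y j"
      using r unfolding char step_fil_membership[OF in1] step_fil_membership[OF in2] by auto
    moreover have "vec2 u v = ?v1 @\<^sub>v ?v2" by (subst app) auto
    ultimately show ?l unfolding FS using in1 in2 by auto
  qed
qed

text \<open>An automorphism that moves every line of the flag to one of the two axes transports the
  splitting of \<open>sum_fil_membership\<close> back.\<close>

lemma split_flag_decomposable:
  fixes c c' :: "'c :: alg_closed_field closed_pt \<Rightarrow> 'c option"
  assumes F: "\<And>y j. y \<in> D \<Longrightarrow> F y j = gfil a b c y j"
    and hom: "mat2 p f g s \<in> bundle_hom 2 (std a b) 2 (std a b)" "mat2 p' f' g' s' \<in> bundle_hom 2 (std a b) 2 (std a b)"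
    and inv: "mat2 p f g s * mat2 p' f' g' s' = 1\<^sub>m 2" "mat2 p' f' g' s' * mat2 p f g s = 1\<^sub>m 2"
    and c': "\<And>y. y \<in> D \<Longrightarrow> c' y = None \<or> c' y = Some 0"
    and line: "\<And>y r0 r1. y \<in> D \<Longrightarrow> on_line (c y) r0 r1 \<longleftrightarrow>
      on_line (c' y) (resid y p * r0 + resid y (f / tw y (a - b)) * r1)
        (resid y (g / tw y (b - a)) * r0 + resid y s * r1)"
  shows "\<not> parabolic_indecomposable D 2 (std a b) F"
proof -
  let ?L1 = "split_bundle 1 (\<lambda>_. a) :: 'c stalks" and ?L2 = "split_bundle 1 (\<lambda>_. b) :: 'c stalks"
  let ?F1 = "step_fil a (\<lambda>y. c' y = None)" and ?F2 = "step_fil b (\<lambda>y. c' y \<noteq> None)"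
  let ?FS = "filtrations_sum 1 ?L1 ?F1 1 ?L2 ?F2"
  have FS: "fibre_class 2 (std a b) y (vec2 u v) \<in> ?FS y j \<longleftrightarrow>
     fibre_class 2 (std a b) y (vec2 u v) \<in> gfil a b c' y j"
    if "y \<in> D" "u / tw y a \<in> local_ring y" "v / tw y b \<in> local_ring y" for y j u v
    using sum_fil_membership[where c = c', OF that(2,3) c'[OF that(1)]] .
  have A: "mat2 p f g s \<in> parabolic_hom D 2 (std a b) F 2 (std a b) ?FS"
    unfolding parabolic_hom_def
  proof (safe intro!: hom)
    fix y j w assume y: "y \<in> D" and w: "w \<in> std a b y" "fibre_class 2 (std a b) y w \<in> F y j"
    from w(1) obtain u v where uv: "w = vec2 u v" "u / tw y a \<in> local_ring y" "v / tw y b \<in> local_ring y"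
      by (rule std_cases)
    note r = std_hom_resid[OF hom(1) uv(2,3)]
    have "fibre_class 2 (std a b) y (vec2 (p * u + f * v) (g * u + s * v)) \<in> gfil a b c' y j"
      using w(2) line[OF y] unfolding F[OF y] uv(1) gfil_membership[OF uv(2,3)] gfil_membership[OF r(1,2)] r(3,4)
      by auto
    thus "fibre_class 2 (std a b) y (mat2 p f g s *\<^sub>v w) \<in> ?FS y j"
      unfolding uv(1) mat2_mult_vec2 FS[OF y r(1,2)] .
  qed
  have B: "mat2 p' f' g' s' \<in> parabolic_hom D 2 (std a b) ?FS 2 (std a b) F"
    unfolding parabolic_hom_def
  proof (safe intro!: hom)
    fix y j w assume y: "y \<in> D" and w: "w \<in> std a b y" "fibre_class 2 (std a b) y w \<in> ?FS y j"
    from w(1) obtain u v where uv: "w = vec2 u v" "u / tw y a \<in> local_ring y" "v / tw y b \<in> local_ring y"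
      by (rule std_cases)
    define u' v' where uv': "u' = p' * u + f' * v" "v' = g' * u + s' * v"
    note r = std_hom_resid[OF hom(2) uv(2,3), folded uv']
    \<comment> \<open>The hypothesis \<open>line\<close> speaks only of the first matrix; as that
      matrix sends the image under its inverse back to \<open>vec2 u v\<close>, it settles the
      inverse too.\<close>
    have "mat2 p f g s *\<^sub>v (mat2 p' f' g' s' *\<^sub>v vec2 u v) = vec2 u v"
      using inv(1) by (subst assoc_mult_mat_vec[symmetric, of _ 2 2 _ 2]) auto
    hence bk: "u = p * u' + f * v'" "v = g * u' + s * v'"
      by (simp_all add: mat2_mult_vec2 uv')
    note r' = std_hom_resid[OF hom(1) r(1,2), folded bk]
    have "on_line (c y) (resid y (u' / tw y a)) (resid y (v' / tw y b)) \<longleftrightarrow>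
        on_line (c' y) (resid y (u / tw y a)) (resid y (v / tw y b))"
      unfolding line[OF y] r'(3,4) ..
    moreover have "resid y (u' / tw y a) = 0 \<and> resid y (v' / tw y b) = 0"
      if "resid y (u / tw y a) = 0" "resid y (v / tw y b) = 0"
      using that unfolding r(3,4) by simp
    ultimately have "fibre_class 2 (std a b) y (vec2 u' v') \<in> gfil a b c y j"
      using w(2) unfolding uv(1) FS[OF y uv(2,3)] gfil_membership[OF uv(2,3)] gfil_membership[OF r(1,2)]
      by blast
    thus "fibre_class 2 (std a b) y (mat2 p' f' g' s' *\<^sub>v w) \<in> F y j"
      unfolding uv(1) mat2_mult_vec2 F[OF y] uv' .
  qed
  have "parabolic_isomorphic D 2 (std a b) F (1 + 1) (bundle_sum ?L1 ?L2) ?FS"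
    unfolding bundle_sum_std one_add_one parabolic_isomorphic_def using A B inv by blast
  thus ?thesis unfolding parabolic_indecomposable_def
    using parabolic_bundle_step by (metis one_neq_zero)
qed

lemma zero_in_sections: "0 \<in> sections n"
  by (simp add: sections_def local_ring_0)

lemma const_in_sections: "const c \<in> sections 0"
  by (simp add: sections_def const_in)

lemma one_in_sections: "1 \<in> sections 0"
  by (simp add: sections_def local_ring_1)

lemma poly_in_sections: "Fr f 1 \<in> sections n \<longleftrightarrow> f \<in> polys_upto n"
proof
  assume "Fr f 1 \<in> sections n"
  then obtain g where g: "g \<in> polys_upto n" "Fr f 1 = Fr g 1" unfolding sections_iff by blast
  thus "f \<in> polys_upto n" by (simp add: eq_fract)
qed (auto simp: sections_iff)

lemma sections_0E:
  assumes "h \<in> sections 0" obtains c where "h = const c"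
proof -
  obtain f where f: "f \<in> polys_upto 0" "h = Fr f 1" using assms unfolding sections_iff by blast
  hence "Polynomial.degree f = 0" by (auto simp: polys_upto_def)
  then obtain c where "f = [:c:]" by (rule degree_eq_zeroE)
  thus ?thesis using that f by (simp add: const_def)
qed

lemma sections_neg: "n < 0 \<Longrightarrow> h \<in> sections n \<Longrightarrow> h = 0"
  by (auto simp: sections_iff polys_upto_def)

lemma sections_nonpos_E:
  assumes "n \<le> 0" "h \<in> sections n" obtains c where "h = const c" "n < 0 \<longrightarrow> c = 0"
proof (cases "n = 0")
  case True
  thus ?thesis using assms that by (auto elim: sections_0E)
next
  case False
  thus ?thesis using assms that[of 0] sections_neg[of n h] by simp
qed

text \<open>The second root is recorded as a rational expression in the first, so that over the
  ground field both roots are rational as soon as one is.\<close>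

lemma quadratic_factorization:
  fixes A B C :: "'c :: alg_closed_field"
  assumes A: "A \<noteq> 0"
  obtains z1 z2 where "\<And>z. A * z\<^sup>2 + B * z + C = A * ((z - z1) * (z - z2))" "z2 = - B / A - z1"
proof -
  obtain z1 where z1: "poly [:C, B, A:] z1 = 0"
    using alg_closed_imp_poly_has_root[of "[:C, B, A:]"] A by auto
  define z2 where "z2 = - B / A - z1"
  have "A * z\<^sup>2 + B * z + C = A * ((z - z1) * (z - z2))" for z
  proof -
    have 1: "A * z2 = - B - A * z1" using A by (simp add: z2_def right_diff_distrib)
    have 2: "C = - (B * z1 + A * z1\<^sup>2)"
      using z1 by (simp add: power2_eq_square algebra_simps eq_neg_iff_add_eq_0)
    have "A * ((z - z1) * (z - z2)) = (z - z1) * (A * z - A * z2)" by (simp add: algebra_simps)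
    also have "\<dots> = A * z\<^sup>2 + B * z - (B * z1 + A * z1\<^sup>2)"
      unfolding 1 by (simp add: algebra_simps power2_eq_square)
    finally show ?thesis unfolding 2 by simp
  qed
  thus ?thesis using that z2_def by blast
qed

text \<open>The shear by -f moves the lines on the graph of f to the axis of O(b) and fixes the axis
  of O(a).\<close>

lemma affine_flag_decomposable:
  fixes c :: "'c :: alg_closed_field closed_pt \<Rightarrow> 'c option"
  assumes F: "\<And>y j. y \<in> D \<Longrightarrow> F y j = gfil a b c y j" and f: "f \<in> polys_upto (a - b)"
    and c: "\<And>y. y \<in> D \<Longrightarrow> c y = None \<or> c y = Some (evs (a - b) y f)"
  shows "\<not> parabolic_indecomposable D 2 (std a b) F"
proof (rule split_flag_decomposable[where c = c and c' = "\<lambda>y. if c y = None then None else Some 0"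
      and p = 1 and f = "Fr (- f) 1" and g = 0 and s = 1 and p' = 1 and f' = "Fr f 1" and g' = 0 and s' = 1])
  have "- f \<in> polys_upto (a - b)" using f by (rule polys_upto_uminus)
  thus "mat2 1 (Fr (- f) 1) 0 1 \<in> bundle_hom 2 (std a b) 2 (std a b)"
    "mat2 1 (Fr f 1) 0 1 \<in> bundle_hom 2 (std a b) 2 (std a b)"
    using f by (auto simp: std_hom_iff one_in_sections zero_in_sections poly_in_sections)
  have m: "Fr (- f) 1 = - Fr f 1" by simp
  show "mat2 1 (Fr (- f) 1) 0 1 * mat2 1 (Fr f 1) 0 1 = 1\<^sub>m 2"
    "mat2 1 (Fr f 1) 0 1 * mat2 1 (Fr (- f) 1) 0 1 = 1\<^sub>m 2"
    unfolding m mat2_mult one_mat2 by simp_all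
  fix y r0 r1 assume y: "y \<in> D"
  have "resid y (Fr (- f) 1 / tw y (a - b)) = - evs (a - b) y f"
    using evs_uminus[OF f, of y] by (simp add: evs_def)
  thus "on_line (c y) r0 r1 \<longleftrightarrow> on_line (if c y = None then None else Some 0)
      (resid y 1 * r0 + resid y (Fr (- f) 1 / tw y (a - b)) * r1)
      (resid y (0 / tw y (b - a)) * r0 + resid y 1 * r1)"
    using c[OF y] by auto
qed (use F in auto)

text \<open>The map z to (z - z1) / (z - z2) sends the two points to 0 and infinity; its matrix has
  determinant z1 - z2, the denominator \<open>t\<close> in the entries of the inverse.\<close>

lemma two_point_flag_decomposable:
  fixes c :: "'c :: alg_closed_field closed_pt \<Rightarrow> 'c option"
  assumes F: "\<And>y j. y \<in> D \<Longrightarrow> F y j = gfil a a c y j" and ne: "z1 \<noteq> z2"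
    and c: "\<And>y. y \<in> D \<Longrightarrow> c y = Some z1 \<or> c y = Some z2"
  shows "\<not> parabolic_indecomposable D 2 (std a a) F"
proof -
  define t where "t = z1 - z2"
  have t: "t \<noteq> 0" using ne by (simp add: t_def)
  have 1: "z1 / t - z2 / t = 1" using t by (simp add: t_def flip: diff_divide_distrib)
  show ?thesis
  proof (rule split_flag_decomposable[where c = c and c' = "\<lambda>y. if c y = Some z1 then Some 0 else None"
      and p = "const 1" and f = "const (- z1)" and g = "const 1" and s = "const (- z2)"
      and p' = "const (- z2 / t)" and f' = "const (z1 / t)" and g' = "const (- 1 / t)" and s' = "const (1 / t)"])
    show "mat2 (const 1) (const (- z1)) (const 1) (const (- z2)) \<in> bundle_hom 2 (std a a) 2 (std a a)"
      "mat2 (const (- z2 / t)) (const (z1 / t)) (const (- 1 / t)) (const (1 / t)) \<in> bundle_hom 2 (std a a) 2 (std a a)"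
      unfolding std_hom_iff diff_self by (intro conjI const_in_sections)+
    have one: "mat2 (const 1) (const 0) (const 0) (const 1) = 1\<^sub>m 2" by (simp add: one_mat2)
    show "mat2 (const 1) (const (- z1)) (const 1) (const (- z2)) *
        mat2 (const (- z2 / t)) (const (z1 / t)) (const (- 1 / t)) (const (1 / t)) = 1\<^sub>m 2"
      "mat2 (const (- z2 / t)) (const (z1 / t)) (const (- 1 / t)) (const (1 / t)) *
       mat2 (const 1) (const (- z1)) (const 1) (const (- z2)) = 1\<^sub>m 2"
      unfolding mat2_mult const_mult[symmetric] const_add[symmetric] one[symmetric] mat2_eq_iff const_eq_iff
      using 1 by (auto simp: mult.commute)
    fix y r0 r1 assume y: "y \<in> D"
    show "on_line (c y) r0 r1 \<longleftrightarrow> on_line (if c y = Some z1 then Some 0 else None)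
      (resid y (const 1) * r0 + resid y (const (- z1) / tw y (a - a)) * r1)
      (resid y (const 1 / tw y (a - a)) * r0 + resid y (const (- z2)) * r1)"
      using c[OF y] ne by (auto simp del: const_1)
  qed (use F in auto)
qed

text \<open>A non-scalar endomorphism splits the flag over the closure. With \<open>c2 = 0\<close>
  and \<open>c1\<close> non-zero the eigenlines are O(a) and a graph; with
  \<open>c2 = c1 = 0\<close> it is nilpotent and interpolation produces one of the former kind; with
  \<open>c2\<close> non-zero all codes are roots of one quadratic equation.\<close>

lemma not_brick_imp_not_geom_indec:
  fixes u :: "'k :: {field, finite} closed_pt \<Rightarrow> 'k alg_closure option"
  assumes fin: "finite D" and ab: "b \<le> a" and u: "\<And>x. x \<in> D \<Longrightarrow> u x \<in> codes x"
    and nb: "\<not> brick (a - b) D u"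
  shows "\<not> geom_indecomposable D 2 (std a b) (flag_filtrations (std a b) (\<lambda>x\<in>D. kline a b x (u x)))"
proof -
  define e where "e = a - b"
  have e: "e \<ge> 0" using ab by (simp add: e_def)
  define F where "F = filtrations_ac 2 (std a b) (flag_filtrations (std a b) (\<lambda>x\<in>D. kline a b x (u x)))"
  let ?D = "{y. pt_below y \<in> D}"
  define c where "c = (\<lambda>y. gcode y (u (pt_below y)))"
  have F: "F y j = gfil a b c y j" if "y \<in> ?D" for y j
    unfolding F_def c_def using filtrations_ac_flag[of "pt_below y" D y u a b j] that u by simp
  have goal: "\<not> parabolic_indecomposable ?D 2 (std a b) F \<Longrightarrow> ?thesis"
    by (simp add: geom_indecomposable_def bundle_ac_std F_def)
  have trans: "qcond e y (c y) (to_ac c2) (to_ac c1) (pac f)"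
    if "f \<in> polys_upto e" "\<forall>x\<in>D. qcond e (pick x) (u x) (to_ac c2) (to_ac c1) (pac f)" "y \<in> ?D" for c2 c1 f y
    using qcond_transfer[of "u (pt_below y)" y f e c2 c1] u that by (simp add: c_def)
  \<comment> \<open>All codes other than \<open>None\<close> lie on the graph of -f / c1, so a shear
    splits the flag.\<close>
  have linear: ?thesis
    if lin: "f \<in> polys_upto e" "c1 \<noteq> 0" "\<forall>x\<in>D. qcond e (pick x) (u x) (to_ac 0) (to_ac c1) (pac f)" for c1 f
  proof (rule goal, rule affine_flag_decomposable[where f = "Polynomial.smult (- 1 / to_ac c1) (pac f)" and c = c, OF F])
    show "Polynomial.smult (- 1 / to_ac c1) (pac f) \<in> polys_upto (a - b)"
      using lin by (intro polys_upto_smult) (simp add: pac_polys_upto e_def)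
    fix y assume y: "y \<in> ?D"
    have "evs (a - b) y (Polynomial.smult (- 1 / to_ac c1) (pac f)) = - evs e y (pac f) / to_ac c1"
      using lin(1) unfolding e_def[symmetric] by (subst evs_smult) (auto simp: pac_polys_upto)
    moreover have "z = - evs e y (pac f) / to_ac c1" if z: "c y = Some z" for z
    proof -
      have "qcond e y (c y) (to_ac 0) (to_ac c1) (pac f)" using lin(1,3) y by (rule trans)
      hence "to_ac c1 * z + evs e y (pac f) = 0" using z by (simp add: qcond_def)
      hence "z * to_ac c1 = - evs e y (pac f)" by (simp add: eq_neg_iff_add_eq_0 mult.commute)
      moreover have "to_ac c1 \<noteq> 0" using lin(2) by simp
      ultimately show ?thesis by (metis nonzero_eq_divide_eq)
    qed
    ultimately show "c y = None \<or> c y = Some (evs (a - b) y (Polynomial.smult (- 1 / to_ac c1) (pac f)))"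
      by (cases "c y") auto
  qed
  from nb obtain c2 c1 f where s: "e > 0 \<longrightarrow> c2 = 0" "f \<in> polys_upto e"
    "\<forall>x\<in>D. qcond e (pick x) (u x) (to_ac c2) (to_ac c1) (pac f)" "\<not> (c2 = 0 \<and> c1 = 0 \<and> f = 0)"
    unfolding brick_def e_def by blast
  consider "c2 = 0" "c1 \<noteq> 0" | "c2 = 0" "c1 = 0" "f \<noteq> 0" | "c2 \<noteq> 0" using s(4) by blast
  thus ?thesis
  proof cases
    case 1
    thus ?thesis using linear s(2,3) by blast
  next
    case 2
    \<comment> \<open>The nilpotent case: the non-zero section \<open>f\<close> vanishes on
      \<open>I\<close>, which bounds the degree of \<open>I\<close> by e. Any values on
      \<open>I\<close> can then be interpolated by a section \<open>g\<close>, and the lines lie on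
      its graph.\<close>
    define I where "I = {x \<in> D. u x \<noteq> None}"
    have finI: "finite I" using fin by (simp add: I_def)
    have "evs e (pick x) (pac f) = 0" if "x \<in> I" for x
      using s(3) that 2 by (auto simp: I_def qcond_def)
    hence "\<not> deg_sum I \<ge> nat e + 1" using vanishing_section_eq_0[OF finI s(2) e] 2(3) by blast
    hence ds: "deg_sum I \<le> nat e + 1" by simp
    have "the (u x) \<in> resf x" if "x \<in> I" for x
      using u[of x] that by (auto simp: I_def codes_def)
    from interpolation[OF finI e ds, of "\<lambda>x. the (u x)", OF this] obtain g where
      g: "g \<in> polys_upto e" "\<And>x. x \<in> I \<Longrightarrow> evs e (pick x) (pac g) = the (u x)" by blast
    have "qcond e (pick x) (u x) (to_ac 0) (to_ac 1) (pac (- g))" if "x \<in> D" for x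
    proof (cases "u x")
      case (Some z)
      hence "evs e (pick x) (pac (- g)) = - z"
        using g(1) g(2)[of x] that by (simp add: I_def pac_uminus evs_uminus pac_polys_upto)
      thus ?thesis using Some by (simp add: qcond_def)
    qed (simp add: qcond_def)
    thus ?thesis using linear[of "- g" 1] polys_upto_uminus[OF g(1)] by simp
  next
    case 3
    hence e0: "e = 0" using s(1) e by simp
    hence ba: "b = a" by (simp add: e_def)
    have "Polynomial.degree f = 0" using s(2) e0 by (auto simp: polys_upto_def)
    then obtain c0 where f: "f = [:c0:]" by (rule degree_eq_zeroE)
    have ev: "evs e y (pac f) = to_ac c0" for y
      unfolding f e0 using const_def[of "to_ac c0"] resid_const[of y "to_ac c0"]
      by (simp add: evs_def map_poly_pCons)
    let ?A = "to_ac c2" and ?B = "to_ac c1" and ?C = "to_ac c0"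
    have A: "?A \<noteq> 0" using 3 by simp
    obtain z1 z2 where fac: "\<And>z. ?A * z\<^sup>2 + ?B * z + ?C = ?A * ((z - z1) * (z - z2))"
      using quadratic_factorization[OF A] by metis
    have c: "c y = Some z1 \<or> c y = Some z2" if "y \<in> ?D" for y
      using trans[OF s(2,3) that] A fac by (cases "c y") (auto simp: qcond_def ev)
    show ?thesis
    \<comment> \<open>A double root makes all codes equal, so a constant section interpolates them;
      distinct roots are moved to the axes.\<close>
    proof (cases "z1 = z2")
      case True
      show ?thesis
      proof (rule goal, rule affine_flag_decomposable[where f = "[:z1:]" and c = c, OF F])
        fix y assume "y \<in> ?D"
        moreover have "evs (a - b) y [:z1:] = z1"
          using const_def[of z1] resid_const[of y z1] by (simp add: evs_def ba)
        ultimately show "c y = None \<or> c y = Some (evs (a - b) y [:z1:])" using c True by auto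
      qed (auto simp: polys_upto_def ba)
    next
      case False
      show ?thesis
        by (rule goal, unfold ba, rule two_point_flag_decomposable[where c = c, OF _ False])
           (use F c ba in auto)
    qed
  qed
qed

text \<open>The projection to a summand is idempotent and neither 0 nor 1, hence not scalar. Its
  entries solve the conditions \<open>qcond\<close> over the closure, and
  \<open>brick_descent\<close> brings a solution down to the ground field.\<close>

lemma not_geom_indec_imp_not_brick:
  fixes u :: "'k :: {field, finite} closed_pt \<Rightarrow> 'k alg_closure option"
  assumes ab: "b \<le> a" and u: "\<And>x. x \<in> D \<Longrightarrow> u x \<in> codes x"
    and ni: "\<not> geom_indecomposable D 2 (std a b) (flag_filtrations (std a b) (\<lambda>x\<in>D. kline a b x (u x)))"
  shows "\<not> brick (a - b) D u"
proof -
  define F where "F = filtrations_ac 2 (std a b) (flag_filtrations (std a b) (\<lambda>x\<in>D. kline a b x (u x)))"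
  let ?D = "{y. pt_below y \<in> D}"
  define c where "c = (\<lambda>y. gcode y (u (pt_below y)))"
  have F: "F y j = gfil a b c y j" if "y \<in> ?D" for y j
    unfolding F_def c_def using filtrations_ac_flag[of "pt_below y" D y u a b j] that u by simp
  from ni have "\<not> parabolic_indecomposable ?D 2 (std a b) F"
    by (simp add: geom_indecomposable_def bundle_ac_std F_def)
  then obtain A where A: "A \<in> parabolic_hom ?D 2 (std a b) F 2 (std a b) F" "A * A = A" "A \<noteq> 0\<^sub>m 2 2" "A \<noteq> 1\<^sub>m 2"
    using decomposable_imp_idempotent[OF split_bundle_ok, of 2 ?D _ F] by auto
  have hom: "A \<in> bundle_hom 2 (std a b) 2 (std a b)" using A(1) by (rule parabolic_hom_bundle_hom)
  then obtain p f g s where pm: "A = mat2 p f g s" using mat2_cases[OF bundle_hom_dim] by metis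
  note sec = hom[unfolded pm std_hom_iff]
  obtain p0 where p0: "p = const p0" using sec sections_0E by (metis diff_self)
  obtain s0 where s0: "s = const s0" using sec sections_0E by (metis diff_self)
  obtain g0 where g0: "g = const g0" "b - a < 0 \<longrightarrow> g0 = 0"
    using sec sections_nonpos_E[of "b - a" g] ab by auto
  obtain f0 where f0: "f0 \<in> polys_upto (a - b)" "f = Fr f0 1" using sec unfolding sections_iff by blast
  have resg: "resid y (g / tw y (b - a)) = g0" for y
    using g0 ab by (cases "b = a") auto
  have q: "qcond (a - b) y (c y) (- g0) (p0 - s0) f0" if y: "y \<in> ?D" for y
  proof -
    \<comment> \<open>Homogeneous coordinates of the line at \<open>y\<close>: the test vector (1,
      0) or (z, 1). That its image is again on the line is the quadratic condition.\<close>
    define r0 r1 where r: "r0 = (case c y of None \<Rightarrow> 1 | Some z \<Rightarrow> z)" "r1 = (case c y of None \<Rightarrow> 0 | Some z \<Rightarrow> (1 :: 'k alg_closure))"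
    define U V where UV: "U = const r0 * tw y a" "V = const r1 * tw y b"
    have w: "U / tw y a \<in> local_ring y" "V / tw y b \<in> local_ring y" by (auto simp: UV const_in)
    have wr: "resid y (U / tw y a) = r0" "resid y (V / tw y b) = r1" by (simp_all add: UV)
    note h = std_hom_resid[OF hom[unfolded pm] w]
    have "fibre_class 2 (std a b) y (vec2 U V) \<in> F y 1"
      unfolding F[OF y] gfil_membership[OF w] wr by (auto simp: r split: option.splits)
    moreover have "vec2 U V \<in> std a b y" using w by (simp add: std_iff)
    ultimately have "fibre_class 2 (std a b) y (A *\<^sub>v vec2 U V) \<in> F y 1"
      using parabolic_hom_filtration[OF A(1) y] by blast
    hence "on_line (c y) (p0 * r0 + evs (a - b) y f0 * r1) (g0 * r0 + s0 * r1)"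
      unfolding pm mat2_mult_vec2 F[OF y] gfil_membership[OF h(1,2)] h(3,4) wr resg
      by (simp add: p0 s0 f0 evs_def)
    thus ?thesis by (cases "c y") (auto simp: r qcond_def power2_eq_square algebra_simps)
  qed
  have "\<not> (- g0 = 0 \<and> p0 - s0 = 0 \<and> f0 = 0)"
  proof
    assume "- g0 = 0 \<and> p0 - s0 = 0 \<and> f0 = 0"
    hence Ac: "A = mat2 (const p0) 0 0 (const p0)" by (simp add: pm p0 s0 g0 f0)
    hence "const (p0 * p0) = const p0" using A(2) by (simp add: mat2_mult const_mult)
    hence "p0 = 0 \<or> p0 = 1" by simp
    thus False using A(3,4) by (auto simp: Ac zero_mat2 one_mat2)
  qed
  moreover have "a - b > 0 \<longrightarrow> - g0 = 0" using g0(2) by simp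
  moreover have "a - b \<ge> 0" using ab by simp
  moreover have "qcond (a - b) y (gcode y (u (pt_below y))) (- g0) (p0 - s0) f0" if "pt_below y \<in> D" for y
    using q[of y] that by (simp add: c_def)
  ultimately show ?thesis using brick_descent[OF _ u _ f0(1)] by blast
qed

lemma geom_indec_iff_brick:
  fixes u :: "'k :: {field, finite} closed_pt \<Rightarrow> 'k alg_closure option"
  assumes "finite D" "b \<le> a" "\<And>x. x \<in> D \<Longrightarrow> u x \<in> codes x"
  shows "geom_indecomposable D 2 (std a b) (flag_filtrations (std a b) (\<lambda>x\<in>D. kline a b x (u x)))
    \<longleftrightarrow> brick (a - b) D u"
  using not_brick_imp_not_geom_indec[OF assms] not_geom_indec_imp_not_brick[OF assms(2,3)] by blast

section \<open>Transport of flags along isomorphisms\<close>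

text \<open>The formula of \<open>flag_action\<close> for two different bundles; it serves both the
  group action and the transport to a split bundle.\<close>

definition flag_map ::
    "'a :: field closed_pt set \<Rightarrow> 'a stalks \<Rightarrow> 'a stalks \<Rightarrow> 'a ratfun mat \<Rightarrow>
     ('a closed_pt \<Rightarrow> 'a ratfun vec set set) \<Rightarrow> ('a closed_pt \<Rightarrow> 'a ratfun vec set set)" where
  "flag_map D L L' A E =
     (\<lambda>x\<in>D. {fibre_class 2 L' x (A *\<^sub>v v) | v. v \<in> L x \<and> fibre_class 2 L x v \<in> E x})"

lemma flag_action_alt: "flag_action D L = flag_map D L L"
  by (intro ext) (simp add: flag_action_def flag_map_def)

lemma flag_map_comp:
  assumes ok: "stalks_ok 2 L" "stalks_ok 2 L'" "stalks_ok 2 L''"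
    and A: "A \<in> bundle_hom 2 L 2 L'" and B: "B \<in> bundle_hom 2 L' 2 L''"
  shows "flag_map D L' L'' B (flag_map D L L' A E) = flag_map D L L'' (B * A) E"
proof
  fix x
  have BA: "(B * A) *\<^sub>v v = B *\<^sub>v (A *\<^sub>v v)" if "v \<in> L x" for v
    by (rule assoc_mult_mat_vec[OF bundle_hom_dim[OF B] bundle_hom_dim[OF A] stalks_ok_dim[OF ok(1) that]])
  show "flag_map D L' L'' B (flag_map D L L' A E) x = flag_map D L L'' (B * A) E x" (is "?l = ?r")
  proof (cases "x \<in> D")
    case True
    show ?thesis
    proof (intro equalityI subsetI)
      fix Z assume "Z \<in> ?l"
      then obtain w v where w: "Z = fibre_class 2 L'' x (B *\<^sub>v w)" "w \<in> L' x"
        "fibre_class 2 L' x w = fibre_class 2 L' x (A *\<^sub>v v)" "v \<in> L x" "fibre_class 2 L x v \<in> E x"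
        using True by (auto simp: flag_map_def)
      have "Z = fibre_class 2 L'' x (B *\<^sub>v (A *\<^sub>v v))"
        unfolding w(1) using w bundle_hom_stalk[OF A w(4)]
        by (intro fibre_class_hom[OF ok(2,3) bundle_hom_dim[OF B] bundle_hom_stalk[OF B] _ _ w(3)])
           (auto intro: stalks_ok_dim[OF ok(2)])
      hence "Z = fibre_class 2 L'' x ((B * A) *\<^sub>v v)" by (simp add: BA[OF w(4)])
      thus "Z \<in> ?r" using True w(4,5) by (auto simp: flag_map_def)
    next
      fix Z assume "Z \<in> ?r"
      then obtain v where v: "Z = fibre_class 2 L'' x (B *\<^sub>v (A *\<^sub>v v))" "v \<in> L x" "fibre_class 2 L x v \<in> E x"
        using True BA by (auto simp: flag_map_def)
      thus "Z \<in> ?l" using True bundle_hom_stalk[OF A v(2)] by (auto simp: flag_map_def)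
    qed
  qed (simp add: flag_map_def)
qed

lemma flag_structuresD:
  assumes "E \<in> flag_structures D L" "x \<in> D"
  obtains w where "w \<in> L x" "fibre_class 2 L x w \<noteq> fibre_class 2 L x (0\<^sub>v 2)"
    "E x = {fibre_class 2 L x (c \<cdot>\<^sub>v w) | c. c \<in> local_ring x}"
proof -
  have "fibre_line 2 L x (E x)" using assms by (auto simp: flag_structures_def)
  thus ?thesis using that unfolding fibre_line_def by blast
qed

lemma flag_map_one:
  assumes ok: "stalks_ok 2 L" and E: "E \<in> flag_structures D L"
  shows "flag_map D L L (1\<^sub>m 2) E = E"
proof
  fix x
  show "flag_map D L L (1\<^sub>m 2) E x = E x"
  proof (cases "x \<in> D")
    case True
    obtain w where w: "w \<in> L x" "fibre_class 2 L x w \<noteq> fibre_class 2 L x (0\<^sub>v 2)"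
      "E x = {fibre_class 2 L x (c \<cdot>\<^sub>v w) | c. c \<in> local_ring x}"
      by (rule flag_structuresD[OF E True])
    have one: "1\<^sub>m 2 *\<^sub>v v = v" if "v \<in> L x" for v using stalks_ok_dim[OF ok that] by simp
    have "flag_map D L L (1\<^sub>m 2) E x = {fibre_class 2 L x v | v. v \<in> L x \<and> fibre_class 2 L x v \<in> E x}"
      (is "_ = ?r")
    proof (intro equalityI subsetI)
      fix Z assume "Z \<in> ?r"
      then obtain v where "Z = fibre_class 2 L x (1\<^sub>m 2 *\<^sub>v v)" "v \<in> L x" "fibre_class 2 L x v \<in> E x"
        using one by force
      thus "Z \<in> flag_map D L L (1\<^sub>m 2) E x" using True unfolding flag_map_def by auto
    qed (use True one in \<open>force simp: flag_map_def\<close>)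
    also have "\<dots> = E x" using w(1) local_submodule_smult[OF stalks_okD[OF ok]] unfolding w(3) by blast
    finally show ?thesis .
  next
    case False
    thus ?thesis using E by (auto simp: flag_map_def flag_structures_def PiE_def extensional_def)
  qed
qed

locale bundle_iso =
  fixes L L' :: "'a :: field stalks" and A B :: "'a ratfun mat"
  assumes ok: "stalks_ok 2 L" and ok': "stalks_ok 2 L'"
    and A: "A \<in> bundle_hom 2 L 2 L'" and B: "B \<in> bundle_hom 2 L' 2 L"
    and AB: "A * B = 1\<^sub>m 2" and BA: "B * A = 1\<^sub>m 2"
begin

lemma inverse: "bundle_iso L' L B A"
  using ok ok' A B AB BA by unfold_locales

lemma B_A_vec:
  assumes "v \<in> L x" shows "B *\<^sub>v (A *\<^sub>v v) = v"
proof -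
  have v: "v \<in> carrier_vec 2" using assms stalks_ok_dim[OF ok] by blast
  have "B *\<^sub>v (A *\<^sub>v v) = (B * A) *\<^sub>v v"
    by (rule assoc_mult_mat_vec[symmetric, OF bundle_hom_dim[OF B] bundle_hom_dim[OF A] v])
  thus ?thesis using v by (simp add: BA)
qed

lemma flag_map_membership:
  assumes "v \<in> L x" "x \<in> D"
  shows "fibre_class 2 L' x (A *\<^sub>v v) \<in> flag_map D L L' A E x \<longleftrightarrow> fibre_class 2 L x v \<in> E x"
proof
  assume "fibre_class 2 L' x (A *\<^sub>v v) \<in> flag_map D L L' A E x"
  then obtain v' where v': "fibre_class 2 L' x (A *\<^sub>v v) = fibre_class 2 L' x (A *\<^sub>v v')" "v' \<in> L x" "fibre_class 2 L x v' \<in> E x"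
    using assms by (auto simp: flag_map_def)
  have "fibre_class 2 L x (B *\<^sub>v (A *\<^sub>v v)) = fibre_class 2 L x (B *\<^sub>v (A *\<^sub>v v'))"
    using bundle_hom_stalk[OF A assms(1)] bundle_hom_stalk[OF A v'(2)]
    by (intro fibre_class_hom[OF ok' ok bundle_hom_dim[OF B] bundle_hom_stalk[OF B] _ _ v'(1)])
       (auto intro: stalks_ok_dim[OF ok'])
  thus "fibre_class 2 L x v \<in> E x" using v'(3) by (simp add: B_A_vec[OF assms(1)] B_A_vec[OF v'(2)])
qed (use assms in \<open>auto simp: flag_map_def\<close>)

lemma flag_map_in:
  assumes E: "E \<in> flag_structures D L"
  shows "flag_map D L L' A E \<in> flag_structures D L'"
proof -
  have "fibre_line 2 L' x (flag_map D L L' A E x)" if x: "x \<in> D" for x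
  proof -
    obtain w where w: "w \<in> L x" "fibre_class 2 L x w \<noteq> fibre_class 2 L x (0\<^sub>v 2)"
      "E x = {fibre_class 2 L x (c \<cdot>\<^sub>v w) | c. c \<in> local_ring x}"
      by (rule flag_structuresD[OF E x])
    have wc: "w \<in> carrier_vec 2" using stalks_ok_dim[OF ok w(1)] .
    have sm: "A *\<^sub>v (c \<cdot>\<^sub>v w) = c \<cdot>\<^sub>v (A *\<^sub>v w)" for c
      using bundle_hom_dim[OF A] wc by (simp add: mult_mat_vec)
    have "flag_map D L L' A E x = {fibre_class 2 L' x (c \<cdot>\<^sub>v (A *\<^sub>v w)) | c. c \<in> local_ring x}"
    proof (intro equalityI subsetI)
      fix Z assume "Z \<in> flag_map D L L' A E x"
      then obtain v c where v: "Z = fibre_class 2 L' x (A *\<^sub>v v)" "v \<in> L x"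
        "fibre_class 2 L x v = fibre_class 2 L x (c \<cdot>\<^sub>v w)" "c \<in> local_ring x"
        using x by (auto simp: flag_map_def w(3))
      have "Z = fibre_class 2 L' x (A *\<^sub>v (c \<cdot>\<^sub>v w))"
        unfolding v(1) using v(2) wc
        by (intro fibre_class_hom[OF ok ok' bundle_hom_dim[OF A] bundle_hom_stalk[OF A] _ _ v(3)])
           (auto intro: stalks_ok_dim[OF ok])
      thus "Z \<in> {fibre_class 2 L' x (c \<cdot>\<^sub>v (A *\<^sub>v w)) | c. c \<in> local_ring x}" using v(4) sm by auto
    next
      fix Z assume "Z \<in> {fibre_class 2 L' x (c \<cdot>\<^sub>v (A *\<^sub>v w)) | c. c \<in> local_ring x}"
      then obtain c where c: "c \<in> local_ring x" "Z = fibre_class 2 L' x (A *\<^sub>v (c \<cdot>\<^sub>v w))" using sm by auto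
      have "c \<cdot>\<^sub>v w \<in> L x" by (rule local_submodule_smult[OF stalks_okD[OF ok] c(1) w(1)])
      thus "Z \<in> flag_map D L L' A E x" unfolding c(2)
        using c(1) x by (subst flag_map_membership) (auto simp: w(3))
    qed
    moreover have "fibre_class 2 L' x (A *\<^sub>v w) \<noteq> fibre_class 2 L' x (0\<^sub>v 2)"
    proof
      assume eq: "fibre_class 2 L' x (A *\<^sub>v w) = fibre_class 2 L' x (0\<^sub>v 2)"
      have "fibre_class 2 L x (B *\<^sub>v (A *\<^sub>v w)) = fibre_class 2 L x (B *\<^sub>v 0\<^sub>v 2)"
        using bundle_hom_stalk[OF A w(1)]
        by (intro fibre_class_hom[OF ok' ok bundle_hom_dim[OF B] bundle_hom_stalk[OF B] _ _ eq])
           (auto intro: stalks_ok_dim[OF ok'])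
      moreover have "B *\<^sub>v 0\<^sub>v 2 = 0\<^sub>v 2" using bundle_hom_dim[OF B] by auto
      ultimately show False using w(2) by (simp add: B_A_vec[OF w(1)])
    qed
    ultimately show ?thesis
      unfolding fibre_line_def using bundle_hom_stalk[OF A w(1)] by blast
  qed
  moreover have "flag_map D L L' A E \<in> extensional D" by (simp add: flag_map_def)
  ultimately show ?thesis by (auto simp: flag_structures_def PiE_def)
qed

lemma flag_map_back:
  assumes "E \<in> flag_structures D L"
  shows "flag_map D L' L B (flag_map D L L' A E) = E"
  using flag_map_one[OF ok assms] by (simp add: flag_map_comp[OF ok ok' ok A B] BA)

lemma parabolic_hom_flag:
  assumes "E \<in> flag_structures D L"
  shows "A \<in> parabolic_hom D 2 L (flag_filtrations L E) 2 L' (flag_filtrations L' (flag_map D L L' A E))"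
  unfolding parabolic_hom_def
proof (safe intro!: A)
  fix x j v assume x: "x \<in> D" and v: "v \<in> L x" "fibre_class 2 L x v \<in> flag_filtrations L E x j"
  have Av: "A *\<^sub>v v \<in> L' x" using bundle_hom_stalk[OF A v(1)] .
  consider "j = 0" | "j = 1" | "j \<ge> 2" by linarith
  thus "fibre_class 2 L' x (A *\<^sub>v v) \<in> flag_filtrations L' (flag_map D L L' A E) x j"
  proof cases
    case 1
    thus ?thesis using Av by (simp add: flag_filtrations_def fibre_def)
  next
    case 2
    thus ?thesis using v flag_map_membership[OF v(1) x, of E] by (simp add: flag_filtrations_def)
  next
    case 3
    hence eq: "fibre_class 2 L x v = fibre_class 2 L x (0\<^sub>v 2)" using v(2) by (simp add: flag_filtrations_def)
    have "fibre_class 2 L' x (A *\<^sub>v v) = fibre_class 2 L' x (A *\<^sub>v 0\<^sub>v 2)"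
      by (intro fibre_class_hom[OF ok ok' bundle_hom_dim[OF A] bundle_hom_stalk[OF A] _ _ eq])
         (auto intro: stalks_ok_dim[OF ok] v)
    moreover have "A *\<^sub>v 0\<^sub>v 2 = 0\<^sub>v 2" using bundle_hom_dim[OF A] by auto
    ultimately show ?thesis using 3 by (simp add: flag_filtrations_def)
  qed
qed

lemma geom_indec_flag_map:
  assumes E: "E \<in> flag_structures D L"
  shows "geom_indecomposable D 2 L (flag_filtrations L E) \<longleftrightarrow>
    geom_indecomposable D 2 L' (flag_filtrations L' (flag_map D L L' A E))"
proof (rule geom_indecomposable_cong[OF ok ok'])
  interpret I: bundle_iso L' L B A by (rule inverse)
  show "parabolic_isomorphic D 2 L (flag_filtrations L E) 2 L' (flag_filtrations L' (flag_map D L L' A E))"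
    unfolding parabolic_isomorphic_def
    using parabolic_hom_flag[OF E] I.parabolic_hom_flag[OF flag_map_in[OF E]] AB BA
    unfolding flag_map_back[OF E] by blast
qed

lemma geom_indec_flags_map:
  "E \<in> geom_indec_flags D L \<Longrightarrow> flag_map D L L' A E \<in> geom_indec_flags D L'"
  unfolding geom_indec_flags_def using flag_map_in geom_indec_flag_map by blast

lemma bij_flag_map: "bij_betw (flag_map D L L' A) (geom_indec_flags D L) (geom_indec_flags D L')"
proof -
  interpret I: bundle_iso L' L B A by (rule inverse)
  show ?thesis
    by (rule bij_betwI[where g = "flag_map D L' L B"])
       (auto simp: geom_indec_flags_map I.geom_indec_flags_map flag_map_back I.flag_map_back
          dest: geom_indec_flags_def[THEN equalityD1, THEN subsetD])
qed

lemma aut_conj: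
  assumes "g \<in> bundle_aut 2 L" shows "A * (g * B) \<in> bundle_aut 2 L'"
proof -
  from assms obtain h where gh: "g \<in> bundle_hom 2 L 2 L" "h \<in> bundle_hom 2 L 2 L" "g * h = 1\<^sub>m 2" "h * g = 1\<^sub>m 2"
    unfolding bundle_aut_def by blast
  note d = bundle_hom_dim[OF A] bundle_hom_dim[OF B] bundle_hom_dim[OF gh(1)] bundle_hom_dim[OF gh(2)]
  have hom: "A * (k * B) \<in> bundle_hom 2 L' 2 L'" if "k \<in> bundle_hom 2 L 2 L" for k
    using bundle_hom_comp[OF bundle_hom_comp[OF B that ok'] A ok'] .
  have *: "(A * (k * B)) * (A * (k' * B)) = 1\<^sub>m 2"
    if k: "k \<in> carrier_mat 2 2" "k' \<in> carrier_mat 2 2" "k * k' = 1\<^sub>m 2" for k k'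
  proof -
    have kB: "k * B \<in> carrier_mat 2 2" "k' * B \<in> carrier_mat 2 2" using k d by auto
    have "(A * (k * B)) * (A * (k' * B)) = A * ((k * B) * A) * (k' * B)"
      by (rule mult_mat_assoc4[OF d(1) kB(1) d(1) kB(2)])
    also have "(k * B) * A = k" using k d by (simp add: assoc_mult_mat[OF k(1) d(2) d(1)] BA)
    also have "A * k * (k' * B) = A * (k * k') * B" by (rule mult_mat_assoc4[OF d(1) k(1,2) d(2)])
    also have "\<dots> = 1\<^sub>m 2" using d by (simp add: k(3) AB)
    finally show ?thesis .
  qed
  show ?thesis unfolding bundle_aut_def using hom[OF gh(1)] hom[OF gh(2)] * gh d by blast
qed

lemma flag_action_conj:
  assumes "g \<in> bundle_aut 2 L" "E \<in> flag_structures D L"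
  shows "flag_action D L' (A * (g * B)) (flag_map D L L' A E) = flag_map D L L' A (flag_action D L g E)"
proof -
  have g: "g \<in> bundle_hom 2 L 2 L" using assms by (simp add: bundle_aut_def)
  note gB = bundle_hom_comp[OF B g ok']
  have "flag_action D L' (A * (g * B)) (flag_map D L L' A E) = flag_map D L L' (A * (g * B) * A) E"
    unfolding flag_action_alt
    by (rule flag_map_comp[OF ok ok' ok' A bundle_hom_comp[OF gB A ok']])
  also have "A * (g * B) * A = A * (g * (B * A))"
    using bundle_hom_dim[OF A] bundle_hom_dim[OF B] bundle_hom_dim[OF g]
    by (simp add: assoc_mult_mat[of _ 2 2 _ 2 _ 2])
  also have "\<dots> = A * g" using bundle_hom_dim[OF g] by (simp add: BA)
  finally show ?thesis unfolding flag_action_alt by (simp add: flag_map_comp[OF ok ok ok' g A])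
qed

end

lemma card_quotient_transport:
  assumes T: "bij_betw T S S'" and R: "R \<subseteq> S \<times> S" "R' \<subseteq> S' \<times> S'"
    and eq: "\<And>E E'. E \<in> S \<Longrightarrow> E' \<in> S \<Longrightarrow> (E, E') \<in> R \<longleftrightarrow> (T E, T E') \<in> R'"
  shows "card (S // R) = card (S' // R')"
proof -
  have im: "R' `` {T E} = T ` (R `` {E})" if "E \<in> S" for E
  proof (intro equalityI subsetI)
    fix z assume "z \<in> R' `` {T E}"
    hence z: "(T E, z) \<in> R'" by simp
    hence "z \<in> T ` S" using R(2) T by (auto simp: bij_betw_def)
    then obtain E' where "E' \<in> S" "z = T E'" by blast
    thus "z \<in> T ` (R `` {E})" using z eq that by blast
  qed (use R eq that in blast)
  have "S' // R' = (\<lambda>C. T ` C) ` (S // R)"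
  proof -
    have "S' // R' = (\<lambda>E. R' `` {E}) ` (T ` S)" using T by (auto simp: quotient_def bij_betw_def)
    also have "\<dots> = (\<lambda>C. T ` C) ` (S // R)" using im by (auto simp: quotient_def image_iff)
    finally show ?thesis .
  qed
  moreover have "inj_on (\<lambda>C. T ` C) (S // R)"
  proof (rule inj_onI)
    fix C C' assume "C \<in> S // R" "C' \<in> S // R" "T ` C = T ` C'"
    moreover have "C \<subseteq> S" if "C \<in> S // R" for C using that R(1) by (auto simp: quotient_def)
    ultimately show "C = C'" using T inj_on_image_eq_iff[of T S C C'] by (auto simp: bij_betw_def)
  qed
  ultimately show ?thesis by (simp add: card_image)
qed

text \<open>An isomorphism carries flags to flags, and conjugation by it carries automorphisms to
  automorphisms, so orbits correspond. This makes \<open>class_flag_count\<close> independent of the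
  representative picked in a class.\<close>

lemma flag_count_cong:
  assumes "bundle_iso L L' A B"
  shows "flag_count D L = flag_count D L'"
proof -
  interpret bundle_iso L L' A B by (rule assms)
  interpret I: bundle_iso L' L B A by (rule inverse)
  have fs: "E \<in> flag_structures D L" if "E \<in> geom_indec_flags D L" for E
    using that by (simp add: geom_indec_flags_def)
  have inj: "inj_on (flag_map D L L' A) (geom_indec_flags D L)" using bij_flag_map by (auto simp: bij_betw_def)
  show ?thesis unfolding flag_count_def
  proof (rule card_quotient_transport[OF bij_flag_map])
    fix E E' assume E: "E \<in> geom_indec_flags D L" "E' \<in> geom_indec_flags D L"
    let ?T = "flag_map D L L' A"
    have "(\<exists>g\<in>bundle_aut 2 L. E' = flag_action D L g E) \<longleftrightarrow> (\<exists>g\<in>bundle_aut 2 L'. ?T E' = flag_action D L' g (?T E))"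
    proof
      assume "\<exists>g\<in>bundle_aut 2 L. E' = flag_action D L g E"
      then obtain g where g: "g \<in> bundle_aut 2 L" "E' = flag_action D L g E" by blast
      have "?T E' = flag_action D L' (A * (g * B)) (?T E)"
        unfolding g(2) flag_action_conj[OF g(1) fs[OF E(1)]] ..
      thus "\<exists>g\<in>bundle_aut 2 L'. ?T E' = flag_action D L' g (?T E)" using aut_conj[OF g(1)] by blast
    next
      assume "\<exists>g\<in>bundle_aut 2 L'. ?T E' = flag_action D L' g (?T E)"
      then obtain g where g: "g \<in> bundle_aut 2 L'" "?T E' = flag_action D L' g (?T E)" by blast
      have "flag_action D L (B * (g * A)) (flag_map D L' L B (?T E)) = flag_map D L' L B (?T E')"
        unfolding g(2) by (rule I.flag_action_conj[OF g(1) flag_map_in[OF fs[OF E(1)]]])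
      hence "E' = flag_action D L (B * (g * A)) E" by (simp add: flag_map_back fs E)
      thus "\<exists>g\<in>bundle_aut 2 L. E' = flag_action D L g E" using I.aut_conj[OF g(1)] by blast
    qed
    thus "((E, E') \<in> {(E, E'). E \<in> geom_indec_flags D L \<and> E' \<in> geom_indec_flags D L \<and>
           (\<exists>g\<in>bundle_aut 2 L. E' = flag_action D L g E)}) =
       ((?T E, ?T E') \<in> {(E, E'). E \<in> geom_indec_flags D L' \<and> E' \<in> geom_indec_flags D L' \<and>
           (\<exists>g\<in>bundle_aut 2 L'. E' = flag_action D L' g E)})"
      using E geom_indec_flags_map by blast
  qed auto
qed

section \<open>Counting orbits\<close>

text \<open>Double counting: each orbit is the image of \<open>G\<close> under a map all of whose
  fibres have \<open>k\<close> elements. The group laws are asked for only as they show in the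
  action on \<open>S\<close>.\<close>

lemma card_quotient_orbits:
  fixes act :: "'g \<Rightarrow> 's \<Rightarrow> 's"
  assumes fin: "finite S" "finite G"
    and closed: "\<And>g E. g \<in> G \<Longrightarrow> E \<in> S \<Longrightarrow> act g E \<in> S"
    and one: "\<exists>g\<in>G. \<forall>E\<in>S. act g E = E"
    and comp: "\<And>g h. g \<in> G \<Longrightarrow> h \<in> G \<Longrightarrow> \<exists>m\<in>G. \<forall>E\<in>S. act g (act h E) = act m E"
    and inv: "\<And>g. g \<in> G \<Longrightarrow> \<exists>h\<in>G. \<forall>E\<in>S. act h (act g E) = E"
    and fib: "\<And>E g. E \<in> S \<Longrightarrow> g \<in> G \<Longrightarrow> card {h\<in>G. act h E = act g E} = k"
  shows "card (S // {(E, E'). E \<in> S \<and> E' \<in> S \<and> (\<exists>g\<in>G. E' = act g E)}) * card G = k * card S"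
proof -
  define R where "R = {(E, E'). E \<in> S \<and> E' \<in> S \<and> (\<exists>g\<in>G. E' = act g E)}"
  have eqv: "equiv S R"
  proof (rule equivI)
    show "R \<subseteq> S \<times> S" by (auto simp: R_def)
    show "refl_on S R"
    proof (rule refl_onI)
      fix E assume "E \<in> S" thus "(E, E) \<in> R" using one by (auto simp: R_def) metis
    qed
    show "sym R"
    proof (rule symI)
      fix E E' assume "(E, E') \<in> R"
      then obtain g where g: "E \<in> S" "E' \<in> S" "g \<in> G" "E' = act g E" by (auto simp: R_def)
      from inv[OF g(3)] obtain h where "h \<in> G" "\<forall>E\<in>S. act h (act g E) = E" by blast
      hence "E = act h E'" "h \<in> G" using g by auto
      thus "(E', E) \<in> R" using g(1,2) unfolding R_def by blast
    qed
    show "trans R"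
    proof (rule transI)
      fix E E' E'' assume "(E, E') \<in> R" "(E', E'') \<in> R"
      then obtain g h where g: "E \<in> S" "E'' \<in> S" "g \<in> G" "h \<in> G" "E'' = act g (act h E)" by (auto simp: R_def)
      from comp[OF g(3,4)] obtain m where "m \<in> G" "E'' = act m E" using g by metis
      thus "(E, E'') \<in> R" using g(1,2) unfolding R_def by blast
    qed
  qed
  have orbit: "k * card C = card G" if "C \<in> S // R" for C
  proof -
    from that obtain E where E: "E \<in> S" "C = R `` {E}" by (rule quotientE)
    have C: "C = (\<lambda>g. act g E) ` G" unfolding E(2) using E(1) closed by (auto simp: R_def)
    have "card G = (\<Sum>g\<in>G. 1)" by simp
    also have "\<dots> = (\<Sum>E'\<in>(\<lambda>g. act g E) ` G. \<Sum>g\<in>{g\<in>G. act g E = E'}. 1)"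
      by (rule sum.image_gen[OF fin(2)])
    also have "\<dots> = (\<Sum>E'\<in>(\<lambda>g. act g E) ` G. k)"
      using fib[OF E(1)] by (intro sum.cong) auto
    finally show ?thesis by (simp add: C mult.commute)
  qed
  have "card S = card (\<Union>(S // R))" by (simp add: Union_quotient[OF eqv])
  also have "\<dots> = (\<Sum>C\<in>S // R. card C)"
  proof (rule card_Union_disjoint)
    show "pairwise disjnt (S // R)" using quotient_disj[OF eqv] by (auto simp: pairwise_def disjnt_def)
    show "finite C" if "C \<in> S // R" for C
      using that fin(1) by (meson eqv finite_subset in_quotient_imp_subset)
  qed
  finally have "k * card S = (\<Sum>C\<in>S // R. k * card C)" by (simp add: sum_distrib_left)
  also have "\<dots> = card (S // R) * card G" using orbit by simp
  finally show ?thesis unfolding R_def by simp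
qed

lemma bundle_aut_iso:
  assumes "stalks_ok 2 L" "g \<in> bundle_aut 2 L"
  obtains h where "h \<in> bundle_aut 2 L" "bundle_iso L L g h"
proof -
  from assms(2) obtain h where "g \<in> bundle_hom 2 L 2 L" "h \<in> bundle_hom 2 L 2 L" "g * h = 1\<^sub>m 2" "h * g = 1\<^sub>m 2"
    unfolding bundle_aut_def by blast
  thus ?thesis using assms(1) by (intro that[of h]) (auto simp: bundle_aut_def bundle_iso_def)
qed

lemma bundle_aut_mult:
  assumes ok: "stalks_ok 2 L" and "g \<in> bundle_aut 2 L" "h \<in> bundle_aut 2 L"
  shows "g * h \<in> bundle_aut 2 L"
proof -
  from assms(2) obtain g' where g: "g \<in> bundle_hom 2 L 2 L" "g' \<in> bundle_hom 2 L 2 L" "g * g' = 1\<^sub>m 2" "g' * g = 1\<^sub>m 2"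
    unfolding bundle_aut_def by blast
  from assms(3) obtain h' where h: "h \<in> bundle_hom 2 L 2 L" "h' \<in> bundle_hom 2 L 2 L" "h * h' = 1\<^sub>m 2" "h' * h = 1\<^sub>m 2"
    unfolding bundle_aut_def by blast
  note d = g(1,2)[THEN bundle_hom_dim] h(1,2)[THEN bundle_hom_dim]
  have "(g * h) * (h' * g') = 1\<^sub>m 2" "(h' * g') * (g * h) = 1\<^sub>m 2"
    unfolding mult_mat_assoc4[OF d(1,3,4,2)] mult_mat_assoc4[OF d(4,2,1,3)] using d g h by simp_all
  thus ?thesis unfolding bundle_aut_def
    using bundle_hom_comp[OF h(1) g(1) ok] bundle_hom_comp[OF g(2) h(2) ok] by blast
qed

lemma card_geom_indec_quotient:
  assumes ok: "stalks_ok 2 L" and fin: "finite (geom_indec_flags D L)" "finite (bundle_aut 2 L)"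
    and fib: "\<And>E g. E \<in> geom_indec_flags D L \<Longrightarrow> g \<in> bundle_aut 2 L \<Longrightarrow>
      card {h \<in> bundle_aut 2 L. flag_action D L h E = flag_action D L g E} = k"
  shows "flag_count D L * card (bundle_aut 2 L) = k * card (geom_indec_flags D L)"
  unfolding flag_count_def
proof (rule card_quotient_orbits[OF fin _ _ _ _ fib])
  have fs: "E \<in> flag_structures D L" if "E \<in> geom_indec_flags D L" for E
    using that by (simp add: geom_indec_flags_def)
  show "flag_action D L g E \<in> geom_indec_flags D L" if g: "g \<in> bundle_aut 2 L" "E \<in> geom_indec_flags D L" for g E
  proof -
    obtain h where "bundle_iso L L g h" by (rule bundle_aut_iso[OF ok g(1)])
    from bundle_iso.geom_indec_flags_map[OF this g(2)] show ?thesis by (simp add: flag_action_alt)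
  qed
  have "1\<^sub>m 2 \<in> bundle_aut 2 L" using bundle_hom_one[OF ok] right_mult_one_mat[OF one_carrier_mat[of 2]]
    unfolding bundle_aut_def by blast
  thus "\<exists>g\<in>bundle_aut 2 L. \<forall>E\<in>geom_indec_flags D L. flag_action D L g E = E"
    using flag_map_one[OF ok fs] by (auto simp: flag_action_alt)
  have hom: "g \<in> bundle_hom 2 L 2 L" if "g \<in> bundle_aut 2 L" for g using that by (simp add: bundle_aut_def)
  show "\<exists>m\<in>bundle_aut 2 L. \<forall>E\<in>geom_indec_flags D L. flag_action D L g (flag_action D L h E) = flag_action D L m E"
    if "g \<in> bundle_aut 2 L" "h \<in> bundle_aut 2 L" for g h
    using bundle_aut_mult[OF ok that] flag_map_comp[OF ok ok ok hom[OF that(2)] hom[OF that(1)]]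
    by (auto simp: flag_action_alt)
  show "\<exists>h\<in>bundle_aut 2 L. \<forall>E\<in>geom_indec_flags D L. flag_action D L h (flag_action D L g E) = E"
    if g: "g \<in> bundle_aut 2 L" for g
  proof -
    obtain h where h: "h \<in> bundle_aut 2 L" "bundle_iso L L g h" by (rule bundle_aut_iso[OF ok g])
    thus ?thesis using bundle_iso.flag_map_back[OF h(2) fs] by (auto simp: flag_action_alt)
  qed
qed

section \<open>Automorphism groups of split bundles and stabilisers\<close>

lemma polys_upto_finite_card:
  assumes "e \<ge> -1"
  shows "finite (polys_upto e :: 'k :: {field, finite} poly set)"
    and "card (polys_upto e :: 'k poly set) = card (UNIV :: 'k set) ^ nat (e + 1)"
  using assms by (simp_all add: polys_upto_alt card_polys_below)

lemma Fract_1_eq_iff [simp]: "Fr f 1 = Fr g 1 \<longleftrightarrow> f = g"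
  by (simp add: eq_fract)

lemma std_homE:
  assumes "A \<in> bundle_hom 2 (std a b) 2 (std a b)" "b \<le> a"
  obtains p f g s where "A = mat2 (const p) (Fr f 1) (const g) (const s)" "f \<in> polys_upto (a - b)" "b < a \<longrightarrow> g = 0"
proof -
  obtain p f g s where A: "A = mat2 p f g s" using mat2_cases[OF bundle_hom_dim[OF assms(1)]] .
  note sec = assms(1)[unfolded A std_hom_iff]
  obtain p0 where p0: "p = const p0" using sec sections_0E[of p] by auto
  obtain s0 where s0: "s = const s0" using sec sections_0E[of s] by auto
  obtain g0 where g0: "g = const g0" "b - a < 0 \<longrightarrow> g0 = 0"
    using sec sections_nonpos_E[of "b - a" g] assms(2) by auto
  obtain f0 where f0: "f0 \<in> polys_upto (a - b)" "f = Fr f0 1" using sec unfolding sections_iff by blast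
  show ?thesis using that[of p0 f0 g0 s0] A p0 s0 g0 f0 by simp
qed

lemma std_homI:
  assumes "f \<in> polys_upto (a - b)" "b < a \<longrightarrow> g = 0" "b \<le> a"
  shows "mat2 (const p) (Fr f 1) (const g) (const s) \<in> bundle_hom 2 (std a b) 2 (std a b)"
proof -
  have "const g \<in> sections (b - a)"
    using assms by (cases "b = a") (auto simp: const_in_sections zero_in_sections)
  thus ?thesis using assms by (auto simp: std_hom_iff const_in_sections poly_in_sections)
qed

text \<open>The lower left entry is a section of O(b - a), hence zero, and the diagonal entries are
  constants; such a triangular matrix is invertible when both constants are non-zero.\<close>

lemma bundle_aut_std_gt:
  assumes "b < a"
  shows "bundle_aut 2 (std a b :: 'a :: field stalks) =
    (\<lambda>(p, s, f). mat2 (const p) (Fr f 1) 0 (const s)) ` ((UNIV - {0}) \<times> (UNIV - {0}) \<times> polys_upto (a - b))"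
proof (intro equalityI subsetI)
  fix A :: "'a ratfun mat" assume A: "A \<in> bundle_aut 2 (std a b)"
  then obtain B where B: "A \<in> bundle_hom 2 (std a b) 2 (std a b)" "B \<in> bundle_hom 2 (std a b) 2 (std a b)" "A * B = 1\<^sub>m 2"
    unfolding bundle_aut_def by blast
  obtain p f g s where A': "A = mat2 (const p) (Fr f 1) (const g) (const s)" "f \<in> polys_upto (a - b)" "g = 0"
    using std_homE[OF B(1)] assms by (metis less_imp_le)
  obtain p' f' g' s' where B': "B = mat2 (const p') (Fr f' 1) (const g') (const s')" "g' = 0"
    using std_homE[OF B(2)] assms by (metis less_imp_le)
  have "const (p * p') = const 1" "const (s * s') = const 1"
    using B(3) unfolding A' B' mat2_mult one_mat2 by (simp_all add: const_mult)
  hence "p * p' = 1" "s * s' = 1" unfolding const_eq_iff .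
  hence "p \<noteq> 0" "s \<noteq> 0" by auto
  thus "A \<in> (\<lambda>(p, s, f). mat2 (const p) (Fr f 1) 0 (const s)) ` ((UNIV - {0}) \<times> (UNIV - {0}) \<times> polys_upto (a - b))"
    using A' by (intro image_eqI[of _ _ "(p, s, f)"]) auto
next
  fix A :: "'a ratfun mat"
  assume "A \<in> (\<lambda>(p, s, f). mat2 (const p) (Fr f 1) 0 (const s)) ` ((UNIV - {0}) \<times> (UNIV - {0}) \<times> polys_upto (a - b))"
  then obtain p s f where A: "A = mat2 (const p) (Fr f 1) (const 0) (const s)" "p \<noteq> 0" "s \<noteq> 0" "f \<in> polys_upto (a - b)"
    by auto
  \<comment> \<open>The inverse of a triangular matrix: its off-diagonal entry -f / (p s) is again a
    section of O(a - b).\<close>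
  let ?B = "mat2 (const (1 / p)) (Fr (Polynomial.smult (- 1 / (p * s)) f) 1) (const 0) (const (1 / s))"
  have 1: "A \<in> bundle_hom 2 (std a b) 2 (std a b)" unfolding A(1) using A assms by (intro std_homI) auto
  have 2: "?B \<in> bundle_hom 2 (std a b) 2 (std a b)" using A assms by (intro std_homI polys_upto_smult) auto
  have "const p * const (1 / p) = 1" "const s * const (1 / s) = 1" "const (1 / p) * const p = 1" "const (1 / s) * const s = 1"
    using A by (simp_all flip: const_mult)
  moreover have "const p * Fr (Polynomial.smult (- 1 / (p * s)) f) 1 + Fr f 1 * const (1 / s) = 0"
    "const (1 / p) * Fr f 1 + Fr (Polynomial.smult (- 1 / (p * s)) f) 1 * const s = 0"
    using A by (simp_all add: const_def)
  ultimately have "A * ?B = 1\<^sub>m 2" "?B * A = 1\<^sub>m 2"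
    unfolding A(1) mat2_mult one_mat2 by simp_all
  thus "A \<in> bundle_aut 2 (std a b)" unfolding bundle_aut_def using 1 2 by blast
qed

lemma bundle_aut_std_eq:
  "bundle_aut 2 (std a a :: 'a :: field stalks) =
    (\<lambda>(p, f, g, s). mat2 (const p) (const f) (const g) (const s)) ` {(p, f, g, s). p * s \<noteq> f * g}"
proof (intro equalityI subsetI)
  have c: "\<exists>p f g s. A = mat2 (const p) (const f) (const g) (const s)"
    if h: "A \<in> bundle_hom 2 (std a a) 2 (std a a)" for A :: "'a ratfun mat"
  proof -
    obtain p f g s where A: "A = mat2 p f g s" using mat2_cases[OF bundle_hom_dim[OF h]] .
    have s0: "\<exists>c. k = const c" if "k \<in> sections 0" for k :: "'a ratfun" using sections_0E[OF that] by blast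
    have "p \<in> sections 0" "f \<in> sections 0" "g \<in> sections 0" "s \<in> sections 0"
      using h unfolding A std_hom_iff diff_self by blast+
    from this[THEN s0] show ?thesis unfolding A by blast
  qed
  fix A :: "'a ratfun mat" assume A: "A \<in> bundle_aut 2 (std a a)"
  then obtain B where B: "A \<in> bundle_hom 2 (std a a) 2 (std a a)" "B \<in> bundle_hom 2 (std a a) 2 (std a a)" "A * B = 1\<^sub>m 2"
    unfolding bundle_aut_def by blast
  obtain p f g s where A': "A = mat2 (const p) (const f) (const g) (const s)" using c[OF B(1)] by blast
  have "det A * det B = 1"
    using det_mult[OF bundle_hom_dim[OF B(1)] bundle_hom_dim[OF B(2)]] B(3) by simp
  hence "det A \<noteq> 0" by auto
  hence "const (p * s - f * g) \<noteq> 0" unfolding A' det_mat2 by (simp only: const_mult const_diff not_False_eq_True)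
  hence "p * s \<noteq> f * g" by simp
  thus "A \<in> (\<lambda>(p, f, g, s). mat2 (const p) (const f) (const g) (const s)) ` {(p, f, g, s). p * s \<noteq> f * g}"
    using A' by (intro image_eqI[of _ _ "(p, f, g, s)"]) auto
next
  fix A :: "'a ratfun mat"
  assume "A \<in> (\<lambda>(p, f, g, s). mat2 (const p) (const f) (const g) (const s)) ` {(p, f, g, s). p * s \<noteq> f * g}"
  then obtain p f g s where A: "A = mat2 (const p) (const f) (const g) (const s)" "p * s \<noteq> f * g" by auto
  define t where "t = p * s - f * g"
  have t: "t \<noteq> 0" using A by (simp add: t_def)
  have 1: "(p * s - f * g) / t = 1" using t by (simp add: t_def)
  let ?B = "mat2 (const (s / t)) (const (- f / t)) (const (- g / t)) (const (p / t))"
  have hom: "mat2 (const p) (const f) (const g) (const s) \<in> bundle_hom 2 (std a a) 2 (std a a)" for p f g s :: 'a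
    unfolding std_hom_iff diff_self by (simp add: const_in_sections)
  have one: "mat2 (const 1) (const 0) (const 0) (const 1) = 1\<^sub>m 2" by (simp add: one_mat2)
  have "A * ?B = 1\<^sub>m 2" "?B * A = 1\<^sub>m 2"
    unfolding A(1) mat2_mult const_mult[symmetric] const_add[symmetric] one[symmetric] mat2_eq_iff const_eq_iff
    using 1 by (auto simp: diff_divide_distrib mult.commute)
  thus "A \<in> bundle_aut 2 (std a a)" unfolding bundle_aut_def using hom A(1) by blast
qed

text \<open>There are q^3 + q^2 - q singular matrices; the subtracted term is moved to the left to
  stay within the natural numbers.\<close>

lemma card_singular_matrices:
  "card {(p, f, g, s). p * s = f * (g :: 'k :: {field, finite})} + card (UNIV :: 'k set) =
    card (UNIV :: 'k set) ^ 3 + card (UNIV :: 'k set) ^ 2"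
proof -
  let ?q = "card (UNIV :: 'k set)"
  let ?U = "UNIV :: 'k set"
  \<comment> \<open>Partition by the first row: if \<open>p\<close> is non-zero it determines
    \<open>s\<close>; if \<open>p\<close> = 0 and \<open>f\<close> is non-zero then \<open>g\<close>
    = 0; if both vanish, \<open>g\<close> and \<open>s\<close> are free.\<close>
  define A where "A = (\<lambda>(p, f, g). (p, f, g, f * g / p)) ` ((?U - {0}) \<times> ?U \<times> ?U)"
  define B where "B = (\<lambda>(f, s). (0 :: 'k, f, 0 :: 'k, s)) ` ((?U - {0}) \<times> ?U)"
  define C where "C = (\<lambda>(g, s). (0 :: 'k, 0 :: 'k, g, s)) ` (?U \<times> ?U)"
  have "{(p, f, g, s). p * s = f * (g :: 'k)} = A \<union> (B \<union> C)"
  proof (intro equalityI subsetI)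
    fix z :: "'k \<times> 'k \<times> 'k \<times> 'k" assume "z \<in> {(p, f, g, s). p * s = f * g}"
    then obtain p f g s where z: "z = (p, f, g, s)" "p * s = f * g" by auto
    consider "p \<noteq> 0" | "p = 0" "f = 0" | "p = 0" "f \<noteq> 0" "g = 0" using z(2) by force
    thus "z \<in> A \<union> (B \<union> C)"
    proof cases
      case 1
      hence "s = f * g / p" using z(2) by (simp add: field_simps)
      thus ?thesis using 1 z(1) by (auto simp: A_def image_iff)
    qed (use z in \<open>auto simp: B_def C_def image_iff\<close>)
  qed (auto simp: A_def B_def C_def split: if_splits)
  moreover have "A \<inter> (B \<union> C) = {}" "B \<inter> C = {}" by (auto simp: A_def B_def C_def)
  ultimately have "card {(p, f, g, s). p * s = f * (g :: 'k)} = card A + (card B + card C)"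
    by (simp add: card_Un_disjoint)
  moreover have "card A = (?q - 1) * (?q * ?q)"
    unfolding A_def by (subst card_image) (auto simp: inj_on_def card_cartesian_product simp del: UNIV_Times_UNIV)
  moreover have "card B = (?q - 1) * ?q"
    unfolding B_def by (subst card_image) (auto simp: inj_on_def card_cartesian_product simp del: UNIV_Times_UNIV)
  moreover have "card C = ?q * ?q"
    unfolding C_def by (subst card_image) (auto simp: inj_on_def card_cartesian_product simp del: UNIV_Times_UNIV)
  moreover have "?q \<ge> 1" using card_UNIV_ge_2[where 'k = 'k] by simp
  then obtain m where "?q = Suc m" by (metis Suc_le_D One_nat_def)
  ultimately show ?thesis by (simp add: power2_eq_square power3_eq_cube algebra_simps)
qed

lemma card_bundle_aut_gt:
  assumes "b < a"
  shows "finite (bundle_aut 2 (std a b :: 'k :: {field, finite} stalks))"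
    and "card (bundle_aut 2 (std a b :: 'k stalks)) = (card (UNIV :: 'k set) - 1)\<^sup>2 * card (UNIV :: 'k set) ^ nat (a - b + 1)"
proof -
  have inj: "inj_on (\<lambda>(p, s, f). mat2 (const p) (Fr f 1) 0 (const s)) ((UNIV - {0}) \<times> (UNIV - {0}) \<times> (polys_upto (a - b) :: 'k poly set))"
    by (auto simp: inj_on_def)
  show "finite (bundle_aut 2 (std a b :: 'k stalks))"
    unfolding bundle_aut_std_gt[OF assms] using assms by (auto simp: polys_upto_finite_card)
  show "card (bundle_aut 2 (std a b :: 'k stalks)) = (card (UNIV :: 'k set) - 1)\<^sup>2 * card (UNIV :: 'k set) ^ nat (a - b + 1)"
    unfolding bundle_aut_std_gt[OF assms] card_image[OF inj] using assms
    by (simp add: card_cartesian_product polys_upto_finite_card power2_eq_square)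
qed

lemma card_bundle_aut_eq:
  fixes q :: int
  defines "q \<equiv> int (card (UNIV :: 'k :: {field, finite} set))"
  shows "finite (bundle_aut 2 (std a a :: 'k stalks))"
    and "int (card (bundle_aut 2 (std a a :: 'k stalks))) = (q - 1) * (q ^ 3 - q)"
proof -
  let ?S = "{(p, f, g, s). p * s \<noteq> f * (g :: 'k)}"
  have inj: "inj_on (\<lambda>(p, f, g, s). mat2 (const p) (const f) (const g) (const s)) ?S"
    by (auto simp: inj_on_def)
  have "int (card ?S) = int (card (UNIV :: ('k \<times> 'k \<times> 'k \<times> 'k) set)) - int (card {(p, f, g, s). p * s = f * (g :: 'k)})"
  proof -
    have "?S = UNIV - {(p, f, g, s). p * s = f * (g :: 'k)}" by auto
    moreover have "card {(p, f, g, s). p * s = f * (g :: 'k)} \<le> card (UNIV :: ('k \<times> 'k \<times> 'k \<times> 'k) set)"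
      by (intro card_mono) auto
    ultimately show ?thesis by (simp add: card_Diff_subset of_nat_diff)
  qed
  also have "card (UNIV :: ('k \<times> 'k \<times> 'k \<times> 'k) set) = card (UNIV :: 'k set) ^ 4"
    by (simp add: card_cartesian_product power4_eq_xxxx mult.assoc flip: UNIV_Times_UNIV)
  also have "int (card {(p, f, g, s). p * s = f * (g :: 'k)}) = q ^ 3 + q ^ 2 - q"
    using arg_cong[OF card_singular_matrices[where 'k = 'k], of int] by (simp add: q_def)
  finally have "int (card ?S) = (q - 1) * (q ^ 3 - q)"
    by (simp add: q_def algebra_simps power2_eq_square power3_eq_cube power4_eq_xxxx)
  thus "int (card (bundle_aut 2 (std a a :: 'k stalks))) = (q - 1) * (q ^ 3 - q)"
    unfolding bundle_aut_std_eq card_image[OF inj] .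
  show "finite (bundle_aut 2 (std a a :: 'k stalks))" unfolding bundle_aut_std_eq by simp
qed

lemma finite_bundle_aut_std: "b \<le> a \<Longrightarrow> finite (bundle_aut 2 (std a b :: 'k :: {field, finite} stalks))"
  using card_bundle_aut_gt(1)[of b a] card_bundle_aut_eq(1)[of a] by (cases "b = a") auto

text \<open>A matrix that maps every line of the flag to itself satisfies \<open>qcond\<close> at
  each point, and for a brick only scalar matrices do. The action modulo scalars is therefore
  free.\<close>

lemma brick_stabiliser_scalar:
  assumes ab: "b \<le> a" and u: "\<And>x. x \<in> D \<Longrightarrow> u x \<in> codes x" and br: "brick (a - b) D u"
    and A: "A \<in> bundle_hom 2 (std a b) 2 (std a b)"
    and st: "flag_map D (std a b) (std a b) A (\<lambda>x\<in>D. kline a b x (u x)) = (\<lambda>x\<in>D. kline a b x (u x))"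
  obtains c where "A = mat2 (const c) 0 0 (const c)"
proof -
  obtain p f g s where pf: "A = mat2 (const p) (Fr f 1) (const g) (const s)" "f \<in> polys_upto (a - b)" "b < a \<longrightarrow> g = 0"
    by (rule std_homE[OF A ab])
  have "\<forall>x\<in>D. qcond (a - b) (pick x) (u x) (to_ac (- g)) (to_ac (p - s)) (pac f)"
  proof
    fix x assume x: "x \<in> D"
    define R0 R1 where R: "R0 = rep0 x (u x)" "R1 = rep1 (u x)"
    have Rin: "R0 \<in> local_ring x" "R1 \<in> local_ring x" unfolding R using rep_in u[OF x] by auto
    let ?U = "R0 * tw x a" and ?V = "R1 * tw x b"
    have w: "?U / tw x a \<in> local_ring x" "?V / tw x b \<in> local_ring x" using Rin by auto
    have kR: "kres (pick x) R0 = (case u x of None \<Rightarrow> 1 | Some z \<Rightarrow> z)" "kres (pick x) R1 = (case u x of None \<Rightarrow> 0 | Some z \<Rightarrow> 1)"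
      using u[OF x] by (auto simp: R rep0_def rep1_def codes_def hrep)
    have sec: "Fr f 1 / tw x (a - b) \<in> local_ring x" by (rule section_local[OF pf(2)])
    \<comment> \<open>Either \<open>g\<close> is zero, for b < a, or the twist is trivial, for b =
      a.\<close>
    have gt: "const g / tw x (b - a) = const g" using pf(3) ab by (cases "b = a") auto
    have 1: "(const p * ?U + Fr f 1 * ?V) / tw x a = const p * R0 + (Fr f 1 / tw x (a - b)) * R1"
      by (simp add: tw_diff add_divide_distrib)
    have 2: "(const g * ?U + const s * ?V) / tw x b = (const g / tw x (b - a)) * R0 + const s * R1"
      by (simp add: tw_diff add_divide_distrib)
    have 2: "(const g * ?U + const s * ?V) / tw x b = const g * R0 + const s * R1" unfolding 2 gt ..
    have in12: "(const p * ?U + Fr f 1 * ?V) / tw x a \<in> local_ring x" "(const g * ?U + const s * ?V) / tw x b \<in> local_ring x"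
      unfolding 1 2 by (intro local_ring_add local_ring_mult Rin sec const_in)+
    have ks: "kres (pick x) ((const p * ?U + Fr f 1 * ?V) / tw x a) =
        to_ac p * kres (pick x) R0 + evs (a - b) (pick x) (pac f) * kres (pick x) R1"
      "kres (pick x) ((const g * ?U + const s * ?V) / tw x b) = to_ac g * kres (pick x) R0 + to_ac s * kres (pick x) R1"
      unfolding 1 2 evs_pac using Rin sec
      by (simp_all add: kres_add kres_mult local_ring_mult const_in del: times_divide_eq_left)
    have "vec2 ?U ?V \<in> std a b x" using w by (simp add: std_iff)
    moreover have "fibre_class 2 (std a b) x (vec2 ?U ?V) \<in> kline a b x (u x)"
      unfolding fibre_class_in_kline_iff[OF w] using kR by (auto split: option.splits)
    ultimately have "fibre_class 2 (std a b) x (A *\<^sub>v vec2 ?U ?V) \<in>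
        flag_map D (std a b) (std a b) A (\<lambda>x\<in>D. kline a b x (u x)) x"
      using x by (auto simp: flag_map_def)
    hence "fibre_class 2 (std a b) x (A *\<^sub>v vec2 ?U ?V) \<in> kline a b x (u x)" unfolding st using x by simp
    hence "on_line (u x) (to_ac p * kres (pick x) R0 + evs (a - b) (pick x) (pac f) * kres (pick x) R1)
      (to_ac g * kres (pick x) R0 + to_ac s * kres (pick x) R1)"
      unfolding pf(1) mat2_mult_vec2 fibre_class_in_kline_iff[OF in12] ks .
    thus "qcond (a - b) (pick x) (u x) (to_ac (- g)) (to_ac (p - s)) (pac f)" unfolding kR
      by (cases "u x") (auto simp: qcond_def power2_eq_square algebra_simps)
  qed
  moreover have "a - b > 0 \<longrightarrow> - g = 0" using pf(3) by simp
  ultimately have "- g = 0 \<and> p - s = 0 \<and> f = 0" using br pf(2) unfolding brick_def by blast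
  thus ?thesis using that[of p] pf(1) by simp
qed

definition scalar2 :: "'a :: field \<Rightarrow> 'a ratfun mat" where
  "scalar2 c = mat2 (const c) 0 0 (const c)"

lemma scalar2_hom: "stalks_ok 2 L \<Longrightarrow> scalar2 c \<in> bundle_hom 2 L 2 L"
  unfolding bundle_hom_def
proof safe
  fix x v assume ok: "stalks_ok 2 L" and v: "v \<in> L x"
  obtain p q where "v = vec2 p q" using vec2_cases[OF stalks_ok_dim[OF ok v]] .
  hence "scalar2 c *\<^sub>v v = const c \<cdot>\<^sub>v v" by (simp add: scalar2_def mat2_mult_vec2 vec2_arith)
  thus "scalar2 c *\<^sub>v v \<in> L x" using local_submodule_smult[OF stalks_okD[OF ok] const_in v] by simp
qed (simp add: scalar2_def)

lemma scalar2_mult: "scalar2 c * scalar2 d = scalar2 (c * d)" "scalar2 1 = 1\<^sub>m 2"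
  by (auto simp: scalar2_def mat2_mult const_mult one_mat2)

lemma flag_map_scalar:
  assumes ok: "stalks_ok 2 L" and E: "E \<in> flag_structures D L" and c: "c \<noteq> 0"
  shows "flag_map D L L (scalar2 c) E = E"
proof -
  have sub: "flag_map D L L (scalar2 c) E x \<subseteq> E x" if x: "x \<in> D" for c x
  proof
    fix Z assume "Z \<in> flag_map D L L (scalar2 c) E x"
    then obtain v where v: "Z = fibre_class 2 L x (scalar2 c *\<^sub>v v)" "v \<in> L x" "fibre_class 2 L x v \<in> E x"
      using x by (auto simp: flag_map_def)
    obtain w where w: "w \<in> L x" "fibre_class 2 L x w \<noteq> fibre_class 2 L x (0\<^sub>v 2)"
      "E x = {fibre_class 2 L x (c \<cdot>\<^sub>v w) | c. c \<in> local_ring x}" by (rule flag_structuresD[OF E x])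
    from v(3) obtain d where d: "d \<in> local_ring x" "fibre_class 2 L x v = fibre_class 2 L x (d \<cdot>\<^sub>v w)"
      unfolding w(3) by blast
    have wc: "w \<in> carrier_vec 2" by (rule stalks_ok_dim[OF ok w(1)])
    note S = scalar2_hom[OF ok, of c]
    have "Z = fibre_class 2 L x (scalar2 c *\<^sub>v (d \<cdot>\<^sub>v w))"
      unfolding v(1) using wc stalks_ok_dim[OF ok v(2)]
      by (intro fibre_class_hom[OF ok ok bundle_hom_dim[OF S] bundle_hom_stalk[OF S] _ _ d(2)]) auto
    moreover obtain p q where "w = vec2 p q" using vec2_cases[OF wc] .
    hence "scalar2 c *\<^sub>v (d \<cdot>\<^sub>v w) = (const c * d) \<cdot>\<^sub>v w" by (simp add: scalar2_def mat2_mult_vec2 vec2_arith mult.assoc)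
    ultimately show "Z \<in> E x" unfolding w(3) using local_ring_mult[OF const_in d(1)] by auto
  qed
  have mono: "flag_map D L L A E' x \<subseteq> flag_map D L L A E x" if "E' x \<subseteq> E x" for A E' x
    using that by (auto simp: flag_map_def)
  show ?thesis
  proof
    fix x show "flag_map D L L (scalar2 c) E x = E x"
    proof (cases "x \<in> D")
      case True
      have "E x = flag_map D L L (scalar2 1) E x" using flag_map_one[OF ok E] by (simp add: scalar2_mult)
      \<comment> \<open>A scalar clearly maps each line into itself; equality follows by applying
        the same inclusion to the inverse scalar.\<close>
      also have "\<dots> = flag_map D L L (scalar2 c) (flag_map D L L (scalar2 (1 / c)) E) x"
        using c by (simp add: flag_map_comp[OF ok ok ok scalar2_hom[OF ok] scalar2_hom[OF ok]] scalar2_mult(1))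
      also have "\<dots> \<subseteq> flag_map D L L (scalar2 c) E x" by (rule mono) (rule sub[OF True])
      finally show ?thesis using sub[OF True] by blast
    next
      case False
      thus ?thesis using E by (auto simp: flag_map_def flag_structures_def PiE_def extensional_def)
    qed
  qed
qed

lemma bij_codes_flags:
  "bij_betw (\<lambda>u. \<lambda>x\<in>D. kline a b x (u x)) (PiE D codes) (flag_structures D (std a b))"
proof -
  let ?T = "\<lambda>u. \<lambda>x\<in>D. kline a b x (u x)"
  have "inj_on ?T (PiE D codes)"
  proof (rule inj_onI)
    fix u u' assume u: "u \<in> PiE D codes" "u' \<in> PiE D codes" "?T u = ?T u'"
    have "u x = u' x" if "x \<in> D" for x
      using fun_cong[OF u(3), of x] that u(1,2) by (intro kline_inj[of _ x _ a b]) auto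
    thus "u = u'" using u(1,2) by (intro PiE_ext[of u D codes u']) auto
  qed
  moreover have "?T ` PiE D codes = flag_structures D (std a b)"
  proof (intro equalityI subsetI)
    fix E assume "E \<in> ?T ` PiE D codes"
    thus "E \<in> flag_structures D (std a b)"
      by (auto simp: flag_structures_def fibre_line_iff_code PiE_iff)
  next
    fix E assume E: "E \<in> flag_structures D (std a b)"
    have "\<forall>x\<in>D. \<exists>c\<in>codes x. E x = kline a b x c"
      using E unfolding flag_structures_def by (auto simp: fibre_line_iff_code)
    then obtain u where u: "\<forall>x\<in>D. u x \<in> codes x \<and> E x = kline a b x (u x)" by metis
    have "E = ?T (\<lambda>x\<in>D. u x)"
      using E u by (auto simp: flag_structures_def PiE_def extensional_def fun_eq_iff)
    moreover have "(\<lambda>x\<in>D. u x) \<in> PiE D codes" using u by auto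
    ultimately show "E \<in> ?T ` PiE D codes" by (rule image_eqI)
  qed
  ultimately show ?thesis by (simp add: bij_betw_def)
qed

lemma finite_codes: "finite (codes (x :: 'k :: {field, finite} closed_pt))"
  by (simp add: codes_def card_resf)

text \<open>Two automorphisms act alike on a brick if and only if they differ by a non-zero scalar,
  so the fibres of each orbit map have q - 1 elements.\<close>

lemma flag_count_std:
  fixes D :: "'k :: {field, finite} closed_pt set"
  assumes fin: "finite D" and ab: "b \<le> a"
  shows "flag_count D (std a b) * card (bundle_aut 2 (std a b :: 'k stalks)) =
    (card (UNIV :: 'k set) - 1) * card {u \<in> PiE D codes. brick (a - b) D u}"
proof -
  let ?L = "std a b :: 'k stalks" and ?T = "\<lambda>u. \<lambda>x\<in>D. kline a b x (u x)"
  let ?S = "{u \<in> PiE D codes. brick (a - b) D u}"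
  have ok: "stalks_ok 2 ?L" by (rule split_bundle_ok)
  have inj: "inj_on ?T (PiE D codes)" and im: "?T ` PiE D codes = flag_structures D ?L"
    using bij_codes_flags[where D = D and a = a and b = b] by (auto simp: bij_betw_def)
  have GI: "geom_indec_flags D ?L = ?T ` ?S"
  proof -
    have "geom_indec_flags D ?L = {E \<in> ?T ` PiE D codes. geom_indecomposable D 2 ?L (flag_filtrations ?L E)}"
      unfolding geom_indec_flags_def im ..
    also have "\<dots> = ?T ` ?S"
      using geom_indec_iff_brick[OF fin ab] by (auto simp: PiE_iff)
    finally show ?thesis .
  qed
  have finBr: "finite (PiE D codes)" using fin finite_codes by (intro finite_PiE) auto
  have cardGI: "card (geom_indec_flags D ?L) = card ?S"
    unfolding GI using inj by (intro card_image) (auto simp: inj_on_def)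
  have "flag_count D ?L * card (bundle_aut 2 ?L) = (card (UNIV :: 'k set) - 1) * card (geom_indec_flags D ?L)"
  proof (rule card_geom_indec_quotient[OF ok])
    show "finite (geom_indec_flags D ?L)" unfolding GI using finBr by simp
    show "finite (bundle_aut 2 ?L)" by (rule finite_bundle_aut_std[OF ab])
    fix E g assume E: "E \<in> geom_indec_flags D ?L" and g: "g \<in> bundle_aut 2 ?L"
    have Ef: "E \<in> flag_structures D ?L" using E by (simp add: geom_indec_flags_def)
    obtain u where u: "u \<in> PiE D codes" "brick (a - b) D u" "E = ?T u" using E unfolding GI by blast
    obtain g' where g': "g' \<in> bundle_aut 2 ?L" "bundle_iso ?L ?L g g'" by (rule bundle_aut_iso[OF ok g])
    have hg: "g \<in> bundle_hom 2 ?L 2 ?L" "g' \<in> bundle_hom 2 ?L 2 ?L" using g g' by (auto simp: bundle_aut_def)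
    note dg = hg[THEN bundle_hom_dim]
    have sd: "scalar2 c \<in> carrier_mat 2 2" for c :: 'k by (simp add: scalar2_def)
    have sc: "scalar2 c \<in> bundle_aut 2 ?L" if "c \<noteq> 0" for c
      using scalar2_hom[OF ok] scalar2_mult(1)[of c "1 / c"] scalar2_mult(1)[of "1 / c" c] scalar2_mult(2) that
      by (auto simp: bundle_aut_def intro!: bexI[of _ "scalar2 (1 / c)"])
    have "{h \<in> bundle_aut 2 ?L. flag_action D ?L h E = flag_action D ?L g E} = (\<lambda>c. g * scalar2 c) ` (UNIV - {0})"
    proof (intro equalityI subsetI)
      fix h assume "h \<in> {h \<in> bundle_aut 2 ?L. flag_action D ?L h E = flag_action D ?L g E}"
      hence h: "h \<in> bundle_aut 2 ?L" "flag_map D ?L ?L h E = flag_map D ?L ?L g E" by (auto simp: flag_action_alt)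
      have hh: "h \<in> bundle_hom 2 ?L 2 ?L" using h by (simp add: bundle_aut_def)
      have "flag_map D ?L ?L (g' * h) E = flag_map D ?L ?L g' (flag_map D ?L ?L g E)"
        unfolding h(2)[symmetric] flag_map_comp[OF ok ok ok hh hg(2)] ..
      also have "\<dots> = E" by (rule bundle_iso.flag_map_back[OF g'(2) Ef])
      finally have st: "flag_map D ?L ?L (g' * h) (?T u) = ?T u" unfolding u(3) .
      obtain c where c: "g' * h = scalar2 c"
        using brick_stabiliser_scalar[OF ab _ u(2) bundle_hom_comp[OF hh hg(2) ok] st] u(1)
        unfolding scalar2_def by (metis PiE_mem)
      have "g * (g' * h) = (g * g') * h" using dg bundle_hom_dim[OF hh] by (simp add: assoc_mult_mat[of _ 2 2 _ 2 _ 2])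
      also have "g * g' = 1\<^sub>m 2" using bundle_iso.AB[OF g'(2)] .
      finally have hgc: "h = g * scalar2 c" using c bundle_hom_dim[OF hh] by simp
      have "c \<noteq> 0"
      proof
        assume "c = 0"
        hence h0: "h = 0\<^sub>m 2 2" using hgc dg by (simp add: scalar2_def flip: zero_mat2)
        obtain h' where h': "h' \<in> bundle_hom 2 ?L 2 ?L" "h * h' = 1\<^sub>m 2" using h(1) unfolding bundle_aut_def by blast
        have "(0\<^sub>m 2 2 :: 'k ratfun mat) = 1\<^sub>m 2" using h'(2) bundle_hom_dim[OF h'(1)] unfolding h0 by simp
        thus False by (simp add: zero_mat2 one_mat2)
      qed
      thus "h \<in> (\<lambda>c. g * scalar2 c) ` (UNIV - {0})" using hgc by blast
    next
      fix h assume "h \<in> (\<lambda>c. g * scalar2 c) ` (UNIV - {0})"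
      then obtain c where c: "c \<noteq> 0" "h = g * scalar2 c" by blast
      have "flag_map D ?L ?L g (flag_map D ?L ?L (scalar2 c) E) = flag_map D ?L ?L h E"
        unfolding c(2) by (rule flag_map_comp[OF ok ok ok scalar2_hom[OF ok] hg(1)])
      thus "h \<in> {h \<in> bundle_aut 2 ?L. flag_action D ?L h E = flag_action D ?L g E}"
        using bundle_aut_mult[OF ok g sc[OF c(1)]] c(2)
        by (simp add: flag_map_scalar[OF ok Ef c(1)] flag_action_alt)
    qed
    moreover have "inj_on (\<lambda>c. g * scalar2 c) (UNIV - {0})"
    proof (rule inj_onI)
      fix c d assume "g * scalar2 c = g * scalar2 d"
      hence "g' * (g * scalar2 c) = g' * (g * scalar2 d)" by simp
      hence "(g' * g) * scalar2 c = (g' * g) * scalar2 d"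
        using dg sd by (simp add: assoc_mult_mat[of _ 2 2 _ 2 _ 2])
      hence "scalar2 c = scalar2 d"
        unfolding bundle_iso.BA[OF g'(2)] left_mult_one_mat[OF sd] .
      thus "c = d" by (simp add: scalar2_def)
    qed
    ultimately show "card {h \<in> bundle_aut 2 ?L. flag_action D ?L h E = flag_action D ?L g E} = card (UNIV :: 'k set) - 1"
      by (simp add: card_image)
  qed
  thus ?thesis by (simp add: cardGI)
qed

section \<open>Counting bricks on unbalanced bundles\<close>

text \<open>Evaluation of sections on \<open>I\<close> is onto for degree at most e + 1 and
  injective for degree at least e + 1. At degree e + 1 it is bijective and no brick is left, in
  accordance with the value 0 of the formula.\<close>

lemma card_bricks_support:
  fixes D :: "'k :: {field, finite} closed_pt set"
  assumes fin: "finite D" and e: "e > 0" and I: "I \<subseteq> D"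
  shows "int (card {u \<in> PiE D codes. {x \<in> D. u x \<noteq> None} = I \<and> brick e D u}) =
    (if deg_sum I \<ge> nat e + 1 then int (card (UNIV :: 'k set)) ^ deg_sum I - int (card (UNIV :: 'k set)) ^ (nat e + 1) else 0)"
proof -
  let ?q = "card (UNIV :: 'k set)"
  \<comment> \<open>The tuples of values of sections: these are the ones split by a shear, hence
    never bricks.\<close>
  define W where "W = (\<lambda>f. \<lambda>x\<in>I. evs e (pick x) (pac f)) ` (polys_upto e :: 'k poly set)"
  define Br where "Br = {u \<in> PiE D codes. {x \<in> D. u x \<noteq> None} = I \<and> brick e D u}"
  let ?emb = "\<lambda>z. \<lambda>x\<in>D. if x \<in> I then Some (z x) else None"
  have finI: "finite I" using fin I finite_subset by blast
  have Wsub: "W \<subseteq> PiE I resf" by (auto simp: W_def intro!: evs_in_resf)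
  have br: "brick e D (?emb z) \<longleftrightarrow> (\<forall>c1 f. f \<in> polys_upto e \<and> (\<forall>x\<in>I. to_ac c1 * z x + evs e (pick x) (pac f) = 0) \<longrightarrow> c1 = 0 \<and> f = 0)" for z
  proof -
    have "(\<forall>x\<in>D. qcond e (pick x) (?emb z x) (to_ac 0) (to_ac c1) (pac f)) \<longleftrightarrow>
       (\<forall>x\<in>I. to_ac c1 * z x + evs e (pick x) (pac f) = 0)" for c1 f
      using I by (auto simp: qcond_def split: if_splits)
    thus ?thesis unfolding brick_def using e by auto
  qed
  have image: "Br = ?emb ` {z \<in> PiE I resf. brick e D (?emb z)}"
  proof (intro equalityI subsetI)
    fix u assume u: "u \<in> Br"
    define z where "z = (\<lambda>x\<in>I. the (u x))"
    have "?emb z x = u x" for x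
    proof (cases "x \<in> D")
      case True
      thus ?thesis using u by (auto simp: Br_def z_def)
    next
      case False
      thus ?thesis using u by (auto simp: Br_def PiE_def extensional_def)
    qed
    hence uz: "u = ?emb z" by auto
    moreover have "z \<in> PiE I resf" using u I by (fastforce simp: Br_def z_def codes_def PiE_iff)
    ultimately show "u \<in> ?emb ` {z \<in> PiE I resf. brick e D (?emb z)}" using u by (auto simp: Br_def)
  next
    fix u assume "u \<in> ?emb ` {z \<in> PiE I resf. brick e D (?emb z)}"
    thus "u \<in> Br" using I by (auto simp: Br_def codes_def PiE_iff split: if_splits)
  qed
  have inj: "inj_on ?emb {z \<in> PiE I resf. brick e D (?emb z)}"
  proof (rule inj_onI)
    fix z z' assume z: "z \<in> {z \<in> PiE I resf. brick e D (?emb z)}" "z' \<in> {z \<in> PiE I resf. brick e D (?emb z)}" "?emb z = ?emb z'"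
    have "z x = z' x" if "x \<in> I" for x using fun_cong[OF z(3), of x] that I by auto
    thus "z = z'" using z(1,2) by (intro PiE_ext[of z I resf z']) auto
  qed
  have cardBr: "card Br = card {z \<in> PiE I resf. brick e D (?emb z)}"
    unfolding image by (rule card_image[OF inj])
  have inW: "\<not> brick e D (?emb z)" if "z \<in> W" for z
  proof -
    from that obtain f where f: "f \<in> polys_upto e" "z = (\<lambda>x\<in>I. evs e (pick x) (pac f))" unfolding W_def by blast
    have "\<forall>x\<in>I. to_ac 1 * z x + evs e (pick x) (pac (- f)) = 0"
      using f by (simp add: pac_uminus evs_uminus pac_polys_upto)
    thus ?thesis unfolding br using polys_upto_uminus[OF f(1)] zero_neq_one[where 'a = 'k] by metis
  qed
  show ?thesis
  proof (cases "deg_sum I \<ge> nat e + 1")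
    case False
    have "PiE I resf \<subseteq> W"
    proof
      fix z assume z: "z \<in> PiE I resf"
      obtain f where f: "f \<in> polys_upto e" "\<And>x. x \<in> I \<Longrightarrow> evs e (pick x) (pac f) = z x"
        using interpolation[OF finI, of e z] e False z by auto
      hence "z = (\<lambda>x\<in>I. evs e (pick x) (pac f))" using z by (auto simp: PiE_def extensional_def)
      thus "z \<in> W" unfolding W_def using f(1) by blast
    qed
    hence "{z \<in> PiE I resf. brick e D (?emb z)} = {}" using inW by blast
    hence "card Br = 0" unfolding cardBr by (simp only: card.empty)
    thus ?thesis using False unfolding Br_def by simp
  next
    case True
    have van: "f = 0" if "f \<in> polys_upto e" "\<And>x. x \<in> I \<Longrightarrow> evs e (pick x) (pac f) = 0" for f :: "'k poly"
      using vanishing_section_eq_0[OF finI that(1) _ that(2)] e True by simp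
    have "brick e D (?emb z)" if z: "z \<in> PiE I resf" "z \<notin> W" for z
      unfolding br
    proof (intro allI impI)
      fix c1 f assume cf: "f \<in> polys_upto e \<and> (\<forall>x\<in>I. to_ac c1 * z x + evs e (pick x) (pac f) = 0)"
      have "c1 = 0"
      proof (rule ccontr)
        assume c: "c1 \<noteq> 0"
        let ?g = "Polynomial.smult (- 1 / c1) f"
        have "z x = evs e (pick x) (pac ?g)" if "x \<in> I" for x
        proof -
          have "to_ac c1 * z x = - evs e (pick x) (pac f)" using cf that by (simp add: eq_neg_iff_add_eq_0)
          hence "z x = - evs e (pick x) (pac f) / to_ac c1" using c by (simp add: field_simps)
          moreover have "pac f \<in> polys_upto e" using cf by (simp add: pac_polys_upto)
          ultimately show ?thesis by (simp only: pac_smult evs_smult) simp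
        qed
        hence "z = (\<lambda>x\<in>I. evs e (pick x) (pac ?g))" using z(1) by (auto simp: PiE_def extensional_def)
        hence "z \<in> W" unfolding W_def using cf polys_upto_smult by blast
        thus False using z(2) by contradiction
      qed
      thus "c1 = 0 \<and> f = 0" using cf van[of f] by simp
    qed
    hence "{z \<in> PiE I resf. brick e D (?emb z)} = PiE I resf - W" using inW by blast
    moreover have "inj_on (\<lambda>f. \<lambda>x\<in>I. evs e (pick x) (pac f)) (polys_upto e :: 'k poly set)"
    proof (rule inj_onI)
      fix f g :: "'k poly" assume fg: "f \<in> polys_upto e" "g \<in> polys_upto e"
        "(\<lambda>x\<in>I. evs e (pick x) (pac f)) = (\<lambda>x\<in>I. evs e (pick x) (pac g))"
      have "evs e (pick x) (pac f) = evs e (pick x) (pac g)" if "x \<in> I" for x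
        using fun_cong[OF fg(3), of x] that by simp
      hence "evs e (pick x) (pac (f - g)) = 0" if "x \<in> I" for x
        using that fg(1,2) by (simp add: pac_diff evs_diff pac_polys_upto)
      hence "f - g = 0" using fg by (intro van polys_upto_diff)
      thus "f = g" by simp
    qed
    hence "card W = ?q ^ (nat e + 1)"
      unfolding W_def using e by (simp add: card_image polys_upto_finite_card nat_add_distrib)
    moreover have "finite (PiE I resf)" "card (PiE I resf) = ?q ^ deg_sum I" using card_PiE_resf[OF finI] by auto
    moreover from this have "card W \<le> card (PiE I resf)" using Wsub by (intro card_mono)
    ultimately have "int (card Br) = int (?q ^ deg_sum I) - int (?q ^ (nat e + 1))"
      unfolding cardBr using Wsub finite_subset[OF Wsub]
      by (simp only: card_Diff_subset of_nat_diff)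
    thus ?thesis using True unfolding Br_def by simp
  qed
qed

lemma card_bricks_pos:
  fixes D :: "'k :: {field, finite} closed_pt set"
  assumes fin: "finite D" and e: "e > 0"
  shows "int (card {u \<in> PiE D codes. brick e D u}) = (\<Sum>I\<in>Pow D.
    if deg_sum I \<ge> nat e + 1 then int (card (UNIV :: 'k set)) ^ deg_sum I - int (card (UNIV :: 'k set)) ^ (nat e + 1) else 0)"
proof -
  let ?Br = "{u \<in> PiE D codes. brick e D u}"
  have "finite (PiE D codes)" using fin finite_codes by (intro finite_PiE) auto
  hence finBr: "finite ?Br" by simp
  have "int (card ?Br) = (\<Sum>u\<in>?Br. 1)" by simp
  also have "\<dots> = (\<Sum>I\<in>Pow D. \<Sum>u\<in>{u \<in> ?Br. {x \<in> D. u x \<noteq> None} = I}. 1)"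
    using finBr fin by (intro sum.group[symmetric]) auto
  also have "\<dots> = (\<Sum>I\<in>Pow D. int (card {u \<in> PiE D codes. {x \<in> D. u x \<noteq> None} = I \<and> brick e D u}))"
    by (intro sum.cong refl) (auto intro!: arg_cong[where f = card])
  finally show ?thesis using card_bricks_support[OF fin e] by simp
qed

section \<open>Counting bricks on balanced bundles\<close>

text \<open>In the factorisation into linear factors a root occurring twice would also be a root of
  the derivative.\<close>

lemma card_roots_separable:
  fixes p :: "'c :: alg_closed_field poly"
  assumes "p \<noteq> 0" and sep: "\<And>z. poly p z = 0 \<Longrightarrow> poly (pderiv p) z \<noteq> 0"
  shows "card {z. poly p z = 0} = Polynomial.degree p"
proof -
  define c where "c = lead_coeff p"
  from alg_closed_imp_factorization[OF assms(1), folded c_def] obtain M where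
    "size M = Polynomial.degree p \<and> p = Polynomial.smult c (\<Prod>x\<in>#M. [:-x, 1:])" ..
  hence M: "size M = Polynomial.degree p" "p = Polynomial.smult c (\<Prod>x\<in>#M. [:-x, 1:])" by (rule conjunct1, rule conjunct2)
  have lc: "c \<noteq> 0" using assms(1) by (simp add: c_def)
  have "poly p z = c * (\<Prod>x\<in>#M. z - x)" for z
    using arg_cong[OF M(2), of "\<lambda>p. poly p z"] by (simp only: poly_smult poly_prod_mset) (simp add: image_mset.compositionality o_def)
  hence roots: "{z. poly p z = 0} = set_mset M" using lc by (auto simp: prod_mset_zero_iff)
  have "count M z = 1" if "z \<in># M" for z
  proof (rule ccontr)
    assume "count M z \<noteq> 1"
    moreover have "count M z \<ge> 1" using that by (simp add: Suc_le_eq)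
    ultimately have "count M z \<ge> 2" by linarith
    hence "replicate_mset 2 z \<subseteq># M" by (simp add: count_le_replicate_mset_subset_eq)
    then obtain N where "M = replicate_mset 2 z + N" by (metis subset_mset.add_diff_inverse)
    hence "M = {#z#} + ({#z#} + N)" by (simp add: numeral_2_eq_2)
    hence "(\<Prod>x\<in>#M. [:-x, 1:]) = [:-z, 1:] * ([:-z, 1:] * (\<Prod>x\<in>#N. [:-x, 1:]))"
      by (simp only: image_mset_union prod_mset_Un image_mset_single prod_mset_singleton)
    hence "p = [:-z, 1:] * ([:-z, 1:] * Polynomial.smult c (\<Prod>x\<in>#N. [:-x, 1:]))"
      using M(2) by (simp only: mult_smult_right)
    then obtain r where r: "p = [:-z, 1:] * ([:-z, 1:] * r)" by blast
    have lin: "poly [:-z, 1:] z = 0" by simp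
    have "poly p z = 0" "poly (pderiv p) z = 0"
      unfolding r pderiv_mult poly_mult poly_add lin by simp_all
    thus False using sep by blast
  qed
  hence "size M = card (set_mset M)" by (simp add: size_multiset_overloaded_eq)
  thus ?thesis using M(1) roots by simp
qed

lemma of_nat_card_eq_0: "of_nat (card (UNIV :: 'k :: {field, finite} set)) = (0 :: 'k alg_closure)"
proof -
  have "of_nat (card (UNIV :: 'k set)) = (0 :: 'k)"
    using binomial_card_eq_0[where 'k = 'k, of 1] card_UNIV_ge_2[where 'k = 'k] by simp
  hence "to_ac (of_nat (card (UNIV :: 'k set)) :: 'k) = 0" by simp
  thus ?thesis by simp
qed

lemma frob_funpow: "(frob ^^ n) (z :: 'k :: {field, finite} alg_closure) = z ^ (card (UNIV :: 'k set) ^ n)"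
proof (induction n)
  case (Suc n)
  have "(frob ^^ Suc n) z = frob (z ^ (card (UNIV :: 'k set) ^ n))" by (simp only: funpow.simps o_apply Suc)
  also have "\<dots> = z ^ (card (UNIV :: 'k set) ^ Suc n)" by (simp add: frob_def mult.commute flip: power_mult)
  finally show ?case .
qed simp

lemma degree_monom_diff_linear:
  assumes "n \<ge> 2"
  shows "Polynomial.degree (Polynomial.monom 1 n - Polynomial.monom 1 1 :: 'a :: field poly) = n"
proof (rule antisym)
  show "Polynomial.degree (Polynomial.monom 1 n - Polynomial.monom 1 1 :: 'a poly) \<le> n"
    using assms by (intro degree_diff_le) (auto simp: degree_monom_eq)
  show "n \<le> Polynomial.degree (Polynomial.monom 1 n - Polynomial.monom 1 1 :: 'a poly)"
    using assms by (intro le_degree) simp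
qed

lemma card_frob2_fixed:
  "finite {z :: 'k :: {field, finite} alg_closure. frob (frob z) = z}"
  "card {z :: 'k alg_closure. frob (frob z) = z} = (card (UNIV :: 'k set))\<^sup>2"
proof -
  let ?q = "card (UNIV :: 'k set)"
  let ?p = "Polynomial.monom 1 (?q\<^sup>2) - Polynomial.monom 1 1 :: 'k alg_closure poly"
  have q2: "?q \<ge> 2" by (rule card_UNIV_ge_2)
  have q4: "?q\<^sup>2 \<ge> 2" using mult_le_mono[OF q2 q2] by (simp add: power2_eq_square)
  have p: "Polynomial.degree ?p = ?q\<^sup>2"
    by (rule degree_monom_diff_linear[OF q4])
  \<comment> \<open>The exponent q^2 is zero in characteristic p, so only the linear term
    contributes.\<close>
  have "poly (pderiv ?p) z = - 1" for z
    by (simp add: pderiv_diff pderiv_monom poly_monom of_nat_card_eq_0 power2_eq_square)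
  moreover have "?p \<noteq> 0" using p q4 by auto
  ultimately have "card {z. poly ?p z = 0} = ?q\<^sup>2" using card_roots_separable[of ?p] p by simp
  moreover have eq: "{z. poly ?p z = 0} = {z :: 'k alg_closure. frob (frob z) = z}"
  proof (rule Collect_cong)
    fix z :: "'k alg_closure"
    have "frob (frob z) = z ^ ?q\<^sup>2" by (simp add: frob_def power2_eq_square power_mult)
    thus "poly ?p z = 0 \<longleftrightarrow> frob (frob z) = z" by (simp add: poly_monom)
  qed
  ultimately show "card {z :: 'k alg_closure. frob (frob z) = z} = ?q\<^sup>2" by simp
  show "finite {z :: 'k alg_closure. frob (frob z) = z}"
    unfolding eq[symmetric] by (rule poly_roots_finite[OF \<open>?p \<noteq> 0\<close>])
qed

text \<open>Elements of the residue field are roots of X^(q^n) - X with n the degree of the point,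
  and there are already q^n of them.\<close>

lemma resf_iff_frob: "z \<in> resf x \<longleftrightarrow> (frob ^^ pt_degree x) z = (z :: 'k :: {field, finite} alg_closure)"
proof -
  let ?n = "card (UNIV :: 'k set) ^ pt_degree x"
  let ?p = "Polynomial.monom 1 ?n - Polynomial.monom 1 1 :: 'k alg_closure poly"
  have "card (UNIV :: 'k set) ^ 1 \<le> ?n"
    using pt_degree_pos[of x] card_UNIV_ge_2[where 'k = 'k] by (intro power_increasing) auto
  hence n: "?n \<ge> 2" using card_UNIV_ge_2[where 'k = 'k] by simp
  have "Polynomial.degree ?p = ?n" by (rule degree_monom_diff_linear[OF n])
  hence p: "?p \<noteq> 0" "Polynomial.degree ?p = ?n" using n by auto
  have sub: "resf x \<subseteq> {z. poly ?p z = 0}"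
  proof
    fix z assume z: "z \<in> resf x"
    have "z ^ card (resf x) = z"
    proof (rule finite_mult_closed_power_card[OF card_resf(1) _ _ z])
      show "0 \<in> resf x" using to_ac_in_resf[of 0 x] by simp
      show "u * v \<in> resf x" if uv: "u \<in> resf x" "v \<in> resf x" for u v
      proof -
        obtain h h' where h: "h \<in> local_ring x" "h' \<in> local_ring x" "u = kres (pick x) h" "v = kres (pick x) h'"
          using uv unfolding resf_def image_iff by (elim bexE)
        hence "u * v = kres (pick x) (h * h')" using kres_mult[of h "pick x" h'] by simp
        thus ?thesis unfolding resf_def using local_ring_mult[OF h(1,2)] by blast
      qed
    qed
    thus "z \<in> {z. poly ?p z = 0}" by (simp add: card_resf poly_monom)
  qed
  have fin: "finite {z. poly ?p z = 0}" by (rule poly_roots_finite[OF p(1)])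
  have "card {z. poly ?p z = 0} \<le> ?n" using card_poly_roots_bound[OF p(1)] p(2) by simp
  hence "card (resf x) = card {z. poly ?p z = 0}"
    using card_mono[OF fin sub] by (simp add: card_resf)
  hence "resf x = {z. poly ?p z = 0}" by (rule card_subset_eq[OF fin sub])
  thus ?thesis by (simp add: frob_funpow poly_monom)
qed

section \<open>Tuples with values in two rational points or in a conjugate pair\<close>

definition rat_pts :: "'k :: {field, finite} alg_closure option set" where
  "rat_pts = insert None (Some ` range to_ac)"

lemma rat_pts_codes: "rat_pts \<subseteq> codes x"
  by (auto simp: rat_pts_def codes_def to_ac_in_resf)

lemma card_rat_pts:
  "finite (rat_pts :: 'k :: {field, finite} alg_closure option set)"
  "card (rat_pts :: 'k alg_closure option set) = card (UNIV :: 'k set) + 1"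
proof -
  have "card (Some ` range to_ac :: 'k alg_closure option set) = card (UNIV :: 'k set)"
    by (simp add: card_image inj_to_ac)
  thus "finite (rat_pts :: 'k alg_closure option set)"
    "card (rat_pts :: 'k alg_closure option set) = card (UNIV :: 'k set) + 1"
    by (auto simp: rat_pts_def)
qed

lemma Some_rat_pts: "Some z \<in> rat_pts \<longleftrightarrow> frob z = z"
  by (auto simp: rat_pts_def frob_fixed_iff)

text \<open>The elements of the quadratic extension of the ground field that are not in the ground
  field.\<close>

definition conj_pts :: "'k :: {field, finite} alg_closure set" where
  "conj_pts = {z. frob (frob z) = z \<and> frob z \<noteq> z}"

lemma frob_conj_pts: "z \<in> conj_pts \<Longrightarrow> frob z \<in> conj_pts"
  by (auto simp: conj_pts_def)

text \<open>The pair of z and \<open>frob z\<close> is symmetric, so its first member can be taken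
  to be the value at a prescribed point.\<close>

lemma conj_pts_pair:
  assumes "\<exists>z\<in>conj_pts. \<forall>x\<in>D. u x = Some z \<or> u x = Some (frob z)" "x \<in> D"
  obtains w where "w \<in> conj_pts" "u x = Some w" "\<forall>y\<in>D. u y = Some w \<or> u y = Some (frob w)"
proof -
  obtain z where z: "z \<in> conj_pts" "\<forall>y\<in>D. u y = Some z \<or> u y = Some (frob z)" using assms(1) by blast
  have ff: "frob (frob z) = z" using z(1) by (simp add: conj_pts_def)
  from z(2) assms(2) have "u x = Some z \<or> u x = Some (frob z)" by blast
  thus ?thesis
  proof
    assume "u x = Some z" thus ?thesis using that[of z] z by blast
  next
    assume "u x = Some (frob z)"
    moreover have "\<forall>y\<in>D. u y = Some (frob z) \<or> u y = Some (frob (frob z))" using z(2) unfolding ff by blast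
    ultimately show ?thesis using that[OF frob_conj_pts[OF z(1)]] by blast
  qed
qed

lemma card_conj_pts:
  "finite (conj_pts :: 'k :: {field, finite} alg_closure set)"
  "int (card (conj_pts :: 'k alg_closure set)) = (int (card (UNIV :: 'k set)))\<^sup>2 - int (card (UNIV :: 'k set))"
proof -
  let ?F = "{z :: 'k alg_closure. frob (frob z) = z}"
  have eq: "conj_pts = ?F - range to_ac" by (auto simp: conj_pts_def frob_fixed_iff[symmetric])
  have sub: "range to_ac \<subseteq> ?F" by auto
  show "finite (conj_pts :: 'k alg_closure set)" unfolding eq using card_frob2_fixed(1) by simp
  have "card (range (to_ac :: 'k \<Rightarrow> _)) \<le> card ?F" by (rule card_mono[OF card_frob2_fixed(1) sub])
  thus "int (card (conj_pts :: 'k alg_closure set)) = (int (card (UNIV :: 'k set)))\<^sup>2 - int (card (UNIV :: 'k set))"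
    unfolding eq by (simp add: card_Diff_subset[OF _ sub] of_nat_diff card_frob2_fixed card_image inj_to_ac)
qed

lemma evs_const: "evs 0 y (pac [:c:]) = to_ac c"
  using const_def[of "to_ac c"] resid_const[of y "to_ac c"] by (simp add: evs_def map_poly_pCons)

text \<open>The points killed by a non-zero binary quadratic form over the ground field are either at most
  two rational points or a pair of conjugate quadratic points.\<close>

lemma not_brick_0_iff:
  fixes u :: "'k :: {field, finite} closed_pt \<Rightarrow> 'k alg_closure option"
  shows "\<not> brick 0 D u \<longleftrightarrow> (\<exists>l\<in>rat_pts. \<exists>l'\<in>rat_pts. \<forall>x\<in>D. u x = l \<or> u x = l') \<or>
    (\<exists>z\<in>conj_pts. \<forall>x\<in>D. u x = Some z \<or> u x = Some (frob z))" (is "_ \<longleftrightarrow> ?R")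
proof
  assume "\<not> brick 0 D u"
  then obtain c2 c1 f where f: "f \<in> polys_upto 0" "\<forall>x\<in>D. qcond 0 (pick x) (u x) (to_ac c2) (to_ac c1) (pac f)"
    "\<not> (c2 = 0 \<and> c1 = 0 \<and> f = 0)" unfolding brick_def by blast
  have "Polynomial.degree f = 0" using f(1) by (auto simp: polys_upto_def)
  then obtain c0 where c0: "f = [:c0:]" by (rule degree_eq_zeroE)
  let ?A = "to_ac c2" and ?B = "to_ac c1" and ?C = "to_ac c0"
  have q: "case u x of None \<Rightarrow> ?A = 0 | Some z \<Rightarrow> ?A * z\<^sup>2 + ?B * z + ?C = 0" if "x \<in> D" for x
    using f(2) that unfolding qcond_def c0 evs_const by blast
  consider "c2 \<noteq> 0" | "c2 = 0" "c1 \<noteq> 0" | "c2 = 0" "c1 = 0" "c0 \<noteq> 0" using f(3) c0 by auto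
  thus ?R
  proof cases
    case 1
    hence A: "?A \<noteq> 0" by simp
    obtain z1 z2 where fac: "\<And>z. ?A * z\<^sup>2 + ?B * z + ?C = ?A * ((z - z1) * (z - z2))" "z2 = - ?B / ?A - z1"
      using quadratic_factorization[OF A] by blast
    have u: "u x = Some z1 \<or> u x = Some z2" if "x \<in> D" for x
      using q[OF that] A fac(1) by (cases "u x") auto
    \<comment> \<open>The quadratic equation has coefficients in the ground field, so Frobenius
      permutes its roots.\<close>
    have fr: "frob z = z1 \<or> frob z = z2" if "z = z1 \<or> z = z2" for z
    proof -
      have "?A * z\<^sup>2 + ?B * z + ?C = 0" using fac(1)[of z] that by auto
      hence "frob (?A * z\<^sup>2 + ?B * z + ?C) = 0" by simp
      hence "?A * (frob z)\<^sup>2 + ?B * frob z + ?C = 0" by (simp add: frob_add frob_mult frob_power)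
      thus ?thesis using fac(1)[of "frob z"] A by simp
    qed
    show ?R
    proof (cases "frob z1 = z1")
      case True
      \<comment> \<open>The second root is -B / A minus the first, a difference of two rational
        elements.\<close>
      hence "frob z2 = z2" using fac(2) by (simp add: frob_diff frob_minus frob_divide)
      hence "Some z1 \<in> rat_pts" "Some z2 \<in> rat_pts" using True by (auto simp: Some_rat_pts)
      thus ?thesis using u by blast
    next
      case False
      hence z12: "frob z1 = z2" using fr[of z1] by auto
      hence "frob z2 \<noteq> z2" using False by (metis frob_eq_iff)
      hence "frob z2 = z1" using fr[of z2] by auto
      hence "z1 \<in> conj_pts" using z12 False by (simp add: conj_pts_def)
      thus ?thesis using u z12 by blast
    qed
  next
    case 2
    have "u x = None \<or> u x = Some (to_ac (- c0 / c1))" if "x \<in> D" for x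
    proof (cases "u x")
      case (Some z)
      hence "?B * z + ?C = 0" using q[OF that] 2 by simp
      hence "z * ?B = - ?C" by (simp add: eq_neg_iff_add_eq_0 mult.commute)
      moreover have "?B \<noteq> 0" using 2 by simp
      ultimately have "z = - ?C / ?B" by (metis nonzero_eq_divide_eq)
      thus ?thesis using Some by simp
    qed simp
    moreover have "None \<in> rat_pts" "Some (to_ac (- c0 / c1)) \<in> rat_pts" unfolding rat_pts_def by blast+
    ultimately show ?R by blast
  next
    case 3
    have "u x = None" if "x \<in> D" for x using q[OF that] 3 by (cases "u x") auto
    moreover have "None \<in> (rat_pts :: 'k alg_closure option set)" by (simp add: rat_pts_def)
    ultimately show ?R by blast
  qed
next
  have nb: "\<not> brick 0 D u" if "\<forall>x\<in>D. case u x of None \<Rightarrow> to_ac c2 = 0 | Some z \<Rightarrow> to_ac c2 * z\<^sup>2 + to_ac c1 * z + to_ac c0 = 0"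
     "\<not> (c2 = 0 \<and> c1 = 0 \<and> c0 = 0)" for c2 c1 c0
  proof -
    have "[:c0:] \<in> polys_upto 0" by (simp add: polys_upto_def)
    moreover have "\<forall>x\<in>D. qcond 0 (pick x) (u x) (to_ac c2) (to_ac c1) (pac [:c0:])"
      using that(1) unfolding qcond_def evs_const .
    moreover have "\<not> (c2 = 0 \<and> c1 = 0 \<and> [:c0:] = 0)" using that(2) by simp
    ultimately show ?thesis unfolding brick_def by blast
  qed
  \<comment> \<open>The form with roots z and z' has their sum and product as coefficients; when
    these are fixed by Frobenius it is defined over the ground field.\<close>
  have split: "\<not> brick 0 D u" if z: "\<forall>x\<in>D. u x = Some z \<or> u x = Some z'" "frob (z + z') = z + z'" "frob (z * z') = z * z'" for z z'
  proof -
    have "z + z' \<in> range to_ac" "z * z' \<in> range to_ac" using z(2,3) by (simp_all add: frob_fixed_iff)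
    then obtain s n where sn: "z + z' = to_ac s" "z * z' = to_ac n" by auto
    have "to_ac 1 * t\<^sup>2 + to_ac (- s) * t + to_ac n = (t - z) * (t - z')" for t
      by (simp add: sn[symmetric] algebra_simps power2_eq_square)
    hence "\<forall>x\<in>D. case u x of None \<Rightarrow> to_ac 1 = 0 | Some t \<Rightarrow> to_ac 1 * t\<^sup>2 + to_ac (- s) * t + to_ac n = 0"
      using z(1) by auto
    thus ?thesis by (rule nb) simp
  qed
  assume ?R
  thus "\<not> brick 0 D u"
  proof
    assume "\<exists>z\<in>conj_pts. \<forall>x\<in>D. u x = Some z \<or> u x = Some (frob z)"
    then obtain z where "z \<in> conj_pts" "\<forall>x\<in>D. u x = Some z \<or> u x = Some (frob z)" by blast
    thus ?thesis using split[of z "frob z"] by (auto simp: conj_pts_def frob_add frob_mult add.commute mult.commute)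
  next
    assume "\<exists>l\<in>rat_pts. \<exists>l'\<in>rat_pts. \<forall>x\<in>D. u x = l \<or> u x = l'"
    then obtain l l' where l: "l \<in> rat_pts" "l' \<in> rat_pts" "\<forall>x\<in>D. u x = l \<or> u x = l'" by blast
    \<comment> \<open>When one of the points is infinity the quadratic form degenerates to the
      linear condition t = r on the remaining values.\<close>
    have mixed: ?thesis if z: "\<forall>x\<in>D. u x = None \<or> u x = Some z" "Some z \<in> rat_pts" for z
    proof -
      obtain r where "z = to_ac r" using z(2) by (auto simp: rat_pts_def)
      hence "\<forall>x\<in>D. case u x of None \<Rightarrow> to_ac 0 = 0 | Some t \<Rightarrow> to_ac 0 * t\<^sup>2 + to_ac 1 * t + to_ac (- r) = 0"
        using z(1) by auto
      thus ?thesis by (rule nb) simp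
    qed
    have zero: "Some 0 \<in> rat_pts" by (simp add: Some_rat_pts)
    show ?thesis
    proof (cases l; cases l')
      fix z z' assume "l = Some z" "l' = Some z'"
      thus ?thesis using l split[of z z'] by (simp add: Some_rat_pts frob_add frob_mult)
    qed (use l mixed[of 0] zero mixed in \<open>auto simp: disj_commute\<close>)
  qed
qed

text \<open>A tuple is determined by its value at the base point \<open>x0\<close>, the other value,
  and the set \<open>J\<close> of points, not containing \<open>x0\<close>, where the other value is
  taken. The first summand counts the constant tuples, for which the other value would be
  ambiguous.\<close>

lemma card_two_rational_codes:
  fixes D :: "'k :: {field, finite} closed_pt set"
  defines "q \<equiv> int (card (UNIV :: 'k set))"
  assumes fin: "finite D" and x0: "x0 \<in> D"
  shows "int (card {u \<in> PiE D codes. \<exists>l\<in>rat_pts. \<exists>l'\<in>rat_pts. \<forall>x\<in>D. u x = l \<or> u x = l'}) =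
    (q + 1) + (q + 1) * q * (2 ^ (card D - 1) - 1)"
proof -
  let ?P = "rat_pts :: 'k alg_closure option set"
  let ?A = "{u \<in> PiE D codes. \<exists>l\<in>?P. \<exists>l'\<in>?P. \<forall>x\<in>D. u x = l \<or> u x = l'}"
  define D' where "D' = D - {x0}"
  define \<Phi> where "\<Phi> = (\<lambda>((l, l'), J). \<lambda>x\<in>D. if x \<in> J then l' else (l :: 'k alg_closure option))"
  define O2 where "O2 = ?P \<times> ?P - (\<lambda>l. (l, l)) ` ?P"
  \<comment> \<open>Constant tuples are listed once, with empty \<open>J\<close>; in
    \<open>Q2\<close> the two values differ and \<open>J\<close> is non-empty.\<close>
  define Q1 where "Q1 = (\<lambda>l. ((l, l), {} :: 'k closed_pt set)) ` ?P"
  define Q2 where "Q2 = O2 \<times> (Pow D' - {{}})"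
  have finD': "finite D'" using fin by (simp add: D'_def)
  have cD': "card D' = card D - 1" using fin x0 by (simp add: D'_def)
  have "?A = \<Phi> ` (Q1 \<union> Q2)"
  proof (intro equalityI subsetI)
    fix u assume "u \<in> ?A"
    then obtain l l' where u: "u \<in> PiE D codes" "l \<in> ?P" "l' \<in> ?P" "\<forall>x\<in>D. u x = l \<or> u x = l'" by blast
    define J where "J = {x \<in> D. u x \<noteq> u x0}"
    define m where "m = (if u x0 = l then l' else l)"
    have m: "u x0 \<in> ?P" "m \<in> ?P" "\<forall>x\<in>J. u x = m" using u x0 by (auto simp: m_def J_def)
    have JD: "J \<subseteq> D'" by (auto simp: J_def D'_def)
    show "u \<in> \<Phi> ` (Q1 \<union> Q2)"
    proof (cases "J = {}")
      case True
      have "u = \<Phi> ((u x0, u x0), {})"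
        using u(1) True by (auto simp: \<Phi>_def J_def fun_eq_iff PiE_def extensional_def)
      thus ?thesis using m(1) by (intro image_eqI) (auto simp: Q1_def)
    next
      case False
      then obtain x where x: "x \<in> J" by blast
      hence "u x \<noteq> u x0" by (simp add: J_def)
      moreover have "u x = m" using m(3) x by blast
      ultimately have "u x0 \<noteq> m" by simp
      hence "((u x0, m), J) \<in> Q2" using m JD False by (auto simp: Q2_def O2_def)
      moreover have "u = \<Phi> ((u x0, m), J)"
      proof
        fix x
        have "x \<notin> D \<Longrightarrow> u x = undefined" using u(1) by (auto simp: PiE_def extensional_def)
        moreover have "x \<in> J \<Longrightarrow> u x = m" using m(3) by blast
        moreover have "x \<in> J \<longleftrightarrow> x \<in> D \<and> u x \<noteq> u x0" by (simp add: J_def)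
        ultimately show "u x = \<Phi> ((u x0, m), J) x" by (simp add: \<Phi>_def)
      qed
      ultimately show ?thesis by blast
    qed
  next
    fix u assume "u \<in> \<Phi> ` (Q1 \<union> Q2)"
    then obtain l l' J where u: "u = \<Phi> ((l, l'), J)" "l \<in> ?P" "l' \<in> ?P" by (auto simp: Q1_def Q2_def O2_def)
    have "u \<in> PiE D codes" using subsetD[OF rat_pts_codes u(2)] subsetD[OF rat_pts_codes u(3)] unfolding u(1) \<Phi>_def by auto
    moreover have "\<forall>x\<in>D. u x = l \<or> u x = l'" unfolding u(1) \<Phi>_def by auto
    ultimately show "u \<in> ?A" using u(2,3) by blast
  qed
  moreover have "inj_on \<Phi> (Q1 \<union> Q2)"
  proof (rule inj_onI)
    fix a b assume a: "a \<in> Q1 \<union> Q2" and b: "b \<in> Q1 \<union> Q2" and eq: "\<Phi> a = \<Phi> b"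
    obtain l l' J where al: "a = ((l, l'), J)" by (metis prod.collapse)
    obtain m m' K where bl: "b = ((m, m'), K)" by (metis prod.collapse)
    have J: "J \<subseteq> D'" "J = {} \<longrightarrow> l = l'" "J \<noteq> {} \<longrightarrow> l \<noteq> l'" using a by (auto simp: al Q1_def Q2_def O2_def)
    have K: "K \<subseteq> D'" "K = {} \<longrightarrow> m = m'" "K \<noteq> {} \<longrightarrow> m \<noteq> m'" using b by (auto simp: bl Q1_def Q2_def O2_def)
    have e: "(if x \<in> J then l' else l) = (if x \<in> K then m' else m)" if "x \<in> D" for x
      using fun_cong[OF eq, of x] that by (simp add: al bl \<Phi>_def)
    have "x0 \<notin> J" "x0 \<notin> K" using J(1) K(1) by (auto simp: D'_def)
    hence lm: "l = m" using e[OF x0] by simp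
    have JK: "J = K"
    proof (intro equalityI subsetI)
      fix x assume x: "x \<in> J"
      hence "x \<in> D" "l \<noteq> l'" using J by (auto simp: D'_def)
      thus "x \<in> K" using e[of x] x lm by (auto split: if_splits)
    next
      fix x assume x: "x \<in> K"
      hence "x \<in> D" "m \<noteq> m'" using K by (auto simp: D'_def)
      thus "x \<in> J" using e[of x] x lm by (auto split: if_splits)
    qed
    have "l' = m'"
    proof (cases "J = {}")
      case False
      then obtain x where "x \<in> J" by blast
      thus ?thesis using e[of x] JK J(1) by (auto simp: D'_def)
    qed (use J K JK lm in auto)
    thus "a = b" using lm JK al bl by simp
  qed
  ultimately have "card ?A = card (Q1 \<union> Q2)" by (simp add: card_image)
  also have "\<dots> = card Q1 + card Q2"
    using finD' card_rat_pts(1) by (intro card_Un_disjoint) (auto simp: Q1_def Q2_def O2_def)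
  finally have "int (card ?A) = int (card Q1) + int (card Q2)" by simp
  also have "int (card Q1) = q + 1"
    unfolding Q1_def q_def by (subst card_image) (auto simp: inj_on_def card_rat_pts)
  also have "int (card Q2) = int (card O2) * (2 ^ (card D - 1) - 1)"
    using finD' by (simp add: Q2_def card_cartesian_product card_Diff_subset card_Pow cD' of_nat_diff)
  also have "int (card O2) = (q + 1) * q"
  proof -
    have "card ((\<lambda>l. (l, l)) ` ?P) = card ?P" by (rule card_image) (auto simp: inj_on_def)
    moreover have "(\<lambda>l. (l, l)) ` ?P \<subseteq> ?P \<times> ?P" by auto
    moreover from this have "card ((\<lambda>l. (l, l)) ` ?P) \<le> card (?P \<times> ?P)"
      using card_rat_pts(1) by (intro card_mono) auto
    ultimately show ?thesis unfolding O2_def q_def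
      by (simp add: card_Diff_subset card_rat_pts card_cartesian_product of_nat_diff algebra_simps)
  qed
  finally show ?thesis .
qed

lemma frob_funpow_conj_pts:
  assumes "z \<in> conj_pts" shows "(frob ^^ n) z = (if even n then z else frob z)"
  using assms by (induction n) (auto simp: conj_pts_def)

lemma conj_pts_resf: "z \<in> conj_pts \<Longrightarrow> z \<in> resf x \<longleftrightarrow> even (pt_degree x)"
  unfolding resf_iff_frob by (subst frob_funpow_conj_pts) (auto simp: conj_pts_def)

text \<open>A quadratic element lies in the residue field of a point exactly when the degree of the
  point is even, so one point of odd degree excludes all such tuples. Otherwise a tuple is its value
  at \<open>x0\<close> together with the set of points carrying the conjugate value.\<close>

lemma card_conj_codes:
  fixes D :: "'k :: {field, finite} closed_pt set"
  defines "q \<equiv> int (card (UNIV :: 'k set))"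
  assumes fin: "finite D" and x0: "x0 \<in> D"
  shows "int (card {u \<in> PiE D codes. \<exists>z\<in>conj_pts. \<forall>x\<in>D. u x = Some z \<or> u x = Some (frob z)}) =
    (if \<forall>x\<in>D. even (pt_degree x) then (q\<^sup>2 - q) * 2 ^ (card D - 1) else 0)"
proof -
  let ?A = "{u \<in> PiE D codes. \<exists>z\<in>conj_pts. \<forall>x\<in>D. u x = Some z \<or> u x = Some (frob z)}"
  show ?thesis
  proof (cases "\<forall>x\<in>D. even (pt_degree x)")
    case False
    then obtain x where x: "x \<in> D" "odd (pt_degree x)" by blast
    have False if u: "u \<in> ?A" for u
    proof -
      obtain z where z: "z \<in> conj_pts" "u x = Some z"
        by (rule conj_pts_pair[of D u x]) (use u x(1) in auto)
      hence "Some z \<in> codes x" using u x(1) PiE_mem[of u D codes x] by auto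
      hence "z \<in> resf x" by (auto simp: codes_def)
      thus False using conj_pts_resf[OF z(1)] x(2) by simp
    qed
    hence "?A = {}" by blast
    thus ?thesis using False by (simp only: card.empty) auto
  next
    case True
    define D' where "D' = D - {x0}"
    have finD': "finite D'" using fin by (simp add: D'_def)
    have cD': "card D' = card D - 1" using fin x0 by (simp add: D'_def)
    define \<Psi> where "\<Psi> = (\<lambda>(z, J). \<lambda>x\<in>D. if x \<in> J then Some (frob z) else Some (z :: 'k alg_closure))"
    have "?A = \<Psi> ` (conj_pts \<times> Pow D')"
    proof (intro equalityI subsetI)
      fix u assume "u \<in> ?A"
      hence z: "u \<in> PiE D codes" "\<exists>z\<in>conj_pts. \<forall>x\<in>D. u x = Some z \<or> u x = Some (frob z)" by blast+
      obtain w where w: "w \<in> conj_pts" "u x0 = Some w" "\<forall>x\<in>D. u x = Some w \<or> u x = Some (frob w)"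
        by (rule conj_pts_pair[OF z(2) x0])
      define J where "J = {x \<in> D. u x \<noteq> u x0}"
      have "u = \<Psi> (w, J)"
        using z(1) w by (auto simp: \<Psi>_def J_def fun_eq_iff PiE_def extensional_def)
      moreover have "J \<subseteq> D'" by (auto simp: J_def D'_def)
      ultimately show "u \<in> \<Psi> ` (conj_pts \<times> Pow D')" using w(1) by blast
    next
      fix u assume "u \<in> \<Psi> ` (conj_pts \<times> Pow D')"
      then obtain z J where z: "u = \<Psi> (z, J)" "z \<in> conj_pts" by auto
      have "Some z \<in> codes x" "Some (frob z) \<in> codes x" if "x \<in> D" for x
        using conj_pts_resf[OF z(2)] conj_pts_resf[OF frob_conj_pts[OF z(2)]] True that by (auto simp: codes_def)
      hence "u \<in> PiE D codes" unfolding z(1) \<Psi>_def by auto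
      moreover have "\<forall>x\<in>D. u x = Some z \<or> u x = Some (frob z)" unfolding z(1) \<Psi>_def by auto
      ultimately show "u \<in> ?A" using z(2) by blast
    qed
    moreover have "inj_on \<Psi> (conj_pts \<times> Pow D')"
    proof (rule inj_onI, clarify)
      fix z w J K assume *: "z \<in> conj_pts" "w \<in> conj_pts" "J \<subseteq> D'" "K \<subseteq> D'" "\<Psi> (z, J) = \<Psi> (w, K)"
      have e: "(if x \<in> J then Some (frob z) else Some z) = (if x \<in> K then Some (frob w) else Some w)" if "x \<in> D" for x
        using fun_cong[OF *(5), of x] that by (simp add: \<Psi>_def)
      have zw: "z = w" using e[OF x0] * by (auto simp: D'_def split: if_splits)
      have "frob z \<noteq> z" using * by (simp add: conj_pts_def)
      hence "x \<in> J \<longleftrightarrow> x \<in> K" if "x \<in> D" for x using e[OF that] zw by (auto split: if_splits)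
      hence "J = K" using * by (auto simp: D'_def)
      thus "z = w \<and> J = K" using zw by blast
    qed
    ultimately have "card ?A = card (conj_pts \<times> Pow D' :: ('k alg_closure \<times> _) set)" by (simp add: card_image)
    thus ?thesis using True finD' card_conj_pts[where 'k = 'k]
      by (simp add: card_cartesian_product card_Pow cD' q_def)
  qed
qed

lemma card_codes:
  fixes x :: "'k :: {field, finite} closed_pt"
  shows "card (codes x) = card (UNIV :: 'k set) ^ pt_degree x + 1"
proof -
  have "card (Some ` resf x) = card (resf x)" by (rule card_image) simp
  moreover have "None \<notin> Some ` resf x" by auto
  ultimately show ?thesis using card_resf[of x] by (simp add: codes_def)
qed

text \<open>The two kinds of decomposable tuples are disjoint, since the value at any point of D is
  rational for one kind and not for the other; here D must be non-empty.\<close>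

lemma card_bricks_0:
  fixes D :: "'k :: {field, finite} closed_pt set"
  defines "q \<equiv> int (card (UNIV :: 'k set))"
  assumes fin: "finite D" and ne: "D \<noteq> {}"
  shows "int (card {u \<in> PiE D codes. brick 0 D u}) = (\<Prod>x\<in>D. 1 + q ^ pt_degree x)
    - ((q + 1) + (q + 1) * q * (2 ^ (card D - 1) - 1))
    - (if \<forall>x\<in>D. even (pt_degree x) then (q\<^sup>2 - q) * 2 ^ (card D - 1) else 0)"
proof -
  obtain x0 where x0: "x0 \<in> D" using ne by blast
  let ?A1 = "{u \<in> PiE D codes. \<exists>l\<in>rat_pts. \<exists>l'\<in>rat_pts. \<forall>x\<in>D. u x = l \<or> u x = (l' :: 'k alg_closure option)}"
  let ?A2 = "{u \<in> PiE D codes. \<exists>z\<in>conj_pts. \<forall>x\<in>D. u x = Some z \<or> u x = Some (frob (z :: 'k alg_closure))}"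
  have finPi: "finite (PiE D (codes :: 'k closed_pt \<Rightarrow> _))" using fin finite_codes by (intro finite_PiE) auto
  have eq: "{u \<in> PiE D codes. brick 0 D u} = PiE D codes - (?A1 \<union> ?A2)"
    using not_brick_0_iff[of D] by blast
  have disj: "?A1 \<inter> ?A2 = {}"
  proof -
    have False if u: "u \<in> ?A1" "u \<in> ?A2" for u
    proof -
      have "u x0 \<in> rat_pts" using u(1) x0 by auto
      moreover obtain z where "z \<in> conj_pts" "u x0 = Some z"
        by (rule conj_pts_pair[of D u x0]) (use u(2) x0 in auto)
      ultimately show False by (simp add: conj_pts_def Some_rat_pts)
    qed
    thus ?thesis by blast
  qed
  have sub: "?A1 \<union> ?A2 \<subseteq> PiE D codes" by blast
  have fin12: "finite ?A1" "finite ?A2" using finPi by (auto intro: finite_subset)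
  have "int (card {u \<in> PiE D codes. brick 0 D u}) = int (card (PiE D (codes :: 'k closed_pt \<Rightarrow> _))) - int (card (?A1 \<union> ?A2))"
    unfolding eq using card_mono[OF finPi sub] finite_subset[OF sub finPi] sub
    by (simp add: card_Diff_subset of_nat_diff)
  also have "card (?A1 \<union> ?A2) = card ?A1 + card ?A2" by (rule card_Un_disjoint[OF fin12 disj])
  also have "int (card (PiE D (codes :: 'k closed_pt \<Rightarrow> _))) = (\<Prod>x\<in>D. 1 + q ^ pt_degree x)"
    using fin by (simp add: card_PiE card_codes q_def add.commute)
  finally show ?thesis
    using card_two_rational_codes[OF fin x0] card_conj_codes[OF fin x0] unfolding q_def by simp
qed

text \<open>Without points every endomorphism is admissible, for instance
  \<open>c1 = 1\<close>.\<close>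

lemma no_bricks_empty: "\<not> brick 0 {} u"
  unfolding brick_def by (auto intro!: exI[of _ 0] exI[of _ 1] simp: polys_upto_def)

section \<open>Grothendieck's theorem in rank 2\<close>

declare uniformizer.simps [simp del] uniformizer_nz [simp]

text \<open>The lattice over the local ring at \<open>x\<close> spanned by the columns of
  \<open>g\<close>: multiplying \<open>g\<close> on the left changes the ambient coordinates,
  multiplying it on the right by an invertible matrix over the local ring changes only the
  basis.\<close>

definition lat :: "'a :: field ratfun mat \<Rightarrow> 'a closed_pt \<Rightarrow> 'a ratfun vec set" where
  "lat g x = (\<lambda>v. g *\<^sub>v v) ` local_vecs 2 x"

definition translate :: "'a :: field ratfun mat \<Rightarrow> 'a stalks \<Rightarrow> 'a stalks" where
  "translate A L = (\<lambda>x. (\<lambda>v. A *\<^sub>v v) ` L x)"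

text \<open>A condition on each stalk separately, which is stable under \<open>translate\<close>
  without tracking open sets.\<close>

definition lattice_family :: "'a :: field stalks \<Rightarrow> bool" where
  "lattice_family L \<longleftrightarrow> (\<forall>x. \<exists>g. g \<in> carrier_mat 2 2 \<and> det g \<noteq> 0 \<and> L x = lat g x)"

lemma local_vecs_carrier: "v \<in> local_vecs n x \<Longrightarrow> v \<in> carrier_vec n"
  by (simp add: local_vecs_def)

lemma vec2_local_vecs [simp]: "vec2 u v \<in> local_vecs 2 x \<longleftrightarrow> u \<in> local_ring x \<and> v \<in> local_ring x"
  by (auto simp: local_vecs_def less_2_iff)

lemma lat_carrier: "g \<in> carrier_mat 2 2 \<Longrightarrow> v \<in> lat g x \<Longrightarrow> v \<in> carrier_vec 2"
  by (auto simp: lat_def intro!: mult_mat_vec_carrier[of g 2 2] dest: local_vecs_carrier)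

lemma image_lat:
  assumes "A \<in> carrier_mat 2 2" "g \<in> carrier_mat 2 2"
  shows "(\<lambda>v. A *\<^sub>v v) ` lat g x = lat (A * g) x"
  unfolding lat_def image_image
  by (rule image_cong) (auto simp: assoc_mult_mat_vec[OF assms local_vecs_carrier])

lemma translate_lat: "A \<in> carrier_mat 2 2 \<Longrightarrow> g \<in> carrier_mat 2 2 \<Longrightarrow> L x = lat g x \<Longrightarrow> translate A L x = lat (A * g) x"
  by (simp add: translate_def image_lat)

lemma local_vecs_lat: "local_vecs 2 x = lat (1\<^sub>m 2) x"
  unfolding lat_def using local_vecs_carrier by (force intro!: image_eqI)

text \<open>The adjugate divided by the unit determinant is an inverse with entries in the local
  ring.\<close>

lemma lat_unit:
  assumes O: "p \<in> local_ring x" "q \<in> local_ring x" "r \<in> local_ring x" "s \<in> local_ring x"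
    and u: "local_unit x (p * s - q * r)"
  shows "lat (mat2 p q r s) x = local_vecs 2 x"
proof (intro equalityI subsetI)
  fix v assume "v \<in> lat (mat2 p q r s) x"
  then obtain w where w: "w \<in> local_vecs 2 x" "v = mat2 p q r s *\<^sub>v w" by (auto simp: lat_def)
  obtain y z where "w = vec2 y z" by (rule vec2_cases[OF local_vecs_carrier[OF w(1)]])
  thus "v \<in> local_vecs 2 x" using w O by (auto simp: mat2_mult_vec2 intro!: local_ring_add local_ring_mult)
next
  fix v assume v: "v \<in> local_vecs 2 x"
  obtain y z where yz: "v = vec2 y z" by (rule vec2_cases[OF local_vecs_carrier[OF v]])
  define e where "e = p * s - q * r"
  define e' where "e' = inverse e"
  have e: "e * e' = 1" "e' \<in> local_ring x" using u by (auto simp: local_unit_def e_def[symmetric] e'_def)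
  have I: "h * e' \<in> local_ring x" if "h \<in> local_ring x" for h using local_ring_mult[OF that e(2)] .
  have "mat2 p q r s *\<^sub>v vec2 ((s * y - q * z) * e') ((p * z - r * y) * e') = vec2 (e * y * e') (e * z * e')"
    unfolding mat2_mult_vec2 vec2_eq_iff e_def by (rule conjI) (simp_all add: algebra_simps)
  also have "\<dots> = v" using e(1) by (simp add: yz mult.assoc mult.left_commute[of e])
  finally have "v = mat2 p q r s *\<^sub>v vec2 ((s * y - q * z) * e') ((p * z - r * y) * e')" by simp
  moreover have "vec2 ((s * y - q * z) * e') ((p * z - r * y) * e') \<in> local_vecs 2 x"
    using v O unfolding vec2_local_vecs yz by (auto intro!: I local_ring_diff local_ring_mult)
  ultimately show "v \<in> lat (mat2 p q r s) x" unfolding lat_def by (rule image_eqI)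
qed

lemma lat_mult_unit:
  assumes "p \<in> local_ring x" "q \<in> local_ring x" "r \<in> local_ring x" "s \<in> local_ring x"
    and "local_unit x (p * s - q * r)" "g \<in> carrier_mat 2 2"
  shows "lat (g * mat2 p q r s) x = lat g x"
  using image_lat[OF assms(6) mat2_carrier, of p q r s x] lat_unit[OF assms(1-5)]
  by (simp add: lat_def)

lemma local_unit_minus_1: "local_unit x (- 1)"
  using local_ring_uminus[OF local_ring_1, of x] by (simp add: local_unit_def)

text \<open>Hermite normal form by column operations over the local ring: clear the lower left
  entry, then scale the diagonal entries to powers of the uniformizer.\<close>

lemma lat_triangular:
  assumes "g \<in> carrier_mat 2 2" "det g \<noteq> 0"
  obtains i j f where "lat g x = lat (mat2 (uniformizer x powi i) f 0 (uniformizer x powi j)) x"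
proof -
  have main: "\<exists>i j f. lat g x = lat (mat2 (uniformizer x powi i) f 0 (uniformizer x powi j)) x"
    if g: "g = mat2 a b c d" "a * d - b * c \<noteq> 0" and d: "d \<noteq> 0" "c / d \<in> local_ring x" for g a b c d
  proof -
    define a' where "a' = a - b * (c / d)"
    have "a' * d = a * d - b * c" using d(1) by (simp add: a'_def field_simps)
    hence "a' \<noteq> 0" using g(2) by auto
    then obtain u where u: "local_unit x u" "a' = u * uniformizer x powi valuation x a'" by (rule valuation_decomp)
    obtain w where w: "local_unit x w" "d = w * uniformizer x powi valuation x d" by (rule valuation_decomp[OF d(1)])
    have uw: "u \<noteq> 0" "w \<noteq> 0" "inverse u \<in> local_ring x" "inverse w \<in> local_ring x"
      using u(1) w(1) by (auto simp: local_unit_def)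
    have "lat g x = lat (g * mat2 1 0 (- (c / d)) 1) x"
      by (rule lat_mult_unit[symmetric]) (use d in \<open>auto simp: g local_ring_1 local_ring_0 local_ring_uminus local_unit_1\<close>)
    also have "g * mat2 1 0 (- (c / d)) 1 = mat2 a' b 0 d" using d(1) by (simp add: g mat2_mult a'_def)
    also have "lat (mat2 a' b 0 d) x = lat (mat2 a' b 0 d * mat2 (inverse u) 0 0 (inverse w)) x"
      by (rule lat_mult_unit[symmetric])
         (use uw u(1) w(1) in \<open>auto simp: local_ring_0 intro: local_unit_mult local_unit_inverse\<close>)
    also have "mat2 a' b 0 d * mat2 (inverse u) 0 0 (inverse w) =
      mat2 (uniformizer x powi valuation x a') (b * inverse w) 0 (uniformizer x powi valuation x d)"
    proof -
      have "a' * inverse u = uniformizer x powi valuation x a'" by (subst u(2)) (simp add: uw)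
      moreover have "d * inverse w = uniformizer x powi valuation x d" by (subst w(2)) (simp add: uw)
      ultimately show ?thesis by (simp add: mat2_mult)
    qed
    finally show ?thesis by blast
  qed
  obtain a b c d where g: "g = mat2 a b c d" by (rule mat2_cases[OF assms(1)])
  have det: "a * d - b * c \<noteq> 0" using assms(2) by (simp add: g det_mat2)
  have "\<exists>i j f. lat g x = lat (mat2 (uniformizer x powi i) f 0 (uniformizer x powi j)) x"
  proof (cases "d \<noteq> 0 \<and> c / d \<in> local_ring x")
    case True
    thus ?thesis using main[OF g det] by blast
  next
    case False
    have c: "c \<noteq> 0" using False det by (auto simp: local_ring_0)
    \<comment> \<open>The local ring is a valuation ring, so one of c / d and d / c belongs to it;
      in this case the columns are exchanged.\<close>
    have dc: "d / c \<in> local_ring x"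
    proof (cases "d = 0")
      case False
      hence "c / d \<notin> local_ring x" using \<open>\<not> (d \<noteq> 0 \<and> c / d \<in> local_ring x)\<close> by blast
      hence "valuation x c < valuation x d" using False c by (auto simp: local_ring_iff valuation_divide)
      thus ?thesis using False c by (auto simp: local_ring_iff valuation_divide)
    qed (simp add: local_ring_0)
    have "lat g x = lat (g * mat2 0 1 1 0) x"
      by (rule lat_mult_unit[symmetric]) (auto simp: g local_ring_1 local_ring_0 local_unit_minus_1)
    also have "g * mat2 0 1 1 0 = mat2 b a d c" by (simp add: g mat2_mult)
    finally have eq: "lat g x = lat (mat2 b a d c) x" .
    have "b * c - a * d \<noteq> 0" using det by (simp add: algebra_simps)
    from main[OF refl this c dc] show ?thesis unfolding eq .
  qed
  thus ?thesis using that by (elim exE)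
qed

lemma std_lat: "std a b x = lat (mat2 (tw x a) 0 0 (tw x b)) x"
proof (intro equalityI subsetI)
  fix w assume "w \<in> std a b x"
  then obtain u v where w: "w = vec2 u v" "u / tw x a \<in> local_ring x" "v / tw x b \<in> local_ring x" by (rule std_cases)
  have "w = mat2 (tw x a) 0 0 (tw x b) *\<^sub>v vec2 (u / tw x a) (v / tw x b)" by (simp add: w(1) mat2_mult_vec2)
  moreover have "vec2 (u / tw x a) (v / tw x b) \<in> local_vecs 2 x" using w by simp
  ultimately show "w \<in> lat (mat2 (tw x a) 0 0 (tw x b)) x" unfolding lat_def by (rule image_eqI)
next
  fix w assume "w \<in> lat (mat2 (tw x a) 0 0 (tw x b)) x"
  then obtain v where v: "v \<in> local_vecs 2 x" "w = mat2 (tw x a) 0 0 (tw x b) *\<^sub>v v" by (auto simp: lat_def)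
  obtain y z where "v = vec2 y z" by (rule vec2_cases[OF local_vecs_carrier[OF v(1)]])
  thus "w \<in> std a b x" using v by (simp add: mat2_mult_vec2 std_iff)
qed

lemma lattice_familyE:
  assumes "lattice_family L"
  obtains g where "g \<in> carrier_mat 2 2" "det g \<noteq> 0" "L x = lat g x"
  using assms unfolding lattice_family_def by (elim allE[of _ x] exE conjE)

lemma lattice_family_carrier: "lattice_family L \<Longrightarrow> v \<in> L x \<Longrightarrow> v \<in> carrier_vec 2"
  by (rule lattice_familyE[of L x]) (auto intro: lat_carrier)

lemma lattice_family_translate:
  assumes "lattice_family L" "A \<in> carrier_mat 2 2" "det A \<noteq> 0"
  shows "lattice_family (translate A L)"
  unfolding lattice_family_def
proof
  fix x
  obtain g where g: "g \<in> carrier_mat 2 2" "det g \<noteq> 0" "L x = lat g x" by (rule lattice_familyE[OF assms(1)])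
  have "det (A * g) \<noteq> 0" using det_mult[OF assms(2) g(1)] g(2) assms(3) by simp
  thus "\<exists>g. g \<in> carrier_mat 2 2 \<and> det g \<noteq> 0 \<and> translate A L x = lat g x"
    using translate_lat[where L = L and x = x, OF assms(2) g(1,3)] mult_carrier_mat[OF assms(2) g(1)] by blast
qed

lemma lattice_family_bundle: "vector_bundle 2 L \<Longrightarrow> lattice_family L"
  unfolding lattice_family_def lat_def
proof
  fix x assume "vector_bundle 2 L"
  then obtain g where "g \<in> carrier_mat 2 2" "det g \<noteq> 0" "L x = (\<lambda>v. g *\<^sub>v v) ` local_vecs 2 x" by (rule vector_bundle_stalk)
  thus "\<exists>g. g \<in> carrier_mat 2 2 \<and> det g \<noteq> 0 \<and> L x = (\<lambda>v. g *\<^sub>v v) ` local_vecs 2 x" by blast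
qed

lemma translate_translate:
  assumes "lattice_family L" "A \<in> carrier_mat 2 2" "B \<in> carrier_mat 2 2"
  shows "translate B (translate A L) = translate (B * A) L"
  unfolding translate_def image_image
  by (intro ext image_cong refl) (simp add: assoc_mult_mat_vec[OF assms(3,2) lattice_family_carrier[OF assms(1)]])

lemma translate_one: "lattice_family L \<Longrightarrow> translate (1\<^sub>m 2) L = L"
proof
  fix x assume L: "lattice_family L"
  have "(\<lambda>v. 1\<^sub>m 2 *\<^sub>v v) ` L x = (\<lambda>v. v) ` L x"
    by (rule image_cong) (auto dest: lattice_family_carrier[OF L])
  thus "translate (1\<^sub>m 2) L x = L x" by (simp add: translate_def)
qed

definition splits :: "'a :: field stalks \<Rightarrow> bool" where
  "splits L \<longleftrightarrow> (\<exists>A a b. A \<in> carrier_mat 2 2 \<and> det A \<noteq> 0 \<and> translate A L = std a b)"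

lemma splits_translate:
  assumes "lattice_family L" "A \<in> carrier_mat 2 2" "det A \<noteq> 0" "splits (translate A L)"
  shows "splits L"
proof -
  obtain B a b where B: "B \<in> carrier_mat 2 2" "det B \<noteq> 0" "translate B (translate A L) = std a b"
    using assms(4) unfolding splits_def by (elim exE conjE)
  have "det (B * A) \<noteq> 0" using det_mult[OF B(1) assms(2)] B(2) assms(3) by simp
  thus ?thesis unfolding splits_def
    using B translate_translate[OF assms(1,2) B(1)] mult_carrier_mat[OF B(1) assms(2)] by metis
qed

section \<open>Diagonalisation at infinity and removal of the bad primes\<close>

lemma polynomial_part: "\<exists>Q. h - Fr Q 1 \<in> max_ideal Infty"
proof -
  obtain f g where h: "h = Fr f g" "g \<noteq> 0" by (rule ratfun_cases)
  have "h - Fr (f div g) 1 = Fr (f mod g) g"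
    using h(2) by (simp add: h(1) minus_mult_div_eq_mod mult.commute)
  moreover have "Fr (f mod g) g \<in> max_ideal Infty"
  proof (cases "f mod g = 0")
    case False
    thus ?thesis using h(2) degree_mod_less[OF h(2), of f]
      by (auto simp: max_ideal_iff valuation_Infty)
  qed (simp add: max_ideal_0)
  ultimately show ?thesis by metis
qed

text \<open>Subtracting a polynomial multiple of the second row brings the upper right entry below the
  order of the lower right one; unless the lattice is then already diagonal, exchanging the rows
  makes the gap between the two diagonal orders strictly smaller.\<close>

lemma splits_finite_trivial:
  assumes "\<And>p. L (Fin p) = local_vecs 2 (Fin p)"
    and "L Infty = lat (mat2 (tw Infty a) f 0 (tw Infty b)) Infty"
  shows "splits L"
  using assms
proof (induction "nat (b - a)" arbitrary: L a b f rule: less_induct)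
  case less
  note fin = less.prems(1) and inf = less.prems(2)
  let ?t = "tw Infty"
  have fam: "lattice_family M" if "\<And>p. M (Fin p) = local_vecs 2 (Fin p)" "M Infty = lat (mat2 (?t a) f 0 (?t b)) Infty"
    for M :: "'a stalks" and a b f
    unfolding lattice_family_def
  proof
    fix x
    show "\<exists>g. g \<in> carrier_mat 2 2 \<and> det g \<noteq> 0 \<and> M x = lat g x"
    proof (cases x)
      case Infty
      thus ?thesis using that(2) by (intro exI[of _ "mat2 (?t a) f 0 (?t b)"]) (simp add: det_mat2)
    next
      case (Fin p)
      thus ?thesis using that(1) local_vecs_lat by (intro exI[of _ "1\<^sub>m 2"]) simp
    qed
  qed
  obtain Q where Q: "f / ?t b - Fr Q 1 \<in> max_ideal Infty" using polynomial_part by blast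
  define G where "G = mat2 1 (- Fr Q 1) 0 1"
  define f1 where "f1 = f - Fr Q 1 * ?t b"
  define L1 where "L1 = translate G L"
  have G: "G \<in> carrier_mat 2 2" "det G \<noteq> 0" by (simp_all add: G_def det_mat2)
  have fin1: "L1 (Fin p) = local_vecs 2 (Fin p)" for p
  proof -
    have "L1 (Fin p) = lat G (Fin p)" by (simp add: L1_def translate_def fin lat_def)
    also have "\<dots> = local_vecs 2 (Fin p)" unfolding G_def
      by (rule lat_unit) (auto simp: local_ring_1 local_ring_0 local_unit_1 intro!: local_ring_uminus poly_in_local_ring_Fin simp del: minus_fract)
    finally show ?thesis .
  qed
  have inf1: "L1 Infty = lat (mat2 (?t a) f1 0 (?t b)) Infty"
    using translate_lat[where L = L and x = Infty, OF G(1) mat2_carrier inf]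
    by (simp add: L1_def G_def mat2_mult f1_def del: minus_fract)
  have small: "f1 / ?t b \<in> max_ideal Infty" using Q by (simp add: f1_def diff_divide_distrib)
  have "splits L1"
  proof (cases "f1 / ?t a \<in> local_ring Infty")
    case True
    have "lat (mat2 (?t a) f1 0 (?t b)) Infty = lat (mat2 (?t a) 0 0 (?t b) * mat2 1 (f1 / ?t a) 0 1) Infty"
      by (simp add: mat2_mult)
    also have "\<dots> = lat (mat2 (?t a) 0 0 (?t b)) Infty"
      by (rule lat_mult_unit) (auto simp: True local_ring_1 local_ring_0 local_unit_1)
    finally have "L1 Infty = std a b Infty" unfolding inf1 std_lat .
    moreover have "L1 (Fin p) = std a b (Fin p)" for p
      unfolding fin1 std_lat tw_Fin one_mat2[symmetric] local_vecs_lat ..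
    ultimately have "L1 x = std a b x" for x by (cases x) (simp_all only:)
    hence "L1 = std a b" by (rule ext)
    hence "translate (1\<^sub>m 2) L1 = std a b" using translate_one[OF fam[OF fin1 inf1]] by (simp only:)
    thus ?thesis unfolding splits_def by (intro exI[of _ "1\<^sub>m 2"] exI[of _ a] exI[of _ b]) simp
  next
    case False
    hence f1: "f1 \<noteq> 0" by (auto simp: local_ring_0)
    define j where "j = - valuation Infty f1"
    obtain u where u: "local_unit Infty u" "f1 = u * uniformizer Infty powi valuation Infty f1" by (rule valuation_decomp[OF f1])
    have f1u: "f1 = u * ?t j" using u(2) by (simp add: tw_Infty j_def)
    have u': "u \<noteq> 0" "u \<in> local_ring Infty" "inverse u \<in> local_ring Infty" using u(1) by (auto simp: local_unit_def)
    have aj: "a < j" using False f1 by (simp add: local_ring_iff valuation_divide valuation_tw j_def)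
    have jb: "j < b" using small f1 by (simp add: max_ideal_iff valuation_divide valuation_tw j_def)
    \<comment> \<open>A column operation of determinant -1 that clears the upper left entry, using
      that the upper right one is a unit times t^j; it is integral at infinity because a <
      j.\<close>
    define K where "K = mat2 (- u) 0 (?t (a - j)) (inverse u)"
    define W where "W = (mat2 0 1 1 0 :: 'a ratfun mat)"
    have W: "W \<in> carrier_mat 2 2" "det W \<noteq> 0" by (simp_all add: W_def det_mat2)
    have latK: "lat (g * K) Infty = lat g Infty" if "g \<in> carrier_mat 2 2" for g
      unfolding K_def using that u' aj
      by (intro lat_mult_unit) (auto simp: local_ring_0 local_unit_minus_1 local_ring_uminus local_ring_iff[of "?t _"] valuation_tw)
    have "mat2 (?t a) f1 0 (?t b) * K = mat2 0 (?t j) (?t (a + b - j)) (?t b * inverse u)"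
    proof -
      have te: "?t a = ?t (a - j) * ?t j" "?t (a + b - j) = ?t (a - j) * ?t b" by (simp_all flip: tw_add add: algebra_simps)
      thus ?thesis using u'(1) by (simp add: K_def mat2_mult f1u te mult.commute)
    qed
    hence WK: "W * (mat2 (?t a) f1 0 (?t b) * K) = mat2 (?t (a + b - j)) (?t b * inverse u) 0 (?t j)"
      by (simp add: W_def mat2_mult)
    have LK: "L1 Infty = lat (mat2 (?t a) f1 0 (?t b) * K) Infty" unfolding inf1 by (rule latK[symmetric]) simp
    have Kc: "K \<in> carrier_mat 2 2" by (simp add: K_def)
    have inf2: "translate W L1 Infty = lat (mat2 (?t (a + b - j)) (?t b * inverse u) 0 (?t j)) Infty"
      unfolding WK[symmetric] by (rule translate_lat[where L = L1 and x = Infty, OF W(1) mult_carrier_mat[OF mat2_carrier Kc] LK])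
    have fin2: "translate W L1 (Fin p) = local_vecs 2 (Fin p)" for p
    proof -
      have "translate W L1 (Fin p) = lat W (Fin p)" by (simp add: translate_def fin1 lat_def)
      also have "\<dots> = local_vecs 2 (Fin p)" unfolding W_def
        by (rule lat_unit) (auto simp: local_ring_1 local_ring_0 local_unit_minus_1)
      finally show ?thesis .
    qed
    \<comment> \<open>The new gap is 2 j - a - b, which is smaller than b - a because j < b.\<close>
    have "splits (translate W L1)"
      by (rule less.hyps[OF _ fin2 inf2]) (use aj jb in auto)
    thus ?thesis using splits_translate[OF fam[OF fin1 inf1] W] by blast
  qed
  thus ?case using splits_translate[OF fam[OF fin inf] G] by (simp add: L1_def)
qed

lemma poly_of_power_bezout:
  assumes "\<not> poly_of p dvd h"
  shows "\<exists>s t. s * h + t * poly_of p ^ n = 1"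
proof (induction n)
  case 0
  show ?case by (intro exI[of _ 0] exI[of _ 1]) simp
next
  case (Suc n)
  then obtain s t where st: "s * h + t * poly_of p ^ n = 1" by blast
  obtain u v where uv: "u * h + v * poly_of p = 1" by (rule poly_of_coprime_bezout[OF assms])
  have "1 = s * h + t * poly_of p ^ n * (u * h + v * poly_of p)" by (simp add: st uv)
  also have "\<dots> = (s + t * poly_of p ^ n * u) * h + (t * v) * poly_of p ^ Suc n" by (simp add: algebra_simps)
  finally show ?case by (intro exI) (rule sym)
qed

text \<open>Replaces the part of the denominator prime to p by its inverse modulo a power of p. The
  approximating fraction has only a power of p as denominator and so stays regular at all other
  finite points.\<close>

lemma approximation_at_prime:
  fixes f :: "'a :: field ratfun"
  obtains r n where "(f - Fr r (poly_of p ^ n)) / uniformizer (Fin p) powi i \<in> local_ring (Fin p)"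
proof -
  obtain g h where f: "f = Fr g h" "h \<noteq> 0" by (rule ratfun_cases)
  obtain n h' where h: "h = poly_of p ^ n * h'" "\<not> poly_of p dvd h'" using poly_of_factor[OF f(2)] by blast
  \<comment> \<open>The error is divisible by p^(N - n), so N = i + n gives the required precision;
    negative values are cut off at 0.\<close>
  define N where "N = nat (i + int n)"
  obtain s t where st: "s * h' + t * poly_of p ^ N = 1" using poly_of_power_bezout[OF h(2)] by blast
  have h'0: "h' \<noteq> 0" using h f by auto
  have pn: "poly_of p ^ n \<noteq> 0" by simp
  have "f - Fr (s * g) (poly_of p ^ n) = Fr (g * (1 - s * h')) (poly_of p ^ n * h')"
    using h'0 pn by (simp add: f h(1) eq_fract algebra_simps)
  also have "1 - s * h' = poly_of p ^ N * t" by (simp add: algebra_simps flip: st)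
  also have "Fr (g * (poly_of p ^ N * t)) (poly_of p ^ n * h') =
    uniformizer (Fin p) ^ N / uniformizer (Fin p) ^ n * Fr (g * t) h'"
    using h'0 pn by (simp add: uniformizer.simps Fr_power eq_fract algebra_simps)
  also have "\<dots> = uniformizer (Fin p) powi (int N - int n) * Fr (g * t) h'"
    by (simp add: power_int_diff)
  finally have "(f - Fr (s * g) (poly_of p ^ n)) / uniformizer (Fin p) powi i =
     uniformizer (Fin p) powi (int N - int n - i) * Fr (g * t) h'"
    by (simp add: power_int_diff)
  moreover have "uniformizer (Fin p) powi (int N - int n - i) \<in> local_ring (Fin p)"
    by (subst local_ring_iff) (simp add: valuation_uniformizer_powi N_def)
  ultimately show ?thesis using that local_ring_mult local_ring_FinI[OF h(2)] by metis
qed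

text \<open>The bad primes are removed one at a time: the correcting matrix has entries and
  determinant built from powers of p alone, so it is invertible at the other finite points and
  disturbs only infinity, which is treated last.\<close>

lemma splits_finite_bad:
  assumes "finite S" "lattice_family L" "\<And>p. p \<notin> S \<Longrightarrow> L (Fin p) = local_vecs 2 (Fin p)"
  shows "splits L"
  using assms
proof (induction S arbitrary: L rule: finite_induct)
  case empty
  obtain g where g: "g \<in> carrier_mat 2 2" "det g \<noteq> 0" "L Infty = lat g Infty" by (rule lattice_familyE[OF empty.prems(1)])
  obtain i j f where "lat g Infty = lat (mat2 (uniformizer Infty powi i) f 0 (uniformizer Infty powi j)) Infty"
    by (rule lat_triangular[OF g(1,2)])
  thus ?case using splits_finite_trivial[of L "- i" f "- j"] empty.prems(2) g(3) by (simp add: tw_Infty)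
next
  case (insert p S)
  let ?P = "uniformizer (Fin p)"
  obtain g where g: "g \<in> carrier_mat 2 2" "det g \<noteq> 0" "L (Fin p) = lat g (Fin p)" by (rule lattice_familyE[OF insert.prems(1)])
  obtain i j f where tri: "lat g (Fin p) = lat (mat2 (?P powi i) f 0 (?P powi j)) (Fin p)"
    by (rule lat_triangular[OF g(1,2)])
  obtain r n where rn: "(f - Fr r (poly_of p ^ n)) / ?P powi i \<in> local_ring (Fin p)"
    by (rule approximation_at_prime)
  define c where "c = Fr r (poly_of p ^ n)"
  define A where "A = mat2 (?P powi i) c 0 (?P powi j)"
  define B where "B = mat2 (?P powi (- i)) (- (?P powi (- i) * c * ?P powi (- j))) 0 (?P powi (- j))"
  have P: "?P powi m \<noteq> 0" for m by simp
  have Pm: "?P powi (- m) = inverse (?P powi m)" for m by (simp add: power_int_minus)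
  have BA: "B * A = 1\<^sub>m 2" using P by (simp add: A_def B_def mat2_mult one_mat2 Pm field_simps)
  have B: "B \<in> carrier_mat 2 2" "det B \<noteq> 0" using P by (simp_all add: B_def det_mat2)
  have "mat2 (?P powi i) f 0 (?P powi j) = A * mat2 1 ((f - c) / ?P powi i) 0 1"
    using P by (simp add: A_def mat2_mult)
  hence "L (Fin p) = lat (A * mat2 1 ((f - c) / ?P powi i) 0 1) (Fin p)" using g(3) tri by simp
  also have "\<dots> = lat A (Fin p)"
    by (rule lat_mult_unit) (use rn in \<open>auto simp: local_ring_1 local_ring_0 local_unit_1 c_def A_def\<close>)
  finally have "translate B L (Fin p) = lat (B * A) (Fin p)" by (intro translate_lat B) (simp_all add: A_def)
  hence p: "translate B L (Fin p) = local_vecs 2 (Fin p)" unfolding BA local_vecs_lat .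
  have "translate B L (Fin q) = local_vecs 2 (Fin q)" if "q \<notin> S" for q
  proof (cases "q = p")
    case False
    have nd: "\<not> poly_of q dvd poly_of p" using False by (simp add: poly_of_dvd_poly_of)
    hence "valuation (Fin q) ?P = 0" by (simp add: valuation_Fin_0 uniformizer.simps)
    hence "local_unit (Fin q) ?P" by (simp add: local_unit_iff)
    hence unit: "local_unit (Fin q) (?P powi m)" for m
      by (cases m) (auto simp: local_unit_def power_int_def power_inverse[symmetric] local_ring_power)
    hence O: "?P powi m \<in> local_ring (Fin q)" for m by (simp add: local_unit_def)
    have "\<not> poly_of q dvd poly_of p ^ n" using nd prime_elem_dvd_power[OF prime_poly_of] by blast
    hence c: "c \<in> local_ring (Fin q)" unfolding c_def by (rule local_ring_FinI)
    have "translate B L (Fin q) = lat B (Fin q)" using insert.prems(2)[of q] that False by (simp add: translate_def lat_def)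
    also have "\<dots> = local_vecs 2 (Fin q)" unfolding B_def
      by (rule lat_unit) (auto simp: O c local_ring_0 local_ring_uminus local_ring_mult intro: local_unit_mult unit)
    finally show ?thesis .
  qed (use p in simp)
  hence "splits (translate B L)" by (intro insert.IH lattice_family_translate insert.prems(1) B)
  thus ?case by (rule splits_translate[OF insert.prems(1) B])
qed

text \<open>A trivialisation on one open set, inverted globally, makes all but finitely many stalks
  standard.\<close>

theorem vector_bundle_2_splits:
  assumes "vector_bundle 2 L"
  shows "splits L"
proof -
  obtain U g where g: "finite (- U)" "g \<in> carrier_mat 2 2" "det g \<noteq> 0" "\<forall>y\<in>U. L y = lat g y"
    using assms unfolding vector_bundle_def lat_def by metis
  obtain a b c d where gm: "g = mat2 a b c d" by (rule mat2_cases[OF g(2)])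
  define e where "e = a * d - b * c"
  define h where "h = mat2 (d / e) (- b / e) (- c / e) (a / e)"
  have e: "e \<noteq> 0" using g(3) by (simp add: gm e_def det_mat2)
  have hg: "h * g = 1\<^sub>m 2" unfolding h_def gm by (rule mat2_inverse(2)[OF e_def e])
  have h: "h \<in> carrier_mat 2 2" by (simp add: h_def)
  have "det h * det g = 1" using det_mult[OF h g(2)] by (simp add: hg)
  hence dh: "det h \<noteq> 0" by auto
  have fam: "lattice_family L" by (rule lattice_family_bundle[OF assms])
  have "splits (translate h L)"
  proof (rule splits_finite_bad[of "{p. Fin p \<in> - U}"])
    have "finite (Fin -` (- U))" by (rule finite_vimageI[OF g(1)]) (auto simp: inj_def)
    thus "finite {p. Fin p \<in> - U}" by (simp add: vimage_def)
    show "lattice_family (translate h L)" by (rule lattice_family_translate[OF fam h dh])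
    show "translate h L (Fin p) = local_vecs 2 (Fin p)" if "p \<notin> {p. Fin p \<in> - U}" for p
      using translate_lat[OF h g(2), of L "Fin p"] g(4) that by (simp add: hg local_vecs_lat)
  qed
  thus ?thesis by (rule splits_translate[OF fam h dh])
qed

section \<open>Degrees and isomorphism classes\<close>

text \<open>The degree of the divisor with multiplicities \<open>v\<close>.\<close>

definition wsum :: "('a :: field closed_pt \<Rightarrow> int) \<Rightarrow> int" where
  "wsum v = (\<Sum>x | v x \<noteq> 0. v x * int (pt_degree x))"

lemma wsum_eq:
  assumes "finite S" "{x. v x \<noteq> 0} \<subseteq> S"
  shows "wsum v = (\<Sum>x\<in>S. v x * int (pt_degree x))"
  unfolding wsum_def using assms by (intro sum.mono_neutral_left) auto

lemma wsum_add:
  assumes "finite {x. v x \<noteq> 0}" "finite {x. v' x \<noteq> 0}"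
  shows "wsum (\<lambda>x. v x + v' x) = wsum v + wsum v'"
proof -
  let ?S = "{x. v x \<noteq> 0} \<union> {x. v' x \<noteq> 0}"
  have fin: "finite ?S" using assms by simp
  have "wsum (\<lambda>x. v x + v' x) = (\<Sum>x\<in>?S. (v x + v' x) * int (pt_degree x))" by (rule wsum_eq[OF fin]) auto
  also have "\<dots> = (\<Sum>x\<in>?S. v x * int (pt_degree x)) + (\<Sum>x\<in>?S. v' x * int (pt_degree x))"
    by (simp add: sum.distrib distrib_right)
  also have "(\<Sum>x\<in>?S. v x * int (pt_degree x)) = wsum v" by (rule wsum_eq[OF fin, symmetric]) auto
  also have "(\<Sum>x\<in>?S. v' x * int (pt_degree x)) = wsum v'" by (rule wsum_eq[OF fin, symmetric]) auto
  finally show ?thesis .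
qed

lemma finite_valuation_support:
  assumes "h \<noteq> 0" shows "finite {x. valuation x h \<noteq> 0}"
proof -
  obtain f g where h: "h = Fr f g" "g \<noteq> 0" by (rule ratfun_cases)
  hence "f \<noteq> 0" using assms by auto
  let ?S = "insert Infty (Fin ` ({p. poly_of p dvd f} \<union> {p. poly_of p dvd g}))"
  have "{x. valuation x h \<noteq> 0} \<subseteq> ?S"
  proof
    fix x assume x: "x \<in> {x. valuation x h \<noteq> 0}"
    show "x \<in> ?S"
    proof (cases x)
      case (Fin p)
      thus ?thesis using x h valuation_Fin_0[of p f g] by auto
    qed simp
  qed
  moreover have "finite ?S" using finite_prime_divisors[OF \<open>f \<noteq> 0\<close>] finite_prime_divisors[OF h(2)] by simp
  ultimately show ?thesis by (rule finite_subset)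
qed

text \<open>Principal divisors have degree 0: a prime of degree n has a simple zero at a point of
  degree n and a pole of order n at infinity.\<close>

lemma wsum_poly:
  assumes "f \<noteq> 0" shows "wsum (\<lambda>x. valuation x (Fr f 1)) = 0"
  using assms
proof (induction "Polynomial.degree f" arbitrary: f rule: less_induct)
  case less
  show ?case
  proof (cases "\<exists>p. poly_of p dvd f")
    case True
    then obtain p g where g: "f = poly_of p * g" by (auto elim: dvdE)
    with less.prems have "g \<noteq> 0" by auto
    hence "Polynomial.degree g < Polynomial.degree f"
      using degree_poly_of_pos[of p] by (simp add: g degree_mult_eq)
    from less.hyps[OF this \<open>g \<noteq> 0\<close>] have IH: "wsum (\<lambda>x. valuation x (Fr g 1)) = 0" .
    have nz: "Fr (poly_of p) 1 \<noteq> 0" "Fr g 1 \<noteq> 0" using \<open>g \<noteq> 0\<close> by (simp_all add: Fract_nz_iff)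
    have "Fr f 1 = Fr (poly_of p) 1 * Fr g 1" by (simp add: g)
    hence "wsum (\<lambda>x. valuation x (Fr f 1)) = wsum (\<lambda>x. valuation x (Fr (poly_of p) 1) + valuation x (Fr g 1))"
      by (simp add: valuation_mult nz del: mult_fract)
    also have "\<dots> = wsum (\<lambda>x. valuation x (Fr (poly_of p) 1)) + wsum (\<lambda>x. valuation x (Fr g 1))"
      by (intro wsum_add finite_valuation_support nz)
    also have "wsum (\<lambda>x. valuation x (Fr (poly_of p) 1)) =
      (\<Sum>x\<in>{Infty, Fin p}. valuation x (Fr (poly_of p) 1) * int (pt_degree x))"
    proof (rule wsum_eq)
      show "{x. valuation x (Fr (poly_of p) 1) \<noteq> 0} \<subseteq> {Infty, Fin p}"
      proof
        fix x assume x: "x \<in> {x. valuation x (Fr (poly_of p) 1) \<noteq> 0}"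
        show "x \<in> {Infty, Fin p}"
        proof (cases x)
          case (Fin q)
          hence "poly_of q dvd poly_of p" using x valuation_Fin_0[of q "poly_of p" 1] by auto
          thus ?thesis using Fin by (simp add: poly_of_dvd_poly_of)
        qed simp
      qed
    qed simp
    also have "\<dots> = 0" using valuation_uniformizer[of "Fin p"]
      by (simp add: valuation_Infty uniformizer.simps)
    finally show ?thesis by (simp add: IH)
  next
    case False
    have deg: "Polynomial.degree f = 0" using irreducible_factor[of f] False by blast
    have "valuation x (Fr f 1) = 0" for x
      using less.prems deg False by (cases x) (simp_all add: valuation_Infty valuation_Fin_0)
    thus ?thesis by (simp add: wsum_def)
  qed
qed

lemma wsum_valuation:
  assumes "h \<noteq> 0" shows "wsum (\<lambda>x. valuation x h) = 0"
proof -
  obtain f g where h: "h = Fr f g" "g \<noteq> 0" by (rule ratfun_cases)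
  hence "f \<noteq> 0" using assms by auto
  have g0: "Fr g 1 \<noteq> 0" using h(2) by (simp add: Fract_nz_iff)
  have "h * Fr g 1 = Fr f 1" using h(2) by (simp add: h(1) eq_fract)
  hence "wsum (\<lambda>x. valuation x (Fr f 1)) = wsum (\<lambda>x. valuation x h + valuation x (Fr g 1))"
    using assms g0 by (simp flip: valuation_mult)
  also have "\<dots> = wsum (\<lambda>x. valuation x h) + wsum (\<lambda>x. valuation x (Fr g 1))"
    by (intro wsum_add finite_valuation_support assms g0)
  finally show ?thesis using wsum_poly[OF \<open>f \<noteq> 0\<close>] wsum_poly[OF h(2)] by simp
qed

text \<open>The matrix expressing one basis in the other has entries, hence determinant, in the
  local ring. Applied in both directions it shows that the basis chosen in \<open>local_det\<close>
  does not affect the valuation.\<close>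

lemma lat_subset_valuation_det:
  assumes g: "g \<in> carrier_mat 2 2" "det g \<noteq> 0" and g': "g' \<in> carrier_mat 2 2" "det g' \<noteq> 0"
    and sub: "lat g x \<subseteq> lat g' x"
  shows "valuation x (det g') \<le> valuation x (det g)"
proof -
  obtain a b c d where gm: "g = mat2 a b c d" by (rule mat2_cases[OF g(1)])
  obtain a' b' c' d' where gm': "g' = mat2 a' b' c' d'" by (rule mat2_cases[OF g'(1)])
  have "vec2 a c = g *\<^sub>v vec2 1 0" "vec2 b d = g *\<^sub>v vec2 0 1" by (simp_all add: gm mat2_mult_vec2)
  moreover have "vec2 1 0 \<in> local_vecs 2 x" "vec2 0 1 \<in> local_vecs 2 x" by (simp_all add: local_ring_0 local_ring_1)
  ultimately have mem: "vec2 a c \<in> lat g x" "vec2 b d \<in> lat g x" unfolding lat_def by (simp_all only: imageI)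
  obtain v where v: "vec2 a c = g' *\<^sub>v v" "v \<in> local_vecs 2 x" using subsetD[OF sub mem(1)] unfolding lat_def by (elim imageE)
  obtain w where w: "vec2 b d = g' *\<^sub>v w" "w \<in> local_vecs 2 x" using subsetD[OF sub mem(2)] unfolding lat_def by (elim imageE)
  obtain p r where pr: "v = vec2 p r" by (rule vec2_cases[OF local_vecs_carrier[OF v(2)]])
  obtain q s where qs: "w = vec2 q s" by (rule vec2_cases[OF local_vecs_carrier[OF w(2)]])
  have "g = g' * mat2 p q r s" using v(1) w(1) by (simp add: gm gm' pr qs mat2_mult mat2_mult_vec2)
  hence det: "det g = det g' * (p * s - q * r)" using det_mult[OF g'(1) mat2_carrier] by (simp add: det_mat2)
  hence nz: "p * s - q * r \<noteq> 0" using g(2) by auto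
  have "p * s - q * r \<in> local_ring x" using v(2) w(2) by (auto simp: pr qs intro!: local_ring_diff local_ring_mult)
  thus ?thesis using nz g'(2) by (simp add: det valuation_mult local_ring_iff)
qed

lemma valuation_local_det:
  assumes "g \<in> carrier_mat 2 2" "det g \<noteq> 0" "L x = lat g x"
  shows "valuation x (local_det 2 L x) = valuation x (det g)"
proof -
  define h where "h = (SOME g. g \<in> carrier_mat 2 2 \<and> det g \<noteq> 0 \<and> L x = lat g x)"
  have h: "h \<in> carrier_mat 2 2 \<and> det h \<noteq> 0 \<and> L x = lat h x"
    unfolding h_def by (rule someI[of _ g]) (use assms in simp)
  have "local_det 2 L x = det h" unfolding local_det_def h_def lat_def ..
  moreover have "lat g x = lat h x" using assms(3) h by simp
  ultimately show ?thesis
    using lat_subset_valuation_det[of g h x] lat_subset_valuation_det[of h g x] assms(1,2) h by (simp add: antisym)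
qed

lemma bundle_degree_wsum: "bundle_degree 2 L = - wsum (\<lambda>x. valuation x (local_det 2 L x))"
  by (simp add: bundle_degree_def wsum_def sum_negf)

text \<open>The divisor of the determinant changes by the principal divisor of \<open>det A\<close>,
  of degree 0.\<close>

lemma bundle_degree_translate:
  assumes L: "vector_bundle 2 L" and A: "A \<in> carrier_mat 2 2" "det A \<noteq> 0"
  shows "bundle_degree 2 (translate A L) = bundle_degree 2 L"
proof -
  let ?v = "\<lambda>x. valuation x (local_det 2 L x)"
  have fam: "lattice_family L" by (rule lattice_family_bundle[OF L])
  have eq: "valuation x (local_det 2 (translate A L) x) = valuation x (det A) + ?v x" for x
  proof -
    obtain g where g: "g \<in> carrier_mat 2 2" "det g \<noteq> 0" "L x = lat g x" by (rule lattice_familyE[OF fam])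
    have d: "det (A * g) = det A * det g" by (rule det_mult[OF A(1) g(1)])
    have "valuation x (local_det 2 (translate A L) x) = valuation x (det (A * g))"
      by (rule valuation_local_det[where L = "translate A L" and x = x, OF mult_carrier_mat[OF A(1) g(1)] _ translate_lat[where L = L and x = x, OF A(1) g(1,3)]])
         (use d g A in simp)
    thus ?thesis using g A valuation_local_det[where L = L and x = x, OF g] by (simp add: d valuation_mult)
  qed
  obtain U g where g: "finite (- U)" "g \<in> carrier_mat 2 2" "det g \<noteq> 0" "\<forall>y\<in>U. L y = lat g y"
    using L unfolding vector_bundle_def lat_def by metis
  have "{x. ?v x \<noteq> 0} \<subseteq> - U \<union> {x. valuation x (det g) \<noteq> 0}"
    using valuation_local_det[OF g(2,3)] g(4) by auto
  hence fin: "finite {x. ?v x \<noteq> 0}" using finite_valuation_support[OF g(3)] g(1) by (auto intro: finite_subset)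
  show ?thesis unfolding bundle_degree_wsum eq
    using wsum_add[OF finite_valuation_support[OF A(2)] fin] wsum_valuation[OF A(2)] by simp
qed

lemma bundle_degree_std: "bundle_degree 2 (std a b :: 'a :: field stalks) = a + b"
proof -
  have v: "valuation x (local_det 2 (std a b) x) = (if x = Infty then - (a + b) else 0)" for x :: "'a closed_pt"
  proof -
    have "valuation x (local_det 2 (std a b) x) = valuation x (det (mat2 (tw x a) 0 0 (tw x b)))"
      by (rule valuation_local_det[OF mat2_carrier _ std_lat]) (simp add: det_mat2)
    thus ?thesis by (simp add: det_mat2 valuation_mult valuation_tw)
  qed
  have "wsum (\<lambda>x. valuation x (local_det 2 (std a b) (x :: 'a closed_pt))) = - (a + b)"
    unfolding v by (subst wsum_eq[of "{Infty}"]) auto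
  thus ?thesis by (simp add: bundle_degree_wsum)
qed

section \<open>Isomorphism classes of rank 2 bundles of given degree\<close>

lemma bundle_isomorphic_sym: "bundle_isomorphic n L L' \<Longrightarrow> bundle_isomorphic n L' L"
  unfolding bundle_isomorphic_def by blast

lemma bundle_isomorphic_trans:
  assumes "bundle_isomorphic n L L'" "bundle_isomorphic n L' L''" "stalks_ok n L" "stalks_ok n L''"
  shows "bundle_isomorphic n L L''"
proof -
  obtain A B where A: "A \<in> bundle_hom n L n L'" "B \<in> bundle_hom n L' n L" "A * B = 1\<^sub>m n" "B * A = 1\<^sub>m n"
    using assms(1) unfolding bundle_isomorphic_def by (elim bexE conjE)
  obtain C E where C: "C \<in> bundle_hom n L' n L''" "E \<in> bundle_hom n L'' n L'" "C * E = 1\<^sub>m n" "E * C = 1\<^sub>m n"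
    using assms(2) unfolding bundle_isomorphic_def by (elim bexE conjE)
  note dim = A(1,2)[THEN bundle_hom_dim] C(1,2)[THEN bundle_hom_dim]
  have "(C * A) * (B * E) = 1\<^sub>m n"
    using mult_mat_assoc4[OF dim(3,1,2,4)] A(3) C(3) dim by simp
  moreover have "(B * E) * (C * A) = 1\<^sub>m n"
    using mult_mat_assoc4[OF dim(2,4,3,1)] A(4) C(4) dim by simp
  moreover have "C * A \<in> bundle_hom n L n L''" by (rule bundle_hom_comp[OF A(1) C(1) assms(3)])
  moreover have "B * E \<in> bundle_hom n L'' n L" by (rule bundle_hom_comp[OF C(2) A(2) assms(4)])
  ultimately show ?thesis unfolding bundle_isomorphic_def by (intro bexI conjI)
qed

lemma bundle_isomorphic_iso:
  assumes "bundle_isomorphic 2 L L'" "stalks_ok 2 L" "stalks_ok 2 L'"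
  obtains A B where "bundle_iso L L' A B"
  using assms unfolding bundle_isomorphic_def bundle_iso_def by (elim bexE conjE) blast

lemma bundle_isomorphic_translate:
  assumes L: "lattice_family L" and A: "A \<in> carrier_mat 2 2" "det A \<noteq> 0"
  shows "bundle_isomorphic 2 L (translate A L)"
proof -
  obtain a b c d where Am: "A = mat2 a b c d" by (rule mat2_cases[OF A(1)])
  define e where "e = a * d - b * c"
  define B where "B = mat2 (d / e) (- b / e) (- c / e) (a / e)"
  have e: "e \<noteq> 0" using A(2) by (simp add: Am e_def det_mat2)
  have AB: "A * B = 1\<^sub>m 2" "B * A = 1\<^sub>m 2" unfolding B_def Am by (rule mat2_inverse[OF e_def e])+
  have B: "B \<in> carrier_mat 2 2" by (simp add: B_def)
  have "B *\<^sub>v (A *\<^sub>v v) = v" if "v \<in> L x" for v x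
    using assoc_mult_mat_vec[OF B A(1) lattice_family_carrier[OF L that]] AB(2) lattice_family_carrier[OF L that] by simp
  hence "B \<in> bundle_hom 2 (translate A L) 2 L" using B by (auto simp: bundle_hom_def translate_def)
  moreover have "A \<in> bundle_hom 2 L 2 (translate A L)" using A by (auto simp: bundle_hom_def translate_def)
  ultimately show ?thesis unfolding bundle_isomorphic_def using AB by blast
qed

lemma std_swap: "bundle_isomorphic 2 (std a b :: 'a :: field stalks) (std b a)"
proof -
  have "mat2 0 1 1 0 \<in> bundle_hom 2 (std a b :: 'a stalks) 2 (std b a)" for a b
    by (simp add: std_hom_iff zero_in_sections one_in_sections)
  moreover have "mat2 0 1 1 0 * mat2 0 1 1 0 = (1\<^sub>m 2 :: 'a ratfun mat)" by (simp add: mat2_mult one_mat2)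
  ultimately show ?thesis unfolding bundle_isomorphic_def by blast
qed

text \<open>O(a) has no non-zero map to O(a') or O(b') if a exceeds both, so the first column of the
  isomorphism would vanish.\<close>

lemma std_isomorphic_le:
  assumes "bundle_isomorphic 2 (std a b :: 'a :: field stalks) (std a' b')" "b' \<le> a'"
  shows "a \<le> a'"
proof (rule ccontr)
  assume "\<not> a \<le> a'"
  obtain A B where A: "A \<in> bundle_hom 2 (std a b :: 'a stalks) 2 (std a' b')" "B \<in> bundle_hom 2 (std a' b' :: 'a stalks) 2 (std a b)" "B * A = 1\<^sub>m 2"
    using assms(1) unfolding bundle_isomorphic_def by (elim bexE conjE)
  obtain p f g s where Am: "A = mat2 p f g s" by (rule mat2_cases[OF bundle_hom_dim[OF A(1)]])
  obtain p' f' g' s' where Bm: "B = mat2 p' f' g' s'" by (rule mat2_cases[OF bundle_hom_dim[OF A(2)]])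
  have "p \<in> sections (a' - a)" "g \<in> sections (b' - a)" using A(1) unfolding Am std_hom_iff by simp_all
  hence "p = 0" "g = 0" using \<open>\<not> a \<le> a'\<close> assms(2) sections_neg[of "a' - a" p] sections_neg[of "b' - a" g] by simp_all
  thus False using A(3) by (simp add: Am Bm mat2_mult one_mat2)
qed

text \<open>The class of O(a) + O(d - a). Restricting to d \<le> 2 a makes the larger summand come
  first and the parametrisation injective.\<close>

definition iso_class :: "int \<Rightarrow> int \<Rightarrow> 'a :: field stalks set" where
  "iso_class d a = {L. vector_bundle 2 L \<and> bundle_degree 2 L = d \<and> bundle_isomorphic 2 (std a (d - a)) L}"

lemma std_in_iso_class: "std a (d - a) \<in> iso_class d a"
proof -
  have fam: "lattice_family (std a (d - a))" by (rule lattice_family_bundle[OF vector_bundle_split])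
  have "bundle_isomorphic 2 (std a (d - a)) (translate (1\<^sub>m 2) (std a (d - a)))"
    by (rule bundle_isomorphic_translate[OF fam]) simp_all
  thus ?thesis by (simp add: iso_class_def vector_bundle_split bundle_degree_std translate_one[OF fam])
qed

lemma bundle_isomorphic_std:
  assumes "vector_bundle 2 L" "bundle_degree 2 L = d"
  obtains a where "d \<le> 2 * a" "bundle_isomorphic 2 (std a (d - a)) L"
proof -
  have fam: "lattice_family L" by (rule lattice_family_bundle[OF assms(1)])
  obtain A a b where A: "A \<in> carrier_mat 2 2" "det A \<noteq> 0" "translate A L = std a b"
    using vector_bundle_2_splits[OF assms(1)] unfolding splits_def by (elim exE conjE)
  have ab: "a + b = d" using bundle_degree_translate[OF assms(1) A(1,2)] assms(2) by (simp add: A(3) bundle_degree_std)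
  have iso: "bundle_isomorphic 2 (std a b) L"
    using bundle_isomorphic_translate[OF fam A(1,2)] by (simp add: A(3) bundle_isomorphic_sym)
  show ?thesis
  proof (cases "d \<le> 2 * a")
    case True
    have "b = d - a" using ab by simp
    from that[OF True iso[unfolded this]] show ?thesis .
  next
    case False
    have iso': "bundle_isomorphic 2 (std b a) L"
      by (rule bundle_isomorphic_trans[OF std_swap iso]) (auto intro: vector_bundle_stalks_ok vector_bundle_split assms(1))
    have "a = d - b" "d \<le> 2 * b" using ab False by auto
    from that[OF this(2) iso'[unfolded this(1)]] show ?thesis .
  qed
qed

lemma iso_class_alt:
  assumes "vector_bundle 2 L" "bundle_degree 2 L = d" "bundle_isomorphic 2 (std a (d - a)) L"
  shows "iso_class d a = {L'. vector_bundle 2 L' \<and> bundle_degree 2 L' = d \<and> bundle_isomorphic 2 L L'}"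
proof -
  have "bundle_isomorphic 2 (std a (d - a)) L' \<longleftrightarrow> bundle_isomorphic 2 L L'" if L': "vector_bundle 2 L'" for L'
  proof
    assume "bundle_isomorphic 2 (std a (d - a)) L'"
    thus "bundle_isomorphic 2 L L'"
      by (rule bundle_isomorphic_trans[OF bundle_isomorphic_sym[OF assms(3)]]) (auto intro: vector_bundle_stalks_ok assms(1) L')
  next
    assume "bundle_isomorphic 2 L L'"
    thus "bundle_isomorphic 2 (std a (d - a)) L'"
      by (rule bundle_isomorphic_trans[OF assms(3)]) (auto intro: vector_bundle_stalks_ok vector_bundle_split L')
  qed
  thus ?thesis by (auto simp: iso_class_def)
qed

lemma bundle_classes_eq: "bundle_classes d = iso_class d ` {a. d \<le> 2 * a}"
proof (intro equalityI subsetI)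
  fix C :: "'a stalks set" assume "C \<in> bundle_classes d"
  then obtain L where L: "vector_bundle 2 L" "bundle_degree 2 L = d"
      "C = {L'. vector_bundle 2 L' \<and> bundle_degree 2 L' = d \<and> bundle_isomorphic 2 L L'}"
    unfolding bundle_classes_def by (elim quotientE) auto
  obtain a where "d \<le> 2 * a" "bundle_isomorphic 2 (std a (d - a)) L" by (rule bundle_isomorphic_std[OF L(1,2)])
  thus "C \<in> iso_class d ` {a. d \<le> 2 * a}" using iso_class_alt[OF L(1,2)] L(3) by blast
next
  fix C :: "'a stalks set" assume "C \<in> iso_class d ` {a. d \<le> 2 * a}"
  then obtain a where C: "C = iso_class d a" by blast
  have s: "vector_bundle 2 (std a (d - a) :: 'a stalks)" "bundle_degree 2 (std a (d - a) :: 'a stalks) = d"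
      "bundle_isomorphic 2 (std a (d - a) :: 'a stalks) (std a (d - a))"
    using std_in_iso_class[of a d, where 'a = 'a] by (simp_all add: iso_class_def)
  let ?S = "{L :: 'a stalks. vector_bundle 2 L \<and> bundle_degree 2 L = d}"
  let ?R = "{(L, L'). vector_bundle 2 L \<and> bundle_degree 2 L = d \<and>
          vector_bundle 2 L' \<and> bundle_degree 2 L' = d \<and> bundle_isomorphic 2 (L :: 'a stalks) L'}"
  have "C = ?R `` {std a (d - a)}" using s by (auto simp: C iso_class_def)
  moreover have "?R `` {std a (d - a)} \<in> ?S // ?R" by (rule quotientI) (use s in simp)
  ultimately show "C \<in> bundle_classes d" unfolding bundle_classes_def by simp
qed

lemma inj_iso_class: "inj_on (iso_class d :: int \<Rightarrow> 'a :: field stalks set) {a. d \<le> 2 * a}"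
proof (rule inj_onI)
  fix a a' assume a: "a \<in> {a. d \<le> 2 * a}" "a' \<in> {a. d \<le> 2 * a}" and eq: "(iso_class d a :: 'a stalks set) = iso_class d a'"
  have iso: "bundle_isomorphic 2 (std a (d - a)) (std a' (d - a') :: 'a stalks)"
    "bundle_isomorphic 2 (std a' (d - a')) (std a (d - a) :: 'a stalks)"
    using std_in_iso_class[of a d, where 'a = 'a] std_in_iso_class[of a' d, where 'a = 'a] eq by (auto simp: iso_class_def)
  thus "a = a'" using std_isomorphic_le[OF iso(1)] std_isomorphic_le[OF iso(2)] a by simp
qed

lemma class_flag_count_iso_class:
  "class_flag_count D (iso_class d a) = flag_count D (std a (d - a) :: 'a :: field stalks)"
proof -
  define L where "L = (SOME L :: 'a stalks. L \<in> iso_class d a)"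
  have "L \<in> iso_class d a" unfolding L_def by (rule someI[of "\<lambda>L. L \<in> iso_class d a", OF std_in_iso_class])
  hence L: "vector_bundle 2 L" "bundle_isomorphic 2 (std a (d - a)) L" by (simp_all add: iso_class_def)
  obtain A B where "bundle_iso (std a (d - a)) L A B"
    by (rule bundle_isomorphic_iso[OF L(2)]) (auto intro: vector_bundle_stalks_ok vector_bundle_split L(1))
  from flag_count_cong[OF this] show ?thesis by (simp add: class_flag_count_def L_def)
qed

lemma total_flag_count_eq:
  fixes D :: "'a :: field closed_pt set"
    and d :: int
  defines "T \<equiv> {a. d \<le> 2 * a \<and> flag_count D (std a (d - a)) \<noteq> 0}"
  shows "finite (contributing_classes D d) \<longleftrightarrow> finite T"
    and "total_flag_count D d = (\<Sum>a\<in>T. flag_count D (std a (d - a)))"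
proof -
  have inj: "inj_on (iso_class d :: int \<Rightarrow> 'a stalks set) T"
    by (rule inj_on_subset[OF inj_iso_class]) (auto simp: T_def)
  have eq: "contributing_classes D d = iso_class d ` T"
    by (auto simp: contributing_classes_def bundle_classes_eq class_flag_count_iso_class T_def)
  show "finite (contributing_classes D d) \<longleftrightarrow> finite T" unfolding eq by (rule finite_image_iff[OF inj])
  show "total_flag_count D d = (\<Sum>a\<in>T. flag_count D (std a (d - a)))"
    unfolding total_flag_count_def eq by (simp add: sum.reindex[OF inj] class_flag_count_iso_class)
qed

section \<open>Permutation characters and the final summation\<close>

lemma prod_monom: "(\<Prod>x\<in>P. Polynomial.monom 1 (f x)) = (Polynomial.monom 1 (\<Sum>x\<in>P. f x) :: int poly)"
  by (induction P rule: infinite_finite_induct) (simp_all add: mult_monom)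

text \<open>The generating function of subsets by total weight depends only on the multiset of
  weights. This is how the cycle type of \<open>w\<close> links the orbits of \<open>w\<close> to
  the points of D.\<close>

lemma card_subsets_sum:
  fixes f :: "'b \<Rightarrow> nat"
  assumes "finite A"
  shows "int (card {P \<in> Pow A. sum f P = s}) =
    Polynomial.coeff (\<Prod>n\<in>#image_mset f (mset_set A). Polynomial.monom 1 n + 1) s"
proof -
  have "(\<Prod>n\<in>#image_mset f (mset_set A). Polynomial.monom 1 n + 1) = (\<Prod>x\<in>A. Polynomial.monom 1 (f x) + 1 :: int poly)"
    by (simp add: prod_unfold_prod_mset image_mset.compositionality o_def)
  also have "\<dots> = (\<Sum>P\<in>Pow A. Polynomial.monom 1 (sum f P))"
    using assms by (simp add: prod_add prod_monom)
  also have "Polynomial.coeff \<dots> s = (\<Sum>P\<in>Pow A. if sum f P = s then 1 else 0)"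
    by (simp add: Polynomial.coeff_sum)
  also have "\<dots> = int (card {P \<in> Pow A. sum f P = s})"
    using assms by (simp add: sum.If_cases Int_def)
  finally show ?thesis by simp
qed

text \<open>The invariant subsets are exactly the unions of orbits.\<close>

lemma card_invariant_subsets:
  assumes w: "w permutes A" and fin: "finite A"
  shows "card {S. S \<subseteq> A \<and> card S = s \<and> w ` S = S} = card {P \<in> Pow (orbit w ` A). sum card P = s}"
proof -
  let ?O = "orbit w ` A"
  have perm: "permutation w" using w fin by (auto simp: permutation_permutes)
  have self: "x \<in> orbit w x" for x by (rule permutation_self_in_orbit[OF perm])
  have sub: "c \<subseteq> A" if "c \<in> ?O" for c using that permutes_orbit_subset[OF w] by auto
  have eq: "orbit w y = orbit w x" if "y \<in> orbit w x" for x y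
    using that self orbit_swap[OF self that] by (blast intro: orbit_trans)
  have disj: "c = c'" if c: "c \<in> ?O" "c' \<in> ?O" "x \<in> c" "x \<in> c'" for c c' x
  proof -
    obtain y z where "c = orbit w y" "c' = orbit w z" using c(1,2) by (elim imageE)
    thus ?thesis using eq[of x y] eq[of x z] c(3,4) by simp
  qed
  have cardU: "card (\<Union>P) = sum card P" if P: "P \<subseteq> ?O" for P
  proof (rule card_Union_disjoint)
    show "pairwise disjnt P"
    proof (rule pairwiseI)
      fix c c' assume c: "c \<in> P" "c' \<in> P" "c \<noteq> c'"
      hence O: "c \<in> ?O" "c' \<in> ?O" using subsetD[OF P] by auto
      show "disjnt c c'" unfolding disjnt_iff using disj[OF O] c(3) by blast
    qed
    show "finite c" if c: "c \<in> P" for c by (rule finite_subset[OF sub[OF subsetD[OF P c]] fin])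
  qed
  have "bij_betw Union {P \<in> Pow ?O. sum card P = s} {S. S \<subseteq> A \<and> card S = s \<and> w ` S = S}"
  proof (rule bij_betw_byWitness[where f' = "\<lambda>S. {c \<in> ?O. c \<subseteq> S}"])
    show "\<forall>P\<in>{P \<in> Pow ?O. sum card P = s}. {c \<in> ?O. c \<subseteq> \<Union>P} = P"
    proof
      fix P assume "P \<in> {P \<in> Pow ?O. sum card P = s}"
      hence P: "P \<subseteq> ?O" by simp
      show "{c \<in> ?O. c \<subseteq> \<Union>P} = P"
      proof (intro equalityI subsetI)
        fix o1 assume o1: "o1 \<in> {c \<in> ?O. c \<subseteq> \<Union>P}"
        then obtain x where "x \<in> A" "o1 = orbit w x" by blast
        hence x: "x \<in> o1" using self by simp
        then obtain o2 where "o2 \<in> P" "x \<in> o2" using o1 by blast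
        moreover from this have "o1 = o2" using disj[of o1 o2 x] o1 x P by blast
        ultimately show "o1 \<in> P" by simp
      qed (use P in auto)
    qed
    have stable: "orbit w x \<subseteq> S" if S: "w ` S = S" "x \<in> S" for S x
    proof
      fix y assume "y \<in> orbit w x"
      thus "y \<in> S" by induction (use S in auto)
    qed
    have U: "\<Union>{c \<in> ?O. c \<subseteq> S} = S" if S: "S \<subseteq> A" "w ` S = S" for S
    proof (intro equalityI subsetI)
      fix x assume "x \<in> S"
      hence "orbit w x \<in> {c \<in> ?O. c \<subseteq> S}" using S stable[OF S(2)] by blast
      thus "x \<in> \<Union>{c \<in> ?O. c \<subseteq> S}" using self by blast
    qed blast
    show "\<forall>S\<in>{S. S \<subseteq> A \<and> card S = s \<and> w ` S = S}. \<Union>{c \<in> ?O. c \<subseteq> S} = S" using U by blast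
    show "(\<lambda>S. {c \<in> ?O. c \<subseteq> S}) ` {S. S \<subseteq> A \<and> card S = s \<and> w ` S = S} \<subseteq> {P \<in> Pow ?O. sum card P = s}"
    proof (rule image_subsetI)
      fix S assume S: "S \<in> {S. S \<subseteq> A \<and> card S = s \<and> w ` S = S}"
      have "sum card {c \<in> ?O. c \<subseteq> S} = card (\<Union>{c \<in> ?O. c \<subseteq> S})" by (rule cardU[symmetric]) blast
      also have "\<Union>{c \<in> ?O. c \<subseteq> S} = S" using U S by blast
      finally show "{c \<in> ?O. c \<subseteq> S} \<in> {P \<in> Pow ?O. sum card P = s}" using S by auto
    qed
    show "Union ` {P \<in> Pow ?O. sum card P = s} \<subseteq> {S. S \<subseteq> A \<and> card S = s \<and> w ` S = S}"
    proof (rule image_subsetI)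
      fix P assume P: "P \<in> {P \<in> Pow ?O. sum card P = s}"
      have UA: "\<Union>P \<subseteq> A" using P sub by blast
      have "w x \<in> \<Union>P" if x: "x \<in> \<Union>P" for x
      proof -
        obtain o1 where o1: "o1 \<in> P" "x \<in> o1" using x by blast
        then obtain z where "o1 = orbit w z" using P by blast
        hence "w x \<in> o1" using o1(2) by (simp add: orbit.step)
        thus ?thesis using o1(1) by blast
      qed
      hence "w ` \<Union>P = \<Union>P"
        using permutes_inj_on[OF w] finite_subset[OF UA fin] by (intro endo_inj_surj) auto
      thus "\<Union>P \<in> {S. S \<subseteq> A \<and> card S = s \<and> w ` S = S}" using UA cardU[of P] P by auto
    qed
  qed
  from bij_betw_same_card[OF this] show ?thesis by (rule sym)
qed

text \<open>The trace of a permutation matrix counts the fixed basis elements, here the subsets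
  invariant under \<open>w\<close>.\<close>

lemma subset_character_eq:
  assumes w: "w permutes {1..l}" and ct: "cycle_type w {1..l} = image_mset pt_degree (mset_set D)" and D: "finite D"
  shows "subset_character l s w = of_nat (card {I \<in> Pow D. deg_sum I = s})"
proof -
  have inv: "inv_into UNIV w ` S = S \<longleftrightarrow> w ` S = S" for S
    using permutes_bij[OF w] by (metis bij_image_Collect_eq bij_is_inj bij_is_surj image_inv_f_f image_f_inv_f)
  have fin: "finite (subsets_of_size l s)" by (rule finite_subset[of _ "Pow {1..l}"]) (auto simp: subsets_of_size_def)
  have "subset_character l s w = (\<Sum>S\<in>subsets_of_size l s. if w ` S = S then 1 else 0)"
    unfolding subset_character_def subset_rep_def basis_fun_def inv ..
  also have "\<dots> = of_nat (card {S \<in> subsets_of_size l s. w ` S = S})"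
    using fin by (simp add: sum.If_cases Int_def)
  also have "{S \<in> subsets_of_size l s. w ` S = S} = {S. S \<subseteq> {1..l} \<and> card S = s \<and> w ` S = S}"
    by (auto simp: subsets_of_size_def)
  also have "card \<dots> = card {P \<in> Pow (orbit w ` {1..l}). sum card P = s}"
    by (rule card_invariant_subsets[OF w]) simp
  also have "\<dots> = card {I \<in> Pow D. sum pt_degree I = s}"
    using card_subsets_sum[of "orbit w ` {1..l}" card s] card_subsets_sum[OF D, of pt_degree s] ct
    unfolding cycle_type_def by simp
  finally show ?thesis by (simp add: deg_sum_def)
qed

section \<open>Summation of geometric series\<close>

lemma sum_power_deg_sum:
  fixes z :: "'c :: comm_ring_1"
  assumes "finite D"
  shows "(\<Sum>I\<in>Pow D. z ^ deg_sum I) = (\<Prod>x\<in>D. 1 + z ^ pt_degree x)"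
proof -
  have "(\<Prod>x\<in>D. z ^ pt_degree x + 1) = (\<Sum>I\<in>Pow D. z ^ deg_sum I)"
    using assms by (simp add: prod_add deg_sum_def power_sum)
  thus ?thesis by (simp add: add.commute)
qed

definition geo :: "int \<Rightarrow> nat \<Rightarrow> int" where
  "geo q n = (\<Sum>m<n. q ^ m)"

lemma geo_eq: "(q - 1) * geo q n = q ^ n - 1"
  by (induction n) (simp_all add: geo_def algebra_simps)

text \<open>The top term of \<open>geo q (s - (2 * k + 2))\<close>, which is missing for the next
  larger splitting gap; see \<open>geo_gap\<close>.\<close>

definition gap :: "int \<Rightarrow> nat \<Rightarrow> nat \<Rightarrow> int" where
  "gap q s k = (if 2 * k + 3 \<le> s then q ^ (s - (2 * k + 3)) else 0)"

lemma geo_gap: "geo q (s - (2 * k + 2)) = geo q (s - (2 * k + 3)) + gap q s k"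
proof (cases "2 * k + 3 \<le> s")
  case True
  hence "s - (2 * k + 2) = Suc (s - (2 * k + 3))" by simp
  thus ?thesis using True by (simp add: geo_def gap_def)
next
  case False
  hence "s - (2 * k + 2) = 0" "s - (2 * k + 3) = 0" by simp_all
  thus ?thesis using False by (simp add: gap_def)
qed

text \<open>The leading term contributes (q^3 - q) q^(s - 3) = q^s - q^(s - 2), and the others form
  the same sum for s - 2. The telescope ends at s = 2 or s = 1, whence q^2 or q; \<open>K\<close> is
  only a bound large enough to catch all non-zero terms.\<close>

lemma sum_gap:
  assumes "s \<le> K"
  shows "(q ^ 3 - q) * (\<Sum>k<K. gap q s k) = (if s = 0 then 0 else q ^ s - (if even s then q\<^sup>2 else q))"
  using assms
proof (induction s arbitrary: K rule: less_induct)
  case (less s)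
  show ?case
  proof (cases "s \<le> 2")
    case True
    hence "(\<Sum>k<K. gap q s k) = 0" by (simp add: gap_def)
    moreover have "s = 0 \<or> s = 1 \<or> s = 2" using True by linarith
    ultimately show ?thesis by auto
  next
    case False
    define t where "t = s - 3"
    have s: "s = t + 3" using False by (simp add: t_def)
    obtain K' where K: "K = Suc K'" using less.prems False by (cases K) auto
    have shift: "gap q s (Suc k) = gap q (t + 1) k" for k
    proof -
      have "t + 3 - (2 * Suc k + 3) = t + 1 - (2 * k + 3)" "2 * Suc k + 3 \<le> t + 3 \<longleftrightarrow> 2 * k + 3 \<le> t + 1" by auto
      thus ?thesis unfolding gap_def s by (simp only:)
    qed
    have "(\<Sum>k<K. gap q s k) = gap q s 0 + (\<Sum>k<K'. gap q (t + 1) k)"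
      unfolding K sum.lessThan_Suc_shift shift ..
    also have "gap q s 0 = q ^ t" by (simp add: gap_def s)
    finally have "(q ^ 3 - q) * (\<Sum>k<K. gap q s k) = (q ^ 3 - q) * q ^ t + (q ^ 3 - q) * (\<Sum>k<K'. gap q (t + 1) k)"
      by (simp add: distrib_left)
    also have "(q ^ 3 - q) * (\<Sum>k<K'. gap q (t + 1) k) = q ^ (t + 1) - (if even (t + 1) then q\<^sup>2 else q)"
      using less.IH[of "t + 1" K'] less.prems by (simp add: s K)
    finally show ?thesis by (simp add: s algebra_simps power_add)
  qed
qed

text \<open>Of the factors of the order (q - 1)^2 q^(e + 1) of the automorphism group, one q - 1 is
  due to the scalars; the rest turns q^s - q^(e + 1) into a geometric sum.\<close>

lemma flag_count_unbalanced:
  fixes D :: "'k :: {field, finite} closed_pt set"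
  defines "q \<equiv> int (card (UNIV :: 'k set))"
  assumes D: "finite D" and ab: "b < a"
  shows "int (flag_count D (std a b)) = (\<Sum>I\<in>Pow D. geo q (deg_sum I - nat (a - b + 1)))"
proof -
  let ?N = "nat (a - b + 1)"
  have q: "q \<ge> 2" using card_UNIV_ge_2[where 'k = 'k] by (simp add: q_def)
  have N: "nat (a - b) + 1 = ?N" using ab by simp
  let ?f = "\<lambda>I. if deg_sum I \<ge> ?N then q ^ deg_sum I - q ^ ?N else 0"
  have q1: "int (card (UNIV :: 'k set) - 1) = q - 1" using card_UNIV_ge_2[where 'k = 'k] by (simp add: q_def of_nat_diff)
  have "int (flag_count D (std a b)) * int (card (bundle_aut 2 (std a b :: 'k stalks))) =
      (q - 1) * int (card {u \<in> PiE D codes. brick (a - b) D u})"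
    using arg_cong[OF flag_count_std[OF D, of b a], of int] ab q1 by simp
  also have "int (card (bundle_aut 2 (std a b :: 'k stalks))) = (q - 1)\<^sup>2 * q ^ ?N"
    using card_bundle_aut_gt[OF ab, where 'k = 'k] q1 by (simp add: q_def)
  also have "int (card {u \<in> PiE D codes. brick (a - b) D u}) = (\<Sum>I\<in>Pow D. ?f I)"
    using card_bricks_pos[OF D, of "a - b"] ab unfolding N q_def by simp
  also have "\<dots> = (\<Sum>I\<in>Pow D. (q - 1) * q ^ ?N * geo q (deg_sum I - ?N))"
  proof (rule sum.cong[OF refl])
    fix I
    show "?f I = (q - 1) * q ^ ?N * geo q (deg_sum I - ?N)"
    proof (cases "deg_sum I \<ge> ?N")
      case True
      have "(q - 1) * q ^ ?N * geo q (deg_sum I - ?N) = q ^ ?N * ((q - 1) * geo q (deg_sum I - ?N))" by (simp add: ac_simps)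
      also have "\<dots> = q ^ (?N + (deg_sum I - ?N)) - q ^ ?N" unfolding geo_eq power_add by (simp add: algebra_simps)
      finally show ?thesis using True by simp
    next
      case False
      hence "deg_sum I - ?N = 0" by simp
      thus ?thesis using False by (simp add: geo_def)
    qed
  qed
  finally have "(q - 1)\<^sup>2 * q ^ ?N * int (flag_count D (std a b)) = (q - 1)\<^sup>2 * q ^ ?N * (\<Sum>I\<in>Pow D. geo q (deg_sum I - ?N))"
    by (simp add: sum_distrib_left power2_eq_square ac_simps)
  thus ?thesis using q by simp
qed

text \<open>After multiplication by q^3 - q both sides become polynomials in q. By
  \<open>sum_gap\<close> each subset contributes according to the parity of its degree, which
  matches the corrections in \<open>card_bricks_0\<close> for rational pairs and conjugate
  pairs.\<close>

lemma flag_count_balanced: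
  fixes D :: "'k :: {field, finite} closed_pt set"
  defines "q \<equiv> int (card (UNIV :: 'k set))"
  assumes D: "finite D" and K: "deg_sum D \<le> K"
  shows "int (flag_count D (std a a)) = (\<Sum>I\<in>Pow D. \<Sum>k<K. gap q (deg_sum I) k)"
proof -
  have q: "q \<ge> 2" using card_UNIV_ge_2[where 'k = 'k] by (simp add: q_def)
  have q1: "int (card (UNIV :: 'k set) - 1) = q - 1" using card_UNIV_ge_2[where 'k = 'k] by (simp add: q_def of_nat_diff)
  have "2 * 2 * q \<le> q * q * q" using q by (intro mult_mono) auto
  hence q3: "q ^ 3 - q > 0" using q by (simp add: power3_eq_cube)
  have "int (flag_count D (std a a)) * int (card (bundle_aut 2 (std a a :: 'k stalks))) =
      (q - 1) * int (card {u \<in> PiE D codes. brick 0 D u})"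
    using arg_cong[OF flag_count_std[OF D, of a a], of int] q1 by simp
  also have "int (card (bundle_aut 2 (std a a :: 'k stalks))) = (q - 1) * (q ^ 3 - q)"
    using card_bundle_aut_eq[where 'k = 'k, of a] by (simp add: q_def)
  finally have fc: "(q ^ 3 - q) * int (flag_count D (std a a)) = int (card {u \<in> PiE D codes. brick 0 D u})"
    using q by (simp add: mult.commute)
  have "(q ^ 3 - q) * (\<Sum>I\<in>Pow D. \<Sum>k<K. gap q (deg_sum I) k) = int (card {u \<in> PiE D codes. brick 0 D u})"
  proof (cases "D = {}")
    case True
    thus ?thesis using no_bricks_empty by (simp add: deg_sum_def gap_def)
  next
    case False
    define p where "p = (\<lambda>s :: nat. if even s then q\<^sup>2 else q)"
    have le: "deg_sum I \<le> K" if "I \<in> Pow D" for I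
      using that D K sum_mono2[of D I pt_degree] by (simp add: deg_sum_def)
    have zero: "deg_sum I = 0 \<longleftrightarrow> I = {}" if "I \<in> Pow D" for I
    proof -
      have "finite I" using that D finite_subset by blast
      moreover have "pt_degree x \<noteq> 0" for x :: "'k closed_pt" by (rule pt_degree_pos[THEN less_imp_neq, symmetric])
      ultimately show ?thesis by (auto simp: deg_sum_def simp del: neq0_conv)
    qed
    have "(q ^ 3 - q) * (\<Sum>I\<in>Pow D. \<Sum>k<K. gap q (deg_sum I) k) =
      (\<Sum>I\<in>Pow D. if deg_sum I = 0 then 0 else q ^ deg_sum I - p (deg_sum I))"
      unfolding sum_distrib_left by (intro sum.cong refl) (simp only: sum_distrib_left[symmetric] sum_gap[OF le] p_def)
    \<comment> \<open>The empty set is the only one of degree 0. There the general term would be 1 -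
      q^2 instead of 0, which the last summand corrects.\<close>
    also have "\<dots> = (\<Sum>I\<in>Pow D. (q ^ deg_sum I - p (deg_sum I)) + (if I = {} then q\<^sup>2 - 1 else 0))"
      using zero by (intro sum.cong refl) (auto simp: p_def deg_sum_def)
    also have "\<dots> = (\<Prod>x\<in>D. 1 + q ^ pt_degree x) - (\<Sum>I\<in>Pow D. p (deg_sum I)) + (q\<^sup>2 - 1)"
      using D by (simp add: sum.distrib sum_subtractf sum_power_deg_sum)
    finally have lhs: "(q ^ 3 - q) * (\<Sum>I\<in>Pow D. \<Sum>k<K. gap q (deg_sum I) k) =
      (\<Prod>x\<in>D. 1 + q ^ pt_degree x) - (\<Sum>I\<in>Pow D. p (deg_sum I)) + (q\<^sup>2 - 1)" .
    \<comment> \<open>The sign (-1)^s separates the parities, and its sum over subsets is a product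
      over the points that vanishes as soon as one degree is odd.\<close>
    have "2 * p s = (q\<^sup>2 + q) + (q\<^sup>2 - q) * (- 1) ^ s" for s by (simp add: p_def)
    hence "2 * (\<Sum>I\<in>Pow D. p (deg_sum I)) = (\<Sum>I\<in>Pow D. (q\<^sup>2 + q) + (q\<^sup>2 - q) * (- 1) ^ deg_sum I)"
      by (simp add: sum_distrib_left)
    also have "\<dots> = 2 ^ card D * (q\<^sup>2 + q) + (q\<^sup>2 - q) * (\<Prod>x\<in>D. 1 + (- 1) ^ pt_degree x)"
      using D by (simp add: sum.distrib card_Pow sum_power_deg_sum flip: sum_distrib_left)
    also have "(\<Prod>x\<in>D. 1 + (- 1) ^ pt_degree x) = (if \<forall>x\<in>D. even (pt_degree x) then 2 ^ card D else (0 :: int))"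
    proof (cases "\<forall>x\<in>D. even (pt_degree x)")
      case True
      hence "(\<Prod>x\<in>D. 1 + (- 1) ^ pt_degree x) = (\<Prod>x\<in>D. 2 :: int)" by (intro prod.cong) auto
      thus ?thesis using True by simp
    next
      case False
      then obtain x where "x \<in> D" "odd (pt_degree x)" by blast
      hence "(\<Prod>x\<in>D. 1 + (- 1 :: int) ^ pt_degree x) = 0" using D by (intro prod_zero bexI[of _ x]) auto
      thus ?thesis using False by simp
    qed
    finally have P: "2 * (\<Sum>I\<in>Pow D. p (deg_sum I)) =
      2 ^ card D * (q\<^sup>2 + q) + (q\<^sup>2 - q) * (if \<forall>x\<in>D. even (pt_degree x) then 2 ^ card D else 0)" .
    have "card D \<noteq> 0" using False D by simp
    hence two: "(2 :: int) ^ card D = 2 * 2 ^ (card D - 1)" by (cases "card D") auto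
    have "(\<Sum>I\<in>Pow D. p (deg_sum I)) = 2 ^ (card D - 1) * (q\<^sup>2 + q) +
      (if \<forall>x\<in>D. even (pt_degree x) then (q\<^sup>2 - q) * 2 ^ (card D - 1) else 0)"
      using P unfolding two by (auto simp: algebra_simps split: if_splits)
    thus ?thesis unfolding lhs card_bricks_0[OF D False, folded q_def] by (simp add: algebra_simps power2_eq_square)
  qed
  hence "(q ^ 3 - q) * int (flag_count D (std a a)) = (q ^ 3 - q) * (\<Sum>I\<in>Pow D. \<Sum>k<K. gap q (deg_sum I) k)"
    using fc by simp
  thus ?thesis using q3 by simp
qed

lemma total_flag_count_formula:
  fixes D :: "'k :: {field, finite} closed_pt set" and d :: int
  defines "q \<equiv> int (card (UNIV :: 'k set))"
  assumes D: "finite D"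
  shows "finite (contributing_classes D d)"
    and "int (total_flag_count D d) = (\<Sum>I\<in>Pow D. \<Sum>k<deg_sum D. geo q (deg_sum I - (2 * k + 2)))"
proof -
  let ?l = "deg_sum D"
  define F where "F = (\<lambda>a. flag_count D (std a (d - a)))"
  define T where "T = {a. d \<le> 2 * a \<and> F a \<noteq> 0}"
  have le: "deg_sum I \<le> ?l" if "I \<in> Pow D" for I
    using that D sum_mono2[of D I pt_degree] by (simp add: deg_sum_def)
  \<comment> \<open>\<open>n\<close> is the dimension of the space of sections of O(2 a - d);
    \<open>n \<ge> 2\<close> excludes the balanced bundle.\<close>
  have F: "int (F a) = (\<Sum>I\<in>Pow D. geo q (deg_sum I - n))" if a: "2 * a - d = int n - 1" "n \<ge> 2" for a n
  proof -
    have "d - a < a" "nat (a - (d - a) + 1) = n" using a by linarith+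
    thus ?thesis using flag_count_unbalanced[OF D, of "d - a" a] by (simp add: F_def q_def)
  qed
  have vanish: "F a = 0" if "2 * a - d > int ?l" for a
  proof -
    define n where "n = nat (2 * a - d + 1)"
    have n: "2 * a - d = int n - 1" "n \<ge> 2" "n \<ge> ?l" using that by (auto simp: n_def)
    have "deg_sum I - n = 0" if "I \<in> Pow D" for I using le[OF that] n(3) by simp
    hence "int (F a) = 0" unfolding F[OF n(1,2)] by (simp add: geo_def)
    thus ?thesis by simp
  qed
  define c where "c = d div 2"
  have Tsub: "T \<subseteq> (\<lambda>k. c + int k) ` {..?l}"
  proof
    fix a assume a: "a \<in> T"
    hence "d \<le> 2 * a" "F a \<noteq> 0" by (simp_all add: T_def)
    moreover from this have "2 * a - d \<le> int ?l" using vanish[of a] by linarith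
    ultimately have "a = c + int (nat (a - c))" "nat (a - c) \<le> ?l" by (auto simp: c_def)
    thus "a \<in> (\<lambda>k. c + int k) ` {..?l}" by blast
  qed
  have finT: "finite T" by (rule finite_subset[OF Tsub]) simp
  thus "finite (contributing_classes D d)" using total_flag_count_eq(1)[of D d] by (simp add: T_def F_def)
  have total: "int (total_flag_count D d) = (\<Sum>a\<in>T. int (F a))"
    using total_flag_count_eq(2)[of D d] by (simp add: T_def F_def)
  have inj: "inj_on (\<lambda>k. m + int k) A" for m A by (simp add: inj_on_def)
  show "int (total_flag_count D d) = (\<Sum>I\<in>Pow D. \<Sum>k<?l. geo q (deg_sum I - (2 * k + 2)))"
  proof (cases "even d")
    case True
    hence d: "d = 2 * c" by (simp add: c_def)
    have "int (total_flag_count D d) = (\<Sum>a\<in>(\<lambda>k. c + int k) ` {..?l}. int (F a))"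
      unfolding total by (rule sum.mono_neutral_left[OF _ Tsub]) (auto simp: T_def d)
    also have "\<dots> = (\<Sum>k\<le>?l. int (F (c + int k)))" by (simp add: sum.reindex[OF inj])
    \<comment> \<open>For even d the balanced bundle is split off. The others have \<open>n\<close>
      = 2 k + 3, and the balanced count supplies the terms \<open>gap\<close> that raise them to the
      value for 2 k + 2 found directly for odd d.\<close>
    also have "\<dots> = int (F c) + (\<Sum>k<?l. int (F (c + int (Suc k))))"
      unfolding lessThan_Suc_atMost[symmetric] sum.lessThan_Suc_shift by simp
    also have "int (F c) = (\<Sum>I\<in>Pow D. \<Sum>k<?l. gap q (deg_sum I) k)"
    proof -
      have "d - c = c" by (simp add: d)
      thus ?thesis unfolding F_def q_def using flag_count_balanced[OF D order_refl, of c] by (simp only:)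
    qed
    also have "(\<Sum>k<?l. int (F (c + int (Suc k)))) = (\<Sum>k<?l. \<Sum>I\<in>Pow D. geo q (deg_sum I - (2 * k + 3)))"
      by (intro sum.cong refl F) (simp_all add: d)
    also have "\<dots> = (\<Sum>I\<in>Pow D. \<Sum>k<?l. geo q (deg_sum I - (2 * k + 3)))" by (rule sum.swap)
    also have "(\<Sum>I\<in>Pow D. \<Sum>k<?l. gap q (deg_sum I) k) + \<dots> =
      (\<Sum>I\<in>Pow D. \<Sum>k<?l. geo q (deg_sum I - (2 * k + 2)))"
      unfolding geo_gap sum.distrib by (rule add.commute)
    finally show ?thesis .
  next
    case False
    hence d: "d = 2 * c + 1" by (simp add: c_def)
    have sub: "T \<subseteq> (\<lambda>k. c + 1 + int k) ` {..<?l}"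
    proof
      fix a assume a: "a \<in> T"
      hence "d \<le> 2 * a" "F a \<noteq> 0" by (simp_all add: T_def)
      moreover from this have "2 * a - d \<le> int ?l" using vanish[of a] by linarith
      ultimately have a: "c + 1 \<le> a" "a - c - 1 < int ?l \<or> ?l = 0 \<and> a = c + 1" "F a \<noteq> 0" using d by auto
      \<comment> \<open>For l = 0 the range of \<open>k\<close> is empty, so the candidate a = c + 1
        has to be excluded separately; its splitting gap 1 exceeds l.\<close>
      have "F (c + 1) = 0" if "?l = 0" by (rule vanish) (use that d in simp)
      hence "a - c - 1 < int ?l" using a(2,3) by auto
      hence "a = c + 1 + int (nat (a - c - 1))" "nat (a - c - 1) \<in> {..<?l}" using a(1) by auto
      thus "a \<in> (\<lambda>k. c + 1 + int k) ` {..<?l}" by (rule image_eqI)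
    qed
    have "int (total_flag_count D d) = (\<Sum>a\<in>(\<lambda>k. c + 1 + int k) ` {..<?l}. int (F a))"
      unfolding total by (rule sum.mono_neutral_left[OF _ sub]) (auto simp: T_def d)
    also have "\<dots> = (\<Sum>k<?l. int (F (c + 1 + int k)))" by (simp add: sum.reindex[OF inj])
    also have "\<dots> = (\<Sum>k<?l. \<Sum>I\<in>Pow D. geo q (deg_sum I - (2 * k + 2)))"
      by (intro sum.cong refl F) (simp_all add: d)
    finally show ?thesis by (simp only: sum.swap[of _ "Pow D"])
  qed
qed

text \<open>Put a = k + 1. The condition m + 2 k + 3 \<le> s already implies all upper limits, so
  both ranges can be widened to l and the order of summation exchanged.\<close>

lemma double_sum_geo:
  fixes q :: complex
  assumes "s \<le> l" "l \<ge> 3"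
  shows "(\<Sum>m=0..l-3. \<Sum>a=1..(l - m - 1) div 2. if m + 2 * a + 1 \<le> s then q ^ m else 0) =
    (\<Sum>k<l. \<Sum>m<s - (2 * k + 2). q ^ m)"
proof -
  let ?g = "\<lambda>m k. if m + 2 * k + 3 \<le> s then q ^ m else 0"
  have "(\<Sum>a=1..(l - m - 1) div 2. if m + 2 * a + 1 \<le> s then q ^ m else 0) = (\<Sum>k<l. ?g m k)" for m
  proof -
    have "(\<Sum>a=1..(l - m - 1) div 2. if m + 2 * a + 1 \<le> s then q ^ m else 0) = (\<Sum>k<(l - m - 1) div 2. ?g m k)"
      by (simp add: sum.atLeast1_atMost_eq numeral_3_eq_3)
    also have "\<dots> = (\<Sum>k<l. ?g m k)"
      using assms by (intro sum.mono_neutral_left) auto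
    finally show ?thesis .
  qed
  hence "(\<Sum>m=0..l-3. \<Sum>a=1..(l - m - 1) div 2. if m + 2 * a + 1 \<le> s then q ^ m else 0) = (\<Sum>m=0..l-3. \<Sum>k<l. ?g m k)"
    by simp
  also have "\<dots> = (\<Sum>m<l. \<Sum>k<l. ?g m k)"
    using assms by (intro sum.mono_neutral_left) (auto intro!: sum.neutral)
  also have "\<dots> = (\<Sum>k<l. \<Sum>m<l. ?g m k)" by (rule sum.swap)
  also have "\<dots> = (\<Sum>k<l. \<Sum>m<s - (2 * k + 2). q ^ m)"
  proof (rule sum.cong[OF refl])
    fix k
    have "(\<Sum>m<s - (2 * k + 2). q ^ m) = (\<Sum>m<s - (2 * k + 2). ?g m k)" by (intro sum.cong) auto
    also have "\<dots> = (\<Sum>m<l. ?g m k)" using assms by (intro sum.mono_neutral_left) auto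
    finally show "(\<Sum>m<l. ?g m k) = (\<Sum>m<s - (2 * k + 2). q ^ m)" by simp
  qed
  finally show ?thesis .
qed

theorem corollary1p3p3:
  fixes b :: "nat \<Rightarrow> 'k :: {field, finite} closed_pt"
    and r l :: nat and w :: "nat \<Rightarrow> nat" and d :: int
  assumes "inj_on b {1..r}"
    and "l = (\<Sum>i=1..r. pt_degree (b i))"
    and "w permutes {1..l}"
    and "cycle_type w {1..l} = image_mset (\<lambda>i. pt_degree (b i)) (mset_set {1..r})"
  shows "finite (contributing_classes (b ` {1..r}) d) \<and>
    complex_of_nat (total_flag_count (b ` {1..r}) d) =
      (if l \<ge> 3 then
         (\<Sum>m=0..l-3. \<Sum>a=1..(l - m - 1) div 2.
            (\<Sum>s=m+2*a+1..l. subset_character l s w) * of_nat (card (UNIV :: 'k set)) ^ m)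
       else 0)"
proof -
  let ?D = "b ` {1..r}" and ?q = "of_nat (card (UNIV :: 'k set)) :: complex"
  let ?\<chi> = "\<lambda>s. subset_character l s w"
  have D: "finite ?D" by simp
  have ls: "deg_sum ?D = l" using assms(1,2) by (simp add: deg_sum_def sum.reindex)
  have "mset_set ?D = image_mset b (mset_set {1..r})" using assms(1) by (simp add: image_mset_mset_set)
  hence ct: "cycle_type w {1..l} = image_mset pt_degree (mset_set ?D)"
    using assms(4) by (simp add: image_mset.compositionality o_def)
  have le: "deg_sum I \<le> l" if "I \<in> Pow ?D" for I
    using that D sum_mono2[of ?D I pt_degree] ls by (simp add: deg_sum_def)
  have "complex_of_nat (total_flag_count ?D d) = of_int (int (total_flag_count ?D d))" by simp
  also have "\<dots> = (\<Sum>I\<in>Pow ?D. \<Sum>k<l. \<Sum>m<deg_sum I - (2 * k + 2). ?q ^ m)"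
    unfolding total_flag_count_formula(2)[OF D] ls geo_def by simp
  finally have total: "complex_of_nat (total_flag_count ?D d) =
    (\<Sum>I\<in>Pow ?D. \<Sum>k<l. \<Sum>m<deg_sum I - (2 * k + 2). ?q ^ m)" .
  show ?thesis
  proof (cases "l \<ge> 3")
    case False
    have "deg_sum I - (2 * k + 2) = 0" if "I \<in> Pow ?D" for I k using le[OF that] False by simp
    hence "complex_of_nat (total_flag_count ?D d) = 0" unfolding total by simp
    thus ?thesis using False total_flag_count_formula(1)[OF D] by simp
  next
    case True
    \<comment> \<open>A partial sum of characters counts the subsets of D of degree at least n,
      which turns the sum over s into one over subsets.\<close>
    have inner: "(\<Sum>s=n..l. ?\<chi> s) = (\<Sum>I\<in>Pow ?D. if n \<le> deg_sum I then 1 else 0)" for n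
    proof -
      have "(\<Sum>s=n..l. ?\<chi> s) = (\<Sum>s=n..l. \<Sum>I\<in>Pow ?D. if deg_sum I = s then 1 else 0)"
        by (simp add: subset_character_eq[OF assms(3) ct D] sum.If_cases Int_def)
      also have "\<dots> = (\<Sum>I\<in>Pow ?D. \<Sum>s=n..l. if deg_sum I = s then 1 else 0)" by (rule sum.swap)
      also have "\<dots> = (\<Sum>I\<in>Pow ?D. if n \<le> deg_sum I then 1 else 0)"
        using le by (intro sum.cong refl) auto
      finally show ?thesis .
    qed
    have "(\<Sum>m=0..l-3. \<Sum>a=1..(l - m - 1) div 2. (\<Sum>s=m+2*a+1..l. ?\<chi> s) * ?q ^ m) =
      (\<Sum>m=0..l-3. \<Sum>a=1..(l - m - 1) div 2. \<Sum>I\<in>Pow ?D. if m + 2 * a + 1 \<le> deg_sum I then ?q ^ m else 0)"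
      unfolding inner sum_distrib_right by (intro sum.cong refl) simp
    also have "\<dots> = (\<Sum>I\<in>Pow ?D. \<Sum>m=0..l-3. \<Sum>a=1..(l - m - 1) div 2. if m + 2 * a + 1 \<le> deg_sum I then ?q ^ m else 0)"
      by (simp only: sum.swap[of _ "Pow ?D"])
    also have "\<dots> = complex_of_nat (total_flag_count ?D d)"
      unfolding total by (intro sum.cong refl double_sum_geo le True)
    finally show ?thesis using True total_flag_count_formula(1)[OF D] by simp
  qed
qed

end
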